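(* Let $T>0$ and let $y=\{y(u,t),\ u\in[0,1],\ t\in[0,T]\}$ be a random element of $D([0,1],C[0,T])$ satisfying conditions (C1)–(C5) below. Then for every twice continuously differentiable function $\varphi:\mathbb{R}\to\mathbb{R}$ with bounded derivatives $\dot\varphi,\ddot\varphi$, almost surely for $t\in[0,T]$, $$\int_0^1\varphi(y(u,t))du=\int_0^1\varphi(u)du+\int_0^1\int_0^t\dot{\varphi}(y(u,s))dy(u,s)du+\frac{1}{2}\int_0^t\int_0^1\frac{\ddot{\varphi}(y(u,s))}{m(u,s)}duds.$$
   Context: $D([0,1],C[0,T])$ is the Skorohod space of càdlàg maps from $[0,1]$ to $C[0,T]$ (uniform metric). Let $\mathcal{F}_t=\sigma(y(u,s),\ u\in[0,1],\ s\le t)$. Conditions: (C1) each $y(u,\cdot)$ is a continuous square integrable $(\mathcal{F}_t)$-martingale; (C2) $y(u,0)=u$ for all $u$; (C3) $y(u,t)\le y(v,t)$ for $u<v$, $t\in[0,T]$; (C4) $\langle y(u,\cdot)\rangle_t=\int_0^t ds/m(u,s)$, where $m(u,t)=\mathrm{Leb}\{v\in[0,1]:\ \exists s\le t,\ y(v,s)=y(u,s)\}$; (C5) $\langle y(u,\cdot),y(v,\cdot)\rangle_{t\wedge\tau_{u,v}}=0$ for all $u,v,t$, where $\tau_{u,v}=\inf\{t:\ y(u,t)=y(v,t)\}\wedge T$. Stochastic integral: let $\mathcal{M}$ be the Hilbert space of continuous square integrable $(\mathcal{F}_t)$-martingales on $[0,T]$ with inner product $(M,N)=\mathbf{E}M(T)N(T)$.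 For a bounded piecewise continuous $\psi:\mathbb{R}\to\mathbb{R}$, partitions $0=u_0^n<\dots<u_n^n=1$ with mesh $\lambda_n=\max_k(u_k^n-u_{k-1}^n)$ and points $v_k^n\in[u_{k-1}^n,u_k^n]$, set $M_n(t)=\sum_{k=1}^n\int_0^t\psi(y(v_k^n,s))dy(v_k^n,s)(u_k^n-u_{k-1}^n)$. The limit of $M_n$ in $\mathcal{M}$ as $\lambda_n\to0$ exists and does not depend on the partitions or points; it is denoted $\int_0^1\int_0^{\cdot}\psi(y(u,s))dy(u,s)du$. *)

theory Defs
  imports "HOL-Probability.Probability"
begin

text \<open>Processes are written with the sample point first: X \<omega> t, and the random
field y \<omega> u t. All processes live on the time interval [0,T].\<close>

definition filt :: "'a measure \<Rightarrow> ('a \<Rightarrow> real \<Rightarrow> real \<Rightarrow> real) \<Rightarrow> real \<Rightarrow> 'a measure" where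
  "filt M y t = sigma (space M)
     {(\<lambda>\<omega>. y \<omega> u s) -` A \<inter> space M | u s A. u \<in> {0..1} \<and> s \<in> {0..t} \<and> A \<in> sets borel}"

definition mart :: "'a measure \<Rightarrow> (real \<Rightarrow> 'a measure) \<Rightarrow> real \<Rightarrow> ('a \<Rightarrow> real \<Rightarrow> real) \<Rightarrow> bool" where
  "mart M F T X \<longleftrightarrow>
     (\<forall>t\<in>{0..T}. integrable M (\<lambda>\<omega>. X \<omega> t) \<and> (\<lambda>\<omega>. X \<omega> t) \<in> borel_measurable (F t)) \<and>
     (\<forall>s t. 0 \<le> s \<and> s \<le> t \<and> t \<le> T \<longrightarrow>
        (AE \<omega> in M. real_cond_exp M (F s) (\<lambda>\<omega>. X \<omega> t) \<omega> = X \<omega> s))"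

definition cmart :: "'a measure \<Rightarrow> (real \<Rightarrow> 'a measure) \<Rightarrow> real \<Rightarrow> ('a \<Rightarrow> real \<Rightarrow> real) \<Rightarrow> bool" where
  "cmart M F T X \<longleftrightarrow> mart M F T X \<and>
     (\<forall>t\<in>{0..T}. integrable M (\<lambda>\<omega>. (X \<omega> t)\<^sup>2)) \<and>
     (AE \<omega> in M. continuous_on {0..T} (X \<omega>))"

definition bv_on :: "real \<Rightarrow> (real \<Rightarrow> real) \<Rightarrow> bool" where
  "bv_on T f \<longleftrightarrow> (\<exists>g h. mono_on {0..T} g \<and> mono_on {0..T} h \<and> (\<forall>t\<in>{0..T}. f t = g t - h t))"

definition is_covariation :: "'a measure \<Rightarrow> (real \<Rightarrow> 'a measure) \<Rightarrow> real \<Rightarrow>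
    ('a \<Rightarrow> real \<Rightarrow> real) \<Rightarrow> ('a \<Rightarrow> real \<Rightarrow> real) \<Rightarrow> ('a \<Rightarrow> real \<Rightarrow> real) \<Rightarrow> bool" where
  "is_covariation M F T X Y B \<longleftrightarrow>
     (\<forall>t\<in>{0..T}. (\<lambda>\<omega>. B \<omega> t) \<in> borel_measurable (F t)) \<and>
     (AE \<omega> in M. B \<omega> 0 = 0 \<and> continuous_on {0..T} (B \<omega>) \<and> bv_on T (B \<omega>)) \<and>
     mart M F T (\<lambda>\<omega> t. X \<omega> t * Y \<omega> t - B \<omega> t)"

definition mfun :: "('a \<Rightarrow> real \<Rightarrow> real \<Rightarrow> real) \<Rightarrow> 'a \<Rightarrow> real \<Rightarrow> real \<Rightarrow> real" where
  "mfun y \<omega> u t = measure lebesgue {v \<in> {0..1}. \<exists>s\<in>{0..t}. y \<omega> v s = y \<omega> u s}"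

definition meet_time :: "real \<Rightarrow> ('a \<Rightarrow> real \<Rightarrow> real \<Rightarrow> real) \<Rightarrow> real \<Rightarrow> real \<Rightarrow> 'a \<Rightarrow> real" where
  "meet_time T y u v \<omega> =
     (let S = {t \<in> {0..T}. y \<omega> u t = y \<omega> v t} in if S = {} then T else min (Inf S) T)"

definition part :: "real \<Rightarrow> real \<Rightarrow> (nat \<Rightarrow> real) \<Rightarrow> nat \<Rightarrow> bool" where
  "part a b p n \<longleftrightarrow> p 0 = a \<and> p n = b \<and> (\<forall>k<n. p k < p (Suc k))"

definition mesh :: "(nat \<Rightarrow> real) \<Rightarrow> nat \<Rightarrow> real" where
  "mesh p n = Max ((\<lambda>k. p (Suc k) - p k) ` {..<n})"

definition ito_is :: "'a measure \<Rightarrow> (real \<Rightarrow> 'a measure) \<Rightarrow> real \<Rightarrow>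
    ('a \<Rightarrow> real \<Rightarrow> real) \<Rightarrow> ('a \<Rightarrow> real \<Rightarrow> real) \<Rightarrow> ('a \<Rightarrow> real \<Rightarrow> real) \<Rightarrow> bool" where
  "ito_is M F T H X I \<longleftrightarrow> cmart M F T I \<and> (AE \<omega> in M. I \<omega> 0 = 0) \<and>
     (\<forall>t\<in>{0..T}. \<forall>P :: nat \<Rightarrow> nat \<Rightarrow> real.
        (\<forall>n\<ge>1. part 0 t (P n) n) \<and> (\<lambda>n. mesh (P n) n) \<longlonglongrightarrow> 0 \<longrightarrow>
        (\<lambda>n. \<integral>\<omega>. ((\<Sum>k<n. H \<omega> (P n k) * (X \<omega> (P n (Suc k)) - X \<omega> (P n k))) - I \<omega> t)\<^sup>2 \<partial>M)
          \<longlonglongrightarrow> 0)"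

definition stoch_int :: "'a measure \<Rightarrow> (real \<Rightarrow> 'a measure) \<Rightarrow> real \<Rightarrow>
    ('a \<Rightarrow> real \<Rightarrow> real) \<Rightarrow> ('a \<Rightarrow> real \<Rightarrow> real) \<Rightarrow> ('a \<Rightarrow> real \<Rightarrow> real)" where
  "stoch_int M F T H X = (SOME I. ito_is M F T H X I)"

text \<open>J is the limit in \<M> (norm ||N||^2 = E N(T)^2) of
  M_n(t) = sum_k int_0^t psi(y(v_k,s)) dy(v_k,s) (u_k - u_(k-1)),
  for every sequence of tagged partitions of [0,1] with mesh tending to 0;
  i.e. J = int_0^1 int_0^. psi(y(u,s)) dy(u,s) du.\<close>
definition dint_is :: "'a measure \<Rightarrow> real \<Rightarrow> ('a \<Rightarrow> real \<Rightarrow> real \<Rightarrow> real) \<Rightarrow> (real \<Rightarrow> real) \<Rightarrow>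
    ('a \<Rightarrow> real \<Rightarrow> real) \<Rightarrow> bool" where
  "dint_is M T y \<psi> J \<longleftrightarrow> cmart M (filt M y) T J \<and>
     (\<forall>P V :: nat \<Rightarrow> nat \<Rightarrow> real.
        (\<forall>n\<ge>1. part 0 1 (P n) n \<and> (\<forall>k<n. V n k \<in> {P n k..P n (Suc k)})) \<and>
        (\<lambda>n. mesh (P n) n) \<longlonglongrightarrow> 0 \<longrightarrow>
        (\<lambda>n. \<integral>\<omega>. ((\<Sum>k<n. stoch_int M (filt M y) T (\<lambda>\<omega> s. \<psi> (y \<omega> (V n k) s))
                                 (\<lambda>\<omega> s. y \<omega> (V n k) s) \<omega> T * (P n (Suc k) - P n k))
                    - J \<omega> T)\<^sup>2 \<partial>M) \<longlonglongrightarrow> 0)"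

text \<open>y is a random element of D([0,1], C[0,T]): every path u \<mapsto> y(u,.) is cadlag in
  the uniform metric on C[0,T], each y(u,.) is continuous on [0,T], and all
  coordinates are random variables (they generate the Borel sigma-algebra of D).\<close>
definition random_D :: "'a measure \<Rightarrow> real \<Rightarrow> ('a \<Rightarrow> real \<Rightarrow> real \<Rightarrow> real) \<Rightarrow> bool" where
  "random_D M T y \<longleftrightarrow>
     (\<forall>u\<in>{0..1}. \<forall>t\<in>{0..T}. (\<lambda>\<omega>. y \<omega> u t) \<in> borel_measurable M) \<and>
     (\<forall>\<omega>\<in>space M.
        (\<forall>u\<in>{0..1}. continuous_on {0..T} (y \<omega> u)) \<and>
        (\<forall>u\<in>{0..<1}. \<forall>e>0. \<exists>d>0. \<forall>v\<in>{0..1}. u \<le> v \<and> v < u + d \<longrightarrow>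
            (\<forall>t\<in>{0..T}. \<bar>y \<omega> v t - y \<omega> u t\<bar> < e)) \<and>
        (\<forall>u\<in>{0<..1}. \<forall>e>0. \<exists>d>0. \<forall>v\<in>{0..1}. \<forall>w\<in>{0..1}.
            u - d < v \<and> v < u \<and> u - d < w \<and> w < u \<longrightarrow>
            (\<forall>t\<in>{0..T}. \<bar>y \<omega> v t - y \<omega> w t\<bar> < e)))"

end

theory Submission
  imports Defs
begin

text \<open>For a fixed particle u the bracket of y(u,\<cdot>) is \<integral> ds/m(u,s), so a Taylor expansion along partitions of
the time interval identifies the limit of the Riemann-Ito sums: the stochastic integral of \<phi>'(y(u,\<cdot>)) is
\<phi>(y(u,t)) - \<phi>(u) - 1/2 \<integral> \<phi>''(y(u,s))/m(u,s) ds. The sums converge in L1 because the squared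
increments are compensated by the increments of the bracket after truncation, and in L2 because they are Cauchy
there by the isometry for step integrands.

This explicit integral is continuous in u as a map into L2: the sums for u and v differ by a sum against the
martingale y(u,\<cdot>) - y(v,\<cdot>), whose variance tends to 0 as v tends to u, and by a sum against y(u,\<cdot>) with
integrand \<phi>'(y(u,\<cdot>)) - \<phi>'(y(v,\<cdot>)), which is controlled by dominated convergence since
y(v,s) \<rightarrow> y(u,s) almost surely (monotonicity in u and E y(u,s) = u). Hence the tagged Riemann sums in u converge
to the pathwise integral over u of the explicit expression, and Fubini's theorem gives the formula.\<close>

section \<open>Square-integrable variables and truncated squares\<close>

text \<open>Only second moments are at hand. The squared increments of a particle are merely
  integrable, and the density 1/m(u,s) of its bracket is unbounded near s = 0, because every
  particle starts alone and \<open>mfun\<close> vanishes at time 0. Fourth-moment estimates and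
  bounds on the density are therefore out of reach. This is why squared increments are truncated
  before they are compared with the bracket, why most dominating functions are multiples of the
  bracket itself, and why the sums are first treated in L1.

  Both stochastic integrals of the statement are only characterised as limits, which says nothing
  about their dependence on u. The explicit expression stands in for them: it is a functional of the
  path and of \<open>mfun\<close>, hence jointly measurable in (\<omega>, u) as soon as
  \<open>mfun\<close> is, and right-continuity of the flow in u provides that. The filtration is the
  one generated by the flow, without added null sets, so adaptedness too is read off from explicit
  expressions and not from almost sure identities.\<close>

lemma integrable_mult_square:
  fixes f g :: "'a \<Rightarrow> real"
  assumes [measurable]: "f \<in> borel_measurable M" "g \<in> borel_measurable M"
    and f: "integrable M (\<lambda>x. (f x)^2)" and g: "integrable M (\<lambda>x. (g x)^2)"
  shows "integrable M (\<lambda>x. f x * g x)"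
proof (rule Bochner_Integration.integrable_bound)
  show "integrable M (\<lambda>x. (f x)^2 + (g x)^2)" using f g by simp
  have "\<bar>f x * g x\<bar> \<le> (f x)^2 + (g x)^2" for x
  proof -
    have "0 \<le> (\<bar>f x\<bar> - \<bar>g x\<bar>)^2" by simp
    then have "2 * (\<bar>f x\<bar> * \<bar>g x\<bar>) \<le> (f x)^2 + (g x)^2"
      by (simp add: power2_diff algebra_simps)
    moreover have "0 \<le> \<bar>f x\<bar> * \<bar>g x\<bar>" by simp
    ultimately show ?thesis unfolding abs_mult by linarith
  qed
  then show "AE x in M. norm (f x * g x) \<le> norm ((f x)^2 + (g x)^2)" by simp
qed simp

lemma integrable_square_add:
  fixes f g :: "'a \<Rightarrow> real"
  assumes [measurable]: "f \<in> borel_measurable M" "g \<in> borel_measurable M"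
    and f: "integrable M (\<lambda>x. (f x)^2)" and g: "integrable M (\<lambda>x. (g x)^2)"
  shows "integrable M (\<lambda>x. (f x + g x)^2)"
  using integrable_mult_square[OF assms] f g by (simp add: power2_sum mult.assoc)

lemma integrable_square_diff:
  fixes f g :: "'a \<Rightarrow> real"
  assumes [measurable]: "f \<in> borel_measurable M" "g \<in> borel_measurable M"
    and f: "integrable M (\<lambda>x. (f x)^2)" and g: "integrable M (\<lambda>x. (g x)^2)"
  shows "integrable M (\<lambda>x. (f x - g x)^2)"
  using integrable_mult_square[OF assms] f g by (simp add: power2_diff mult.assoc)

lemma integrable_square_mult_bounded:
  fixes f g :: "'a \<Rightarrow> real"
  assumes [measurable]: "f \<in> borel_measurable M" "g \<in> borel_measurable M"
    and f: "\<And>x. \<bar>f x\<bar> \<le> C" and g: "integrable M (\<lambda>x. (g x)^2)"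
  shows "integrable M (\<lambda>x. (f x * g x)^2)"
proof (rule Bochner_Integration.integrable_bound)
  show "integrable M (\<lambda>x. C^2 * (g x)^2)" using g by simp
  have "(f x)^2 \<le> C^2" for x using f[of x] by (metis abs_le_square_iff abs_of_nonneg abs_ge_zero order_trans)
  then show "AE x in M. norm ((f x * g x)^2) \<le> norm (C^2 * (g x)^2)"
    by (auto simp: power_mult_distrib intro!: mult_right_mono)
qed simp

lemma integrable_square_sum:
  fixes f :: "'i \<Rightarrow> 'a \<Rightarrow> real"
  assumes "finite I" "\<And>i. i \<in> I \<Longrightarrow> f i \<in> borel_measurable M" "\<And>i. i \<in> I \<Longrightarrow> integrable M (\<lambda>x. (f i x)^2)"
  shows "integrable M (\<lambda>x. (\<Sum>i\<in>I. f i x)^2)"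
  using assms
proof (induction I rule: finite_induct)
  case (insert i I)
  then show ?case
    using integrable_square_add[of "f i" M "\<lambda>x. \<Sum>i\<in>I. f i x"] by simp
qed simp

lemma integrable_mult_bounded:
  fixes f g :: "'a \<Rightarrow> real"
  assumes [measurable]: "f \<in> borel_measurable M" and g: "integrable M g"
    and f: "\<And>x. \<bar>f x\<bar> \<le> C"
  shows "integrable M (\<lambda>x. f x * g x)"
proof (rule Bochner_Integration.integrable_bound)
  show "integrable M (\<lambda>x. C * g x)" using g by simp
  have "\<bar>f x\<bar> * \<bar>g x\<bar> \<le> \<bar>C\<bar> * \<bar>g x\<bar>" for x using f[of x] by (intro mult_right_mono) auto
  then show "AE x in M. norm (f x * g x) \<le> norm (C * g x)" by (auto simp: abs_mult)
qed (use g in simp)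

section \<open>Conditional centring, orthogonality and truncation on a probability space\<close>

context prob_space
begin

lemma integrable_of_square:
  fixes f :: "'a \<Rightarrow> real"
  assumes "f \<in> borel_measurable M" "integrable M (\<lambda>x. (f x)^2)"
  shows "integrable M f"
  using integrable_mult_square[of "\<lambda>_. 1" M f] assms by simp

lemma square_integral_le:
  fixes f :: "'a \<Rightarrow> real"
  assumes "f \<in> borel_measurable M" "integrable M (\<lambda>x. (f x)^2)"
  shows "(\<integral>x. f x \<partial>M)^2 \<le> (\<integral>x. (f x)^2 \<partial>M)"
  using variance_positive[of f] variance_eq[OF integrable_of_square[OF assms] assms(2)] by simp

lemma integral_abs_le_sqrt:
  fixes f :: "'a \<Rightarrow> real"
  assumes [measurable]: "f \<in> borel_measurable M" and i: "integrable M (\<lambda>x. (f x)^2)"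
  shows "(\<integral>x. \<bar>f x\<bar> \<partial>M) \<le> sqrt (\<integral>x. (f x)^2 \<partial>M)"
  by (rule real_le_rsqrt) (use square_integral_le[of "\<lambda>x. \<bar>f x\<bar>"] i in simp)

lemma subalgebra_sigma_finite:
  assumes "subalgebra M G"
  shows "sigma_finite_subalgebra M G"
  by (intro finite_measure_subalgebra_is_sigma_finite)
     (simp add: finite_measure_subalgebra_def finite_measure_subalgebra_axioms_def assms finite_measure_axioms)

text \<open>Pulling \<open>W\<close> out of the conditional expectation asks only for an integrable
  product, so unbounded \<open>W\<close> such as past increments are allowed. Later cancellations of
  a martingale increment against the past go through this.\<close>

lemma integral_mult_cond_exp_0:
  assumes G: "subalgebra M G" and [measurable]: "W \<in> borel_measurable G" "f \<in> borel_measurable M"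
    and i: "integrable M (\<lambda>x. W x * f x)"
    and c: "AE x in M. real_cond_exp M G f x = 0"
  shows "(\<integral>x. W x * f x \<partial>M) = 0"
proof -
  interpret sigma_finite_subalgebra M G by (rule subalgebra_sigma_finite[OF G])
  have [measurable]: "W \<in> borel_measurable M" by (rule measurable_from_subalg[OF G]) simp
  have "(\<integral>x. W x * f x \<partial>M) = (\<integral>x. W x * real_cond_exp M G f x \<partial>M)"
    by (rule real_cond_exp_intg(2)[symmetric]) (use i in auto)
  also have "\<dots> = (\<integral>x. 0 \<partial>M)"
    by (rule integral_cong_AE) (use c in auto)
  finally show ?thesis by simp
qed

text \<open>Pythagoras by induction: the partial sum is known at the start of the next term and
  hence orthogonal to it, and square integrability makes the cross products integrable.\<close>

lemma orthogonal_sum_square: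
  fixes n :: nat and \<xi> :: "nat \<Rightarrow> 'a \<Rightarrow> real"
  assumes G: "\<And>k. k < n \<Longrightarrow> subalgebra M (G k)"
    and meas: "\<And>k. k < n \<Longrightarrow> \<xi> k \<in> borel_measurable M"
    and adapted: "\<And>j k. j < k \<Longrightarrow> k < n \<Longrightarrow> \<xi> j \<in> borel_measurable (G k)"
    and sq: "\<And>k. k < n \<Longrightarrow> integrable M (\<lambda>x. (\<xi> k x)^2)"
    and ce: "\<And>k. k < n \<Longrightarrow> AE x in M. real_cond_exp M (G k) (\<xi> k) x = 0"
  shows "(\<integral>x. (\<Sum>k<n. \<xi> k x)^2 \<partial>M) = (\<Sum>k<n. \<integral>x. (\<xi> k x)^2 \<partial>M)"
  using assms
proof (induction n)
  case (Suc n)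
  have [measurable]: "(\<lambda>x. \<Sum>k<n. \<xi> k x) \<in> borel_measurable (G n)"
    by (intro borel_measurable_sum Suc.prems(3)) auto
  have [measurable]: "\<xi> k \<in> borel_measurable M" if "k < Suc n" for k using Suc.prems(2) that by simp
  have [measurable]: "(\<lambda>x. \<Sum>k<n. \<xi> k x) \<in> borel_measurable M"
    by (intro borel_measurable_sum) simp
  have s1: "integrable M (\<lambda>x. (\<Sum>k<n. \<xi> k x)^2)"
    by (rule integrable_square_sum) (use Suc.prems in auto)
  have i: "integrable M (\<lambda>x. (\<Sum>k<n. \<xi> k x) * \<xi> n x)"
    by (rule integrable_mult_square) (use s1 Suc.prems(4)[of n] in auto)
  have 0: "(\<integral>x. (\<Sum>k<n. \<xi> k x) * \<xi> n x \<partial>M) = 0"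
    by (rule integral_mult_cond_exp_0[of "G n"]) (use i Suc.prems in auto)
  have "(\<integral>x. (\<Sum>k<Suc n. \<xi> k x)^2 \<partial>M) = (\<integral>x. (\<Sum>k<n. \<xi> k x)^2 + (2 * ((\<Sum>k<n. \<xi> k x) * \<xi> n x) + (\<xi> n x)^2) \<partial>M)"
    by (simp add: power2_sum algebra_simps)
  also have "\<dots> = (\<integral>x. (\<Sum>k<n. \<xi> k x)^2 \<partial>M) + (\<integral>x. (\<xi> n x)^2 \<partial>M)"
    using s1 i 0 Suc.prems(4)[of n] by simp
  also have "\<dots> = (\<Sum>k<Suc n. \<integral>x. (\<xi> k x)^2 \<partial>M)"
    using Suc.IH Suc.prems by simp
  finally show ?case .
qed simp

lemma integral_abs_cond_exp_le:
  assumes G: "subalgebra M G" and f: "integrable M f"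
  shows "(\<integral>x. \<bar>real_cond_exp M G f x\<bar> \<partial>M) \<le> (\<integral>x. \<bar>f x\<bar> \<partial>M)"
proof -
  interpret sigma_finite_subalgebra M G by (rule subalgebra_sigma_finite[OF G])
  have [measurable]: "f \<in> borel_measurable M" using f by auto
  have [measurable]: "real_cond_exp M G h \<in> borel_measurable M" for h 
    by (rule measurable_from_subalg[OF G]) simp
  \<comment> \<open>The sign of the conditional expectation is itself \<open>G\<close>-measurable.
    Multiplied by it, the conditional expectation may be replaced by \<open>f\<close> under the
    integral.\<close>
  define s where "s x = (if real_cond_exp M G f x \<ge> 0 then 1 else -1 :: real)" for x
  have [measurable]: "s \<in> borel_measurable G" unfolding s_def by measurable
  have [measurable]: "s \<in> borel_measurable M" by (rule measurable_from_subalg[OF G]) simp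
  have i: "integrable M (\<lambda>x. s x * f x)"
    by (rule integrable_mult_bounded[where C=1]) (use f in \<open>auto simp: s_def\<close>)
  have "(\<integral>x. \<bar>real_cond_exp M G f x\<bar> \<partial>M) = (\<integral>x. s x * real_cond_exp M G f x \<partial>M)"
    by (rule Bochner_Integration.integral_cong) (auto simp: s_def)
  also have "\<dots> = (\<integral>x. s x * f x \<partial>M)"
    by (rule real_cond_exp_intg(2)) (use i in auto)
  also have "\<dots> \<le> (\<integral>x. \<bar>f x\<bar> \<partial>M)"
    by (rule integral_mono) (use i f in \<open>auto simp: s_def\<close>)
  finally show ?thesis .
qed

text \<open>\<open>Z\<close> and its compensator \<open>\<alpha>\<close> are only integrable, so the
  sum may have no variance. Truncation at \<open>\<epsilon>\<close> restores second moments but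
  destroys the conditional centring; subtracting the conditional mean \<open>c\<close> of the
  truncated difference repairs it. The centred part is estimated by orthogonality and gives the
  square root, while \<open>c\<close> and the cut-off part \<open>D2\<close> are each bounded by the
  tails, whence the factor 2. In the application \<open>Z\<close> is a squared increment and
  \<open>\<alpha>\<close> an increment of the bracket.\<close>

lemma truncated_compensation:
  fixes Z \<alpha> h :: "nat \<Rightarrow> 'a \<Rightarrow> real"
  assumes G: "\<And>k. k \<le> n \<Longrightarrow> subalgebra M (G k)"
    and mono: "\<And>j k. j \<le> k \<Longrightarrow> k \<le> n \<Longrightarrow> sets (G j) \<subseteq> sets (G k)"
    and Z: "\<And>k. k < n \<Longrightarrow> Z k \<in> borel_measurable (G (Suc k))" "\<And>k. k < n \<Longrightarrow> integrable M (Z k)" "\<And>k x. 0 \<le> Z k x"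
    and \<alpha>: "\<And>k. k < n \<Longrightarrow> \<alpha> k \<in> borel_measurable (G (Suc k))" "\<And>k. k < n \<Longrightarrow> integrable M (\<alpha> k)" "\<And>k x. 0 \<le> \<alpha> k x"
    and ce: "\<And>k. k < n \<Longrightarrow> AE x in M. real_cond_exp M (G k) (\<lambda>x. Z k x - \<alpha> k x) x = 0"
    and h: "\<And>k. k < n \<Longrightarrow> h k \<in> borel_measurable (G k)" "\<And>k x. \<bar>h k x\<bar> \<le> C"
    and \<epsilon>: "0 < \<epsilon>"
  shows "(\<integral>x. \<bar>\<Sum>k<n. h k x * (Z k x - \<alpha> k x)\<bar> \<partial>M) \<le>
    C * (sqrt (2 * \<epsilon> * (\<Sum>k<n. \<integral>x. \<alpha> k x \<partial>M)) +
      2 * (\<Sum>k<n. (\<integral>x. (if Z k x > \<epsilon> then Z k x else 0) \<partial>M) + (\<integral>x. (if \<alpha> k x > \<epsilon> then \<alpha> k x else 0) \<partial>M)))"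
proof -
  \<comment> \<open>The bound holds at every index and every point, so one arbitrary pair already
    shows that \<open>C\<close> dominates an absolute value.\<close>
  have C: "0 \<le> C" using h(2)[of 0 undefined] abs_ge_zero order_trans by blast
  define D1 where "D1 k x = (if Z k x \<le> \<epsilon> then Z k x else 0) - (if \<alpha> k x \<le> \<epsilon> then \<alpha> k x else 0)" for k x
  define D2 where "D2 k x = (if Z k x > \<epsilon> then Z k x else 0) - (if \<alpha> k x > \<epsilon> then \<alpha> k x else 0)" for k x
  define c where "c k = real_cond_exp M (G k) (D1 k)" for k
  have GM: "f \<in> borel_measurable (G k) \<Longrightarrow> k \<le> n \<Longrightarrow> f \<in> borel_measurable M" for f :: "'a \<Rightarrow> real" and k
    by (rule measurable_from_subalg[OF G])
  have GG: "f \<in> borel_measurable (G j) \<Longrightarrow> j \<le> k \<Longrightarrow> k \<le> n \<Longrightarrow> f \<in> borel_measurable (G k)" for f :: "'a \<Rightarrow> real" and j k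
    by (rule measurable_from_subalg[of "G k" "G j"]) (use mono[of j k] G[of j] G[of k] in \<open>simp_all add: subalgebra_def\<close>)
  have [measurable]: "Z k \<in> borel_measurable (G (Suc k))" "\<alpha> k \<in> borel_measurable (G (Suc k))"
    "Z k \<in> borel_measurable M" "\<alpha> k \<in> borel_measurable M" 
    "h k \<in> borel_measurable (G k)" "h k \<in> borel_measurable M" if "k < n" for k
    by (use that in \<open>auto intro!: Z(1) \<alpha>(1) h(1) intro: GM[OF Z(1)[OF that]] GM[OF \<alpha>(1)[OF that]] GM[OF h(1)[OF that]]\<close>)
  have hG: "h k \<in> borel_measurable (G (Suc k))" if "k < n" for k using GG[of "h k" k "Suc k"] h that by simp
  have c_meas: "c k \<in> borel_measurable (G k)" for k unfolding c_def by simp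
  have [measurable]: "c k \<in> borel_measurable M" if "k < n" for k 
    using GM[OF c_meas, of k] that by simp
  have cG: "c k \<in> borel_measurable (G (Suc k))" if "k < n" for k using GG[OF c_meas, of k "Suc k"] that by simp
  have D1m: "D1 k \<in> borel_measurable (G (Suc k))" if "k < n" for k
    unfolding D1_def using that by measurable
  have [measurable]: "D1 k \<in> borel_measurable M" "D2 k \<in> borel_measurable M" if "k < n" for k
    using that unfolding D1_def D2_def by measurable
  have D1b: "\<bar>D1 k x\<bar> \<le> \<epsilon>" "\<bar>D1 k x\<bar> \<le> Z k x + \<alpha> k x" for k x
    using \<epsilon> Z(3)[of k x] \<alpha>(3)[of k x] by (auto simp: D1_def)
  have iZa: "integrable M (\<lambda>x. Z k x + \<alpha> k x)" if "k < n" for k using Z \<alpha> that by simp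
  have iZ1: "integrable M (\<lambda>x. if Z k x > \<epsilon> then Z k x else 0)" if "k < n" for k
    by (rule Bochner_Integration.integrable_bound[OF Z(2)[OF that]]) (use that Z(3) in auto)
  have ia1: "integrable M (\<lambda>x. if \<alpha> k x > \<epsilon> then \<alpha> k x else 0)" if "k < n" for k
    by (rule Bochner_Integration.integrable_bound[OF \<alpha>(2)[OF that]]) (use that \<alpha>(3) in auto)
  have iD1: "integrable M (D1 k)" if "k < n" for k
    by (rule integrable_const_bound[where B=\<epsilon>]) (use that D1b in auto)
  have iD2: "integrable M (D2 k)" if "k < n" for k
    unfolding D2_def using iZ1 ia1 that by simp
  have iD1sq: "integrable M (\<lambda>x. (D1 k x)^2)" if "k < n" for k
    by (rule integrable_const_bound[where B="\<epsilon>^2"]) 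
       (use that D1b \<epsilon> in \<open>auto simp: abs_le_square_iff[symmetric]\<close>)
  have cb: "AE x in M. \<bar>c k x\<bar> \<le> \<epsilon>" if "k < n" for k
  proof -
    interpret sigma_finite_subalgebra M "G k" by (rule subalgebra_sigma_finite) (use G that in simp)
    have "AE x in M. c k x \<le> \<epsilon>" unfolding c_def
      by (rule real_cond_exp_le_c) (use iD1 that D1b in \<open>auto simp: abs_le_iff\<close>)
    moreover have "AE x in M. c k x \<ge> -\<epsilon>" unfolding c_def
    proof (rule real_cond_exp_ge_c)
      show "AE x in M. D1 k x \<ge> -\<epsilon>" using D1b(1)[of k] by (auto simp: abs_le_iff minus_le_iff)
    qed (use iD1 that in auto)
    ultimately show ?thesis by eventually_elim auto
  qed
  have icsq: "integrable M (\<lambda>x. (c k x)^2)" if "k < n" for k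
  proof (rule integrable_const_bound[where B="\<epsilon>^2"])
    show "AE x in M. norm ((c k x)^2) \<le> \<epsilon>^2"
      using cb[OF that] by eventually_elim (use \<epsilon> in \<open>auto simp: abs_le_square_iff[symmetric]\<close>)
  qed (use that in auto)
  have ic: "integrable M (c k)" if "k < n" for k
    by (rule integrable_of_square) (use icsq that in auto)
  define \<xi> where "\<xi> k x = h k x * (D1 k x - c k x)" for k x
  have xim: "\<xi> k \<in> borel_measurable (G (Suc k))" if "k < n" for k
    using D1m[OF that] hG[OF that] cG[OF that] unfolding \<xi>_def by measurable
  have [measurable]: "\<xi> k \<in> borel_measurable M" if "k < n" for k
    using that unfolding \<xi>_def by measurable
  have diffsq: "integrable M (\<lambda>x. (D1 k x - c k x)^2)" if "k < n" for k
    by (rule integrable_square_diff) (use that iD1sq icsq in auto)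
  have xisq: "integrable M (\<lambda>x. (\<xi> k x)^2)" if "k < n" for k
    unfolding \<xi>_def by (rule integrable_square_mult_bounded[where C=C]) (use that diffsq h in auto)
  have xice: "AE x in M. real_cond_exp M (G k) (\<xi> k) x = 0" if "k < n" for k
  proof -
    interpret sigma_finite_subalgebra M "G k" by (rule subalgebra_sigma_finite) (use G that in simp)
    have i: "integrable M (\<lambda>x. D1 k x - c k x)" using iD1 ic that by simp
    have "AE x in M. real_cond_exp M (G k) (\<xi> k) x = h k x * real_cond_exp M (G k) (\<lambda>x. D1 k x - c k x) x"
      unfolding \<xi>_def
      by (rule real_cond_exp_mult) (use that integrable_mult_bounded[OF _ i h(2)] in auto)
    moreover have "AE x in M. real_cond_exp M (G k) (\<lambda>x. D1 k x - c k x) x = real_cond_exp M (G k) (D1 k) x - real_cond_exp M (G k) (c k) x"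
      by (rule real_cond_exp_diff) (use iD1 ic that in auto)
    moreover have "AE x in M. real_cond_exp M (G k) (c k) x = c k x"
      by (rule real_cond_exp_F_meas) (use ic that c_meas in auto)
    ultimately show ?thesis by eventually_elim (simp add: c_def)
  qed
  \<comment> \<open>Centring can only lower the second moment. The bounds \<open>\<epsilon>\<close>
    and \<open>Z k x + \<alpha> k x\<close> for the absolute value of \<open>D1\<close> are then
    multiplied, and \<open>Z\<close> and \<open>\<alpha>\<close> have equal means; this is the
    origin of \<open>2 * \<epsilon>\<close>.\<close>
  have xiE: "(\<integral>x. (\<xi> k x)^2 \<partial>M) \<le> C^2 * (2 * \<epsilon> * (\<integral>x. \<alpha> k x \<partial>M))" if "k < n" for k
  proof -
    interpret sigma_finite_subalgebra M "G k" by (rule subalgebra_sigma_finite) (use G that in simp)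
    have dc: "integrable M (\<lambda>x. c k x * D1 k x)"
      by (rule integrable_mult_square) (use that iD1sq icsq in auto)
    have "(\<integral>x. c k x * D1 k x \<partial>M) = (\<integral>x. c k x * c k x \<partial>M)"
      unfolding c_def by (rule real_cond_exp_intg(2)[symmetric]) (use dc that in \<open>auto simp: c_def\<close>)
    then have e1: "(\<integral>x. c k x * D1 k x \<partial>M) = (\<integral>x. (c k x)^2 \<partial>M)" by (simp add: power2_eq_square)
    have "(\<integral>x. (D1 k x - c k x)^2 \<partial>M) = (\<integral>x. (D1 k x)^2 - 2 * (c k x * D1 k x) + (c k x)^2 \<partial>M)"
      by (simp add: power2_diff algebra_simps)
    also have "\<dots> = (\<integral>x. (D1 k x)^2 \<partial>M) - (\<integral>x. (c k x)^2 \<partial>M)"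
      using dc e1 iD1sq icsq that by simp
    also have "\<dots> \<le> (\<integral>x. (D1 k x)^2 \<partial>M)" by simp
    also have "\<dots> \<le> (\<integral>x. \<epsilon> * (Z k x + \<alpha> k x) \<partial>M)"
    proof (rule integral_mono)
      show "(D1 k x)^2 \<le> \<epsilon> * (Z k x + \<alpha> k x)" for x
        using mult_mono[OF D1b(1)[of k x] D1b(2)[of k x]] \<epsilon> by (simp add: power2_eq_square)
    qed (use iD1sq iZa that in auto)
    also have "\<dots> = \<epsilon> * ((\<integral>x. Z k x \<partial>M) + (\<integral>x. \<alpha> k x \<partial>M))" using Z \<alpha> that by simp
    also have "(\<integral>x. Z k x \<partial>M) = (\<integral>x. \<alpha> k x \<partial>M)"
    proof -
      have "(\<integral>x. 1 * (Z k x - \<alpha> k x) \<partial>M) = 0"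
        by (rule integral_mult_cond_exp_0[of "G k"]) (use that Z \<alpha> ce G in auto)
      then show ?thesis using Z \<alpha> that by simp
    qed
    finally have *: "(\<integral>x. (D1 k x - c k x)^2 \<partial>M) \<le> 2 * \<epsilon> * (\<integral>x. \<alpha> k x \<partial>M)" by simp
    have "(\<integral>x. (\<xi> k x)^2 \<partial>M) \<le> (\<integral>x. C^2 * (D1 k x - c k x)^2 \<partial>M)"
    proof (rule integral_mono)
      show "(\<xi> k x)^2 \<le> C^2 * (D1 k x - c k x)^2" for x
        unfolding \<xi>_def power_mult_distrib using h(2)[of k x] C
        by (intro mult_right_mono) (auto simp: abs_le_square_iff[symmetric])
    qed (use xisq diffsq that in auto)
    also have "\<dots> \<le> C^2 * (2 * \<epsilon> * (\<integral>x. \<alpha> k x \<partial>M))" using * by (simp add: mult_left_mono)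
    finally show ?thesis .
  qed
  have E1: "(\<integral>x. \<bar>\<Sum>k<n. \<xi> k x\<bar> \<partial>M) \<le> C * sqrt (2 * \<epsilon> * (\<Sum>k<n. \<integral>x. \<alpha> k x \<partial>M))"
  proof -
    have "(\<integral>x. (\<Sum>k<n. \<xi> k x)^2 \<partial>M) = (\<Sum>k<n. \<integral>x. (\<xi> k x)^2 \<partial>M)"
    proof (rule orthogonal_sum_square[where G=G])
      show "\<xi> j \<in> borel_measurable (G k)" if "j < k" "k < n" for j k
        using GG[OF xim[of j], of k] that by simp
    qed (use xisq xice G in auto)
    also have "\<dots> \<le> (\<Sum>k<n. C^2 * (2 * \<epsilon> * (\<integral>x. \<alpha> k x \<partial>M)))"
      by (rule sum_mono) (use xiE in simp)
    finally have "(\<integral>x. (\<Sum>k<n. \<xi> k x)^2 \<partial>M) \<le> C^2 * (2 * \<epsilon> * (\<Sum>k<n. (\<integral>x. \<alpha> k x \<partial>M)))"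
      by (simp add: sum_distrib_left)
    then have "sqrt (\<integral>x. (\<Sum>k<n. \<xi> k x)^2 \<partial>M) \<le> sqrt (C^2 * (2 * \<epsilon> * (\<Sum>k<n. (\<integral>x. \<alpha> k x \<partial>M))))"
      by simp
    also have "\<dots> = C * sqrt (2 * \<epsilon> * (\<Sum>k<n. (\<integral>x. \<alpha> k x \<partial>M)))" using C by (simp add: real_sqrt_mult)
    finally show ?thesis
      using integral_abs_le_sqrt[of "\<lambda>x. \<Sum>k<n. \<xi> k x"] integrable_square_sum[of "{..<n}" \<xi> M] xisq by fastforce
  qed
  have D2E: "(\<integral>x. \<bar>D2 k x\<bar> \<partial>M) \<le> (\<integral>x. (if Z k x > \<epsilon> then Z k x else 0) \<partial>M) + (\<integral>x. (if \<alpha> k x > \<epsilon> then \<alpha> k x else 0) \<partial>M)"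
    (is "_ \<le> ?r k") if "k < n" for k
  proof -
    have "(\<integral>x. \<bar>D2 k x\<bar> \<partial>M) \<le> (\<integral>x. (if Z k x > \<epsilon> then Z k x else 0) + (if \<alpha> k x > \<epsilon> then \<alpha> k x else 0) \<partial>M)"
      by (rule integral_mono) (use that iD2 iZ1 ia1 Z(3)[of k] \<alpha>(3)[of k] in \<open>auto simp: D2_def abs_le_iff add_increasing add_increasing2\<close>)
    then show ?thesis using iZ1 ia1 that by simp
  qed
  \<comment> \<open>\<open>D1 + D2 = Z - \<alpha>\<close> is conditionally centred, hence
    \<open>c\<close> is minus the conditional expectation of \<open>D2\<close> and inherits its L1
    bound by contraction.\<close>
  have cE: "(\<integral>x. \<bar>c k x\<bar> \<partial>M) \<le> ?r k" if "k < n" for k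
  proof -
    interpret sigma_finite_subalgebra M "G k" by (rule subalgebra_sigma_finite) (use G that in simp)
    have "(\<lambda>x. D1 k x + D2 k x) = (\<lambda>x. Z k x - \<alpha> k x)" by (auto simp: D1_def D2_def)
    moreover have "AE x in M. real_cond_exp M (G k) (\<lambda>x. D1 k x + D2 k x) x = c k x + real_cond_exp M (G k) (D2 k) x"
      unfolding c_def by (rule real_cond_exp_add) (use iD1 iD2 that in auto)
    ultimately have "AE x in M. \<bar>c k x\<bar> = \<bar>real_cond_exp M (G k) (D2 k) x\<bar>"
      using ce[OF that] by auto
    then have "(\<integral>x. \<bar>c k x\<bar> \<partial>M) = (\<integral>x. \<bar>real_cond_exp M (G k) (D2 k) x\<bar> \<partial>M)"
      by (intro integral_cong_AE) (use that in \<open>auto intro!: measurable_from_subalg[OF G]\<close>)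
    also have "\<dots> \<le> (\<integral>x. \<bar>D2 k x\<bar> \<partial>M)" by (rule integral_abs_cond_exp_le) (use G iD2 that in auto)
    finally show ?thesis using D2E[OF that] by simp
  qed
  have ih: "integrable M (\<lambda>x. h k x * f x)" if "k < n" "integrable M f" for k f
    using integrable_mult_bounded[OF _ that(2) h(2)] that(1) by simp
  have hE: "(\<integral>x. \<bar>h k x * f x\<bar> \<partial>M) \<le> C * (\<integral>x. \<bar>f x\<bar> \<partial>M)" if "k < n" "integrable M f" for k f
  proof -
    have "(\<integral>x. \<bar>h k x * f x\<bar> \<partial>M) \<le> (\<integral>x. C * \<bar>f x\<bar> \<partial>M)"
      by (rule integral_mono) (use integrable_abs[OF ih[OF that]] that h(2) in \<open>auto simp: abs_mult intro!: mult_right_mono\<close>)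
    then show ?thesis by simp
  qed
  have ixi: "integrable M (\<xi> k)" if "k < n" for k
    by (rule integrable_of_square) (use xisq that in auto)
  have dec: "h k x * (Z k x - \<alpha> k x) = \<xi> k x + h k x * c k x + h k x * D2 k x" for k x
    by (simp add: \<xi>_def algebra_simps D1_def D2_def)
  have "(\<integral>x. \<bar>\<Sum>k<n. h k x * (Z k x - \<alpha> k x)\<bar> \<partial>M) \<le>
     (\<integral>x. \<bar>\<Sum>k<n. \<xi> k x\<bar> + (\<Sum>k<n. \<bar>h k x * c k x\<bar> + \<bar>h k x * D2 k x\<bar>) \<partial>M)"
  proof (rule integral_mono)
    fix x
    have "\<bar>\<Sum>k<n. h k x * (Z k x - \<alpha> k x)\<bar> \<le> \<bar>\<Sum>k<n. \<xi> k x\<bar> + \<bar>\<Sum>k<n. h k x * c k x + h k x * D2 k x\<bar>"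
      unfolding dec sum.distrib by simp
    also have "\<bar>\<Sum>k<n. h k x * c k x + h k x * D2 k x\<bar> \<le> (\<Sum>k<n. \<bar>h k x * c k x\<bar> + \<bar>h k x * D2 k x\<bar>)"
      by (rule order_trans[OF sum_abs]) (intro sum_mono abs_triangle_ineq)
    finally show "\<bar>\<Sum>k<n. h k x * (Z k x - \<alpha> k x)\<bar> \<le> \<bar>\<Sum>k<n. \<xi> k x\<bar> + (\<Sum>k<n. \<bar>h k x * c k x\<bar> + \<bar>h k x * D2 k x\<bar>)" by simp
  next
    show "integrable M (\<lambda>x. \<bar>\<Sum>k<n. h k x * (Z k x - \<alpha> k x)\<bar>)"
      by (intro integrable_abs Bochner_Integration.integrable_sum ih) (use Z \<alpha> in auto)
    show "integrable M (\<lambda>x. \<bar>\<Sum>k<n. \<xi> k x\<bar> + (\<Sum>k<n. \<bar>h k x * c k x\<bar> + \<bar>h k x * D2 k x\<bar>))"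
      by (intro Bochner_Integration.integrable_add integrable_abs Bochner_Integration.integrable_sum ih) (use ixi ic iD2 in auto)
  qed
  also have "\<dots> = (\<integral>x. \<bar>\<Sum>k<n. \<xi> k x\<bar> \<partial>M) + (\<Sum>k<n. (\<integral>x. \<bar>h k x * c k x\<bar> \<partial>M) + (\<integral>x. \<bar>h k x * D2 k x\<bar> \<partial>M))"
  proof -
    have i1: "integrable M (\<lambda>x. \<bar>\<Sum>k<n. \<xi> k x\<bar>)"
      by (intro integrable_abs Bochner_Integration.integrable_sum) (use ixi in auto)
    have i2: "integrable M (\<lambda>x. \<bar>h k x * c k x\<bar>)" "integrable M (\<lambda>x. \<bar>h k x * D2 k x\<bar>)" if "k < n" for k
      by (intro integrable_abs ih that ic iD2)+
    have "(\<integral>x. \<bar>\<Sum>k<n. \<xi> k x\<bar> + (\<Sum>k<n. \<bar>h k x * c k x\<bar> + \<bar>h k x * D2 k x\<bar>) \<partial>M)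
        = (\<integral>x. \<bar>\<Sum>k<n. \<xi> k x\<bar> \<partial>M) + (\<integral>x. (\<Sum>k<n. \<bar>h k x * c k x\<bar> + \<bar>h k x * D2 k x\<bar>) \<partial>M)"
      by (rule Bochner_Integration.integral_add)
        (intro i1 Bochner_Integration.integrable_sum Bochner_Integration.integrable_add i2; simp)+
    also have "(\<integral>x. (\<Sum>k<n. \<bar>h k x * c k x\<bar> + \<bar>h k x * D2 k x\<bar>) \<partial>M)
        = (\<Sum>k<n. \<integral>x. \<bar>h k x * c k x\<bar> + \<bar>h k x * D2 k x\<bar> \<partial>M)"
      by (rule Bochner_Integration.integral_sum) (intro Bochner_Integration.integrable_add i2; simp)
    also have "\<dots> = (\<Sum>k<n. (\<integral>x. \<bar>h k x * c k x\<bar> \<partial>M) + (\<integral>x. \<bar>h k x * D2 k x\<bar> \<partial>M))"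
      by (intro sum.cong refl Bochner_Integration.integral_add i2) simp_all
    finally show ?thesis .
  qed
  also have "\<dots> \<le> C * sqrt (2 * \<epsilon> * (\<Sum>k<n. \<integral>x. \<alpha> k x \<partial>M)) + (\<Sum>k<n. C * ?r k + C * ?r k)"
  proof (intro add_mono E1 sum_mono)
    fix k assume "k \<in> {..<n}" then have k: "k < n" by simp
    show "(\<integral>x. \<bar>h k x * c k x\<bar> \<partial>M) \<le> C * ?r k"
      by (rule order_trans[OF hE[OF k ic[OF k]]]) (rule mult_left_mono[OF cE[OF k] C])
    show "(\<integral>x. \<bar>h k x * D2 k x\<bar> \<partial>M) \<le> C * ?r k"
      by (rule order_trans[OF hE[OF k iD2[OF k]]]) (rule mult_left_mono[OF D2E[OF k] C])
  qed
  also have "\<dots> = C * (sqrt (2 * \<epsilon> * (\<Sum>k<n. \<integral>x. \<alpha> k x \<partial>M)) + 2 * (\<Sum>k<n. ?r k))"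
    by (simp add: algebra_simps sum_distrib_left sum.distrib)
  finally show ?thesis .
qed

end

section \<open>Step integrands and the Doleans measure\<close>

text \<open>Unlike in \<open>part\<close>, nodes may coincide: stopping a partition at an
  intermediate time s, as in \<open>min (p k) s\<close>, produces degenerate steps.\<close>

definition wpart :: "real \<Rightarrow> (nat \<Rightarrow> real) \<Rightarrow> nat \<Rightarrow> bool" where
  "wpart t p n \<longleftrightarrow> p 0 = 0 \<and> p n = t \<and> (\<forall>k<n. p k \<le> p (Suc k))"

lemma wpart_facts:
  assumes "wpart t p n"
  shows wpart_mono: "i \<le> j \<Longrightarrow> j \<le> n \<Longrightarrow> p i \<le> p j"
    and wpart_nonneg: "i \<le> n \<Longrightarrow> 0 \<le> p i" and wpart_le: "i \<le> n \<Longrightarrow> p i \<le> t"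
proof -
  have mono: "p i \<le> p j" if "i \<le> j" "j \<le> n" for i j
    using that
  proof (induction j)
    case (Suc j)
    show ?case
    proof (cases "i = Suc j")
      case False
      then have "p i \<le> p j" using Suc by simp
      also have "p j \<le> p (Suc j)" using assms(1) Suc.prems by (simp add: wpart_def)
      finally show ?thesis .
    qed simp
  qed simp
  show "i \<le> j \<Longrightarrow> j \<le> n \<Longrightarrow> p i \<le> p j" by (rule mono)
  show "i \<le> n \<Longrightarrow> 0 \<le> p i" using mono[of 0 i] assms by (simp add: wpart_def)
  show le: "i \<le> n \<Longrightarrow> p i \<le> t" using mono[of i n] assms by (simp add: wpart_def)
qed

text \<open>The least node at or above s is the right end of its step. Steps are open on the left
  and closed on the right, as for predictable integrands, so time 0 belongs to none.\<close>

lemma wpart_find: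
  assumes p: "wpart t p n" and s: "0 < s" "s \<le> t"
  obtains k where "k < n" "p k < s" "s \<le> p (Suc k)"
proof -
  define j where "j = (LEAST j. s \<le> p j)"
  have ex: "s \<le> p n" using p s by (simp add: wpart_def)
  have j: "s \<le> p j" unfolding j_def by (rule LeastI[of _ n]) (rule ex)
  have jn: "j \<le> n" unfolding j_def by (rule Least_le) (rule ex)
  have "j \<noteq> 0" using j p s by (auto simp: wpart_def intro: ccontr)
  then obtain k where k: "j = Suc k" by (cases j) auto
  have "\<not> s \<le> p k" using not_less_Least[of k "\<lambda>j. s \<le> p j"] k j_def by simp
  with j jn k show thesis by (intro that[of k]) auto
qed

lemma wpart_sum_indicator:
  assumes p: "wpart t p n" and k: "k < n" "p k < s" "s \<le> p (Suc k)"
  shows "(\<Sum>j<n. f j * indicator {p j<..p (Suc j)} s) = (f k :: real)"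
proof -
  have "indicator {p j<..p (Suc j)} s = (0::real)" if "j < n" "j \<noteq> k" for j
  proof (cases "j < k")
    case True
    then have "p (Suc j) \<le> p k" using wpart_mono[OF p, of "Suc j" k] k by simp
    with k show ?thesis by (auto simp: indicator_def)
  next
    case False
    then have "p (Suc k) \<le> p j" using wpart_mono[OF p, of "Suc k" j] that by simp
    with k show ?thesis by (auto simp: indicator_def)
  qed
  then have "(\<Sum>j<n. f j * indicator {p j<..p (Suc j)} s) = (\<Sum>j<n. if j = k then f k else 0)"
    using k by (intro sum.cong) auto
  then show ?thesis using k by simp
qed

lemma wpart_sum_outside:
  assumes p: "wpart t p n" and s: "\<not> (0 < s \<and> s \<le> t)"
  shows "(\<Sum>j<n. f j * indicator {p j<..p (Suc j)} s) = (0 :: real)"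
proof (rule sum.neutral, rule ballI)
  fix j assume "j \<in> {..<n}"
  then have "0 \<le> p j" "p (Suc j) \<le> t" using wpart_nonneg[OF p, of j] wpart_le[OF p, of "Suc j"] by auto
  with s show "f j * indicator {p j<..p (Suc j)} s = 0" by (auto simp: indicator_def)
qed

lemma wpart_sum_abs_le:
  assumes p: "wpart t p n" and f: "\<And>j. \<bar>f j\<bar> \<le> C"
  shows "\<bar>\<Sum>j<n. f j * indicator {p j<..p (Suc j)} s\<bar> \<le> (C::real)"
proof (cases "0 < s \<and> s \<le> t")
  case True
  then obtain k where "k < n" "p k < s" "s \<le> p (Suc k)" using wpart_find[OF p] by blast
  then show ?thesis using wpart_sum_indicator[OF p] f by simp
next
  case False
  then show ?thesis using wpart_sum_outside[OF p] f[of 0] by simp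
qed

lemma wpart_bound: "wpart t p n \<Longrightarrow> t \<le> T \<Longrightarrow> i \<le> n \<Longrightarrow> p i \<le> T"
  using wpart_le[of t p n i] by simp

section \<open>Martingales on a filtration and their discrete transforms\<close>

locale filtered_prob_space = prob_space M for M :: "'a measure" +
  fixes F :: "real \<Rightarrow> 'a measure" and T :: real
  assumes T_pos: "0 < T"
    and sub: "t \<in> {0..T} \<Longrightarrow> subalgebra M (F t)"
    and F_mono: "0 \<le> s \<Longrightarrow> s \<le> t \<Longrightarrow> t \<le> T \<Longrightarrow> sets (F s) \<subseteq> sets (F t)"
begin

lemma adapted_mono:
  assumes "f \<in> borel_measurable (F s)" "0 \<le> s" "s \<le> t" "t \<le> T"
  shows "f \<in> borel_measurable (F t)"
  by (rule measurable_from_subalg[OF _ assms(1)])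
     (use sub[of s] sub[of t] F_mono[of s t] assms in \<open>simp_all add: subalgebra_def\<close>)

lemma adapted_M:
  assumes "f \<in> borel_measurable (F s)" "0 \<le> s" "s \<le> T"
  shows "f \<in> borel_measurable M"
  by (rule measurable_from_subalg[OF sub assms(1)]) (use assms in auto)

lemma mart_adapted: "mart M F T N \<Longrightarrow> 0 \<le> t \<Longrightarrow> t \<le> T \<Longrightarrow> (\<lambda>\<omega>. N \<omega> t) \<in> borel_measurable (F t)"
  by (auto simp: mart_def)

lemma mart_integrable: "mart M F T N \<Longrightarrow> 0 \<le> t \<Longrightarrow> t \<le> T \<Longrightarrow> integrable M (\<lambda>\<omega>. N \<omega> t)"
  by (auto simp: mart_def)

lemma mart_increment:
  assumes N: "mart M F T N" and st: "0 \<le> s" "s \<le> t" "t \<le> T"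
  shows "AE \<omega> in M. real_cond_exp M (F s) (\<lambda>\<omega>. N \<omega> t - N \<omega> s) \<omega> = 0"
proof -
  interpret sigma_finite_subalgebra M "F s" by (rule subalgebra_sigma_finite) (use sub st in simp)
  have i: "integrable M (\<lambda>\<omega>. N \<omega> t)" "integrable M (\<lambda>\<omega>. N \<omega> s)"
    using mart_integrable[OF N] st by auto
  have "AE \<omega> in M. real_cond_exp M (F s) (\<lambda>\<omega>. N \<omega> t - N \<omega> s) \<omega>
      = real_cond_exp M (F s) (\<lambda>\<omega>. N \<omega> t) \<omega> - real_cond_exp M (F s) (\<lambda>\<omega>. N \<omega> s) \<omega>"
    by (rule real_cond_exp_diff[OF i])
  moreover have "AE \<omega> in M. real_cond_exp M (F s) (\<lambda>\<omega>. N \<omega> t) \<omega> = N \<omega> s"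
    using N st by (auto simp: mart_def)
  moreover have "AE \<omega> in M. real_cond_exp M (F s) (\<lambda>\<omega>. N \<omega> s) \<omega> = N \<omega> s"
    by (rule real_cond_exp_F_meas[OF i(2)]) (use mart_adapted[OF N] st in auto)
  ultimately show ?thesis by eventually_elim simp
qed

text \<open>Testing against events of \<open>F s\<close> replaces conditional expectations by plain
  integrals. In this form the martingale property passes to finite sums and to L1 limits.\<close>

lemma martI:
  assumes N: "\<And>t. 0 \<le> t \<Longrightarrow> t \<le> T \<Longrightarrow> (\<lambda>\<omega>. N \<omega> t) \<in> borel_measurable (F t)"
     "\<And>t. 0 \<le> t \<Longrightarrow> t \<le> T \<Longrightarrow> integrable M (\<lambda>\<omega>. N \<omega> t)"
    and eq: "\<And>s t A. 0 \<le> s \<Longrightarrow> s \<le> t \<Longrightarrow> t \<le> T \<Longrightarrow> A \<in> sets (F s) \<Longrightarrow>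
       (\<integral>\<omega>. indicator A \<omega> * N \<omega> t \<partial>M) = (\<integral>\<omega>. indicator A \<omega> * N \<omega> s \<partial>M)"
  shows "mart M F T N"
  unfolding mart_def
proof (intro conjI ballI allI impI)
  fix s t assume st: "0 \<le> s \<and> s \<le> t \<and> t \<le> T"
  interpret sigma_finite_subalgebra M "F s" by (rule subalgebra_sigma_finite) (use sub st in simp)
  show "AE \<omega> in M. real_cond_exp M (F s) (\<lambda>\<omega>. N \<omega> t) \<omega> = N \<omega> s"
    by (rule real_cond_exp_charact) (use N eq st in \<open>auto simp: set_lebesgue_integral_def\<close>)
qed (use N in auto)

lemma mart_indicator:
  assumes N: "mart M F T N" and st: "0 \<le> s" "s \<le> t" "t \<le> T" and A: "A \<in> sets (F s)"
  shows "(\<integral>\<omega>. indicator A \<omega> * N \<omega> t \<partial>M) = (\<integral>\<omega>. indicator A \<omega> * N \<omega> s \<partial>M)"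
proof -
  have [measurable]: "A \<in> sets M" using A sub[of s] st by (auto simp: subalgebra_def)
  have [measurable]: "(\<lambda>\<omega>. N \<omega> t) \<in> borel_measurable M" "(\<lambda>\<omega>. N \<omega> s) \<in> borel_measurable M"
    using mart_integrable[OF N] st by auto
  have i: "integrable M (\<lambda>\<omega>. indicator A \<omega> * N \<omega> r)" if "0 \<le> r" "r \<le> T" for r
    by (rule integrable_mult_bounded[where C=1]) (use mart_integrable[OF N that] in \<open>auto simp: indicator_def\<close>)
  have "(\<integral>\<omega>. indicator A \<omega> * (N \<omega> t - N \<omega> s) \<partial>M) = 0"
  proof (rule integral_mult_cond_exp_0[of "F s"])
    show "AE \<omega> in M. real_cond_exp M (F s) (\<lambda>\<omega>. N \<omega> t - N \<omega> s) \<omega> = 0"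
      by (rule mart_increment[OF N st])
    show "integrable M (\<lambda>\<omega>. indicator A \<omega> * (N \<omega> t - N \<omega> s))"
      using i[of t] i[of s] st by (simp add: right_diff_distrib)
  qed (use sub st A in auto)
  then show ?thesis using i[of t] i[of s] st by (simp add: right_diff_distrib)
qed

lemma mart_diff:
  assumes N: "mart M F T N" and L: "mart M F T L"
  shows "mart M F T (\<lambda>\<omega> t. N \<omega> t - L \<omega> t)"
proof (rule martI)
  fix s t A assume st: "0 \<le> s" "s \<le> t" "t \<le> T" and A: "A \<in> sets (F s)"
  have [measurable]: "A \<in> sets M" using A sub[of s] st by (auto simp: subalgebra_def)
  have i: "integrable M (\<lambda>\<omega>. indicator A \<omega> * K \<omega> r)" if "mart M F T K" "0 \<le> r" "r \<le> T" for r K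
    by (rule integrable_mult_bounded[where C=1]) (use mart_integrable[OF that] in \<open>auto simp: indicator_def\<close>)
  show "(\<integral>\<omega>. indicator A \<omega> * (N \<omega> t - L \<omega> t) \<partial>M) = (\<integral>\<omega>. indicator A \<omega> * (N \<omega> s - L \<omega> s) \<partial>M)"
    using mart_indicator[OF N st A] mart_indicator[OF L st A] i[OF N, of t] i[OF N, of s] i[OF L, of t] i[OF L, of s] st
    by (simp add: right_diff_distrib)
qed (use mart_adapted[OF N] mart_adapted[OF L] mart_integrable[OF N] mart_integrable[OF L] in auto)

text \<open>Orthogonality of the increments of \<open>N\<close> is all that enters: the weights are
  replaced by their bound and the sum of squared increments folds back into one increment. This
  makes the estimate applicable to the difference of two particles without computing its
  bracket.\<close>

lemma mart_transform_bound:
  assumes N: "mart M F T N" and sq: "\<And>t. 0 \<le> t \<Longrightarrow> t \<le> T \<Longrightarrow> integrable M (\<lambda>\<omega>. (N \<omega> t)^2)"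
    and p: "wpart t p n" "t \<le> T"
    and h: "\<And>k. k < n \<Longrightarrow> h k \<in> borel_measurable (F (p k))" "\<And>k \<omega>. \<bar>h k \<omega>\<bar> \<le> C"
  shows "integrable M (\<lambda>\<omega>. (\<Sum>k<n. h k \<omega> * (N \<omega> (p (Suc k)) - N \<omega> (p k)))^2)"
    and "(\<integral>\<omega>. (\<Sum>k<n. h k \<omega> * (N \<omega> (p (Suc k)) - N \<omega> (p k)))^2 \<partial>M) \<le> C^2 * (\<integral>\<omega>. (N \<omega> t - N \<omega> 0)^2 \<partial>M)"
proof -
  note pf = wpart_mono[OF p(1)] wpart_nonneg[OF p(1)] wpart_bound[OF p]
  have NF: "(\<lambda>\<omega>. N \<omega> (p k)) \<in> borel_measurable (F (p j))" if "k \<le> j" "j \<le> n" for k j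
    by (intro adapted_mono[OF mart_adapted[OF N]] pf) (use that in auto)
  have NM[measurable]: "(\<lambda>\<omega>. N \<omega> (p k)) \<in> borel_measurable M" if "k \<le> n" for k
    by (intro adapted_M[OF mart_adapted[OF N]] pf) (use that in auto)
  have hF: "h k \<in> borel_measurable (F (p j))" if "k \<le> j" "j \<le> n" "k < n" for k j
    by (intro adapted_mono[OF h(1)] pf) (use that in auto)
  have hM[measurable]: "h k \<in> borel_measurable M" if "k < n" for k
    by (intro adapted_M[OF h(1)] pf) (use that in auto)
  have dsq: "integrable M (\<lambda>\<omega>. (N \<omega> (p (Suc k)) - N \<omega> (p k))^2)" if "k < n" for k
    by (rule integrable_square_diff) (use that in \<open>auto intro!: sq pf\<close>)
  have xsq: "integrable M (\<lambda>\<omega>. (h k \<omega> * (N \<omega> (p (Suc k)) - N \<omega> (p k)))^2)" if "k < n" for k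
    by (rule integrable_square_mult_bounded[where C=C]) (use dsq h that in auto)
  show "integrable M (\<lambda>\<omega>. (\<Sum>k<n. h k \<omega> * (N \<omega> (p (Suc k)) - N \<omega> (p k)))^2)"
    by (rule integrable_square_sum) (use xsq in auto)
  \<comment> \<open>Stated for arbitrary bounded adapted weights because it is used in both
    directions: with \<open>h\<close> to split the square, and with weights 1 to reassemble a
    telescoping sum.\<close>
  have orth: "(\<integral>\<omega>. (\<Sum>k<n. g k \<omega> * (N \<omega> (p (Suc k)) - N \<omega> (p k)))^2 \<partial>M)
      = (\<Sum>k<n. \<integral>\<omega>. (g k \<omega> * (N \<omega> (p (Suc k)) - N \<omega> (p k)))^2 \<partial>M)"
    if g: "\<And>k. k < n \<Longrightarrow> g k \<in> borel_measurable (F (p k))" "\<And>k \<omega>. \<bar>g k \<omega>\<bar> \<le> K" for g K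
  proof (rule orthogonal_sum_square[where G="\<lambda>k. F (p k)"])
    have gM[measurable]: "g k \<in> borel_measurable M" if "k < n" for k
      by (intro adapted_M[OF g(1)] pf) (use that in auto)
    show "subalgebra M (F (p k))" if "k < n" for k using that by (auto intro!: sub pf)
    show "(\<lambda>\<omega>. g k \<omega> * (N \<omega> (p (Suc k)) - N \<omega> (p k))) \<in> borel_measurable M" if "k < n" for k
      by (intro borel_measurable_times borel_measurable_diff NM gM) (use that in auto)
    show "(\<lambda>\<omega>. g j \<omega> * (N \<omega> (p (Suc j)) - N \<omega> (p j))) \<in> borel_measurable (F (p k))" if "j < k" "k < n" for j k
      by (intro borel_measurable_times borel_measurable_diff NF adapted_mono[OF g(1)] pf) (use that in auto)
    show "integrable M (\<lambda>\<omega>. (g k \<omega> * (N \<omega> (p (Suc k)) - N \<omega> (p k)))^2)" if "k < n" for k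
      by (rule integrable_square_mult_bounded[where C=K]) (use dsq g that in auto)
    show "AE \<omega> in M. real_cond_exp M (F (p k)) (\<lambda>\<omega>. g k \<omega> * (N \<omega> (p (Suc k)) - N \<omega> (p k))) \<omega> = 0" if "k < n" for k
    proof -
      interpret sigma_finite_subalgebra M "F (p k)" by (rule subalgebra_sigma_finite) (use that in \<open>auto intro!: sub pf\<close>)
      have i: "integrable M (\<lambda>\<omega>. N \<omega> (p (Suc k)) - N \<omega> (p k))"
        by (intro Bochner_Integration.integrable_diff mart_integrable[OF N] pf) (use that in auto)
      have "AE \<omega> in M. real_cond_exp M (F (p k)) (\<lambda>\<omega>. g k \<omega> * (N \<omega> (p (Suc k)) - N \<omega> (p k))) \<omega>
          = g k \<omega> * real_cond_exp M (F (p k)) (\<lambda>\<omega>. N \<omega> (p (Suc k)) - N \<omega> (p k)) \<omega>"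
        by (rule real_cond_exp_mult) (use that g integrable_mult_bounded[OF _ i g(2)] in auto)
      moreover have "AE \<omega> in M. real_cond_exp M (F (p k)) (\<lambda>\<omega>. N \<omega> (p (Suc k)) - N \<omega> (p k)) \<omega> = 0"
        by (intro mart_increment[OF N] pf) (use that in auto)
      ultimately show ?thesis by eventually_elim simp
    qed
  qed
  have "(\<integral>\<omega>. (\<Sum>k<n. h k \<omega> * (N \<omega> (p (Suc k)) - N \<omega> (p k)))^2 \<partial>M)
      = (\<Sum>k<n. \<integral>\<omega>. (h k \<omega> * (N \<omega> (p (Suc k)) - N \<omega> (p k)))^2 \<partial>M)"
    by (rule orth[OF h])
  also have "\<dots> \<le> (\<Sum>k<n. \<integral>\<omega>. C^2 * (1 * (N \<omega> (p (Suc k)) - N \<omega> (p k)))^2 \<partial>M)"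
  proof (intro sum_mono integral_mono)
    fix k \<omega>
    show "(h k \<omega> * (N \<omega> (p (Suc k)) - N \<omega> (p k)))^2 \<le> C^2 * (1 * (N \<omega> (p (Suc k)) - N \<omega> (p k)))^2"
      unfolding power_mult_distrib using h(2)[of k \<omega>]
      by (auto intro!: mult_right_mono simp: abs_le_square_iff[symmetric])
  qed (use xsq dsq in auto)
  also have "\<dots> = C^2 * (\<Sum>k<n. \<integral>\<omega>. (1 * (N \<omega> (p (Suc k)) - N \<omega> (p k)))^2 \<partial>M)"
    by (simp add: sum_distrib_left)
  also have "(\<Sum>k<n. \<integral>\<omega>. (1 * (N \<omega> (p (Suc k)) - N \<omega> (p k)))^2 \<partial>M)
      = (\<integral>\<omega>. (\<Sum>k<n. 1 * (N \<omega> (p (Suc k)) - N \<omega> (p k)))^2 \<partial>M)"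
    by (rule orth[symmetric, where K=1]) auto
  also have "(\<lambda>\<omega>. (\<Sum>k<n. 1 * (N \<omega> (p (Suc k)) - N \<omega> (p k)))^2) = (\<lambda>\<omega>. (N \<omega> t - N \<omega> 0)^2)"
    using p sum_lessThan_telescope[of "\<lambda>k. N \<omega> (p k)" n for \<omega>] by (simp add: wpart_def)
  finally show "(\<integral>\<omega>. (\<Sum>k<n. h k \<omega> * (N \<omega> (p (Suc k)) - N \<omega> (p k)))^2 \<partial>M) \<le> C^2 * (\<integral>\<omega>. (N \<omega> t - N \<omega> 0)^2 \<partial>M)" .
qed

end

text \<open>A continuous square integrable martingale whose bracket has density \<open>a\<close>.
  The conditions with \<open>min s t\<close> express progressive measurability on the whole time
  line instead of on [0, t], so that time integrals up to t become measurable for \<open>F t\<close>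
  by Fubini.\<close>

locale ito_process = filtered_prob_space M F T for M :: "'a measure" and F T +
  fixes X a :: "'a \<Rightarrow> real \<Rightarrow> real"
  assumes X_cont: "\<omega> \<in> space M \<Longrightarrow> continuous_on {0..T} (X \<omega>)"
    and X_meas: "(\<lambda>(\<omega>, s). X \<omega> s) \<in> borel_measurable (M \<Otimes>\<^sub>M lborel)"
    and X_prog: "t \<in> {0..T} \<Longrightarrow> (\<lambda>(\<omega>, s). X \<omega> (min s t)) \<in> borel_measurable (F t \<Otimes>\<^sub>M lborel)"
    and a_meas: "(\<lambda>(\<omega>, s). a \<omega> s) \<in> borel_measurable (M \<Otimes>\<^sub>M lborel)"
    and a_prog: "t \<in> {0..T} \<Longrightarrow> (\<lambda>(\<omega>, s). a \<omega> (min s t)) \<in> borel_measurable (F t \<Otimes>\<^sub>M lborel)"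
    and a_nonneg: "0 \<le> a \<omega> s"
    and X_mart: "mart M F T X"
    and X_sq: "t \<in> {0..T} \<Longrightarrow> integrable M (\<lambda>\<omega>. (X \<omega> t)^2)"
    and a_int: "integrable (M \<Otimes>\<^sub>M lborel) (\<lambda>(\<omega>, s). indicator {0..T} s * a \<omega> s)"
    and A_mart: "mart M F T (\<lambda>\<omega> t. (X \<omega> t)^2 - (\<integral>s. indicator {0..t} s * a \<omega> s \<partial>lborel))"
begin

sublocale pair_sigma_finite M lborel ..

lemma X_ad: "0 \<le> t \<Longrightarrow> t \<le> T \<Longrightarrow> (\<lambda>\<omega>. X \<omega> t) \<in> borel_measurable (F t)"
  by (rule mart_adapted[OF X_mart])

lemma X_M[measurable]: "0 \<le> t \<Longrightarrow> t \<le> T \<Longrightarrow> (\<lambda>\<omega>. X \<omega> t) \<in> borel_measurable M"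
  by (rule adapted_M[OF X_ad])

text \<open>The increment of the bracket of \<open>X\<close> over (c, e]. The half-open interval
  matches the steps of a partition.\<close>

definition clock :: "real \<Rightarrow> real \<Rightarrow> 'a \<Rightarrow> real" where
  "clock c e \<omega> = (\<integral>s. indicator {c<..e} s * a \<omega> s \<partial>lborel)"

lemma clock_nonneg: "0 \<le> clock c e \<omega>"
  unfolding clock_def by (rule integral_nonneg_AE) (auto simp: a_nonneg)

lemma clock_ad: 
  assumes "0 \<le> e" "e \<le> T"
  shows "clock c e \<in> borel_measurable (F e)"
proof -
  have [measurable]: "(\<lambda>(\<omega>, s). a \<omega> (min s e)) \<in> borel_measurable (F e \<Otimes>\<^sub>M lborel)"
    by (rule a_prog) (use assms in auto)
  \<comment> \<open>On the range of integration \<open>min s e\<close> equals s; the rewriting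
    brings in the version of \<open>a\<close> that is measurable for \<open>F e\<close>.\<close>
  have "clock c e = (\<lambda>\<omega>. \<integral>s. indicator {c<..e} s * a \<omega> (min s e) \<partial>lborel)"
    unfolding clock_def by (intro ext Bochner_Integration.integral_cong) (auto simp: indicator_def min_def)
  also have "\<dots> \<in> borel_measurable (F e)" by measurable
  finally show ?thesis .
qed

lemma clock_M[measurable]: "0 \<le> e \<Longrightarrow> e \<le> T \<Longrightarrow> clock c e \<in> borel_measurable M"
  by (rule adapted_M[OF clock_ad])

lemma a_AE: "AE \<omega> in M. integrable lborel (\<lambda>s. indicator {0..T} s * a \<omega> s)"
  using AE_integrable_fst[OF a_int] by simp

lemma ind_a_integrable:
  assumes "integrable lborel (\<lambda>s. indicator {0..T} s * a \<omega> s)" "S \<in> sets borel" "S \<subseteq> {0..T}" "\<omega> \<in> space M"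
  shows "integrable lborel (\<lambda>s. indicator S s * a \<omega> s)"
proof (rule Bochner_Integration.integrable_bound[OF assms(1)])
  have [measurable]: "(\<lambda>s. a \<omega> s) \<in> borel_measurable lborel"
    using measurable_Pair2[OF a_meas assms(4)] by simp
  show "(\<lambda>s. indicator S s * a \<omega> s) \<in> borel_measurable lborel" using assms(2) by measurable
  show "AE s in lborel. norm (indicator S s * a \<omega> s) \<le> norm (indicator {0..T} s * a \<omega> s)"
    by (intro AE_I2) (use assms(3) in \<open>auto simp: indicator_def\<close>)
qed

lemma clock_integrable:
  assumes "0 \<le> c" "e \<le> T"
  shows "integrable M (clock c e)"
proof -
  have "integrable (M \<Otimes>\<^sub>M lborel) (\<lambda>(\<omega>, s). indicator {c<..e} s * a \<omega> s)"
  proof (rule Bochner_Integration.integrable_bound[OF a_int])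
    show "(\<lambda>(\<omega>, s). indicator {c<..e} s * a \<omega> s) \<in> borel_measurable (M \<Otimes>\<^sub>M lborel)"
      using a_meas by measurable
    show "AE x in M \<Otimes>\<^sub>M lborel. norm (case x of (\<omega>, s) \<Rightarrow> indicator {c<..e} s * a \<omega> s) \<le> norm (case x of (\<omega>, s) \<Rightarrow> indicator {0..T} s * a \<omega> s)"
      using assms by (auto simp: indicator_def)
  qed
  from integrable_fst[OF this] show ?thesis by (simp add: clock_def[abs_def])
qed

text \<open>Additivity over intervals needs an integrable path of \<open>a\<close>, which is known
  only almost surely; on the exceptional set a Bochner integral may take its default value
  0.\<close>

lemma clock_AE:
  assumes ce: "0 \<le> c" "c \<le> e" "e \<le> T"
  shows "AE \<omega> in M. (\<integral>s. indicator {0..e} s * a \<omega> s \<partial>lborel) - (\<integral>s. indicator {0..c} s * a \<omega> s \<partial>lborel) = clock c e \<omega>"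
  using a_AE AE_space
proof eventually_elim
  case (elim \<omega>)
  have "clock c e \<omega> = (\<integral>s. indicator {0..e} s * a \<omega> s - indicator {0..c} s * a \<omega> s \<partial>lborel)"
    unfolding clock_def using ce by (intro Bochner_Integration.integral_cong) (auto simp: indicator_def)
  also have "\<dots> = (\<integral>s. indicator {0..e} s * a \<omega> s \<partial>lborel) - (\<integral>s. indicator {0..c} s * a \<omega> s \<partial>lborel)"
    by (rule Bochner_Integration.integral_diff; rule ind_a_integrable[OF elim(1)]) (use elim ce in auto)
  finally show ?case by simp
qed

lemma X_increment: 
  "0 \<le> s \<Longrightarrow> s \<le> t \<Longrightarrow> t \<le> T \<Longrightarrow> AE \<omega> in M. real_cond_exp M (F s) (\<lambda>\<omega>. X \<omega> t - X \<omega> s) \<omega> = 0"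
  by (rule mart_increment[OF X_mart])

lemma dX_sq: "0 \<le> s \<Longrightarrow> s \<le> T \<Longrightarrow> 0 \<le> t \<Longrightarrow> t \<le> T \<Longrightarrow> integrable M (\<lambda>\<omega>. (X \<omega> t - X \<omega> s)^2)"
  by (rule integrable_square_diff) (auto intro: X_sq)

text \<open>The squared increment minus \<open>clock s t\<close> differs from the increment of the
  martingale X^2 - <X> by 2 X_s (X_t - X_s), whose conditional mean given \<open>F s\<close>
  vanishes.\<close>

lemma square_increment:
  assumes st: "0 \<le> s" "s \<le> t" "t \<le> T"
  shows "AE \<omega> in M. real_cond_exp M (F s) (\<lambda>\<omega>. (X \<omega> t - X \<omega> s)^2 - clock s t \<omega>) \<omega> = 0"
proof -
  interpret sigma_finite_subalgebra M "F s" by (rule subalgebra_sigma_finite) (use sub st in simp)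
  define N where "N \<omega> r = (X \<omega> r)^2 - (\<integral>q. indicator {0..r} q * a \<omega> q \<partial>lborel)" for \<omega> r
  have Nm: "mart M F T N" unfolding N_def by (rule A_mart)
  note [measurable] = X_ad[OF st(1)]
  have s': "s \<le> T" "0 \<le> t" using st by auto
  have [measurable]: "(\<lambda>\<omega>. N \<omega> t) \<in> borel_measurable M" "(\<lambda>\<omega>. N \<omega> s) \<in> borel_measurable M"
    using mart_integrable[OF Nm] st s' by auto
  have iN: "integrable M (\<lambda>\<omega>. N \<omega> t - N \<omega> s)"
    using mart_integrable[OF Nm] st s' by auto
  have iX: "integrable M (\<lambda>\<omega>. X \<omega> s * (X \<omega> t - X \<omega> s))"
    by (rule integrable_mult_square) (use X_sq dX_sq st s' in auto)
  have "AE \<omega> in M. (N \<omega> t - N \<omega> s) - 2 * (X \<omega> s * (X \<omega> t - X \<omega> s)) = (X \<omega> t - X \<omega> s)^2 - clock s t \<omega>"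
    using clock_AE[OF st] unfolding N_def by eventually_elim (simp add: power2_diff power2_eq_square algebra_simps)
  then have "AE \<omega> in M. real_cond_exp M (F s) (\<lambda>\<omega>. (N \<omega> t - N \<omega> s) - 2 * (X \<omega> s * (X \<omega> t - X \<omega> s))) \<omega>
      = real_cond_exp M (F s) (\<lambda>\<omega>. (X \<omega> t - X \<omega> s)^2 - clock s t \<omega>) \<omega>"
    by (rule real_cond_exp_cong) (use st s' in measurable)
  moreover have "AE \<omega> in M. real_cond_exp M (F s) (\<lambda>\<omega>. (N \<omega> t - N \<omega> s) - 2 * (X \<omega> s * (X \<omega> t - X \<omega> s))) \<omega>
      = real_cond_exp M (F s) (\<lambda>\<omega>. N \<omega> t - N \<omega> s) \<omega> - real_cond_exp M (F s) (\<lambda>\<omega>. 2 * (X \<omega> s * (X \<omega> t - X \<omega> s))) \<omega>"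
    by (rule real_cond_exp_diff) (use iN iX in auto)
  moreover have "AE \<omega> in M. real_cond_exp M (F s) (\<lambda>\<omega>. 2 * (X \<omega> s * (X \<omega> t - X \<omega> s))) \<omega>
      = 2 * real_cond_exp M (F s) (\<lambda>\<omega>. X \<omega> s * (X \<omega> t - X \<omega> s)) \<omega>"
    by (rule real_cond_exp_cmult[OF iX])
  moreover have "AE \<omega> in M. real_cond_exp M (F s) (\<lambda>\<omega>. X \<omega> s * (X \<omega> t - X \<omega> s)) \<omega>
      = X \<omega> s * real_cond_exp M (F s) (\<lambda>\<omega>. X \<omega> t - X \<omega> s) \<omega>"
    by (rule real_cond_exp_mult) (use iX st s' in auto)
  ultimately show ?thesis
    using mart_increment[OF Nm st] X_increment[OF st] by eventually_elim simp
qed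

text \<open>The Doleans measure d<X> dP on [0, T], for which the Ito isometry is an isometry of L2
  spaces. Its total mass is E<X>_T, hence finite, and bounded convergence applies to
  integrands.\<close>

definition doleans :: "('a \<times> real) measure" where
  "doleans = density (M \<Otimes>\<^sub>M lborel) (\<lambda>(\<omega>, s). ennreal (indicator {0..T} s * a \<omega> s))"

lemma sets_doleans[measurable_cong, simp]: "sets doleans = sets (M \<Otimes>\<^sub>M lborel)"
  by (simp add: doleans_def)

lemma space_doleans[simp]: "space doleans = space M \<times> UNIV"
  by (simp add: doleans_def space_pair_measure)

lemma dens_meas: "(\<lambda>(\<omega>, s). indicator {0..T} s * a \<omega> s) \<in> borel_measurable (M \<Otimes>\<^sub>M lborel)"
  using a_meas by measurable

lemma finite_doleans: "finite_measure doleans"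
proof
  have "emeasure doleans (space doleans) = (\<integral>\<^sup>+x. ennreal (case x of (\<omega>, s) \<Rightarrow> indicator {0..T} s * a \<omega> s) \<partial>(M \<Otimes>\<^sub>M lborel))"
    unfolding doleans_def using dens_meas
    by (subst emeasure_density) (auto intro!: nn_integral_cong simp: space_pair_measure split: prod.splits split_indicator)
  also have "\<dots> < \<infinity>"
    using a_int a_nonneg by (subst nn_integral_eq_integral[OF a_int]) (auto simp: split_beta')
  finally show "emeasure doleans (space doleans) \<noteq> \<infinity>" by simp
qed

sublocale dol: finite_measure doleans by (rule finite_doleans)

lemma integral_doleans:
  fixes f :: "'a \<times> real \<Rightarrow> real"
  assumes "f \<in> borel_measurable (M \<Otimes>\<^sub>M lborel)"
  shows "integral\<^sup>L doleans f = (\<integral>x. indicator {0..T} (snd x) * a (fst x) (snd x) * f x \<partial>(M \<Otimes>\<^sub>M lborel))"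
    and "integrable doleans f \<longleftrightarrow> integrable (M \<Otimes>\<^sub>M lborel) (\<lambda>x. indicator {0..T} (snd x) * a (fst x) (snd x) * f x)"
proof -
  have d: "doleans = density (M \<Otimes>\<^sub>M lborel) (\<lambda>x. ennreal (indicator {0..T} (snd x) * a (fst x) (snd x)))"
    unfolding doleans_def by (simp add: split_beta')
  have m: "(\<lambda>x. indicator {0..T} (snd x) * a (fst x) (snd x)) \<in> borel_measurable (M \<Otimes>\<^sub>M lborel)"
    using dens_meas by (simp add: split_beta')
  show "integral\<^sup>L doleans f = (\<integral>x. indicator {0..T} (snd x) * a (fst x) (snd x) * f x \<partial>(M \<Otimes>\<^sub>M lborel))"
    unfolding d using integral_density[OF assms m] a_nonneg by auto
  show "integrable doleans f \<longleftrightarrow> integrable (M \<Otimes>\<^sub>M lborel) (\<lambda>x. indicator {0..T} (snd x) * a (fst x) (snd x) * f x)"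
    unfolding d using integrable_density[OF assms m] a_nonneg by auto
qed

lemma integral_doleans_rect:
  assumes [measurable]: "Z \<in> borel_measurable M" and Z: "\<And>\<omega>. \<bar>Z \<omega>\<bar> \<le> C" and ce: "0 \<le> c" "e \<le> T"
  shows "(\<integral>x. Z (fst x) * indicator {c<..e} (snd x) \<partial>doleans) = (\<integral>\<omega>. Z \<omega> * clock c e \<omega> \<partial>M)"
proof -
  have m: "(\<lambda>x. Z (fst x) * indicator {c<..e} (snd x)) \<in> borel_measurable (M \<Otimes>\<^sub>M lborel)" by measurable
  have i: "integrable doleans (\<lambda>x. Z (fst x) * indicator {c<..e} (snd x))"
    by (rule dol.integrable_const_bound[where B=C])
      (use m Z in \<open>auto simp: indicator_def order_trans[OF abs_ge_zero Z]\<close>)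
  have "(\<integral>x. Z (fst x) * indicator {c<..e} (snd x) \<partial>doleans)
     = (\<integral>x. (case x of (\<omega>, s) \<Rightarrow> indicator {0..T} s * a \<omega> s * (Z \<omega> * indicator {c<..e} s)) \<partial>(M \<Otimes>\<^sub>M lborel))"
    by (subst integral_doleans(1)[OF m]) (simp add: split_beta')
  also have "\<dots> = (\<integral>\<omega>. (\<integral>s. indicator {0..T} s * a \<omega> s * (Z \<omega> * indicator {c<..e} s) \<partial>lborel) \<partial>M)"
    by (rule integral_fst[symmetric]) (use i in \<open>subst (asm) integral_doleans(2)[OF m], simp add: split_beta'\<close>)
  also have "\<dots> = (\<integral>\<omega>. Z \<omega> * clock c e \<omega> \<partial>M)"
  proof (rule Bochner_Integration.integral_cong[OF refl])
    fix \<omega>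
    have "(\<integral>s. indicator {0..T} s * a \<omega> s * (Z \<omega> * indicator {c<..e} s) \<partial>lborel)
      = (\<integral>s. Z \<omega> * (indicator {c<..e} s * a \<omega> s) \<partial>lborel)"
      using ce by (intro Bochner_Integration.integral_cong) (auto simp: indicator_def)
    then show "(\<integral>s. indicator {0..T} s * a \<omega> s * (Z \<omega> * indicator {c<..e} s) \<partial>lborel) = Z \<omega> * clock c e \<omega>"
      by (simp add: clock_def)
  qed
  finally show ?thesis .
qed

lemma orth_increment:
  assumes W: "W \<in> borel_measurable (F c)" "integrable M (\<lambda>\<omega>. (W \<omega>)^2)" and cd: "0 \<le> c" "c \<le> d" "d \<le> T"
  shows "integrable M (\<lambda>\<omega>. W \<omega> * (X \<omega> d - X \<omega> c))" and "(\<integral>\<omega>. W \<omega> * (X \<omega> d - X \<omega> c) \<partial>M) = 0"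
proof -
  have [measurable]: "W \<in> borel_measurable M" by (rule adapted_M[OF W(1)]) (use cd in auto)
  show i: "integrable M (\<lambda>\<omega>. W \<omega> * (X \<omega> d - X \<omega> c))"
    by (rule integrable_mult_square) (use W dX_sq cd in auto)
  show "(\<integral>\<omega>. W \<omega> * (X \<omega> d - X \<omega> c) \<partial>M) = 0"
    by (rule integral_mult_cond_exp_0[of "F c"]) (use i W cd X_increment sub in auto)
qed

lemma square_clock:
  assumes W: "W \<in> borel_measurable (F c)" "\<And>\<omega>. \<bar>W \<omega>\<bar> \<le> C" and cd: "0 \<le> c" "c \<le> d" "d \<le> T"
  shows "integrable M (\<lambda>\<omega>. W \<omega> * (X \<omega> d - X \<omega> c)^2)"
    and "(\<integral>\<omega>. W \<omega> * (X \<omega> d - X \<omega> c)^2 \<partial>M) = (\<integral>\<omega>. W \<omega> * clock c d \<omega> \<partial>M)"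
proof -
  have [measurable]: "W \<in> borel_measurable M" by (rule adapted_M[OF W(1)]) (use cd in auto)
  show i: "integrable M (\<lambda>\<omega>. W \<omega> * (X \<omega> d - X \<omega> c)^2)"
    by (rule integrable_mult_bounded[OF _ _ W(2)]) (use dX_sq cd in auto)
  have j: "integrable M (\<lambda>\<omega>. W \<omega> * clock c d \<omega>)"
    by (rule integrable_mult_bounded[OF _ _ W(2)]) (use clock_integrable cd in auto)
  have "(\<integral>\<omega>. W \<omega> * ((X \<omega> d - X \<omega> c)^2 - clock c d \<omega>) \<partial>M) = 0"
    by (rule integral_mult_cond_exp_0[of "F c"]) (use i j W cd square_increment sub in \<open>auto simp: right_diff_distrib\<close>)
  then show "(\<integral>\<omega>. W \<omega> * (X \<omega> d - X \<omega> c)^2 \<partial>M) = (\<integral>\<omega>. W \<omega> * clock c d \<omega> \<partial>M)"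
    using i j by (simp add: right_diff_distrib)
qed

text \<open>Disjoint intervals contribute 0 on both sides, since the later increment is orthogonal
  to everything before it. For overlapping ones both increments are cut at the ends of the overlap
  (r, e]; each mixed product contains an increment orthogonal to its past, and only the square over
  the overlap survives, which is exchanged for the bracket.\<close>

lemma pair_isometry_ordered:
  assumes H1: "H1 \<in> borel_measurable (F p)" "\<And>\<omega>. \<bar>H1 \<omega>\<bar> \<le> C" 
    and H2: "H2 \<in> borel_measurable (F r)" "\<And>\<omega>. \<bar>H2 \<omega>\<bar> \<le> D"
    and pq: "0 \<le> p" "p \<le> q" "q \<le> T" and rs: "0 \<le> r" "r \<le> s" "s \<le> T" and pr: "p \<le> r"
  shows "(\<integral>\<omega>. (H1 \<omega> * (X \<omega> q - X \<omega> p)) * (H2 \<omega> * (X \<omega> s - X \<omega> r)) \<partial>M)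
     = (\<integral>x. (H1 (fst x) * indicator {p<..q} (snd x)) * (H2 (fst x) * indicator {r<..s} (snd x)) \<partial>doleans)"
proof -
  have C: "0 \<le> C" using H1(2) abs_ge_zero order_trans by blast
  have H1r: "H1 \<in> borel_measurable (F r)" by (rule adapted_mono[OF H1(1)]) (use pq rs pr in auto)
  have [measurable]: "H1 \<in> borel_measurable M" by (rule adapted_M[OF H1(1)]) (use pq in auto)
  have [measurable]: "H2 \<in> borel_measurable M" by (rule adapted_M[OF H2(1)]) (use rs in auto)
  have H12: "\<bar>H1 \<omega> * H2 \<omega>\<bar> \<le> C * D" for \<omega>
    unfolding abs_mult by (rule mult_mono) (use H1 H2 C in auto)
  have Xad: "(\<lambda>\<omega>. X \<omega> u) \<in> borel_measurable (F v)" if "0 \<le> u" "u \<le> v" "v \<le> T" for u v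
    by (rule adapted_mono[OF X_ad]) (use that in auto)
  have Wsq: "integrable M (\<lambda>\<omega>. (H1 \<omega> * H2 \<omega> * (X \<omega> v - X \<omega> u))^2)" if "0 \<le> u" "u \<le> v" "v \<le> T" for u v
    by (rule integrable_square_mult_bounded[OF _ _ H12]) (use dX_sq that in auto)
  show ?thesis
  proof (cases "q \<le> r")
    case True
    have [measurable]: "H1 \<in> borel_measurable (F r)" "H2 \<in> borel_measurable (F r)"
      "(\<lambda>\<omega>. X \<omega> q) \<in> borel_measurable (F r)" "(\<lambda>\<omega>. X \<omega> p) \<in> borel_measurable (F r)"
      using H1r H2 Xad pq rs pr True by auto
    have "(\<integral>\<omega>. (H1 \<omega> * (X \<omega> q - X \<omega> p)) * (H2 \<omega> * (X \<omega> s - X \<omega> r)) \<partial>M)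
       = (\<integral>\<omega>. (H1 \<omega> * H2 \<omega> * (X \<omega> q - X \<omega> p)) * (X \<omega> s - X \<omega> r) \<partial>M)" by (simp add: mult_ac)
    also have "\<dots> = 0"
      by (rule orth_increment) (use Wsq pq rs in auto)
    also have "0 = (\<integral>x. (H1 (fst x) * indicator {p<..q} (snd x)) * (H2 (fst x) * indicator {r<..s} (snd x)) \<partial>doleans)"
      using True by (intro integral_eq_zero_AE[symmetric] AE_I2) (auto simp: indicator_def)
    finally show ?thesis .
  next
    case False
    define e where "e = min q s"
    have e: "r \<le> e" "e \<le> q" "e \<le> s" "e \<le> T" "0 \<le> e" "e = q \<or> e = s"
      using False pq rs by (auto simp: e_def min_def)
    have [measurable]: "H1 \<in> borel_measurable (F r)" "H2 \<in> borel_measurable (F r)"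
      "(\<lambda>\<omega>. X \<omega> p) \<in> borel_measurable (F r)" "(\<lambda>\<omega>. X \<omega> r) \<in> borel_measurable (F r)"
      using H1r H2 Xad pq rs pr by auto
    have [measurable]: "H1 \<in> borel_measurable (F e)" "H2 \<in> borel_measurable (F e)"
      "(\<lambda>\<omega>. X \<omega> e) \<in> borel_measurable (F e)" "(\<lambda>\<omega>. X \<omega> r) \<in> borel_measurable (F e)"
      by (rule adapted_mono[OF H1r] adapted_mono[OF H2(1)] Xad; use e rs in auto)+
    let ?W = "\<lambda>u v \<omega>. H1 \<omega> * H2 \<omega> * (X \<omega> v - X \<omega> u)"
    have o1: "integrable M (\<lambda>\<omega>. ?W p r \<omega> * (X \<omega> s - X \<omega> r))" "(\<integral>\<omega>. ?W p r \<omega> * (X \<omega> s - X \<omega> r) \<partial>M) = 0"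
      by (rule orth_increment; use Wsq pq rs pr in auto)+
    have o2: "integrable M (\<lambda>\<omega>. ?W r e \<omega> * (X \<omega> s - X \<omega> e))" "(\<integral>\<omega>. ?W r e \<omega> * (X \<omega> s - X \<omega> e) \<partial>M) = 0"
      by (rule orth_increment; use Wsq pq rs e in auto)+
    have o3: "integrable M (\<lambda>\<omega>. ?W r e \<omega> * (X \<omega> q - X \<omega> e))" "(\<integral>\<omega>. ?W r e \<omega> * (X \<omega> q - X \<omega> e) \<partial>M) = 0"
      by (rule orth_increment; use Wsq pq rs e in auto)+
    have o4: "integrable M (\<lambda>\<omega>. (H1 \<omega> * H2 \<omega>) * (X \<omega> e - X \<omega> r)^2)"
        "(\<integral>\<omega>. (H1 \<omega> * H2 \<omega>) * (X \<omega> e - X \<omega> r)^2 \<partial>M) = (\<integral>\<omega>. (H1 \<omega> * H2 \<omega>) * clock r e \<omega> \<partial>M)"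
      by (rule square_clock[OF _ H12]; use pq rs e in auto)+
    \<comment> \<open>Cutting at r and e would also produce (X q - X e)(X s - X e), which vanishes
      because e is q or s.\<close>
    have "(H1 \<omega> * (X \<omega> q - X \<omega> p)) * (H2 \<omega> * (X \<omega> s - X \<omega> r)) =
       ?W p r \<omega> * (X \<omega> s - X \<omega> r) + ?W r e \<omega> * (X \<omega> s - X \<omega> e) + ?W r e \<omega> * (X \<omega> q - X \<omega> e) + (H1 \<omega> * H2 \<omega>) * (X \<omega> e - X \<omega> r)^2" for \<omega>
      using e(6) by (auto simp: power2_eq_square algebra_simps)
    then have "(\<integral>\<omega>. (H1 \<omega> * (X \<omega> q - X \<omega> p)) * (H2 \<omega> * (X \<omega> s - X \<omega> r)) \<partial>M)
       = (\<integral>\<omega>. ?W p r \<omega> * (X \<omega> s - X \<omega> r) + ?W r e \<omega> * (X \<omega> s - X \<omega> e) + ?W r e \<omega> * (X \<omega> q - X \<omega> e) + (H1 \<omega> * H2 \<omega>) * (X \<omega> e - X \<omega> r)^2 \<partial>M)"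
      by simp
    also have "\<dots> = (\<integral>\<omega>. (H1 \<omega> * H2 \<omega>) * clock r e \<omega> \<partial>M)"
      using o1 o2 o3 o4 by simp
    also have "\<dots> = (\<integral>x. (H1 (fst x) * H2 (fst x)) * indicator {r<..e} (snd x) \<partial>doleans)"
      by (rule integral_doleans_rect[symmetric, OF _ H12]) (use rs e in auto)
    also have "\<dots> = (\<integral>x. (H1 (fst x) * indicator {p<..q} (snd x)) * (H2 (fst x) * indicator {r<..s} (snd x)) \<partial>doleans)"
      using pr by (intro Bochner_Integration.integral_cong refl) (auto simp: indicator_def e_def)
    finally show ?thesis .
  qed
qed

lemma pair_isometry:
  assumes H1: "H1 \<in> borel_measurable (F p)" "\<And>\<omega>. \<bar>H1 \<omega>\<bar> \<le> C" 
    and H2: "H2 \<in> borel_measurable (F r)" "\<And>\<omega>. \<bar>H2 \<omega>\<bar> \<le> D"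
    and pq: "0 \<le> p" "p \<le> q" "q \<le> T" and rs: "0 \<le> r" "r \<le> s" "s \<le> T"
  shows "(\<integral>\<omega>. (H1 \<omega> * (X \<omega> q - X \<omega> p)) * (H2 \<omega> * (X \<omega> s - X \<omega> r)) \<partial>M)
     = (\<integral>x. (H1 (fst x) * indicator {p<..q} (snd x)) * (H2 (fst x) * indicator {r<..s} (snd x)) \<partial>doleans)"
  using pair_isometry_ordered[OF H1 H2 pq rs] pair_isometry_ordered[OF H2 H1 rs pq]
  by (cases "p \<le> r") (simp_all add: mult.commute)

section \<open>Step integrands and their isometry\<close>

definition isum :: "(nat \<Rightarrow> real) \<Rightarrow> nat \<Rightarrow> (nat \<Rightarrow> 'a \<Rightarrow> real) \<Rightarrow> 'a \<Rightarrow> real" where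
  "isum p n h \<omega> = (\<Sum>k<n. h k \<omega> * (X \<omega> (p (Suc k)) - X \<omega> (p k)))"

definition istep :: "(nat \<Rightarrow> real) \<Rightarrow> nat \<Rightarrow> (nat \<Rightarrow> 'a \<Rightarrow> real) \<Rightarrow> 'a \<times> real \<Rightarrow> real" where
  "istep p n h x = (\<Sum>k<n. h k (fst x) * indicator {p k<..p (Suc k)} (snd x))"

definition simple_integrand :: "real \<Rightarrow> (nat \<Rightarrow> real) \<Rightarrow> nat \<Rightarrow> (nat \<Rightarrow> 'a \<Rightarrow> real) \<Rightarrow> bool" where
  "simple_integrand t p n h \<longleftrightarrow> wpart t p n \<and> t \<le> T \<and> (\<forall>k<n. h k \<in> borel_measurable (F (p k))) \<and> (\<exists>C. \<forall>k \<omega>. \<bar>h k \<omega>\<bar> \<le> C)"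

lemma simple_facts:
  assumes h: "simple_integrand t p n h"
  shows isum_M: "isum p n h \<in> borel_measurable M"
    and isum_sq: "integrable M (\<lambda>\<omega>. (isum p n h \<omega>)^2)"
    and istep_meas: "istep p n h \<in> borel_measurable (M \<Otimes>\<^sub>M lborel)"
    and istep_bounded: "\<exists>B. \<forall>x. \<bar>istep p n h x\<bar> \<le> B"
proof -
  from h obtain C where p: "wpart t p n" "t \<le> T" and hF: "\<And>k. k < n \<Longrightarrow> h k \<in> borel_measurable (F (p k))" and C: "\<And>k \<omega>. \<bar>h k \<omega>\<bar> \<le> C"
    unfolding simple_integrand_def by blast
  note pf = wpart_mono[OF p(1)] wpart_nonneg[OF p(1)] wpart_bound[OF p]
  have hM[measurable]: "h k \<in> borel_measurable M" if "k < n" for k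
    by (intro adapted_M[OF hF] pf) (use that in auto)
  show "isum p n h \<in> borel_measurable M"
    unfolding isum_def[abs_def]
    by (intro borel_measurable_sum borel_measurable_times borel_measurable_diff X_M hM pf) auto
  show "istep p n h \<in> borel_measurable (M \<Otimes>\<^sub>M lborel)"
    unfolding istep_def[abs_def] by (intro borel_measurable_sum) measurable
  show "integrable M (\<lambda>\<omega>. (isum p n h \<omega>)^2)"
    unfolding isum_def[abs_def]
    by (rule mart_transform_bound(1)[OF X_mart _ p hF C]) (use X_sq in auto)
  have C1: "\<bar>h k \<omega> * indicator S u\<bar> \<le> C" for k \<omega> u and S :: "real set"
    using C[of k \<omega>] by (cases "u \<in> S") auto
  have "\<bar>istep p n h x\<bar> \<le> (\<Sum>k<n. C)" for x
    unfolding istep_def by (rule order_trans[OF sum_abs sum_mono]) (rule C1)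
  then show "\<exists>B. \<forall>x. \<bar>istep p n h x\<bar> \<le> B" by blast
qed

lemma istep_prod_integrable:
  assumes "simple_integrand t p n h" "simple_integrand t' q m g"
  shows "integrable doleans (\<lambda>x. istep p n h x * istep q m g x)"
proof -
  note [measurable] = istep_meas[OF assms(1)] istep_meas[OF assms(2)]
  obtain B B' where B: "\<And>x. \<bar>istep p n h x\<bar> \<le> B" "\<And>x. \<bar>istep q m g x\<bar> \<le> B'"
    using istep_bounded[OF assms(1)] istep_bounded[OF assms(2)] by blast
  have "0 \<le> B" using B(1) abs_ge_zero order_trans by blast
  then show ?thesis
    by (intro dol.integrable_const_bound[where B="B * B'"]) (use B in \<open>auto simp: abs_mult intro!: mult_mono\<close>)
qed

text \<open>The two partitions are unrelated. Bilinear expansion and the isometry for pairs of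
  steps, which may overlap partially, take the place of a common refinement.\<close>

lemma isum_inner:
  assumes h: "simple_integrand t p n h" and g: "simple_integrand t' q m g"
  shows "(\<integral>\<omega>. isum p n h \<omega> * isum q m g \<omega> \<partial>M) = (\<integral>x. istep p n h x * istep q m g x \<partial>doleans)"
proof -
  from h obtain C where p: "wpart t p n" "t \<le> T" and hF: "\<And>k. k < n \<Longrightarrow> h k \<in> borel_measurable (F (p k))" and C: "\<And>k \<omega>. \<bar>h k \<omega>\<bar> \<le> C"
    unfolding simple_integrand_def by blast
  from g obtain D where q: "wpart t' q m" "t' \<le> T" and gF: "\<And>k. k < m \<Longrightarrow> g k \<in> borel_measurable (F (q k))" and D: "\<And>k \<omega>. \<bar>g k \<omega>\<bar> \<le> D"
    unfolding simple_integrand_def by blast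
  note pf = wpart_mono[OF p(1)] wpart_nonneg[OF p(1)] wpart_bound[OF p] wpart_mono[OF q(1)] wpart_nonneg[OF q(1)] wpart_bound[OF q]
  have hM[measurable]: "h k \<in> borel_measurable M" if "k < n" for k
    by (intro adapted_M[OF hF] pf) (use that in auto)
  have gM[measurable]: "g k \<in> borel_measurable M" if "k < m" for k
    by (intro adapted_M[OF gF] pf) (use that in auto)
  have C0: "0 \<le> C" using C abs_ge_zero order_trans by blast
  have i1: "integrable M (\<lambda>\<omega>. (h k \<omega> * (X \<omega> (p (Suc k)) - X \<omega> (p k))) * (g j \<omega> * (X \<omega> (q (Suc j)) - X \<omega> (q j))))" 
    if "k < n" "j < m" for k j
    by (intro integrable_mult_square integrable_square_mult_bounded[OF _ _ C] integrable_square_mult_bounded[OF _ _ D]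
        dX_sq borel_measurable_times borel_measurable_diff X_M hM gM pf) (use that in auto)
  have i2: "integrable doleans (\<lambda>x. (h k (fst x) * indicator {p k<..p (Suc k)} (snd x)) * (g j (fst x) * indicator {q j<..q (Suc j)} (snd x)))"
    if "k < n" "j < m" for k j
  proof (rule dol.integrable_const_bound[where B="C * D"])
    show "(\<lambda>x. (h k (fst x) * indicator {p k<..p (Suc k)} (snd x)) * (g j (fst x) * indicator {q j<..q (Suc j)} (snd x))) \<in> borel_measurable doleans"
      using that by measurable
    have "\<bar>h k \<omega>\<bar> * \<bar>g j \<omega>\<bar> \<le> C * D" for \<omega> by (rule mult_mono) (use C D C0 in auto)
    moreover have "0 \<le> C * D" using C0 D[of 0 undefined] abs_ge_zero[of "g 0 undefined"] by (intro mult_nonneg_nonneg) auto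
    ultimately show "AE x in doleans. norm ((h k (fst x) * indicator {p k<..p (Suc k)} (snd x)) * (g j (fst x) * indicator {q j<..q (Suc j)} (snd x))) \<le> C * D"
      by (auto simp: indicator_def abs_mult)
  qed
  have "(\<integral>\<omega>. isum p n h \<omega> * isum q m g \<omega> \<partial>M)
     = (\<integral>\<omega>. (\<Sum>k<n. \<Sum>j<m. (h k \<omega> * (X \<omega> (p (Suc k)) - X \<omega> (p k))) * (g j \<omega> * (X \<omega> (q (Suc j)) - X \<omega> (q j)))) \<partial>M)"
    unfolding isum_def by (simp only: sum_product)
  also have "\<dots> = (\<Sum>k<n. \<Sum>j<m. \<integral>\<omega>. (h k \<omega> * (X \<omega> (p (Suc k)) - X \<omega> (p k))) * (g j \<omega> * (X \<omega> (q (Suc j)) - X \<omega> (q j))) \<partial>M)"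
    using i1 by (subst Bochner_Integration.integral_sum) (auto intro!: sum.cong Bochner_Integration.integral_sum)
  also have "\<dots> = (\<Sum>k<n. \<Sum>j<m. \<integral>x. (h k (fst x) * indicator {p k<..p (Suc k)} (snd x)) * (g j (fst x) * indicator {q j<..q (Suc j)} (snd x)) \<partial>doleans)"
    by (intro sum.cong refl pair_isometry[OF hF C gF D] pf) auto
  also have "\<dots> = (\<integral>x. (\<Sum>k<n. \<Sum>j<m. (h k (fst x) * indicator {p k<..p (Suc k)} (snd x)) * (g j (fst x) * indicator {q j<..q (Suc j)} (snd x))) \<partial>doleans)"
    using i2 by (subst Bochner_Integration.integral_sum) (auto intro!: sum.cong Bochner_Integration.integral_sum[symmetric])
  also have "\<dots> = (\<integral>x. istep p n h x * istep q m g x \<partial>doleans)"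
    unfolding istep_def by (simp only: sum_product)
  finally show ?thesis .
qed

lemma isum_diff_square:
  assumes h: "simple_integrand t p n h" and g: "simple_integrand t' q m g"
  shows "(\<integral>\<omega>. (isum p n h \<omega> - isum q m g \<omega>)^2 \<partial>M) = (\<integral>x. (istep p n h x - istep q m g x)^2 \<partial>doleans)"
proof -
  note [measurable] = isum_M[OF h] isum_M[OF g]
  have i: "integrable M (\<lambda>\<omega>. isum p n h \<omega> * isum q m g \<omega>)"
    by (rule integrable_mult_square) (use isum_sq[OF h] isum_sq[OF g] in auto)
  have "(\<integral>\<omega>. (isum p n h \<omega> - isum q m g \<omega>)^2 \<partial>M)
    = (\<integral>\<omega>. (isum p n h \<omega>)^2 + (isum q m g \<omega>)^2 - 2 * (isum p n h \<omega> * isum q m g \<omega>) \<partial>M)"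
    by (simp add: power2_diff mult.assoc)
  also have "\<dots> = (\<integral>\<omega>. (isum p n h \<omega>)^2 \<partial>M) + (\<integral>\<omega>. (isum q m g \<omega>)^2 \<partial>M) - 2 * (\<integral>\<omega>. isum p n h \<omega> * isum q m g \<omega> \<partial>M)"
    using i isum_sq[OF h] isum_sq[OF g] by simp
  also have "\<dots> = (\<integral>x. (istep p n h x)^2 \<partial>doleans) + (\<integral>x. (istep q m g x)^2 \<partial>doleans) - 2 * (\<integral>x. istep p n h x * istep q m g x \<partial>doleans)"
    using isum_inner[OF h h] isum_inner[OF g g] isum_inner[OF h g] by (simp add: power2_eq_square)
  also have "\<dots> = (\<integral>x. (istep p n h x)^2 + (istep q m g x)^2 - 2 * (istep p n h x * istep q m g x) \<partial>doleans)"
    using istep_prod_integrable[OF h h] istep_prod_integrable[OF g g] istep_prod_integrable[OF h g]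
    by (simp add: power2_eq_square)
  also have "\<dots> = (\<integral>x. (istep p n h x - istep q m g x)^2 \<partial>doleans)"
    by (simp add: power2_diff mult.assoc)
  finally show ?thesis .
qed

end

section \<open>Quadratic variation along partitions\<close>

lemma continuous_on_integral_upto:
  fixes f :: "real \<Rightarrow> real"
  assumes "integrable lborel (\<lambda>s. indicator {0..T} s * f s)"
  shows "continuous_on {0..T} (\<lambda>r. \<integral>s. indicator {0..r} s * f s \<partial>lborel)"
proof -
  have s: "set_integrable lborel {0..T} f" using assms by (simp add: set_integrable_def)
  have c: "continuous_on {0..T} (\<lambda>r. integral {0..r} f)"
    by (rule indefinite_integral_continuous_1) (rule set_borel_integral_eq_integral(1)[OF s])
  have "(\<integral>s. indicator {0..r} s * f s \<partial>lborel) = integral {0..r} f" if "r \<in> {0..T}" for r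
  proof -
    have "set_integrable lborel {0..r} f" by (rule set_integrable_subset[OF s]) (use that in auto)
    from set_borel_integral_eq_integral(2)[OF this] show ?thesis by (simp add: set_lebesgue_integral_def)
  qed
  with c show ?thesis by (metis (no_types, lifting) continuous_on_cong)
qed

text \<open>The L1 limit identifies the limit, the Cauchy bound gives the strength: by Fatou's lemma
  in the second index along an almost surely convergent subsequence, \<open>q m\<close> disappears
  and \<open>q n\<close> remains. In particular the limit is at finite L2 distance from each term,
  which is not assumed beforehand.\<close>

lemma (in prob_space) L2_convergence_of_L1_Cauchy:
  fixes S :: "nat \<Rightarrow> 'a \<Rightarrow> real"
  assumes [measurable]: "\<And>n. S n \<in> borel_measurable M" "I \<in> borel_measurable M"
    and i: "\<And>n. n \<ge> 1 \<Longrightarrow> integrable M (\<lambda>\<omega>. S n \<omega> - I \<omega>)"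
    and sq: "\<And>n. n \<ge> 1 \<Longrightarrow> integrable M (\<lambda>\<omega>. (S n \<omega>)^2)"
    and L1: "(\<lambda>n. \<integral>\<omega>. \<bar>S n \<omega> - I \<omega>\<bar> \<partial>M) \<longlonglongrightarrow> 0"
    and cauchy: "\<And>n m. n \<ge> 1 \<Longrightarrow> m \<ge> 1 \<Longrightarrow> (\<integral>\<omega>. (S n \<omega> - S m \<omega>)^2 \<partial>M) \<le> q n + q m"
    and q: "q \<longlonglongrightarrow> 0"
  shows "n \<ge> 1 \<Longrightarrow> integrable M (\<lambda>\<omega>. (S n \<omega> - I \<omega>)^2)"
    and "n \<ge> 1 \<Longrightarrow> (\<integral>\<omega>. (S n \<omega> - I \<omega>)^2 \<partial>M) \<le> q n"
    and "(\<lambda>n. \<integral>\<omega>. (S n \<omega> - I \<omega>)^2 \<partial>M) \<longlonglongrightarrow> 0"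
proof -
  \<comment> \<open>The hypotheses on integrability begin at index 1, hence the shift by
    \<open>Suc\<close>.\<close>
  have "\<exists>r::nat\<Rightarrow>nat. strict_mono r \<and> (AE \<omega> in M. (\<lambda>n. S (Suc (r n)) \<omega> - I \<omega>) \<longlonglongrightarrow> 0)"
    using tendsto_L1_AE_subseq[of M "\<lambda>n \<omega>. S (Suc n) \<omega> - I \<omega>"] i LIMSEQ_Suc[OF L1] by simp
  then obtain r :: "nat \<Rightarrow> nat" where r: "strict_mono r" and ae: "AE \<omega> in M. (\<lambda>n. S (Suc (r n)) \<omega> - I \<omega>) \<longlonglongrightarrow> 0"
    by blast
  have qr: "(\<lambda>j. q (Suc (r j))) \<longlonglongrightarrow> 0"
    using LIMSEQ_subseq_LIMSEQ[OF LIMSEQ_Suc[OF q] r] by (simp add: o_def)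
  have dsq: "integrable M (\<lambda>\<omega>. (S n \<omega> - S m \<omega>)^2)" if "n \<ge> 1" "m \<ge> 1" for n m
    by (rule integrable_square_diff) (use sq that in auto)
  have qn: "0 \<le> q n" if "n \<ge> 1" for n
    using cauchy[OF that that] by simp
  have bound: "(\<integral>\<^sup>+\<omega>. ennreal ((S n \<omega> - I \<omega>)^2) \<partial>M) \<le> ennreal (q n)" if n: "n \<ge> 1" for n
  proof -
    have "AE \<omega> in M. ennreal ((S n \<omega> - I \<omega>)^2) = liminf (\<lambda>j. ennreal ((S n \<omega> - S (Suc (r j)) \<omega>)^2))"
      using ae
    proof eventually_elim
      case (elim \<omega>)
      have "(\<lambda>j. S (Suc (r j)) \<omega>) \<longlonglongrightarrow> I \<omega>" using elim by (simp add: LIM_zero_iff)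
      then have "(\<lambda>j. ennreal ((S n \<omega> - S (Suc (r j)) \<omega>)^2)) \<longlonglongrightarrow> ennreal ((S n \<omega> - I \<omega>)^2)"
        by (intro tendsto_ennrealI tendsto_intros)
      then show ?case by (intro lim_imp_Liminf[symmetric]) simp_all
    qed
    then have "(\<integral>\<^sup>+\<omega>. ennreal ((S n \<omega> - I \<omega>)^2) \<partial>M) = (\<integral>\<^sup>+\<omega>. liminf (\<lambda>j. ennreal ((S n \<omega> - S (Suc (r j)) \<omega>)^2)) \<partial>M)"
      by (rule nn_integral_cong_AE)
    also have "\<dots> \<le> liminf (\<lambda>j. \<integral>\<^sup>+\<omega>. ennreal ((S n \<omega> - S (Suc (r j)) \<omega>)^2) \<partial>M)"
      by (rule nn_integral_liminf) measurable
    also have "\<dots> \<le> liminf (\<lambda>j. ennreal (q n + q (Suc (r j))))"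
    proof (rule Liminf_mono, rule always_eventually, rule allI)
      fix j
      have "(\<integral>\<^sup>+\<omega>. ennreal ((S n \<omega> - S (Suc (r j)) \<omega>)^2) \<partial>M) = ennreal (\<integral>\<omega>. (S n \<omega> - S (Suc (r j)) \<omega>)^2 \<partial>M)"
        by (rule nn_integral_eq_integral) (use dsq n in auto)
      then show "(\<integral>\<^sup>+\<omega>. ennreal ((S n \<omega> - S (Suc (r j)) \<omega>)^2) \<partial>M) \<le> ennreal (q n + q (Suc (r j)))"
        using cauchy[OF n, of "Suc (r j)"] by (simp add: ennreal_leI)
    qed
    also have "\<dots> = ennreal (q n)"
    proof (rule lim_imp_Liminf)
      have "(\<lambda>j. q n + q (Suc (r j))) \<longlonglongrightarrow> q n + 0" by (intro tendsto_intros qr)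
      then show "(\<lambda>j. ennreal (q n + q (Suc (r j)))) \<longlonglongrightarrow> ennreal (q n)"
        by (intro tendsto_ennrealI) simp
    qed simp
    finally show ?thesis .
  qed
  show int: "integrable M (\<lambda>\<omega>. (S n \<omega> - I \<omega>)^2)" if "n \<ge> 1" for n
    by (rule integrableI_bounded) (auto intro: le_less_trans[OF bound[OF that]])
  show le: "(\<integral>\<omega>. (S n \<omega> - I \<omega>)^2 \<partial>M) \<le> q n" if "n \<ge> 1" for n
    using bound[OF that] nn_integral_eq_integral[OF int[OF that]] qn[OF that] by simp
  show "(\<lambda>n. \<integral>\<omega>. (S n \<omega> - I \<omega>)^2 \<partial>M) \<longlonglongrightarrow> 0"
    by (rule tendsto_sandwich[OF _ _ tendsto_const q])
      (use le in \<open>auto intro!: eventually_mono[OF eventually_ge_at_top[of 1]]\<close>)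
qed

text \<open>The n-th partition has exactly n steps. For n = 0 there is no step and the maximum in
  \<open>mesh\<close> is over the empty set, so statements are made for n \<ge> 1 or
  eventually.\<close>

locale partition_sequence = filtered_prob_space +
  fixes t :: real and P :: "nat \<Rightarrow> nat \<Rightarrow> real"
  assumes t: "0 < t" "t \<le> T"
    and P: "1 \<le> n \<Longrightarrow> wpart t (P n) n"
    and mesh0: "(\<lambda>n. mesh (P n) n) \<longlonglongrightarrow> 0"
begin

lemma mesh_small:
  assumes "0 < \<eta>"
  shows "\<forall>\<^sub>F n in sequentially. 1 \<le> n \<and> (\<forall>k<n. P n (Suc k) - P n k < \<eta>)"
  using order_tendstoD(2)[OF mesh0 assms] eventually_ge_at_top[of 1]
proof eventually_elim
  case (elim n)
  have "P n (Suc k) - P n k \<le> mesh (P n) n" if "k < n" for k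
    unfolding mesh_def by (rule Max_ge) (use that in auto)
  with elim show ?case by force
qed

lemma oscillation_small:
  assumes f: "continuous_on {0..t} (f :: real \<Rightarrow> real)" and \<eta>: "0 < \<eta>"
  shows "\<forall>\<^sub>F n in sequentially. 1 \<le> n \<and> (\<forall>k<n. \<forall>s\<in>{P n k..P n (Suc k)}. \<bar>f s - f (P n k)\<bar> < \<eta>)"
proof -
  have "uniformly_continuous_on {0..t} f" by (rule compact_uniformly_continuous[OF f]) simp
  then obtain d where d: "0 < d" "\<And>x x'. x \<in> {0..t} \<Longrightarrow> x' \<in> {0..t} \<Longrightarrow> dist x' x < d \<Longrightarrow> dist (f x') (f x) < \<eta>"
    unfolding uniformly_continuous_on_def using \<eta> by metis
  show ?thesis using mesh_small[OF d(1)]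
  proof eventually_elim
    case (elim n)
    have p: "wpart t (P n) n" using P elim by simp
    have "\<bar>f s - f (P n k)\<bar> < \<eta>" if "k < n" "s \<in> {P n k..P n (Suc k)}" for k s
    proof -
      have "0 \<le> P n k" "P n (Suc k) \<le> t" using wpart_nonneg[OF p, of k] wpart_le[OF p, of "Suc k"] t that by auto
      moreover have "P n (Suc k) - P n k < d" using elim that by simp
      ultimately show ?thesis using d(2)[of "P n k" s] that by (auto simp: dist_real_def)
    qed
    with elim show ?case by blast
  qed
qed

text \<open>The value at the left end of the step containing s differs from \<open>f s\<close> by at
  most the oscillation of \<open>f\<close> on one step. The indicator of (0, t] in the limit
  reflects that 0 lies in no step.\<close>

lemma step_tendsto:
  assumes f: "continuous_on {0..t} (f :: real \<Rightarrow> real)"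
  shows "(\<lambda>n. \<Sum>k<n. f (P n k) * indicator {P n k<..P n (Suc k)} s) \<longlonglongrightarrow> f s * indicator {0<..t} s"
proof (cases "0 < s \<and> s \<le> t")
  case True
  show ?thesis
  proof (rule LIMSEQ_I)
    fix r :: real assume "0 < r"
    from oscillation_small[OF f this]
    have "\<forall>\<^sub>F n in sequentially. norm ((\<Sum>k<n. f (P n k) * indicator {P n k<..P n (Suc k)} s) - f s * indicator {0<..t} s) < r"
    proof eventually_elim
      case (elim n)
      then have p: "wpart t (P n) n" using P by simp
      obtain k where k: "k < n" "P n k < s" "s \<le> P n (Suc k)" using wpart_find[OF p] True by blast
      have "(\<Sum>k<n. f (P n k) * indicator {P n k<..P n (Suc k)} s) = f (P n k)"
        by (rule wpart_sum_indicator[OF p k])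
      moreover have "\<bar>f s - f (P n k)\<bar> < r" using elim k by auto
      ultimately show ?case using True by (simp add: abs_minus_commute)
    qed
    then show "\<exists>no. \<forall>n\<ge>no. norm ((\<Sum>k<n. f (P n k) * indicator {P n k<..P n (Suc k)} s) - f s * indicator {0<..t} s) < r"
      by (simp add: eventually_sequentially)
  qed
next
  case False
  have "\<forall>\<^sub>F n in sequentially. (\<Sum>k<n. f (P n k) * indicator {P n k<..P n (Suc k)} s) = f s * indicator {0<..t} s"
    using eventually_ge_at_top[of 1]
    by eventually_elim (use wpart_sum_outside[OF P False] False in \<open>auto simp: indicator_def\<close>)
  then show ?thesis by (rule tendsto_eventually)
qed

end

section \<open>Bracket increments and squared increments along partitions of vanishing mesh\<close>

locale ito_partitions = ito_process M F T X a + partition_sequence M F T t P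
  for M :: "'a measure" and F T X a t P
begin

abbreviation Z where "Z n k \<omega> \<equiv> (X \<omega> (P n (Suc k)) - X \<omega> (P n k))^2"
abbreviation al where "al n k \<equiv> clock (P n k) (P n (Suc k))"

lemma Pf:
  assumes "1 \<le> n"
  shows "i \<le> j \<Longrightarrow> j \<le> n \<Longrightarrow> P n i \<le> P n j" "i \<le> n \<Longrightarrow> 0 \<le> P n i" "i \<le> n \<Longrightarrow> P n i \<le> t" "i \<le> n \<Longrightarrow> P n i \<le> T"
  using wpart_mono[OF P[OF assms]] wpart_nonneg[OF P[OF assms]] wpart_le[OF P[OF assms]] wpart_bound[OF P[OF assms] t(2)]
  by auto

lemma P_ends: "1 \<le> n \<Longrightarrow> P n 0 = 0" "1 \<le> n \<Longrightarrow> P n n = t"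
  using P by (auto simp: wpart_def)

lemma Z_M: "1 \<le> n \<Longrightarrow> k < n \<Longrightarrow> (\<lambda>\<omega>. Z n k \<omega>) \<in> borel_measurable M"
  by (intro borel_measurable_power borel_measurable_diff X_M Pf) auto

lemma al_M: "1 \<le> n \<Longrightarrow> k < n \<Longrightarrow> al n k \<in> borel_measurable M"
  by (intro clock_M Pf) auto

lemma Z_int: "1 \<le> n \<Longrightarrow> k < n \<Longrightarrow> integrable M (\<lambda>\<omega>. Z n k \<omega>)"
  by (intro dX_sq Pf) auto

lemma al_int: "1 \<le> n \<Longrightarrow> k < n \<Longrightarrow> integrable M (al n k)"
  by (intro clock_integrable Pf) auto

lemma sum_al_AE:
  assumes n: "1 \<le> n"
  shows "AE \<omega> in M. (\<Sum>k<n. al n k \<omega>) = clock 0 t \<omega>"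
proof -
  have "AE \<omega> in M. \<forall>k\<in>{..<n}. (\<integral>s. indicator {0..P n (Suc k)} s * a \<omega> s \<partial>lborel) - (\<integral>s. indicator {0..P n k} s * a \<omega> s \<partial>lborel) = al n k \<omega>"
    by (rule AE_finite_allI) (auto intro!: clock_AE Pf[OF n])
  moreover have "AE \<omega> in M. (\<integral>s. indicator {0..t} s * a \<omega> s \<partial>lborel) - (\<integral>s. indicator {0..0} s * a \<omega> s \<partial>lborel) = clock 0 t \<omega>"
    by (rule clock_AE) (use t in auto)
  ultimately show ?thesis
  proof eventually_elim
    case (elim \<omega>)
    have "(\<Sum>k<n. al n k \<omega>) = (\<Sum>k<n. (\<integral>s. indicator {0..P n (Suc k)} s * a \<omega> s \<partial>lborel) - (\<integral>s. indicator {0..P n k} s * a \<omega> s \<partial>lborel))"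
      by (rule sum.cong) (use elim in auto)
    also have "\<dots> = clock 0 t \<omega>"
      using sum_lessThan_telescope[of "\<lambda>k. (\<integral>s. indicator {0..P n k} s * a \<omega> s \<partial>lborel)" n] P_ends[OF n] elim by simp
    finally show ?case .
  qed
qed

lemma sum_al_E: "1 \<le> n \<Longrightarrow> (\<Sum>k<n. \<integral>\<omega>. al n k \<omega> \<partial>M) = (\<integral>\<omega>. clock 0 t \<omega> \<partial>M)"
proof -
  assume n: "1 \<le> n"
  have "(\<Sum>k<n. \<integral>\<omega>. al n k \<omega> \<partial>M) = (\<integral>\<omega>. (\<Sum>k<n. al n k \<omega>) \<partial>M)"
    by (rule Bochner_Integration.integral_sum[symmetric]) (use al_int n in auto)
  also have "\<dots> = (\<integral>\<omega>. clock 0 t \<omega> \<partial>M)"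
    by (rule integral_cong_AE) (use sum_al_AE[OF n] al_M[OF n] t in auto)
  finally show ?thesis .
qed

text \<open>The bracket is an indefinite integral, so its path is uniformly continuous and all its
  increments eventually stay below \<open>\<epsilon>\<close>; the sum of the large ones is dominated
  by the whole bracket \<open>clock 0 t\<close>.\<close>

lemma big_al:
  assumes \<epsilon>: "0 < \<epsilon>"
  shows "(\<lambda>n. \<Sum>k<n. \<integral>\<omega>. (if al n k \<omega> > \<epsilon> then al n k \<omega> else 0) \<partial>M) \<longlonglongrightarrow> 0"
proof -
  have i: "integrable M (\<lambda>\<omega>. if al n k \<omega> > \<epsilon> then al n k \<omega> else 0)" if "1 \<le> n" "k < n" for n k
    by (rule Bochner_Integration.integrable_bound[OF al_int[OF that]]) (use al_M[OF that] in auto)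
  define g where "g n \<omega> = (if 1 \<le> n then \<Sum>k<n. (if al n k \<omega> > \<epsilon> then al n k \<omega> else 0) else 0)" for n \<omega>
  have "(\<lambda>n. \<integral>\<omega>. g n \<omega> \<partial>M) \<longlonglongrightarrow> (\<integral>\<omega>. 0 \<partial>M)"
  proof (rule integral_dominated_convergence[where w="clock 0 t"])
    show "g n \<in> borel_measurable M" for n
      unfolding g_def using al_M[of n] by (cases "1 \<le> n") (auto intro!: borel_measurable_sum)
    show "integrable M (clock 0 t)" by (rule clock_integrable) (use t in auto)
    show "AE \<omega> in M. norm (g n \<omega>) \<le> clock 0 t \<omega>" for n
    proof (cases "1 \<le> n")
      case True
      from sum_al_AE[OF this] show ?thesis
      proof eventually_elim
        case (elim \<omega>)
        have "g n \<omega> \<le> (\<Sum>k<n. al n k \<omega>)" unfolding g_def using clock_nonneg True by (auto intro!: sum_mono)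
        moreover have "0 \<le> g n \<omega>" unfolding g_def using clock_nonneg by (auto intro!: sum_nonneg)
        ultimately show ?case using elim by simp
      qed
    qed (simp add: g_def clock_nonneg)
    \<comment> \<open>A single null set serves all steps of all partitions, as there are countably
      many; the pathwise argument below lets n vary.\<close>
    have "AE \<omega> in M. \<forall>n. \<forall>k\<in>{..<n}. 1 \<le> n \<longrightarrow> (\<integral>s. indicator {0..P n (Suc k)} s * a \<omega> s \<partial>lborel) - (\<integral>s. indicator {0..P n k} s * a \<omega> s \<partial>lborel) = al n k \<omega>"
      unfolding AE_all_countable
    proof (intro allI AE_finite_allI)
      fix n k :: nat assume "k \<in> {..<n}"
      then show "AE \<omega> in M. 1 \<le> n \<longrightarrow> (\<integral>s. indicator {0..P n (Suc k)} s * a \<omega> s \<partial>lborel) - (\<integral>s. indicator {0..P n k} s * a \<omega> s \<partial>lborel) = al n k \<omega>"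
        by (cases "1 \<le> n") (auto intro!: clock_AE Pf)
    qed simp
    with a_AE show "AE \<omega> in M. (\<lambda>n. g n \<omega>) \<longlonglongrightarrow> 0"
    proof eventually_elim
      case (elim \<omega>)
      note good = elim(2)
      have "continuous_on {0..t} (\<lambda>r. \<integral>s. indicator {0..r} s * a \<omega> s \<partial>lborel)"
        by (rule continuous_on_subset[OF continuous_on_integral_upto[OF elim(1)]]) (use t in auto)
      from oscillation_small[OF this \<epsilon>]
      have "\<forall>\<^sub>F n in sequentially. g n \<omega> = 0"
      proof eventually_elim
        case (elim n)
        have "al n k \<omega> < \<epsilon>" if "k < n" for k
        proof -
          have "P n k \<le> P n (Suc k)" using Pf(1)[of n k "Suc k"] elim that by simp
          moreover have "al n k \<omega> = (\<integral>s. indicator {0..P n (Suc k)} s * a \<omega> s \<partial>lborel) - (\<integral>s. indicator {0..P n k} s * a \<omega> s \<partial>lborel)"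
            using good elim that by simp
          moreover have "\<forall>s\<in>{P n k..P n (Suc k)}. \<bar>(\<integral>x. indicator {0..s} x * a \<omega> x \<partial>lborel) - (\<integral>s. indicator {0..P n k} s * a \<omega> s \<partial>lborel)\<bar> < \<epsilon>"
            using elim that by simp
          ultimately show ?thesis by (auto dest: bspec[of _ _ "P n (Suc k)"])
        qed
        then have "\<not> \<epsilon> < al n k \<omega>" if "k < n" for k using that by (simp add: not_less less_imp_le)
        then show ?case unfolding g_def by (auto intro!: sum.neutral)
      qed
      then show ?case by (rule tendsto_eventually)
    qed
  qed simp
  moreover have "\<forall>\<^sub>F n in sequentially. (\<integral>\<omega>. g n \<omega> \<partial>M) = (\<Sum>k<n. \<integral>\<omega>. (if al n k \<omega> > \<epsilon> then al n k \<omega> else 0) \<partial>M)"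
    using eventually_ge_at_top[of 1]
  proof eventually_elim
    case (elim n)
    have "(\<integral>\<omega>. (\<Sum>k<n. if al n k \<omega> > \<epsilon> then al n k \<omega> else 0) \<partial>M) = (\<Sum>k<n. \<integral>\<omega>. (if al n k \<omega> > \<epsilon> then al n k \<omega> else 0) \<partial>M)"
      by (rule Bochner_Integration.integral_sum) (use i elim in auto)
    then show ?case using elim by (simp add: g_def)
  qed
  ultimately show ?thesis by (simp add: tendsto_cong)
qed


definition jump :: "real \<Rightarrow> nat \<Rightarrow> 'a \<Rightarrow> real" where
  "jump \<epsilon> n \<omega> = of_bool (\<exists>k\<in>{..<n}. Z n k \<omega> > \<epsilon>)"

text \<open>All partitions are taken together so that the event does not depend on n. Its indicator
  tends to 0 as \<open>K\<close> grows, uniformly in n, and \<open>K\<close> can be fixed before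
  n.\<close>

definition large :: "real \<Rightarrow> 'a \<Rightarrow> real" where
  "large K \<omega> = of_bool (\<exists>n. 1 \<le> n \<and> (\<exists>j\<in>{..n}. \<bar>X \<omega> (P n j)\<bar> > K))"

lemma jump_M: "1 \<le> n \<Longrightarrow> jump \<epsilon> n \<in> borel_measurable M"
proof -
  assume n: "1 \<le> n"
  have [measurable]: "Measurable.pred M (\<lambda>\<omega>. Z n k \<omega> > \<epsilon>)" if "k < n" for k
    using Z_M[OF n that] by measurable
  have "Measurable.pred M (\<lambda>\<omega>. \<exists>k\<in>{..<n}. Z n k \<omega> > \<epsilon>)"
    by (rule pred_intros_finite(4)) auto
  then show ?thesis unfolding jump_def[abs_def] by measurable
qed

lemma large_M: "large K \<in> borel_measurable M"
proof -
  have "Measurable.pred M (\<lambda>\<omega>. 1 \<le> n \<and> (\<exists>j\<in>{..n}. \<bar>X \<omega> (P n j)\<bar> > K))" for n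
  proof (cases "1 \<le> n")
    case True
    have "Measurable.pred M (\<lambda>\<omega>. \<bar>X \<omega> (P n j)\<bar> > K)" if "j \<le> n" for j
      using X_M[OF Pf(2)[OF True that] Pf(4)[OF True that]] by measurable
    then have "Measurable.pred M (\<lambda>\<omega>. \<exists>j\<in>{..n}. \<bar>X \<omega> (P n j)\<bar> > K)"
      by (intro pred_intros_finite(4)) auto
    then show ?thesis using True by simp
  qed simp
  then have "Measurable.pred M (\<lambda>\<omega>. \<exists>n. 1 \<le> n \<and> (\<exists>j\<in>{..n}. \<bar>X \<omega> (P n j)\<bar> > K))"
    by (rule pred_intros_countable(2))
  then show ?thesis unfolding large_def[abs_def] by measurable
qed

text \<open>Let b_k be the indicator that a value above K or a squared increment above \<epsilon> has occurred
by time k. Increments after such an event are compared with the clock, and a first large increment is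
dominated by X_t, so no maximal inequality is needed.\<close>

lemma big_Z_bound:
  assumes n: "1 \<le> n" and K: "0 \<le> K" and \<epsilon>: "0 < \<epsilon>"
  shows "(\<Sum>k<n. \<integral>\<omega>. (if Z n k \<omega> > \<epsilon> then Z n k \<omega> else 0) \<partial>M) \<le>
    (\<integral>\<omega>. large K \<omega> * clock 0 t \<omega> \<partial>M) + (\<integral>\<omega>. jump \<epsilon> n \<omega> * clock 0 t \<omega> \<partial>M)
    + 2 * (\<integral>\<omega>. jump \<epsilon> n \<omega> * (X \<omega> t)^2 \<partial>M) + 2 * K^2 * (\<integral>\<omega>. jump \<epsilon> n \<omega> \<partial>M)"
proof -
  define B where "B k \<omega> \<longleftrightarrow> (\<exists>j\<in>{..k}. \<bar>X \<omega> (P n j)\<bar> > K) \<or> (\<exists>j\<in>{..<k}. Z n j \<omega> > \<epsilon>)" for k \<omega>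
  define b where "b k \<omega> = (of_bool (B k \<omega>) :: real)" for k \<omega>
  \<comment> \<open>Marks the first large squared increment, starting from a still moderate value:
    \<open>B k\<close> excludes any earlier one, so at each sample point at most one
    \<open>c k\<close> is 1, as \<open>sumc\<close> records below.\<close>
  define c where "c k \<omega> = (of_bool (\<not> B k \<omega> \<and> Z n k \<omega> > \<epsilon>) :: real)" for k \<omega>
  note Pf = Pf[OF n]
  have XF: "(\<lambda>\<omega>. X \<omega> (P n j)) \<in> borel_measurable (F (P n k))" if "j \<le> k" "k \<le> n" for j k
    by (intro adapted_mono[OF X_ad] Pf) (use that in auto)
  have ZF: "(\<lambda>\<omega>. Z n j \<omega>) \<in> borel_measurable (F (P n k))" if "j < k" "k \<le> n" for j k
    by (intro borel_measurable_power borel_measurable_diff XF) (use that in auto)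
  have BF: "Measurable.pred (F (P n k)) (B k)" if "k \<le> n" for k
  proof -
    have "Measurable.pred (F (P n k)) (\<lambda>\<omega>. \<exists>j\<in>{..k}. \<bar>X \<omega> (P n j)\<bar> > K)"
    proof (rule pred_intros_finite(4))
      fix j assume "j \<in> {..k}"
      then have [measurable]: "(\<lambda>\<omega>. X \<omega> (P n j)) \<in> borel_measurable (F (P n k))" using XF that by simp
      show "Measurable.pred (F (P n k)) (\<lambda>\<omega>. \<bar>X \<omega> (P n j)\<bar> > K)" by measurable
    qed simp
    moreover have "Measurable.pred (F (P n k)) (\<lambda>\<omega>. \<exists>j\<in>{..<k}. Z n j \<omega> > \<epsilon>)"
    proof (rule pred_intros_finite(4))
      fix j assume "j \<in> {..<k}"
      then have [measurable]: "(\<lambda>\<omega>. Z n j \<omega>) \<in> borel_measurable (F (P n k))" using ZF that by simp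
      show "Measurable.pred (F (P n k)) (\<lambda>\<omega>. Z n j \<omega> > \<epsilon>)" by measurable
    qed simp
    ultimately show ?thesis unfolding B_def[abs_def] by (rule pred_intros_logic)
  qed
  have bF: "b k \<in> borel_measurable (F (P n k))" if "k \<le> n" for k
    using BF[OF that] unfolding b_def[abs_def] by measurable
  have cF: "c k \<in> borel_measurable (F (P n (Suc k)))" if "k < n" for k
  proof -
    have [measurable]: "(\<lambda>\<omega>. Z n k \<omega>) \<in> borel_measurable (F (P n (Suc k)))" using ZF that by simp
    have "b k \<in> borel_measurable (F (P n (Suc k)))"
      by (intro adapted_mono[OF bF] Pf) (use that in auto)
    then have "(\<lambda>\<omega>. (1 - b k \<omega>) * of_bool (Z n k \<omega> > \<epsilon>)) \<in> borel_measurable (F (P n (Suc k)))"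
      by measurable
    also have "(\<lambda>\<omega>. (1 - b k \<omega>) * of_bool (Z n k \<omega> > \<epsilon>)) = c k"
      by (auto simp: c_def b_def)
    finally show ?thesis .
  qed
  have bM[measurable]: "b k \<in> borel_measurable M" if "k \<le> n" for k
    by (intro adapted_M[OF bF] Pf) (use that in auto)
  have cM[measurable]: "c k \<in> borel_measurable M" if "k < n" for k
    by (intro adapted_M[OF cF] Pf) (use that in auto)
  have b1: "\<bar>b k \<omega>\<bar> \<le> 1" and c1: "\<bar>c k \<omega>\<bar> \<le> 1" for k \<omega> by (auto simp: b_def c_def)
  note tT = less_imp_le[OF t(1)] t(2)
  note [measurable] = jump_M[OF n] large_M clock_M[OF tT]
  have j1: "\<bar>jump \<epsilon> n \<omega>\<bar> \<le> 1" and l1: "\<bar>large K \<omega>\<bar> \<le> 1" for \<omega> by (auto simp: jump_def large_def)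
  have ic: "integrable M (clock 0 t)" by (rule clock_integrable) (use t in auto)
  have ibZ: "integrable M (\<lambda>\<omega>. b k \<omega> * Z n k \<omega>)" "(\<integral>\<omega>. b k \<omega> * Z n k \<omega> \<partial>M) = (\<integral>\<omega>. b k \<omega> * al n k \<omega> \<partial>M)" if "k < n" for k
    by (intro square_clock[OF _ b1] bF Pf; use that in auto)+
  have ibal: "integrable M (\<lambda>\<omega>. b k \<omega> * al n k \<omega>)" "integrable M (\<lambda>\<omega>. b n \<omega> * al n k \<omega>)" if "k < n" for k
    by (intro integrable_mult_bounded[OF _ _ b1] bM al_int n; use that in auto)+
  have icX: "integrable M (\<lambda>\<omega>. c k \<omega> * (X \<omega> (P n j))^2)" if "k < n" "j \<le> n" for k j
    by (intro integrable_mult_bounded[OF _ _ c1] cM) (use that in \<open>auto intro!: X_sq Pf\<close>)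
  have icc: "integrable M (c k)" if "k < n" for k
    by (rule integrable_const_bound[where B=1]) (use c1 that in auto)
  \<comment> \<open>Submartingale property of the square, on an event known at the right end of the
    step: expanding around that time, the mixed term has mean 0 and the remaining square is
    nonnegative. All first large increments are thereby referred to the single variable
    \<open>(X \<omega> t)^2\<close>.\<close>
  have sub: "(\<integral>\<omega>. c k \<omega> * (X \<omega> (P n (Suc k)))^2 \<partial>M) \<le> (\<integral>\<omega>. c k \<omega> * (X \<omega> t)^2 \<partial>M)" if k: "k < n" for k
  proof -
    have [measurable]: "(\<lambda>\<omega>. X \<omega> (P n (Suc k))) \<in> borel_measurable M" by (intro X_M Pf) (use k in auto)
    have WF: "(\<lambda>\<omega>. c k \<omega> * X \<omega> (P n (Suc k))) \<in> borel_measurable (F (P n (Suc k)))"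
      by (intro borel_measurable_times cF XF) (use k in auto)
    have Wsq: "integrable M (\<lambda>\<omega>. (c k \<omega> * X \<omega> (P n (Suc k)))^2)"
      by (rule integrable_square_mult_bounded[OF _ _ c1]) (use k in \<open>auto intro!: X_sq Pf\<close>)
    have o: "integrable M (\<lambda>\<omega>. c k \<omega> * X \<omega> (P n (Suc k)) * (X \<omega> t - X \<omega> (P n (Suc k))))"
      "(\<integral>\<omega>. c k \<omega> * X \<omega> (P n (Suc k)) * (X \<omega> t - X \<omega> (P n (Suc k))) \<partial>M) = 0"
      by (rule orth_increment[OF WF Wsq]; use k t Pf(2,3)[of "Suc k"] in auto)+
    have isq: "integrable M (\<lambda>\<omega>. c k \<omega> * (X \<omega> t - X \<omega> (P n (Suc k)))^2)"
      by (intro integrable_mult_bounded[OF _ _ c1] cM dX_sq Pf) (use k t in auto)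
    have "c k \<omega> * (X \<omega> t)^2 = c k \<omega> * (X \<omega> (P n (Suc k)))^2 + 2 * (c k \<omega> * X \<omega> (P n (Suc k)) * (X \<omega> t - X \<omega> (P n (Suc k))))
        + c k \<omega> * (X \<omega> t - X \<omega> (P n (Suc k)))^2" for \<omega>
      by (simp add: power2_eq_square algebra_simps)
    then have "(\<integral>\<omega>. c k \<omega> * (X \<omega> t)^2 \<partial>M) = (\<integral>\<omega>. c k \<omega> * (X \<omega> (P n (Suc k)))^2 + 2 * (c k \<omega> * X \<omega> (P n (Suc k)) * (X \<omega> t - X \<omega> (P n (Suc k))))
        + c k \<omega> * (X \<omega> t - X \<omega> (P n (Suc k)))^2 \<partial>M)" by simp
    also have "\<dots> = (\<integral>\<omega>. c k \<omega> * (X \<omega> (P n (Suc k)))^2 \<partial>M) + (\<integral>\<omega>. c k \<omega> * (X \<omega> t - X \<omega> (P n (Suc k)))^2 \<partial>M)"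
      using o isq icX[OF k, of "Suc k"] k by simp
    also have "\<dots> \<ge> (\<integral>\<omega>. c k \<omega> * (X \<omega> (P n (Suc k)))^2 \<partial>M)"
      by (auto intro!: integral_nonneg_AE simp: c_def)
    finally show ?thesis .
  qed
  have sumc: "(\<Sum>k<m. c k \<omega>) \<le> of_bool (\<exists>k\<in>{..<m}. Z n k \<omega> > \<epsilon>)" for m \<omega>
  proof (induction m)
    case (Suc m)
    show ?case
    proof (cases "\<exists>k\<in>{..<m}. Z n k \<omega> > \<epsilon>")
      case True
      then have "c m \<omega> = 0" by (auto simp: c_def B_def)
      moreover have "\<exists>k\<in>{..<Suc m}. Z n k \<omega> > \<epsilon>" using True by (auto intro: less_SucI)
      ultimately show ?thesis using Suc True by simp
    next
      case False
      have "c m \<omega> \<le> of_bool (\<exists>k\<in>{..<Suc m}. Z n k \<omega> > \<epsilon>)" by (auto simp: c_def)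
      then show ?thesis using Suc False by simp
    qed
  qed simp
  \<comment> \<open>As long as \<open>B k\<close> fails, the left value is at most \<open>K\<close>
    and (x - y)^2 \<le> 2 x^2 + 2 y^2 separates the two ends. Afterwards \<open>b k\<close> keeps
    the full square, to be exchanged for the bracket.\<close>
  have pw: "(if Z n k \<omega> > \<epsilon> then Z n k \<omega> else 0) \<le> b k \<omega> * Z n k \<omega> + (2 * (c k \<omega> * (X \<omega> (P n (Suc k)))^2) + 2 * K^2 * c k \<omega>)"
    for k \<omega>
  proof (cases "B k \<omega>")
    case False
    then have xK: "\<bar>X \<omega> (P n k)\<bar> \<le> K" by (auto simp: B_def not_less)
    have "Z n k \<omega> \<le> 2 * (X \<omega> (P n (Suc k)))^2 + 2 * (X \<omega> (P n k))^2"
    proof -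
      have "0 \<le> (X \<omega> (P n (Suc k)) + X \<omega> (P n k))^2" by simp
      then show ?thesis by (simp add: power2_eq_square algebra_simps)
    qed
    moreover have "(X \<omega> (P n k))^2 \<le> K^2" using xK K by (simp add: abs_le_square_iff[symmetric])
    ultimately show ?thesis using False \<epsilon> by (auto simp: b_def c_def)
  qed (use \<epsilon> in \<open>auto simp: b_def c_def\<close>)
  have iZ: "integrable M (\<lambda>\<omega>. if Z n k \<omega> > \<epsilon> then Z n k \<omega> else 0)" if "k < n" for k
    by (rule Bochner_Integration.integrable_bound[OF Z_int[OF n that]]) (use Z_M[OF n that] in auto)
  have "(\<Sum>k<n. \<integral>\<omega>. (if Z n k \<omega> > \<epsilon> then Z n k \<omega> else 0) \<partial>M)
     \<le> (\<Sum>k<n. (\<integral>\<omega>. b k \<omega> * al n k \<omega> \<partial>M) + (2 * (\<integral>\<omega>. c k \<omega> * (X \<omega> t)^2 \<partial>M) + 2 * K^2 * (\<integral>\<omega>. c k \<omega> \<partial>M)))"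
  proof (rule sum_mono)
    fix k assume "k \<in> {..<n}" then have k: "k < n" by simp
    have "(\<integral>\<omega>. (if Z n k \<omega> > \<epsilon> then Z n k \<omega> else 0) \<partial>M) \<le>
       (\<integral>\<omega>. b k \<omega> * Z n k \<omega> + (2 * (c k \<omega> * (X \<omega> (P n (Suc k)))^2) + 2 * K^2 * c k \<omega>) \<partial>M)"
      by (rule integral_mono[OF iZ[OF k] _ pw]) (use ibZ(1) icX icc k in auto)
    also have "\<dots> = (\<integral>\<omega>. b k \<omega> * Z n k \<omega> \<partial>M) + (2 * (\<integral>\<omega>. c k \<omega> * (X \<omega> (P n (Suc k)))^2 \<partial>M) + 2 * K^2 * (\<integral>\<omega>. c k \<omega> \<partial>M))"
      using ibZ(1)[OF k] icX[OF k, of "Suc k"] icc[OF k] k by simp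
    also have "\<dots> \<le> (\<integral>\<omega>. b k \<omega> * al n k \<omega> \<partial>M) + (2 * (\<integral>\<omega>. c k \<omega> * (X \<omega> t)^2 \<partial>M) + 2 * K^2 * (\<integral>\<omega>. c k \<omega> \<partial>M))"
      using ibZ(2)[OF k] sub[OF k] by simp
    finally show "(\<integral>\<omega>. (if Z n k \<omega> > \<epsilon> then Z n k \<omega> else 0) \<partial>M)
       \<le> (\<integral>\<omega>. b k \<omega> * al n k \<omega> \<partial>M) + (2 * (\<integral>\<omega>. c k \<omega> * (X \<omega> t)^2 \<partial>M) + 2 * K^2 * (\<integral>\<omega>. c k \<omega> \<partial>M))" .
  qed
  also have "\<dots> = (\<Sum>k<n. (\<integral>\<omega>. b k \<omega> * al n k \<omega> \<partial>M)) + 2 * (\<Sum>k<n. \<integral>\<omega>. c k \<omega> * (X \<omega> t)^2 \<partial>M) + 2 * K^2 * (\<Sum>k<n. \<integral>\<omega>. c k \<omega> \<partial>M)"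
    by (simp add: sum.distrib sum_distrib_left)
  finally have main: "(\<Sum>k<n. \<integral>\<omega>. (if Z n k \<omega> > \<epsilon> then Z n k \<omega> else 0) \<partial>M)
    \<le> (\<Sum>k<n. (\<integral>\<omega>. b k \<omega> * al n k \<omega> \<partial>M)) + 2 * (\<Sum>k<n. \<integral>\<omega>. c k \<omega> * (X \<omega> t)^2 \<partial>M) + 2 * K^2 * (\<Sum>k<n. \<integral>\<omega>. c k \<omega> \<partial>M)" .
  have "(\<Sum>k<n. (\<integral>\<omega>. b k \<omega> * al n k \<omega> \<partial>M)) \<le> (\<integral>\<omega>. large K \<omega> * clock 0 t \<omega> \<partial>M) + (\<integral>\<omega>. jump \<epsilon> n \<omega> * clock 0 t \<omega> \<partial>M)"
  proof -
    have il: "integrable M (\<lambda>\<omega>. large K \<omega> * clock 0 t \<omega>)" "integrable M (\<lambda>\<omega>. jump \<epsilon> n \<omega> * clock 0 t \<omega>)"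
      by (rule integrable_mult_bounded[OF _ ic l1]; simp) (rule integrable_mult_bounded[OF _ ic j1]; simp)
    have "(\<Sum>k<n. (\<integral>\<omega>. b k \<omega> * al n k \<omega> \<partial>M)) = (\<integral>\<omega>. (\<Sum>k<n. b k \<omega> * al n k \<omega>) \<partial>M)"
      by (rule Bochner_Integration.integral_sum[symmetric]) (use ibal in auto)
    also have "\<dots> \<le> (\<integral>\<omega>. large K \<omega> * clock 0 t \<omega> + jump \<epsilon> n \<omega> * clock 0 t \<omega> \<partial>M)"
    proof (rule integral_mono_AE)
      show "integrable M (\<lambda>\<omega>. \<Sum>k<n. b k \<omega> * al n k \<omega>)" using ibal by auto
      show "integrable M (\<lambda>\<omega>. large K \<omega> * clock 0 t \<omega> + jump \<epsilon> n \<omega> * clock 0 t \<omega>)" using il by simp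
      show "AE \<omega> in M. (\<Sum>k<n. b k \<omega> * al n k \<omega>) \<le> large K \<omega> * clock 0 t \<omega> + jump \<epsilon> n \<omega> * clock 0 t \<omega>"
        using sum_al_AE[OF n]
      proof eventually_elim
        case (elim \<omega>)
        \<comment> \<open>The events only accumulate, so every weight may be replaced by the last
          one, after which the bracket increments add up to the whole bracket.\<close>
        have "(\<Sum>k<n. b k \<omega> * al n k \<omega>) \<le> (\<Sum>k<n. b n \<omega> * al n k \<omega>)"
        proof (intro sum_mono mult_right_mono clock_nonneg)
          fix k assume "k \<in> {..<n}"
          then have "B k \<omega> \<Longrightarrow> B n \<omega>" unfolding B_def by (auto intro: order_trans less_imp_le less_trans)
          then show "b k \<omega> \<le> b n \<omega>" by (auto simp: b_def)
        qed
        also have "\<dots> = b n \<omega> * clock 0 t \<omega>" using elim by (simp add: sum_distrib_left[symmetric])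
        also have "\<dots> \<le> (large K \<omega> + jump \<epsilon> n \<omega>) * clock 0 t \<omega>"
        proof (rule mult_right_mono[OF _ clock_nonneg])
          show "b n \<omega> \<le> large K \<omega> + jump \<epsilon> n \<omega>"
            unfolding b_def B_def large_def jump_def using n by (auto simp: of_bool_def)
        qed
        finally show ?case by (simp add: distrib_right)
      qed
    qed
    finally show ?thesis using il by simp
  qed
  moreover have "(\<Sum>k<n. \<integral>\<omega>. c k \<omega> * (X \<omega> t)^2 \<partial>M) \<le> (\<integral>\<omega>. jump \<epsilon> n \<omega> * (X \<omega> t)^2 \<partial>M)"
  proof -
    have icXt: "integrable M (\<lambda>\<omega>. c k \<omega> * (X \<omega> t)^2)" if "k < n" for k
      using icX[OF that, of n] P_ends(2)[OF n] by simp
    have "(\<Sum>k<n. \<integral>\<omega>. c k \<omega> * (X \<omega> t)^2 \<partial>M) = (\<integral>\<omega>. (\<Sum>k<n. c k \<omega> * (X \<omega> t)^2) \<partial>M)"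
      by (rule Bochner_Integration.integral_sum[symmetric]) (use icXt in auto)
    also have "\<dots> \<le> (\<integral>\<omega>. jump \<epsilon> n \<omega> * (X \<omega> t)^2 \<partial>M)"
    proof (rule integral_mono)
      show "integrable M (\<lambda>\<omega>. jump \<epsilon> n \<omega> * (X \<omega> t)^2)"
        by (rule integrable_mult_bounded[OF _ _ j1]) (use t in \<open>auto intro!: X_sq\<close>)
      show "(\<Sum>k<n. c k \<omega> * (X \<omega> t)^2) \<le> jump \<epsilon> n \<omega> * (X \<omega> t)^2" for \<omega>
        using sumc[of _ n] unfolding sum_distrib_right[symmetric] jump_def by (intro mult_right_mono) auto
    qed (use icXt in auto)
    finally show ?thesis .
  qed
  moreover have "2 * K^2 * (\<Sum>k<n. \<integral>\<omega>. c k \<omega> \<partial>M) \<le> 2 * K^2 * (\<integral>\<omega>. jump \<epsilon> n \<omega> \<partial>M)"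
  proof (rule mult_left_mono)
    have "(\<Sum>k<n. \<integral>\<omega>. c k \<omega> \<partial>M) = (\<integral>\<omega>. (\<Sum>k<n. c k \<omega>) \<partial>M)"
      by (rule Bochner_Integration.integral_sum[symmetric]) (use icc in auto)
    also have "\<dots> \<le> (\<integral>\<omega>. jump \<epsilon> n \<omega> \<partial>M)"
    proof (rule integral_mono)
      show "integrable M (jump \<epsilon> n)" by (rule integrable_const_bound[where B=1]) (use j1 in auto)
      show "(\<Sum>k<n. c k \<omega>) \<le> jump \<epsilon> n \<omega>" for \<omega> using sumc[of _ n] unfolding jump_def by simp
    qed (use icc in auto)
    finally show "(\<Sum>k<n. \<integral>\<omega>. c k \<omega> \<partial>M) \<le> (\<integral>\<omega>. jump \<epsilon> n \<omega> \<partial>M)" .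
  qed simp
  ultimately show ?thesis using main by linarith
qed

lemma jump_tendsto:
  assumes \<epsilon>: "0 < \<epsilon>" and \<omega>: "\<omega> \<in> space M"
  shows "(\<lambda>n. jump \<epsilon> n \<omega>) \<longlonglongrightarrow> 0"
proof -
  have c: "continuous_on {0..t} (X \<omega>)" by (rule continuous_on_subset[OF X_cont[OF \<omega>]]) (use t in auto)
  have "0 < sqrt \<epsilon>" using \<epsilon> by simp
  from oscillation_small[OF c this]
  have "\<forall>\<^sub>F n in sequentially. jump \<epsilon> n \<omega> = 0"
  proof eventually_elim
    case (elim n)
    have "Z n k \<omega> < \<epsilon>" if "k < n" for k
    proof -
      have "P n k \<le> P n (Suc k)" using Pf(1)[of n k "Suc k"] elim that by simp
      then have "\<bar>X \<omega> (P n (Suc k)) - X \<omega> (P n k)\<bar> < sqrt \<epsilon>" using elim that by auto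
      then have "\<bar>X \<omega> (P n (Suc k)) - X \<omega> (P n k)\<bar>^2 < (sqrt \<epsilon>)^2" by (intro power_strict_mono) auto
      then show ?thesis using \<epsilon> by simp
    qed
    then have "\<not> \<epsilon> < Z n k \<omega>" if "k < n" for k using that by (simp add: not_less less_imp_le)
    then show ?case by (auto simp: jump_def)
  qed
  then show ?thesis by (rule tendsto_eventually)
qed

text \<open>A continuous path is bounded on the compact interval [0, t], and all nodes of all
  partitions lie there.\<close>

lemma large_tendsto:
  assumes \<omega>: "\<omega> \<in> space M"
  shows "(\<lambda>i. large (real i) \<omega>) \<longlonglongrightarrow> 0"
proof -
  have "compact (X \<omega> ` {0..t})"
    by (intro compact_continuous_image continuous_on_subset[OF X_cont[OF \<omega>]]) (use t in auto)
  then obtain K where K: "\<And>s. s \<in> {0..t} \<Longrightarrow> \<bar>X \<omega> s\<bar> \<le> K"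
    unfolding compact_eq_bounded_closed bounded_real by blast
  have "\<forall>\<^sub>F i in sequentially. large (real i) \<omega> = 0"
    using eventually_ge_at_top[of "nat \<lceil>K\<rceil>"]
  proof eventually_elim
    case (elim i)
    have "\<bar>X \<omega> (P n j)\<bar> \<le> real i" if "1 \<le> n" "j \<le> n" for n j
      using K[of "P n j"] Pf(2,3)[OF that] elim by (auto simp: nat_le_iff ceiling_le_iff)
    then show ?case by (force simp: large_def not_less)
  qed
  then show ?thesis by (rule tendsto_eventually)
qed

lemma jump_integral_tendsto:
  assumes \<epsilon>: "0 < \<epsilon>" and f: "integrable M f"
  shows "(\<lambda>n. \<integral>\<omega>. jump \<epsilon> n \<omega> * f \<omega> \<partial>M) \<longlonglongrightarrow> 0"
proof (rule LIMSEQ_offset[where k=1])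
  have "(\<lambda>n. \<integral>\<omega>. jump \<epsilon> (n + 1) \<omega> * f \<omega> \<partial>M) \<longlonglongrightarrow> (\<integral>\<omega>. 0 \<partial>M)"
  proof (rule integral_dominated_convergence[where w="\<lambda>\<omega>. \<bar>f \<omega>\<bar>"])
    show "AE \<omega> in M. (\<lambda>n. jump \<epsilon> (n + 1) \<omega> * f \<omega>) \<longlonglongrightarrow> 0"
      using LIMSEQ_ignore_initial_segment[OF jump_tendsto[OF \<epsilon>], of _ 1]
      by (intro AE_I2) (auto intro!: tendsto_mult_left_zero)
    show "(\<lambda>\<omega>. jump \<epsilon> (n + 1) \<omega> * f \<omega>) \<in> borel_measurable M" for n
      using jump_M[of "n+1" \<epsilon>] f by measurable
  qed (use f in \<open>auto simp: jump_def\<close>)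
  then show "(\<lambda>n. \<integral>\<omega>. jump \<epsilon> (n + 1) \<omega> * f \<omega> \<partial>M) \<longlonglongrightarrow> 0" by simp
qed

text \<open>The order of the limits matters: first the level is chosen so large that the bracket on
  \<open>large\<close> has small mean, then n grows and removes the terms with \<open>jump\<close>,
  one of which carries the square of that level.\<close>

lemma big_Z:
  assumes \<epsilon>: "0 < \<epsilon>"
  shows "(\<lambda>n. \<Sum>k<n. \<integral>\<omega>. (if Z n k \<omega> > \<epsilon> then Z n k \<omega> else 0) \<partial>M) \<longlonglongrightarrow> 0"
proof (rule LIMSEQ_I)
  fix \<eta> :: real assume \<eta>: "0 < \<eta>"
  have ic: "integrable M (clock 0 t)" by (rule clock_integrable) (use t in auto)
  have "(\<lambda>i. \<integral>\<omega>. large (real i) \<omega> * clock 0 t \<omega> \<partial>M) \<longlonglongrightarrow> (\<integral>\<omega>. 0 \<partial>M)"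
  proof (rule integral_dominated_convergence[where w="clock 0 t"])
    show "AE \<omega> in M. (\<lambda>i. large (real i) \<omega> * clock 0 t \<omega>) \<longlonglongrightarrow> 0"
      using large_tendsto by (intro AE_I2 tendsto_mult_left_zero) auto
    show "(\<lambda>\<omega>. large (real i) \<omega> * clock 0 t \<omega>) \<in> borel_measurable M" for i
      using large_M[of "real i"] ic by measurable
  qed (use ic clock_nonneg in \<open>auto simp: large_def abs_mult\<close>)
  then have "\<forall>\<^sub>F i in sequentially. (\<integral>\<omega>. large (real i) \<omega> * clock 0 t \<omega> \<partial>M) < \<eta> / 2"
    by (rule order_tendstoD(2)) (use \<eta> in simp)
  then obtain i where i: "(\<integral>\<omega>. large (real i) \<omega> * clock 0 t \<omega> \<partial>M) < \<eta> / 2"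
    by (auto simp: eventually_sequentially)
  let ?K = "real i"
  have "(\<lambda>n. (\<integral>\<omega>. jump \<epsilon> n \<omega> * clock 0 t \<omega> \<partial>M) + 2 * (\<integral>\<omega>. jump \<epsilon> n \<omega> * (X \<omega> t)^2 \<partial>M) + 2 * ?K^2 * (\<integral>\<omega>. jump \<epsilon> n \<omega> * 1 \<partial>M))
     \<longlonglongrightarrow> 0 + 2 * 0 + 2 * ?K^2 * 0"
    by (intro tendsto_intros jump_integral_tendsto \<epsilon> ic X_sq) (use t in auto)
  then have "\<forall>\<^sub>F n in sequentially. (\<integral>\<omega>. jump \<epsilon> n \<omega> * clock 0 t \<omega> \<partial>M) + 2 * (\<integral>\<omega>. jump \<epsilon> n \<omega> * (X \<omega> t)^2 \<partial>M) + 2 * ?K^2 * (\<integral>\<omega>. jump \<epsilon> n \<omega> * 1 \<partial>M) < \<eta> / 2"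
    by (rule order_tendstoD(2)) (use \<eta> in simp)
  with eventually_ge_at_top[of 1]
  have "\<forall>\<^sub>F n in sequentially. norm ((\<Sum>k<n. \<integral>\<omega>. (if Z n k \<omega> > \<epsilon> then Z n k \<omega> else 0) \<partial>M) - 0) < \<eta>"
  proof eventually_elim
    case (elim n)
    have "0 \<le> (\<Sum>k<n. \<integral>\<omega>. (if Z n k \<omega> > \<epsilon> then Z n k \<omega> else 0) \<partial>M)"
      by (intro sum_nonneg integral_nonneg_AE) auto
    then show ?case using big_Z_bound[OF elim(1) _ \<epsilon>, of ?K] i elim by simp
  qed
  then show "\<exists>no. \<forall>n\<ge>no. norm ((\<Sum>k<n. \<integral>\<omega>. (if Z n k \<omega> > \<epsilon> then Z n k \<omega> else 0) \<partial>M) - 0) < \<eta>"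
    by (simp add: eventually_sequentially)
qed

lemma quadratic_variation:
  assumes h: "\<And>n k. 1 \<le> n \<Longrightarrow> k < n \<Longrightarrow> h n k \<in> borel_measurable (F (P n k))" "\<And>n k \<omega>. \<bar>h n k \<omega>\<bar> \<le> C"
  shows "(\<lambda>n. \<integral>\<omega>. \<bar>\<Sum>k<n. h n k \<omega> * (Z n k \<omega> - al n k \<omega>)\<bar> \<partial>M) \<longlonglongrightarrow> 0"
proof (rule LIMSEQ_I)
  fix \<eta> :: real assume \<eta>: "0 < \<eta>"
  have C: "0 \<le> C" using h(2)[of 0 0 undefined] abs_ge_zero order_trans by blast
  define A where "A = (\<integral>\<omega>. clock 0 t \<omega> \<partial>M)"
  have A: "0 \<le> A" unfolding A_def by (rule integral_nonneg_AE) (auto simp: clock_nonneg)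
  \<comment> \<open>Chosen so that \<open>C * sqrt (2 * \<epsilon> * A)\<close>, the orthogonal part
    of the truncation estimate, stays below \<open>\<eta> / 2\<close>. The additions of 1 guard
    against \<open>C = 0\<close> and \<open>A = 0\<close>.\<close>
  define \<epsilon> where "\<epsilon> = (\<eta> / (2 * (C + 1)))^2 / (2 * (A + 1))"
  have \<epsilon>: "0 < \<epsilon>" unfolding \<epsilon>_def using \<eta> C A by (intro divide_pos_pos zero_less_power) auto
  have "2 * \<epsilon> * A = (\<eta> / (2 * (C + 1)))^2 * (A / (A + 1))"
    unfolding \<epsilon>_def using A by (simp add: divide_simps)
  also have "\<dots> \<le> (\<eta> / (2 * (C + 1)))^2" using A by (intro mult_left_le) auto
  finally have "sqrt (2 * \<epsilon> * A) \<le> \<eta> / (2 * (C + 1))"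
    using real_sqrt_le_mono[of "2 * \<epsilon> * A" "(\<eta> / (2 * (C + 1)))^2"] \<eta> C by simp
  then have "C * sqrt (2 * \<epsilon> * A) \<le> C * (\<eta> / (2 * (C + 1)))" by (rule mult_left_mono[OF _ C])
  also have "\<dots> < \<eta> / 2" using \<eta> C by (simp add: field_simps)
  finally have e: "C * sqrt (2 * \<epsilon> * A) < \<eta> / 2" .
  have "(\<lambda>n. C * (2 * ((\<Sum>k<n. \<integral>\<omega>. (if Z n k \<omega> > \<epsilon> then Z n k \<omega> else 0) \<partial>M) + (\<Sum>k<n. \<integral>\<omega>. (if al n k \<omega> > \<epsilon> then al n k \<omega> else 0) \<partial>M))))
     \<longlonglongrightarrow> C * (2 * (0 + 0))"
    by (intro tendsto_intros big_Z big_al \<epsilon>)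
  then have "\<forall>\<^sub>F n in sequentially. C * (2 * ((\<Sum>k<n. \<integral>\<omega>. (if Z n k \<omega> > \<epsilon> then Z n k \<omega> else 0) \<partial>M) + (\<Sum>k<n. \<integral>\<omega>. (if al n k \<omega> > \<epsilon> then al n k \<omega> else 0) \<partial>M))) < \<eta> / 2"
    by (rule order_tendstoD(2)) (use \<eta> in simp)
  with eventually_ge_at_top[of 1]
  have "\<forall>\<^sub>F n in sequentially. norm ((\<integral>\<omega>. \<bar>\<Sum>k<n. h n k \<omega> * (Z n k \<omega> - al n k \<omega>)\<bar> \<partial>M) - 0) < \<eta>"
  proof eventually_elim
    case (elim n)
    note n = elim(1)
    have XF: "(\<lambda>\<omega>. X \<omega> (P n j)) \<in> borel_measurable (F (P n k))" if "j \<le> k" "k \<le> n" for j k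
      by (intro adapted_mono[OF X_ad] Pf n) (use that in auto)
    have "(\<integral>\<omega>. \<bar>\<Sum>k<n. h n k \<omega> * (Z n k \<omega> - al n k \<omega>)\<bar> \<partial>M) \<le>
      C * (sqrt (2 * \<epsilon> * (\<Sum>k<n. \<integral>\<omega>. al n k \<omega> \<partial>M)) +
        2 * (\<Sum>k<n. (\<integral>\<omega>. (if Z n k \<omega> > \<epsilon> then Z n k \<omega> else 0) \<partial>M) + (\<integral>\<omega>. (if al n k \<omega> > \<epsilon> then al n k \<omega> else 0) \<partial>M)))"
    proof (rule truncated_compensation[where G="\<lambda>k. F (P n k)"])
      show "subalgebra M (F (P n k))" if "k \<le> n" for k using that by (auto intro!: sub Pf n)
      show "sets (F (P n j)) \<subseteq> sets (F (P n k))" if "j \<le> k" "k \<le> n" for j k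
        by (intro F_mono Pf n) (use that in auto)
      show "(\<lambda>\<omega>. Z n k \<omega>) \<in> borel_measurable (F (P n (Suc k)))" if "k < n" for k
        by (intro borel_measurable_power borel_measurable_diff XF) (use that in auto)
      show "al n k \<in> borel_measurable (F (P n (Suc k)))" if "k < n" for k
        by (intro clock_ad Pf n) (use that in auto)
      show "AE \<omega> in M. real_cond_exp M (F (P n k)) (\<lambda>\<omega>. Z n k \<omega> - al n k \<omega>) \<omega> = 0" if "k < n" for k
        by (intro square_increment Pf n) (use that in auto)
    qed (use Z_int al_int clock_nonneg h n \<epsilon> in auto)
    moreover have "(\<Sum>k<n. \<integral>\<omega>. al n k \<omega> \<partial>M) = A" unfolding A_def by (rule sum_al_E[OF n])
    ultimately show ?case using elim e by (simp add: sum.distrib algebra_simps)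
  qed
  then show "\<exists>no. \<forall>n\<ge>no. norm ((\<integral>\<omega>. \<bar>\<Sum>k<n. h n k \<omega> * (Z n k \<omega> - al n k \<omega>)\<bar> \<partial>M) - 0) < \<eta>"
    by (simp add: eventually_sequentially)
qed

end

section \<open>The Ito formula in L1\<close>

locale smooth_function =
  fixes \<phi> \<phi>' \<phi>'' :: "real \<Rightarrow> real" and C :: real
  assumes d1: "(\<phi> has_real_derivative \<phi>' x) (at x)"
    and d2: "(\<phi>' has_real_derivative \<phi>'' x) (at x)"
    and c2: "continuous_on UNIV \<phi>''"
    and b1: "\<bar>\<phi>' x\<bar> \<le> C" and b2: "\<bar>\<phi>'' x\<bar> \<le> C"
begin

lemma C_nonneg: "0 \<le> C"
  using b1[of 0] abs_ge_zero order_trans by blast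

lemma \<phi>_cont: "continuous_on S \<phi>"
  by (rule continuous_on_subset[of UNIV]) (auto intro!: DERIV_isCont d1 continuous_at_imp_continuous_on)

lemma \<phi>'_cont: "continuous_on S \<phi>'"
  by (rule continuous_on_subset[of UNIV]) (auto intro!: DERIV_isCont d2 continuous_at_imp_continuous_on)

lemma \<phi>''_cont: "continuous_on S \<phi>''"
  by (rule continuous_on_subset[OF c2]) simp

lemma \<phi>_meas[measurable]: "\<phi> \<in> borel_measurable borel" "\<phi>' \<in> borel_measurable borel" "\<phi>'' \<in> borel_measurable borel"
  by (intro borel_measurable_continuous_onI \<phi>_cont \<phi>'_cont \<phi>''_cont)+

lemma \<phi>_lipschitz: "\<bar>\<phi> x - \<phi> y\<bar> \<le> C * \<bar>x - y\<bar>"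
  using field_differentiable_bound[of UNIV \<phi> \<phi>' C x y] d1 b1 by (auto intro: DERIV_subset)

lemma \<phi>_growth: "\<bar>\<phi> x\<bar> \<le> \<bar>\<phi> 0\<bar> + C * \<bar>x\<bar>"
  using \<phi>_lipschitz[of x 0] by simp

definition remainder :: "real \<Rightarrow> real \<Rightarrow> real" where
  "remainder x y = \<phi> y - \<phi> x - \<phi>' x * (y - x) - \<phi>'' x * (y - x)^2 / 2"

text \<open>Lagrange form of the second-order remainder. The case x = y is split off since the
  expansion is applied between distinct points.\<close>

lemma remainder_eq:
  obtains \<xi> where "min x y \<le> \<xi>" "\<xi> \<le> max x y" "remainder x y = (\<phi>'' \<xi> - \<phi>'' x) / 2 * (y - x)^2"
proof (cases "x = y")
  case True
  then show ?thesis using that[of x] by (simp add: remainder_def)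
next
  case False
  define diff where "diff m = (if m = 0 then \<phi> else if m = Suc 0 then \<phi>' else \<phi>'')" for m :: nat
  have D: "\<forall>m t. m < 2 \<and> min x y \<le> t \<and> t \<le> max x y \<longrightarrow> DERIV (diff m) t :> diff (Suc m) t"
    using d1 d2 by (auto simp: diff_def less_Suc_eq numeral_2_eq_2)
  obtain \<xi> where \<xi>: "if y < x then y < \<xi> \<and> \<xi> < x else x < \<xi> \<and> \<xi> < y"
    and e: "\<phi> y = (\<Sum>m<2. (diff m x / fact m) * (y - x)^m) + (diff 2 \<xi> / fact 2) * (y - x)^2"
    using Taylor[of 2 diff \<phi> "min x y" "max x y" x y] D False by (auto simp: diff_def)
  have "remainder x y = (\<phi>'' \<xi> - \<phi>'' x) / 2 * (y - x)^2"
  proof -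
    have "(\<Sum>m<2. (diff m x / fact m) * (y - x)^m) = \<phi> x + \<phi>' x * (y - x)"
      by (simp add: numeral_2_eq_2 diff_def)
    moreover have "diff 2 \<xi> / fact 2 = \<phi>'' \<xi> / 2" by (simp add: diff_def)
    ultimately show ?thesis unfolding remainder_def e by (simp add: left_diff_distrib diff_divide_distrib)
  qed
  then show ?thesis using \<xi> by (intro that[of \<xi>]) (auto split: if_splits)
qed

lemma remainder_le: "\<bar>remainder x y\<bar> \<le> C * (y - x)^2"
proof -
  obtain \<xi> where e: "remainder x y = (\<phi>'' \<xi> - \<phi>'' x) / 2 * (y - x)^2" using remainder_eq by metis
  have "\<bar>(\<phi>'' \<xi> - \<phi>'' x) / 2\<bar> \<le> C" using b2[of \<xi>] b2[of x] by simp
  then show ?thesis unfolding e abs_mult by (intro mult_mono) auto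
qed

end

locale ito_calculus = ito_process M F T X a + smooth_function \<phi> \<phi>' \<phi>'' C
  for M :: "'a measure" and F T X a \<phi> \<phi>' \<phi>'' C
begin

definition drift :: "real \<Rightarrow> 'a \<Rightarrow> real" where
  "drift r \<omega> = (\<integral>s. indicator {0..r} s * (\<phi>'' (X \<omega> s) * a \<omega> s) \<partial>lborel)"

text \<open>The value that Ito's formula predicts for the stochastic integral of
  \<open>\<phi>' (X \<omega> s)\<close> against \<open>X\<close>. It is introduced as a pathwise
  expression and only afterwards shown to be the limit of the sums.\<close>

definition ito_int :: "'a \<Rightarrow> real \<Rightarrow> real" where
  "ito_int \<omega> r = \<phi> (X \<omega> r) - \<phi> (X \<omega> 0) - drift r \<omega> / 2"

lemma drift_ad:
  assumes "0 \<le> r" "r \<le> T"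
  shows "drift r \<in> borel_measurable (F r)"
proof -
  have [measurable]: "(\<lambda>(\<omega>, s). a \<omega> (min s r)) \<in> borel_measurable (F r \<Otimes>\<^sub>M lborel)"
    by (rule a_prog) (use assms in auto)
  have [measurable]: "(\<lambda>(\<omega>, s). X \<omega> (min s r)) \<in> borel_measurable (F r \<Otimes>\<^sub>M lborel)"
    by (rule X_prog) (use assms in auto)
  have "drift r = (\<lambda>\<omega>. \<integral>s. indicator {0..r} s * (\<phi>'' (X \<omega> (min s r)) * a \<omega> (min s r)) \<partial>lborel)"
    unfolding drift_def by (intro ext Bochner_Integration.integral_cong) (auto simp: indicator_def min_def)
  also have "\<dots> \<in> borel_measurable (F r)" by measurable
  finally show ?thesis .
qed

lemma drift_M: "0 \<le> r \<Longrightarrow> r \<le> T \<Longrightarrow> drift r \<in> borel_measurable M"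
  by (rule adapted_M[OF drift_ad])

lemma ito_int_ad: "0 \<le> r \<Longrightarrow> r \<le> T \<Longrightarrow> (\<lambda>\<omega>. ito_int \<omega> r) \<in> borel_measurable (F r)"
proof -
  assume r: "0 \<le> r" "r \<le> T"
  have [measurable]: "(\<lambda>\<omega>. X \<omega> r) \<in> borel_measurable (F r)" by (rule X_ad[OF r])
  have [measurable]: "(\<lambda>\<omega>. X \<omega> 0) \<in> borel_measurable (F r)"
    by (rule adapted_mono[OF X_ad[of 0]]) (use r in auto)
  have [measurable]: "drift r \<in> borel_measurable (F r)" by (rule drift_ad[OF r])
  show ?thesis unfolding ito_int_def by measurable
qed

lemma ito_int_M: "0 \<le> r \<Longrightarrow> r \<le> T \<Longrightarrow> (\<lambda>\<omega>. ito_int \<omega> r) \<in> borel_measurable M"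
  by (rule adapted_M[OF ito_int_ad])

lemma \<phi>''a_integrable:
  assumes "integrable lborel (\<lambda>s. indicator {0..T} s * a \<omega> s)" "S \<in> sets borel" "S \<subseteq> {0..T}" "\<omega> \<in> space M"
  shows "integrable lborel (\<lambda>s. indicator S s * (\<phi>'' (X \<omega> s) * a \<omega> s))"
proof -
  have [measurable]: "(\<lambda>s. X \<omega> s) \<in> borel_measurable lborel"
    using measurable_Pair2[OF X_meas assms(4)] by simp
  have "integrable lborel (\<lambda>s. \<phi>'' (X \<omega> s) * (indicator S s * a \<omega> s))"
    by (rule integrable_mult_bounded[OF _ ind_a_integrable[OF assms] b2]) measurable
  then show ?thesis by (simp add: mult_ac)
qed

lemma drift_bound:
  assumes r: "0 \<le> r" "r \<le> T"
  shows "AE \<omega> in M. \<bar>drift r \<omega>\<bar> \<le> C * clock 0 r \<omega>"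
  using a_AE AE_space clock_AE[OF order_refl r]
proof eventually_elim
  case (elim \<omega>)
  \<comment> \<open>The half-open and the closed interval differ by the null set {0}.\<close>
  have e: "clock 0 r \<omega> = (\<integral>s. indicator {0..r} s * a \<omega> s \<partial>lborel)"
  proof -
    have "(\<integral>s. indicator {0..0} s * a \<omega> s \<partial>lborel) = 0"
      by (rule integral_eq_zero_AE) (use AE_lborel_singleton[of 0] in eventually_elim, auto simp: indicator_def)
    then show ?thesis using elim(3) r by simp
  qed
  have "\<bar>drift r \<omega>\<bar> \<le> (\<integral>s. \<bar>indicator {0..r} s * (\<phi>'' (X \<omega> s) * a \<omega> s)\<bar> \<partial>lborel)"
    unfolding drift_def by (rule integral_abs_bound)
  also have "\<dots> \<le> (\<integral>s. C * (indicator {0..r} s * a \<omega> s) \<partial>lborel)"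
  proof (rule integral_mono)
    show "integrable lborel (\<lambda>s. \<bar>indicator {0..r} s * (\<phi>'' (X \<omega> s) * a \<omega> s)\<bar>)"
      by (intro integrable_abs \<phi>''a_integrable[OF elim(1)]) (use elim r in auto)
    show "integrable lborel (\<lambda>s. C * (indicator {0..r} s * a \<omega> s))"
      by (intro integrable_mult_right ind_a_integrable[OF elim(1)]) (use elim r in auto)
    show "\<bar>indicator {0..r} s * (\<phi>'' (X \<omega> s) * a \<omega> s)\<bar> \<le> C * (indicator {0..r} s * a \<omega> s)" for s
      using b2[of "X \<omega> s"] a_nonneg[of \<omega> s] by (auto simp: indicator_def abs_mult intro!: mult_right_mono)
  qed
  finally show ?case by (simp add: e)
qed

lemma drift_integrable:
  assumes r: "0 \<le> r" "r \<le> T"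
  shows "integrable M (drift r)"
proof (rule Bochner_Integration.integrable_bound)
  show "integrable M (\<lambda>\<omega>. C * clock 0 r \<omega>)" by (intro integrable_mult_right clock_integrable) (use r in auto)
  show "AE \<omega> in M. norm (drift r \<omega>) \<le> norm (C * clock 0 r \<omega>)"
    using drift_bound[OF r] by eventually_elim (auto simp: C_nonneg clock_nonneg)
qed (rule drift_M[OF r])

lemma \<phi>X_integrable: "0 \<le> r \<Longrightarrow> r \<le> T \<Longrightarrow> integrable M (\<lambda>\<omega>. \<phi> (X \<omega> r))"
proof (rule Bochner_Integration.integrable_bound)
  assume r: "0 \<le> r" "r \<le> T"
  show "integrable M (\<lambda>\<omega>. \<bar>\<phi> 0\<bar> + C * \<bar>X \<omega> r\<bar>)"
    using mart_integrable[OF X_mart r] by simp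
  show "(\<lambda>\<omega>. \<phi> (X \<omega> r)) \<in> borel_measurable M" using X_M[OF r] by measurable
  show "AE \<omega> in M. norm (\<phi> (X \<omega> r)) \<le> norm (\<bar>\<phi> 0\<bar> + C * \<bar>X \<omega> r\<bar>)"
    by (intro AE_I2) (use order_trans[OF \<phi>_growth abs_ge_self] in simp)
qed

lemma ito_int_integrable: "0 \<le> r \<Longrightarrow> r \<le> T \<Longrightarrow> integrable M (\<lambda>\<omega>. ito_int \<omega> r)"
  unfolding ito_int_def using \<phi>X_integrable[of r] \<phi>X_integrable[of 0] drift_integrable[of r] by auto

lemma ito_int_0: "AE \<omega> in M. ito_int \<omega> 0 = 0"
proof -
  have "drift 0 \<omega> = 0" for \<omega>
    unfolding drift_def
    by (rule integral_eq_zero_AE) (use AE_lborel_singleton[of 0] in eventually_elim, auto simp: indicator_def)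
  then show ?thesis by (simp add: ito_int_def)
qed

lemma ito_int_continuous: "AE \<omega> in M. continuous_on {0..T} (ito_int \<omega>)"
  using a_AE AE_space
proof eventually_elim
  case (elim \<omega>)
  have "continuous_on {0..T} (\<lambda>r. drift r \<omega>)"
    unfolding drift_def
    by (rule continuous_on_integral_upto) (rule \<phi>''a_integrable[OF elim(1)]; use elim in simp)
  moreover have "continuous_on {0..T} (\<lambda>r. \<phi> (X \<omega> r))"
    by (rule continuous_on_compose2[OF \<phi>_cont[of UNIV] X_cont[OF elim(2)]]) simp
  ultimately show ?case unfolding ito_int_def[abs_def] by (auto intro!: continuous_intros)
qed

end

locale ito_formula = ito_calculus M F T X a \<phi> \<phi>' \<phi>'' C + partition_sequence M F T t P
  for M :: "'a measure" and F T X a \<phi> \<phi>' \<phi>'' C t P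
begin

sublocale ito_partitions M F T X a t P ..

abbreviation S where "S n \<equiv> isum (P n) n (\<lambda>k \<omega>. \<phi>' (X \<omega> (P n k)))"

lemma \<phi>_adapted:
  assumes "1 \<le> n" "k \<le> n" and g: "g \<in> borel_measurable borel"
  shows "(\<lambda>\<omega>. g (X \<omega> (P n k))) \<in> borel_measurable (F (P n k))"
proof -
  have "(\<lambda>\<omega>. X \<omega> (P n k)) \<in> borel_measurable (F (P n k))" by (intro X_ad Pf) (use assms in auto)
  with g show ?thesis by measurable
qed

lemma \<phi>_M: "1 \<le> n \<Longrightarrow> k \<le> n \<Longrightarrow> g \<in> borel_measurable borel \<Longrightarrow> (\<lambda>\<omega>. g (X \<omega> (P n k))) \<in> borel_measurable M"
  by (intro adapted_M[OF \<phi>_adapted] Pf) auto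

lemma simple: "1 \<le> n \<Longrightarrow> simple_integrand t (P n) n (\<lambda>k \<omega>. \<phi>' (X \<omega> (P n k)))"
  unfolding simple_integrand_def using P t b1 by (auto intro!: \<phi>_adapted)

lemma Z_al_sum: "(\<lambda>n. \<integral>\<omega>. \<bar>\<Sum>k<n. Z n k \<omega> - al n k \<omega>\<bar> \<partial>M) \<longlonglongrightarrow> 0"
  using quadratic_variation[of "\<lambda>_ _ _. 1" 1] by simp

lemma \<phi>''_Z: "(\<lambda>n. \<integral>\<omega>. \<bar>\<Sum>k<n. \<phi>'' (X \<omega> (P n k)) * (Z n k \<omega> - al n k \<omega>)\<bar> \<partial>M) \<longlonglongrightarrow> 0"
  by (rule quadratic_variation[where C=C]) (auto intro!: \<phi>_adapted b2)

lemma \<phi>''_al_integrable: 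
  assumes "1 \<le> n" "k < n"
  shows "integrable M (\<lambda>\<omega>. \<phi>'' (X \<omega> (P n k)) * al n k \<omega>)"
  by (rule integrable_mult_bounded[OF _ al_int[OF assms] b2]) (use assms in \<open>auto intro!: \<phi>_M\<close>)

text \<open>The weighted bracket increments are the integral of a left-endpoint step function
  against \<open>a\<close>. Dominated convergence is used twice: in s for a fixed path, under a
  multiple of \<open>a\<close>, and then in \<omega>, under a multiple of the bracket.\<close>

lemma \<phi>''_al: "(\<lambda>n. \<integral>\<omega>. \<bar>(\<Sum>k<n. \<phi>'' (X \<omega> (P n k)) * al n k \<omega>) - drift t \<omega>\<bar> \<partial>M) \<longlonglongrightarrow> 0"
proof -
  note tT = less_imp_le[OF t(1)] t(2)
  define Q where "Q n \<omega> = (\<Sum>k<n. \<phi>'' (X \<omega> (P n k)) * al n k \<omega>)" for n \<omega>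
  have QM: "Q n \<in> borel_measurable M" if "1 \<le> n" for n
    unfolding Q_def using that by (intro borel_measurable_sum borel_measurable_times \<phi>_M al_M) auto
  have "(\<lambda>n. \<integral>\<omega>. \<bar>Q (n+1) \<omega> - drift t \<omega>\<bar> \<partial>M) \<longlonglongrightarrow> (\<integral>\<omega>. 0 \<partial>M)"
  proof (rule integral_dominated_convergence[where w="\<lambda>\<omega>. 2 * C * clock 0 t \<omega>"])
    show "integrable M (\<lambda>\<omega>. 2 * C * clock 0 t \<omega>)"
      by (intro integrable_mult_right clock_integrable) (use t in auto)
    show "(\<lambda>\<omega>. \<bar>Q (n+1) \<omega> - drift t \<omega>\<bar>) \<in> borel_measurable M" for n
      using drift_M[OF tT] QM[of "n+1"] by measurable
    have "AE \<omega> in M. norm \<bar>Q n \<omega> - drift t \<omega>\<bar> \<le> 2 * C * clock 0 t \<omega>" if n: "1 \<le> n" for n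
      using sum_al_AE[OF n] drift_bound[OF tT]
    proof eventually_elim
      case (elim \<omega>)
      have "\<bar>Q n \<omega>\<bar> \<le> (\<Sum>k<n. C * al n k \<omega>)" unfolding Q_def
        by (rule order_trans[OF sum_abs]) 
          (intro sum_mono, auto simp: abs_mult clock_nonneg intro!: mult_right_mono b2)
      also have "\<dots> = C * clock 0 t \<omega>" using elim by (simp add: sum_distrib_left[symmetric])
      finally show ?case using elim by simp
    qed
    then show "AE \<omega> in M. norm \<bar>Q (n+1) \<omega> - drift t \<omega>\<bar> \<le> 2 * C * clock 0 t \<omega>" for n by simp
    show "AE \<omega> in M. (\<lambda>n. \<bar>Q (n+1) \<omega> - drift t \<omega>\<bar>) \<longlonglongrightarrow> 0"
      using a_AE AE_space
    proof eventually_elim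
      case (elim \<omega>)
      note ia = ind_a_integrable[OF elim(1) _ _ elim(2)]
      have [measurable]: "(\<lambda>s. a \<omega> s) \<in> borel_measurable lborel"
        using measurable_Pair2[OF a_meas elim(2)] by simp
      have [measurable]: "(\<lambda>s. X \<omega> s) \<in> borel_measurable lborel"
        using measurable_Pair2[OF X_meas elim(2)] by simp
      define st where "st n s = (\<Sum>k<n. \<phi>'' (X \<omega> (P n k)) * indicator {P n k<..P n (Suc k)} s)" for n s
      have [measurable]: "st n \<in> borel_measurable lborel" for n unfolding st_def by measurable
      have eq: "Q n \<omega> = (\<integral>s. st n s * a \<omega> s \<partial>lborel)" if n: "1 \<le> n" for n
      proof -
        have "Q n \<omega> = (\<Sum>k<n. \<integral>s. \<phi>'' (X \<omega> (P n k)) * (indicator {P n k<..P n (Suc k)} s * a \<omega> s) \<partial>lborel)"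
          by (simp add: clock_def Q_def)
        also have "\<dots> = (\<integral>s. (\<Sum>k<n. \<phi>'' (X \<omega> (P n k)) * (indicator {P n k<..P n (Suc k)} s * a \<omega> s)) \<partial>lborel)"
        proof (rule Bochner_Integration.integral_sum[symmetric])
          fix k assume "k \<in> {..<n}"
          then have "0 \<le> P n k" "P n (Suc k) \<le> T" using Pf(2,4)[OF n] by auto
          then show "integrable lborel (\<lambda>s. \<phi>'' (X \<omega> (P n k)) * (indicator {P n k<..P n (Suc k)} s * a \<omega> s))"
            by (intro integrable_mult_right ia) auto
        qed
        finally show ?thesis by (simp only: sum_distrib_right mult.assoc st_def)
      qed
      have cont: "continuous_on {0..t} (\<lambda>s. \<phi>'' (X \<omega> s))"
      proof (rule continuous_on_compose2[OF \<phi>''_cont[of UNIV]])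
        show "continuous_on {0..t} (X \<omega>)"
          by (rule continuous_on_subset[OF X_cont[OF elim(2)]]) (use t in auto)
      qed simp
      have "norm (st n s * a \<omega> s) \<le> C * (indicator {0..T} s * a \<omega> s)" if n: "1 \<le> n" for n s
      proof (cases "s \<in> {0..T}")
        case True
        have "\<bar>st n s\<bar> \<le> C" unfolding st_def by (rule wpart_sum_abs_le[OF P[OF n]]) (rule b2)
        then show ?thesis using True a_nonneg[of \<omega> s] by (simp add: abs_mult mult_right_mono)
      next
        case False
        then have "st n s = 0" unfolding st_def by (intro wpart_sum_outside[OF P[OF n]]) (use t in auto)
        then show ?thesis using False by simp
      qed
      note st_bound = this
      have "(\<lambda>n. \<integral>s. st (n+1) s * a \<omega> s \<partial>lborel) \<longlonglongrightarrow> (\<integral>s. \<phi>'' (X \<omega> s) * indicator {0<..t} s * a \<omega> s \<partial>lborel)"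
      proof (rule integral_dominated_convergence[where w="\<lambda>s. C * (indicator {0..T} s * a \<omega> s)"])
        show "integrable lborel (\<lambda>s. C * (indicator {0..T} s * a \<omega> s))" using elim(1) by simp
        show "AE s in lborel. (\<lambda>n. st (n+1) s * a \<omega> s) \<longlonglongrightarrow> \<phi>'' (X \<omega> s) * indicator {0<..t} s * a \<omega> s"
        proof (rule AE_I2)
          fix s
          have "(\<lambda>n. st n s) \<longlonglongrightarrow> \<phi>'' (X \<omega> s) * indicator {0<..t} s"
            unfolding st_def by (rule step_tendsto[OF cont])
          from LIMSEQ_ignore_initial_segment[OF this, of 1]
          show "(\<lambda>n. st (n+1) s * a \<omega> s) \<longlonglongrightarrow> \<phi>'' (X \<omega> s) * indicator {0<..t} s * a \<omega> s"
            by (rule tendsto_mult_right)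
        qed
        show "AE s in lborel. norm (st (n+1) s * a \<omega> s) \<le> C * (indicator {0..T} s * a \<omega> s)" for n
          by (intro AE_I2 st_bound) simp
      qed measurable
      moreover have "(\<integral>s. \<phi>'' (X \<omega> s) * indicator {0<..t} s * a \<omega> s \<partial>lborel) = drift t \<omega>"
        unfolding drift_def
        by (rule integral_cong_AE) (measurable, use AE_lborel_singleton[of 0] in eventually_elim, auto simp: indicator_def)
      ultimately have "(\<lambda>n. Q (n+1) \<omega>) \<longlonglongrightarrow> drift t \<omega>"
        using eq[of "n+1" for n] by simp
      from tendsto_rabs_zero[OF LIM_zero[OF this]] show ?case .
    qed
  qed simp
  then have "(\<lambda>n. \<integral>\<omega>. \<bar>Q n \<omega> - drift t \<omega>\<bar> \<partial>M) \<longlonglongrightarrow> 0" using LIMSEQ_offset[where k=1] by auto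
  then show ?thesis unfolding Q_def .
qed

section \<open>The Taylor remainder along partitions and the L1 limit of the sums\<close>

abbreviation rem where "rem n k \<omega> \<equiv> remainder (X \<omega> (P n k)) (X \<omega> (P n (Suc k)))"

text \<open>A vanishing increment contributes 0 to the maximum, consistently with x / 0 = 0,
since the remainder vanishes with the increment.\<close>

definition osc :: "nat \<Rightarrow> 'a \<Rightarrow> real" where
  "osc n \<omega> = Max ((\<lambda>k. \<bar>rem n k \<omega>\<bar> / Z n k \<omega>) ` {..<n})"

lemma rem_M: "1 \<le> n \<Longrightarrow> k < n \<Longrightarrow> (\<lambda>\<omega>. rem n k \<omega>) \<in> borel_measurable M"
proof -
  assume n: "1 \<le> n" "k < n"
  have [measurable]: "(\<lambda>\<omega>. X \<omega> (P n k)) \<in> borel_measurable M" "(\<lambda>\<omega>. X \<omega> (P n (Suc k))) \<in> borel_measurable M"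
    by (intro X_M Pf; use n in auto)+
  show ?thesis unfolding remainder_def by measurable
qed

lemma osc_M: "1 \<le> n \<Longrightarrow> osc n \<in> borel_measurable M"
  unfolding osc_def[abs_def] 
  by (intro borel_measurable_Max borel_measurable_divide borel_measurable_abs rem_M Z_M) auto

lemma osc_bounds:
  assumes n: "1 \<le> n"
  shows "0 \<le> osc n \<omega>" "osc n \<omega> \<le> C" "k < n \<Longrightarrow> \<bar>rem n k \<omega>\<bar> \<le> osc n \<omega> * Z n k \<omega>"
proof -
  have fin: "finite ((\<lambda>k. \<bar>rem n k \<omega>\<bar> / Z n k \<omega>) ` {..<n})" "(\<lambda>k. \<bar>rem n k \<omega>\<bar> / Z n k \<omega>) ` {..<n} \<noteq> {}"
    using n by (auto simp: lessThan_empty_iff)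
  have le: "\<bar>rem n k \<omega>\<bar> / Z n k \<omega> \<le> osc n \<omega>" if "k < n" for k
    unfolding osc_def by (rule Max_ge) (use that in auto)
  have "0 \<le> \<bar>rem n 0 \<omega>\<bar> / Z n 0 \<omega>" by simp
  also have "\<dots> \<le> osc n \<omega>" using le[of 0] n by simp
  finally show "0 \<le> osc n \<omega>" .
  have "\<bar>rem n k \<omega>\<bar> / Z n k \<omega> \<le> C" for k
  proof (cases "Z n k \<omega> = 0")
    case False
    then have "0 < Z n k \<omega>" by (simp add: less_le)
    with remainder_le[of "X \<omega> (P n k)" "X \<omega> (P n (Suc k))"] show ?thesis by (simp add: divide_le_eq)
  qed (simp add: C_nonneg)
  then show "osc n \<omega> \<le> C" unfolding osc_def using fin by simp
  show "\<bar>rem n k \<omega>\<bar> \<le> osc n \<omega> * Z n k \<omega>" if "k < n"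
  proof (cases "Z n k \<omega> = 0")
    case True
    then show ?thesis using remainder_le[of "X \<omega> (P n k)" "X \<omega> (P n (Suc k))"] by simp
  next
    case False
    then have "0 < Z n k \<omega>" by (simp add: less_le)
    with le[OF that] show ?thesis by (simp add: divide_le_eq)
  qed
qed

lemma osc_tendsto:
  assumes \<omega>: "\<omega> \<in> space M"
  shows "(\<lambda>n. osc n \<omega>) \<longlonglongrightarrow> 0"
proof (rule LIMSEQ_I)
  fix \<eta> :: real assume \<eta>: "0 < \<eta>"
  have c: "continuous_on {0..t} (X \<omega>)" by (rule continuous_on_subset[OF X_cont[OF \<omega>]]) (use t in auto)
  have "compact (X \<omega> ` {0..t})"
    by (intro compact_continuous_image c) auto
  then obtain R where R: "\<And>s. s \<in> {0..t} \<Longrightarrow> \<bar>X \<omega> s\<bar> \<le> R"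
    unfolding compact_eq_bounded_closed bounded_real by blast
  \<comment> \<open>The path stays in [-R, R]. The intermediate point of the remainder lies between
    neighbouring values of the path, hence near the left one; the factor 1/2 in the remainder yields
    the bound \<open>\<eta> / 2\<close>.\<close>
  have "uniformly_continuous_on {-R..R} \<phi>''" by (rule compact_uniformly_continuous[OF \<phi>''_cont]) simp
  then obtain d where d: "0 < d" "\<And>x y. x \<in> {-R..R} \<Longrightarrow> y \<in> {-R..R} \<Longrightarrow> dist y x < d \<Longrightarrow> dist (\<phi>'' y) (\<phi>'' x) < \<eta>"
    unfolding uniformly_continuous_on_def using \<eta> by metis
  from oscillation_small[OF c d(1)]
  have "\<forall>\<^sub>F n in sequentially. norm (osc n \<omega> - 0) < \<eta>"
  proof eventually_elim
    case (elim n)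
    then have n: "1 \<le> n" by simp
    have "\<bar>rem n k \<omega>\<bar> / Z n k \<omega> \<le> \<eta> / 2" if k: "k < n" for k
    proof (cases "Z n k \<omega> = 0")
      case False
      then have Z: "0 < Z n k \<omega>" by (simp add: less_le)
      let ?x = "X \<omega> (P n k)" and ?y = "X \<omega> (P n (Suc k))"
      obtain \<xi> where \<xi>: "min ?x ?y \<le> \<xi>" "\<xi> \<le> max ?x ?y" and e: "rem n k \<omega> = (\<phi>'' \<xi> - \<phi>'' ?x) / 2 * (?y - ?x)^2"
        using remainder_eq by metis
      have "P n k \<le> P n (Suc k)" using Pf(1)[OF n, of k "Suc k"] k by simp
      then have "\<bar>?y - ?x\<bar> < d" using elim k by auto
      then have xd: "\<bar>\<xi> - ?x\<bar> < d" using \<xi> by (auto simp: min_def max_def split: if_splits)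
      have "\<bar>?x\<bar> \<le> R" "\<bar>?y\<bar> \<le> R" using R Pf(2,3)[OF n, of k] Pf(2,3)[OF n, of "Suc k"] k by auto
      then have "?x \<in> {-R..R}" "\<xi> \<in> {-R..R}" using \<xi> by (auto simp: min_def max_def split: if_splits)
      from d(2)[OF this] xd have "\<bar>\<phi>'' \<xi> - \<phi>'' ?x\<bar> < \<eta>" by (simp add: dist_real_def)
      then have "\<bar>rem n k \<omega>\<bar> \<le> \<eta> / 2 * Z n k \<omega>" unfolding e abs_mult by (intro mult_mono) auto
      then show ?thesis using Z by (simp add: divide_le_eq)
    qed (use \<eta> in simp)
    moreover have "finite ((\<lambda>k. \<bar>rem n k \<omega>\<bar> / Z n k \<omega>) ` {..<n})" "(\<lambda>k. \<bar>rem n k \<omega>\<bar> / Z n k \<omega>) ` {..<n} \<noteq> {}"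
      using n by (auto simp: lessThan_empty_iff)
    ultimately have "osc n \<omega> \<le> \<eta> / 2" unfolding osc_def by (intro Max.boundedI) auto
    then show ?case using osc_bounds(1)[OF n, of \<omega>] \<eta> by simp
  qed
  then show "\<exists>no. \<forall>n\<ge>no. norm (osc n \<omega> - 0) < \<eta>"
    by (simp add: eventually_sequentially)
qed

lemma rem_integrable: 
  assumes "1 \<le> n" "k < n"
  shows "integrable M (\<lambda>\<omega>. rem n k \<omega>)"
proof (rule Bochner_Integration.integrable_bound)
  show "integrable M (\<lambda>\<omega>. C * Z n k \<omega>)" using Z_int[OF assms] by simp
  show "AE \<omega> in M. norm (rem n k \<omega>) \<le> norm (C * Z n k \<omega>)"
    using remainder_le by (intro AE_I2) (auto simp: C_nonneg abs_mult)
qed (rule rem_M[OF assms])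

text \<open>The sum of squared increments converges only in L1 and \<open>osc\<close> only
  pointwise, so their product is split. Against the deviation of that sum from the bracket,
  \<open>osc\<close> is replaced by its bound \<open>C\<close>; against the bracket itself it tends
  to 0 by dominated convergence.\<close>

lemma rem_sum: "(\<lambda>n. \<integral>\<omega>. \<bar>\<Sum>k<n. rem n k \<omega>\<bar> \<partial>M) \<longlonglongrightarrow> 0"
proof -
  have ic: "integrable M (clock 0 t)" by (rule clock_integrable) (use t in auto)
  have iD: "integrable M (\<lambda>\<omega>. \<Sum>k<n. Z n k \<omega> - al n k \<omega>)" if "1 \<le> n" for n
    using Z_int[OF that] al_int[OF that] by auto
  have ioc: "integrable M (\<lambda>\<omega>. osc n \<omega> * clock 0 t \<omega>)" if "1 \<le> n" for n
  proof (rule Bochner_Integration.integrable_bound)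
    show "integrable M (\<lambda>\<omega>. C * clock 0 t \<omega>)" using ic by simp
    show "AE \<omega> in M. norm (osc n \<omega> * clock 0 t \<omega>) \<le> norm (C * clock 0 t \<omega>)"
      using osc_bounds[OF that] C_nonneg clock_nonneg by (intro AE_I2) (auto simp: abs_mult intro!: mult_right_mono)
  qed (use osc_M[OF that] ic in measurable)
  have "(\<lambda>n. \<integral>\<omega>. osc (n+1) \<omega> * clock 0 t \<omega> \<partial>M) \<longlonglongrightarrow> (\<integral>\<omega>. 0 \<partial>M)"
  proof (rule integral_dominated_convergence[where w="\<lambda>\<omega>. C * clock 0 t \<omega>"])
    show "integrable M (\<lambda>\<omega>. C * clock 0 t \<omega>)" using ic by simp
    show "AE \<omega> in M. norm (osc (n+1) \<omega> * clock 0 t \<omega>) \<le> C * clock 0 t \<omega>" for n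
      using osc_bounds[of "n+1"] C_nonneg clock_nonneg by (intro AE_I2) (auto simp: abs_mult intro!: mult_right_mono)
    show "AE \<omega> in M. (\<lambda>n. osc (n+1) \<omega> * clock 0 t \<omega>) \<longlonglongrightarrow> 0"
      using LIMSEQ_ignore_initial_segment[OF osc_tendsto, of _ 1] by (intro AE_I2 tendsto_mult_left_zero) auto
    show "(\<lambda>\<omega>. osc (n+1) \<omega> * clock 0 t \<omega>) \<in> borel_measurable M" for n
      using osc_M[of "n+1"] ic by measurable
  qed simp
  then have o: "(\<lambda>n. \<integral>\<omega>. osc n \<omega> * clock 0 t \<omega> \<partial>M) \<longlonglongrightarrow> 0"
    using LIMSEQ_offset[where k=1] by auto
  have lim: "(\<lambda>n. C * (\<integral>\<omega>. \<bar>\<Sum>k<n. Z n k \<omega> - al n k \<omega>\<bar> \<partial>M) + (\<integral>\<omega>. osc n \<omega> * clock 0 t \<omega> \<partial>M)) \<longlonglongrightarrow> C * 0 + 0"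
    by (intro tendsto_intros Z_al_sum o)
  have "\<forall>\<^sub>F n in sequentially. (\<integral>\<omega>. \<bar>\<Sum>k<n. rem n k \<omega>\<bar> \<partial>M) \<le> C * (\<integral>\<omega>. \<bar>\<Sum>k<n. Z n k \<omega> - al n k \<omega>\<bar> \<partial>M) + (\<integral>\<omega>. osc n \<omega> * clock 0 t \<omega> \<partial>M)"
    using eventually_ge_at_top[of 1]
  proof eventually_elim
    case (elim n)
    have "(\<integral>\<omega>. \<bar>\<Sum>k<n. rem n k \<omega>\<bar> \<partial>M) \<le> (\<integral>\<omega>. C * \<bar>\<Sum>k<n. Z n k \<omega> - al n k \<omega>\<bar> + osc n \<omega> * clock 0 t \<omega> \<partial>M)"
    proof (rule integral_mono_AE)
      show "integrable M (\<lambda>\<omega>. \<bar>\<Sum>k<n. rem n k \<omega>\<bar>)"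
        by (intro integrable_abs Bochner_Integration.integrable_sum rem_integrable[OF elim]) auto
      show "integrable M (\<lambda>\<omega>. C * \<bar>\<Sum>k<n. Z n k \<omega> - al n k \<omega>\<bar> + osc n \<omega> * clock 0 t \<omega>)"
        using iD[OF elim] ioc[OF elim] by simp
      show "AE \<omega> in M. \<bar>\<Sum>k<n. rem n k \<omega>\<bar> \<le> C * \<bar>\<Sum>k<n. Z n k \<omega> - al n k \<omega>\<bar> + osc n \<omega> * clock 0 t \<omega>"
        using sum_al_AE[OF elim]
      proof eventually_elim
        case (elim \<omega>)
        note o = osc_bounds[OF \<open>1 \<le> n\<close>, where \<omega>=\<omega>]
        have "\<bar>\<Sum>k<n. rem n k \<omega>\<bar> \<le> (\<Sum>k<n. osc n \<omega> * Z n k \<omega>)"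
          by (rule order_trans[OF sum_abs]) (intro sum_mono o(3), simp)
        also have "\<dots> = osc n \<omega> * (\<Sum>k<n. Z n k \<omega> - al n k \<omega>) + osc n \<omega> * clock 0 t \<omega>"
          using elim by (simp add: sum_distrib_left[symmetric] sum_subtractf algebra_simps)
        also have "osc n \<omega> * (\<Sum>k<n. Z n k \<omega> - al n k \<omega>) \<le> C * \<bar>\<Sum>k<n. Z n k \<omega> - al n k \<omega>\<bar>"
        proof -
          have "osc n \<omega> * (\<Sum>k<n. Z n k \<omega> - al n k \<omega>) \<le> osc n \<omega> * \<bar>\<Sum>k<n. Z n k \<omega> - al n k \<omega>\<bar>"
            by (rule mult_left_mono) (use o in auto)
          also have "\<dots> \<le> C * \<bar>\<Sum>k<n. Z n k \<omega> - al n k \<omega>\<bar>" by (rule mult_right_mono) (use o in auto)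
          finally show ?thesis .
        qed
        finally show ?case by simp
      qed
    qed
    also have "\<dots> = C * (\<integral>\<omega>. \<bar>\<Sum>k<n. Z n k \<omega> - al n k \<omega>\<bar> \<partial>M) + (\<integral>\<omega>. osc n \<omega> * clock 0 t \<omega> \<partial>M)"
      using iD[OF elim] ioc[OF elim] by simp
    finally show ?case .
  qed
  then show ?thesis
    by (intro tendsto_sandwich[OF _ _ tendsto_const lim[simplified]]) auto
qed

text \<open>\<open>\<phi>\<close> telescopes along the nodes. The bracket increments are added and
  subtracted so that each of the three errors has its own L1 limit.\<close>

lemma taylor_sum:
  assumes n: "1 \<le> n"
  shows "S n \<omega> - ito_int \<omega> t = - ((\<Sum>k<n. \<phi>'' (X \<omega> (P n k)) * al n k \<omega>) - drift t \<omega>) / 2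
     - (\<Sum>k<n. \<phi>'' (X \<omega> (P n k)) * (Z n k \<omega> - al n k \<omega>)) / 2 - (\<Sum>k<n. rem n k \<omega>)"
proof -
  have "\<phi> (X \<omega> t) - \<phi> (X \<omega> 0) = (\<Sum>k<n. \<phi> (X \<omega> (P n (Suc k))) - \<phi> (X \<omega> (P n k)))"
    using sum_lessThan_telescope[of "\<lambda>k. \<phi> (X \<omega> (P n k))" n] P_ends[OF n] by simp
  also have "\<dots> = (\<Sum>k<n. \<phi>' (X \<omega> (P n k)) * (X \<omega> (P n (Suc k)) - X \<omega> (P n k)) + \<phi>'' (X \<omega> (P n k)) * Z n k \<omega> / 2 + rem n k \<omega>)"
    by (simp add: remainder_def)
  also have "\<dots> = S n \<omega> + (\<Sum>k<n. \<phi>'' (X \<omega> (P n k)) * Z n k \<omega>) / 2 + (\<Sum>k<n. rem n k \<omega>)"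
    by (simp add: isum_def sum.distrib sum_divide_distrib)
  finally show ?thesis
    unfolding ito_int_def by (simp add: sum_subtractf right_diff_distrib field_simps)
qed

lemma S_integrable: "1 \<le> n \<Longrightarrow> integrable M (S n)"
  by (rule integrable_of_square) (use isum_M[OF simple] isum_sq[OF simple] in auto)

lemma L1_limit: "(\<lambda>n. \<integral>\<omega>. \<bar>S n \<omega> - ito_int \<omega> t\<bar> \<partial>M) \<longlonglongrightarrow> 0"
proof -
  note tT = less_imp_le[OF t(1)] t(2)
  have lim: "(\<lambda>n. (\<integral>\<omega>. \<bar>(\<Sum>k<n. \<phi>'' (X \<omega> (P n k)) * al n k \<omega>) - drift t \<omega>\<bar> \<partial>M) / 2 +
     (\<integral>\<omega>. \<bar>\<Sum>k<n. \<phi>'' (X \<omega> (P n k)) * (Z n k \<omega> - al n k \<omega>)\<bar> \<partial>M) / 2 + (\<integral>\<omega>. \<bar>\<Sum>k<n. rem n k \<omega>\<bar> \<partial>M)) \<longlonglongrightarrow> 0 / 2 + 0 / 2 + 0"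
    by (intro tendsto_intros \<phi>''_al \<phi>''_Z rem_sum) auto
  have "\<forall>\<^sub>F n in sequentially. (\<integral>\<omega>. \<bar>S n \<omega> - ito_int \<omega> t\<bar> \<partial>M) \<le> (\<integral>\<omega>. \<bar>(\<Sum>k<n. \<phi>'' (X \<omega> (P n k)) * al n k \<omega>) - drift t \<omega>\<bar> \<partial>M) / 2 +
     (\<integral>\<omega>. \<bar>\<Sum>k<n. \<phi>'' (X \<omega> (P n k)) * (Z n k \<omega> - al n k \<omega>)\<bar> \<partial>M) / 2 + (\<integral>\<omega>. \<bar>\<Sum>k<n. rem n k \<omega>\<bar> \<partial>M)"
    using eventually_ge_at_top[of 1]
  proof eventually_elim
    case (elim n)
    define f1 where "f1 \<omega> = (\<Sum>k<n. \<phi>'' (X \<omega> (P n k)) * al n k \<omega>) - drift t \<omega>" for \<omega>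
    define f2 where "f2 \<omega> = (\<Sum>k<n. \<phi>'' (X \<omega> (P n k)) * (Z n k \<omega> - al n k \<omega>))" for \<omega>
    define f3 where "f3 \<omega> = (\<Sum>k<n. rem n k \<omega>)" for \<omega>
    have i1: "integrable M f1" unfolding f1_def
      by (intro Bochner_Integration.integrable_diff Bochner_Integration.integrable_sum drift_integrable[OF tT] \<phi>''_al_integrable[OF elim]) auto
    have "integrable M (\<lambda>\<omega>. \<phi>'' (X \<omega> (P n k)) * (Z n k \<omega> - al n k \<omega>))" if "k < n" for k
      by (rule integrable_mult_bounded[OF _ _ b2]) (use Z_int[OF elim that] al_int[OF elim that] elim that in \<open>auto intro!: \<phi>_M\<close>)
    then have i2: "integrable M f2" unfolding f2_def by auto
    have i3: "integrable M f3" unfolding f3_def by (intro Bochner_Integration.integrable_sum rem_integrable[OF elim]) auto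
    have "(\<integral>\<omega>. \<bar>S n \<omega> - ito_int \<omega> t\<bar> \<partial>M) \<le> (\<integral>\<omega>. \<bar>f1 \<omega>\<bar> / 2 + \<bar>f2 \<omega>\<bar> / 2 + \<bar>f3 \<omega>\<bar> \<partial>M)"
    proof (rule integral_mono)
      show "integrable M (\<lambda>\<omega>. \<bar>S n \<omega> - ito_int \<omega> t\<bar>)"
        using S_integrable[OF elim] ito_int_integrable[OF tT] by auto
      show "\<bar>S n \<omega> - ito_int \<omega> t\<bar> \<le> \<bar>f1 \<omega>\<bar> / 2 + \<bar>f2 \<omega>\<bar> / 2 + \<bar>f3 \<omega>\<bar>" for \<omega>
        unfolding taylor_sum[OF elim] f1_def[symmetric] f2_def[symmetric] f3_def[symmetric] by simp
    qed (use i1 i2 i3 in auto)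
    also have "\<dots> = (\<integral>\<omega>. \<bar>f1 \<omega>\<bar> \<partial>M) / 2 + (\<integral>\<omega>. \<bar>f2 \<omega>\<bar> \<partial>M) / 2 + (\<integral>\<omega>. \<bar>f3 \<omega>\<bar> \<partial>M)"
      using i1 i2 i3 by simp
    finally show ?case unfolding f1_def f2_def f3_def .
  qed
  then show ?thesis
    by (intro tendsto_sandwich[OF _ _ tendsto_const lim[simplified]]) auto
qed

end

section \<open>The stochastic integral in L2\<close>

lemma (in prob_space) tendsto_integral_indicator:
  fixes f :: "nat \<Rightarrow> 'a \<Rightarrow> real"
  assumes A[measurable]: "A \<in> sets M" and f: "\<And>n. 1 \<le> n \<Longrightarrow> integrable M (f n)" and g: "integrable M g"
    and lim: "(\<lambda>n. \<integral>\<omega>. \<bar>f n \<omega> - g \<omega>\<bar> \<partial>M) \<longlonglongrightarrow> 0"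
  shows "(\<lambda>n. \<integral>\<omega>. indicator A \<omega> * f n \<omega> \<partial>M) \<longlonglongrightarrow> (\<integral>\<omega>. indicator A \<omega> * g \<omega> \<partial>M)"
proof (rule LIM_zero_cancel, rule tendsto_rabs_zero_cancel, rule tendsto_sandwich[OF _ _ tendsto_const lim])
  have ind: "integrable M (\<lambda>\<omega>. indicator A \<omega> * h \<omega>)" if "integrable M h" for h :: "'a \<Rightarrow> real"
    by (rule integrable_mult_bounded[where C=1]) (use that in \<open>auto simp: indicator_def\<close>)
  show "\<forall>\<^sub>F n in sequentially. \<bar>(\<integral>\<omega>. indicator A \<omega> * f n \<omega> \<partial>M) - (\<integral>\<omega>. indicator A \<omega> * g \<omega> \<partial>M)\<bar> \<le> (\<integral>\<omega>. \<bar>f n \<omega> - g \<omega>\<bar> \<partial>M)"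
    using eventually_ge_at_top[of 1]
  proof eventually_elim
    case (elim n)
    note fn = f[OF elim]
    have "(\<integral>\<omega>. indicator A \<omega> * f n \<omega> \<partial>M) - (\<integral>\<omega>. indicator A \<omega> * g \<omega> \<partial>M) = (\<integral>\<omega>. indicator A \<omega> * (f n \<omega> - g \<omega>) \<partial>M)"
      using ind[OF fn] ind[OF g] by (simp add: right_diff_distrib)
    also have "\<bar>\<dots>\<bar> \<le> (\<integral>\<omega>. \<bar>indicator A \<omega> * (f n \<omega> - g \<omega>)\<bar> \<partial>M)" by (rule integral_abs_bound)
    also have "\<dots> \<le> (\<integral>\<omega>. \<bar>f n \<omega> - g \<omega>\<bar> \<partial>M)"
    proof (rule integral_mono)
      show "integrable M (\<lambda>\<omega>. \<bar>indicator A \<omega> * (f n \<omega> - g \<omega>)\<bar>)"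
        by (intro integrable_abs ind) (use fn g in auto)
    qed (use fn g in \<open>auto simp: indicator_def\<close>)
    finally show ?case .
  qed
qed auto


lemma (in prob_space) L2_limit_unique:
  fixes S :: "nat \<Rightarrow> 'a \<Rightarrow> real"
  assumes [measurable]: "\<And>n. n \<ge> 1 \<Longrightarrow> S n \<in> borel_measurable M" "I \<in> borel_measurable M" "J \<in> borel_measurable M"
    and sq: "\<And>n. n \<ge> 1 \<Longrightarrow> integrable M (\<lambda>\<omega>. (S n \<omega>)^2)" "integrable M (\<lambda>\<omega>. (I \<omega>)^2)" "integrable M (\<lambda>\<omega>. (J \<omega>)^2)"
    and lim: "(\<lambda>n. \<integral>\<omega>. (S n \<omega> - I \<omega>)^2 \<partial>M) \<longlonglongrightarrow> 0" "(\<lambda>n. \<integral>\<omega>. (S n \<omega> - J \<omega>)^2 \<partial>M) \<longlonglongrightarrow> 0"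
  shows "AE \<omega> in M. I \<omega> = J \<omega>"
proof -
  have iIJ: "integrable M (\<lambda>\<omega>. (I \<omega> - J \<omega>)^2)" by (rule integrable_square_diff) (use sq in auto)
  have "(\<integral>\<omega>. (I \<omega> - J \<omega>)^2 \<partial>M) \<le> 2 * (\<integral>\<omega>. (S n \<omega> - I \<omega>)^2 \<partial>M) + 2 * (\<integral>\<omega>. (S n \<omega> - J \<omega>)^2 \<partial>M)" if n: "n \<ge> 1" for n
  proof -
    have i: "integrable M (\<lambda>\<omega>. (S n \<omega> - I \<omega>)^2)" "integrable M (\<lambda>\<omega>. (S n \<omega> - J \<omega>)^2)"
      by (rule integrable_square_diff; use sq n in auto)+
    have "(\<integral>\<omega>. (I \<omega> - J \<omega>)^2 \<partial>M) \<le> (\<integral>\<omega>. 2 * (S n \<omega> - I \<omega>)^2 + 2 * (S n \<omega> - J \<omega>)^2 \<partial>M)"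
    proof (rule integral_mono)
      show "(I \<omega> - J \<omega>)^2 \<le> 2 * (S n \<omega> - I \<omega>)^2 + 2 * (S n \<omega> - J \<omega>)^2" for \<omega>
      proof -
        have "0 \<le> ((S n \<omega> - I \<omega>) + (S n \<omega> - J \<omega>))^2" by simp
        then show ?thesis by (simp add: power2_eq_square algebra_simps)
      qed
    qed (use iIJ i in auto)
    then show ?thesis using i by simp
  qed
  moreover have "(\<lambda>n. 2 * (\<integral>\<omega>. (S n \<omega> - I \<omega>)^2 \<partial>M) + 2 * (\<integral>\<omega>. (S n \<omega> - J \<omega>)^2 \<partial>M)) \<longlonglongrightarrow> 2 * 0 + 2 * 0"
    by (intro tendsto_intros lim)
  ultimately have "(\<integral>\<omega>. (I \<omega> - J \<omega>)^2 \<partial>M) \<le> 0"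
    by (intro LIMSEQ_le_const) (auto intro!: exI[of _ 1])
  then have "(\<integral>\<omega>. (I \<omega> - J \<omega>)^2 \<partial>M) = 0" by (intro antisym) auto
  then have "AE \<omega> in M. (I \<omega> - J \<omega>)^2 = 0"
    using integral_nonneg_eq_0_iff_AE[OF iIJ] by simp
  then show ?thesis by eventually_elim simp
qed

text \<open>A concrete sequence with vanishing mesh, for limits that are characterised through all
  partition sequences.\<close>

definition uniform_partition :: "real \<Rightarrow> nat \<Rightarrow> nat \<Rightarrow> real" where
  "uniform_partition t n k = t * real k / real n"

lemma part_uniform: "0 < t \<Longrightarrow> 1 \<le> n \<Longrightarrow> part 0 t (uniform_partition t n) n"
  by (auto simp: part_def uniform_partition_def divide_strict_right_mono)

lemma mesh_uniform: "0 < t \<Longrightarrow> (\<lambda>n. mesh (uniform_partition t n) n) \<longlonglongrightarrow> 0"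
proof -
  assume "0 < t"
  have "\<forall>\<^sub>F n in sequentially. t / real n = mesh (uniform_partition t n) n"
    using eventually_ge_at_top[of 1]
  proof eventually_elim
    case (elim n)
    have "(\<lambda>k. uniform_partition t n (Suc k) - uniform_partition t n k) ` {..<n} = {t / real n}"
      using elim by (auto simp: uniform_partition_def field_simps intro!: image_eqI[of _ _ 0])
    then show ?case by (simp add: mesh_def)
  qed
  moreover have "(\<lambda>n. t / real n) \<longlonglongrightarrow> 0" by (rule lim_const_over_n)
  ultimately show ?thesis by (simp add: tendsto_cong)
qed

lemma wpart_part: "part 0 t p n \<Longrightarrow> wpart t p n"
  by (auto simp: part_def wpart_def less_imp_le)

lemma mesh_min_le:
  assumes "wpart t p n" "1 \<le> n"
  shows "0 \<le> mesh (\<lambda>k. min (p k) s) n" "mesh (\<lambda>k. min (p k) s) n \<le> mesh p n"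
proof -
  have mem: "p (Suc k) - p k \<le> mesh p n" if "k < n" for k
    unfolding mesh_def by (rule Max_ge) (use that in auto)
  have fin: "finite ((\<lambda>k. min (p (Suc k)) s - min (p k) s) ` {..<n})" "(\<lambda>k. min (p (Suc k)) s - min (p k) s) ` {..<n} \<noteq> {}"
    using assms by (auto simp: lessThan_empty_iff)
  have le: "min (p (Suc k)) s - min (p k) s \<le> p (Suc k) - p k" "0 \<le> min (p (Suc k)) s - min (p k) s" if "k < n" for k
    using assms(1) that by (auto simp: wpart_def min_def)
  show "mesh (\<lambda>k. min (p k) s) n \<le> mesh p n"
    unfolding mesh_def[of "\<lambda>k. min (p k) s"] using fin
    by (intro Max.boundedI) (auto intro: order_trans[OF le(1) mem])
  have "min (p (Suc 0)) s - min (p 0) s \<le> mesh (\<lambda>k. min (p k) s) n"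
    unfolding mesh_def by (rule Max_ge) (use assms in auto)
  then show "0 \<le> mesh (\<lambda>k. min (p k) s) n" using le(2)[of 0] assms by simp
qed

context ito_partitions
begin

text \<open>Bounded convergence for the finite measure \<open>doleans\<close>. Path continuity of
  \<open>g\<close> gives pointwise convergence of the left-endpoint steps, and joint measurability
  of the limiting integrand comes with it.\<close>

lemma istep_tendsto:
  assumes g: "\<And>\<omega>. \<omega> \<in> space M \<Longrightarrow> continuous_on {0..t} (g \<omega>)" "\<And>s. 0 \<le> s \<Longrightarrow> s \<le> t \<Longrightarrow> (\<lambda>\<omega>. g \<omega> s) \<in> borel_measurable M"
      "\<And>\<omega> s. \<bar>g \<omega> s\<bar> \<le> K"
  shows istep_limit_meas: "(\<lambda>x. g (fst x) (snd x) * indicator {0<..t} (snd x)) \<in> borel_measurable (M \<Otimes>\<^sub>M lborel)"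
    and istep_L2: "(\<lambda>n. \<integral>x. (istep (P n) n (\<lambda>k \<omega>. g \<omega> (P n k)) x - g (fst x) (snd x) * indicator {0<..t} (snd x))^2 \<partial>doleans) \<longlonglongrightarrow> 0"
    and istep_norm: "(\<lambda>n. \<integral>x. (istep (P n) n (\<lambda>k \<omega>. g \<omega> (P n k)) x)^2 \<partial>doleans)
       \<longlonglongrightarrow> (\<integral>x. (g (fst x) (snd x) * indicator {0<..t} (snd x))^2 \<partial>doleans)"
proof -
  define st where "st n = istep (P n) n (\<lambda>k \<omega>. g \<omega> (P n k))" for n
  define L where "L x = g (fst x) (snd x) * indicator {0<..t} (snd x)" for x :: "'a \<times> real"
  have K: "0 \<le> K" using g(3)[of undefined 0] abs_ge_zero order_trans by blast
  have stM: "st n \<in> borel_measurable (M \<Otimes>\<^sub>M lborel)" if n: "1 \<le> n" for n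
    unfolding st_def istep_def[abs_def]
  proof (intro borel_measurable_sum borel_measurable_times)
    fix k assume "k \<in> {..<n}"
    then have [measurable]: "(\<lambda>\<omega>. g \<omega> (P n k)) \<in> borel_measurable M" using Pf(2,3)[OF n, of k] by (intro g) auto
    show "(\<lambda>x. g (fst x) (P n k)) \<in> borel_measurable (M \<Otimes>\<^sub>M lborel)" by measurable
  qed measurable
  have stK: "\<bar>st n x\<bar> \<le> K" if n: "1 \<le> n" for n x
    unfolding st_def istep_def by (rule wpart_sum_abs_le[OF P[OF n]]) (rule g(3))
  have lim: "(\<lambda>n. st n x) \<longlonglongrightarrow> L x" if "x \<in> space (M \<Otimes>\<^sub>M lborel)" for x
    unfolding st_def istep_def L_def by (rule step_tendsto[OF g(1)]) (use that in \<open>auto simp: space_pair_measure\<close>)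
  have LK: "\<bar>L x\<bar> \<le> K" for x using g(3)[of "fst x" "snd x"] K by (auto simp: L_def indicator_def)
  have LM: "L \<in> borel_measurable (M \<Otimes>\<^sub>M lborel)"
    by (rule borel_measurable_LIMSEQ_real[where u="\<lambda>n. st (n+1)"])
       (use LIMSEQ_ignore_initial_segment[OF lim, of _ 1] stM in auto)
  show "(\<lambda>x. g (fst x) (snd x) * indicator {0<..t} (snd x)) \<in> borel_measurable (M \<Otimes>\<^sub>M lborel)"
    using LM unfolding L_def[abs_def] .
  have sqb: "z^2 \<le> B^2" if "\<bar>z\<bar> \<le> B" for z B :: real
    using power_mono[OF that abs_ge_zero, of 2] by simp
  have lim': "(\<lambda>n. st (n+1) x) \<longlonglongrightarrow> L x" if "x \<in> space doleans" for x
    using LIMSEQ_ignore_initial_segment[OF lim, of x 1] that by (simp add: space_pair_measure)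
  have "(\<lambda>n. \<integral>x. (st (n+1) x - L x)^2 \<partial>doleans) \<longlonglongrightarrow> (\<integral>x. 0 \<partial>doleans)"
  proof (rule integral_dominated_convergence[where w="\<lambda>_. (K+K)^2"])
    show "AE x in doleans. (\<lambda>n. (st (n+1) x - L x)^2) \<longlonglongrightarrow> 0"
    proof (rule AE_I2)
      fix x assume "x \<in> space doleans"
      then have "(\<lambda>n. (st (n+1) x - L x)^2) \<longlonglongrightarrow> (L x - L x)^2" by (intro tendsto_intros lim')
      then show "(\<lambda>n. (st (n+1) x - L x)^2) \<longlonglongrightarrow> 0" by simp
    qed
    have "\<bar>st (n+1) x - L x\<bar> \<le> K + K" for n x
      using stK[of "n+1" x] LK[of x] by simp
    then have "(st (n+1) x - L x)^2 \<le> (K+K)^2" for n x by (rule sqb)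
    then show "AE x in doleans. norm ((st (n+1) x - L x)^2) \<le> (K+K)^2" for n
      by (intro AE_I2) (simp only: real_norm_def abs_power2)
    show "(\<lambda>x. (st (n+1) x - L x)^2) \<in> borel_measurable doleans" for n
      using stM[of "n+1"] LM by measurable
  qed simp_all
  then have "(\<lambda>n. \<integral>x. (st n x - L x)^2 \<partial>doleans) \<longlonglongrightarrow> 0"
    using LIMSEQ_offset[where k=1] by auto
  then show "(\<lambda>n. \<integral>x. (istep (P n) n (\<lambda>k \<omega>. g \<omega> (P n k)) x - g (fst x) (snd x) * indicator {0<..t} (snd x))^2 \<partial>doleans) \<longlonglongrightarrow> 0"
    unfolding st_def L_def .
  have "(\<lambda>n. \<integral>x. (st (n+1) x)^2 \<partial>doleans) \<longlonglongrightarrow> (\<integral>x. (L x)^2 \<partial>doleans)"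
  proof (rule integral_dominated_convergence[where w="\<lambda>_. K^2"])
    show "AE x in doleans. (\<lambda>n. (st (n+1) x)^2) \<longlonglongrightarrow> (L x)^2"
      by (intro AE_I2 tendsto_intros lim')
    show "AE x in doleans. norm ((st (n+1) x)^2) \<le> K^2" for n
      by (intro AE_I2) (use sqb[OF stK[of "n+1"]] in simp)
    show "(\<lambda>x. (st (n+1) x)^2) \<in> borel_measurable doleans" for n
      using stM[of "n+1"] by measurable
  qed (use LM in \<open>simp_all, measurable\<close>)
  then have "(\<lambda>n. \<integral>x. (st n x)^2 \<partial>doleans) \<longlonglongrightarrow> (\<integral>x. (L x)^2 \<partial>doleans)"
    by (rule LIMSEQ_offset[where k=1])
  then show "(\<lambda>n. \<integral>x. (istep (P n) n (\<lambda>k \<omega>. g \<omega> (P n k)) x)^2 \<partial>doleans)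
       \<longlonglongrightarrow> (\<integral>x. (g (fst x) (snd x) * indicator {0<..t} (snd x))^2 \<partial>doleans)"
    unfolding st_def L_def .
qed

end

context ito_formula
begin

text \<open>The explicit integral is not known to be square integrable in advance, so the isometry
  is applied to differences of two sums only; together with the L1 limit this gives both the
  integrability and the convergence.\<close>

lemma L2_limit:
  shows "1 \<le> n \<Longrightarrow> integrable M (\<lambda>\<omega>. (S n \<omega> - ito_int \<omega> t)^2)"
    and "(\<lambda>n. \<integral>\<omega>. (S n \<omega> - ito_int \<omega> t)^2 \<partial>M) \<longlonglongrightarrow> 0"
proof -
  note tT = less_imp_le[OF t(1)] t(2)
  let ?g = "\<lambda>\<omega> s. \<phi>' (X \<omega> s)"
  have g: "continuous_on {0..t} (?g \<omega>)" if "\<omega> \<in> space M" for \<omega>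
  proof (rule continuous_on_compose2[OF \<phi>'_cont[of UNIV]])
    show "continuous_on {0..t} (X \<omega>)"
      by (rule continuous_on_subset[OF X_cont[OF that]]) (use t in auto)
  qed simp
  have gm: "(\<lambda>\<omega>. ?g \<omega> s) \<in> borel_measurable M" if "0 \<le> s" "s \<le> t" for s
  proof -
    have [measurable]: "(\<lambda>\<omega>. X \<omega> s) \<in> borel_measurable M" by (rule X_M) (use that t in auto)
    show ?thesis by measurable
  qed
  define st where "st n = istep (P n) n (\<lambda>k \<omega>. ?g \<omega> (P n k))" for n
  define L where "L x = ?g (fst x) (snd x) * indicator {0<..t} (snd x)" for x :: "'a \<times> real"
  \<comment> \<open>Twice the squared distance of the step integrand to its limit: by (a - b)^2
    \<le> 2 (a - l)^2 + 2 (b - l)^2 the isometry turns it into a Cauchy bound.\<close>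
  define q where "q n = 2 * (\<integral>x. (st n x - L x)^2 \<partial>doleans)" for n
  have LM: "L \<in> borel_measurable (M \<Otimes>\<^sub>M lborel)"
    unfolding L_def[abs_def] using istep_limit_meas[OF g gm b1] by blast
  have LC: "\<bar>L x\<bar> \<le> C" for x using b1[of "X (fst x) (snd x)"] C_nonneg by (auto simp: L_def indicator_def)
  have q: "q \<longlonglongrightarrow> 0"
    unfolding q_def st_def L_def using tendsto_mult_left[OF istep_L2[OF g gm b1], of 2] by simp
  have ist: "integrable doleans (\<lambda>x. (st n x - L x)^2)" if n: "1 \<le> n" for n
  proof (rule dol.integrable_const_bound[where B="(C+C)^2"])
    have "\<bar>st n x\<bar> \<le> C" for x
      unfolding st_def istep_def by (rule wpart_sum_abs_le[OF P[OF n]]) (rule b1)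
    then have "\<bar>st n x - L x\<bar> \<le> C + C" for x using LC[of x] by (smt (verit))
    from power_mono[OF this abs_ge_zero, of _ 2] show "AE x in doleans. norm ((st n x - L x)^2) \<le> (C+C)^2"
      by simp
    show "(\<lambda>x. (st n x - L x)^2) \<in> borel_measurable doleans"
      using istep_meas[OF simple[OF n]] LM unfolding st_def by measurable
  qed
  have cauchy: "(\<integral>\<omega>. (S n \<omega> - S m \<omega>)^2 \<partial>M) \<le> q n + q m" if n: "1 \<le> n" "1 \<le> m" for n m
  proof -
    have "(\<integral>\<omega>. (S n \<omega> - S m \<omega>)^2 \<partial>M) = (\<integral>x. (st n x - st m x)^2 \<partial>doleans)"
      unfolding st_def by (rule isum_diff_square[OF simple[OF n(1)] simple[OF n(2)]])
    also have "\<dots> \<le> (\<integral>x. 2 * (st n x - L x)^2 + 2 * (st m x - L x)^2 \<partial>doleans)"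
    proof (rule integral_mono')
      show "(st n x - st m x)^2 \<le> 2 * (st n x - L x)^2 + 2 * (st m x - L x)^2" for x
      proof -
        have "0 \<le> ((st n x - L x) + (st m x - L x))^2" by simp
        then show ?thesis by (simp add: power2_eq_square algebra_simps)
      qed
    qed (use ist n in auto)
    also have "\<dots> = q n + q m" unfolding q_def using ist n by simp
    finally show ?thesis .
  qed
  define S' where "S' n = (if 1 \<le> n then S n else (\<lambda>_. 0))" for n
  have S'M: "S' n \<in> borel_measurable M" for n unfolding S'_def using isum_M[OF simple] by auto
  have conv: "integrable M (\<lambda>\<omega>. (S' n \<omega> - ito_int \<omega> t)^2)" "(\<lambda>n. \<integral>\<omega>. (S' n \<omega> - ito_int \<omega> t)^2 \<partial>M) \<longlonglongrightarrow> 0"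
    if "1 \<le> n" for n
  proof -
    have 1: "integrable M (\<lambda>\<omega>. S' n \<omega> - ito_int \<omega> t)" if "1 \<le> n" for n
      using that S_integrable[OF that] ito_int_integrable[OF tT] by (simp add: S'_def)
    have 2: "integrable M (\<lambda>\<omega>. (S' n \<omega>)^2)" if "1 \<le> n" for n
      using that isum_sq[OF simple[OF that]] by (simp add: S'_def)
    have "\<forall>\<^sub>F n in sequentially. (\<integral>\<omega>. \<bar>S' n \<omega> - ito_int \<omega> t\<bar> \<partial>M) = (\<integral>\<omega>. \<bar>S n \<omega> - ito_int \<omega> t\<bar> \<partial>M)"
      using eventually_ge_at_top[of 1] by eventually_elim (simp add: S'_def)
    then have 3: "(\<lambda>n. \<integral>\<omega>. \<bar>S' n \<omega> - ito_int \<omega> t\<bar> \<partial>M) \<longlonglongrightarrow> 0" using L1_limit by (simp add: tendsto_cong)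
    have 4: "(\<integral>\<omega>. (S' n \<omega> - S' m \<omega>)^2 \<partial>M) \<le> q n + q m" if "1 \<le> n" "1 \<le> m" for n m
      using cauchy[OF that] that by (simp add: S'_def)
    note * = L2_convergence_of_L1_Cauchy[OF S'M ito_int_M[OF tT] 1 2 3 4 q]
    show "integrable M (\<lambda>\<omega>. (S' n \<omega> - ito_int \<omega> t)^2)" by (rule *(1)) (use that in auto)
    show "(\<lambda>n. \<integral>\<omega>. (S' n \<omega> - ito_int \<omega> t)^2 \<partial>M) \<longlonglongrightarrow> 0" by (rule *(3)) (use that in auto)
  qed
  show "integrable M (\<lambda>\<omega>. (S n \<omega> - ito_int \<omega> t)^2)" if "1 \<le> n"
    using conv(1)[OF that] that by (simp add: S'_def)
  have "\<forall>\<^sub>F n in sequentially. (\<integral>\<omega>. (S' n \<omega> - ito_int \<omega> t)^2 \<partial>M) = (\<integral>\<omega>. (S n \<omega> - ito_int \<omega> t)^2 \<partial>M)"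
    using eventually_ge_at_top[of 1] by eventually_elim (simp add: S'_def)
  then show "(\<lambda>n. \<integral>\<omega>. (S n \<omega> - ito_int \<omega> t)^2 \<partial>M) \<longlonglongrightarrow> 0"
    using conv(2)[of 1] by (simp add: tendsto_cong)
qed

lemma ito_int_sq: "integrable M (\<lambda>\<omega>. (ito_int \<omega> t)^2)"
proof -
  note tT = less_imp_le[OF t(1)] t(2)
  \<comment> \<open>The integral is the sum over the first partition minus its error, and both are
    square integrable.\<close>
  have "integrable M (\<lambda>\<omega>. (S 1 \<omega> - (S 1 \<omega> - ito_int \<omega> t))^2)"
    by (rule integrable_square_diff) (use isum_M[OF simple] isum_sq[OF simple] L2_limit(1)[of 1] ito_int_M[OF tT] in auto)
  then show ?thesis by simp
qed

end

section \<open>The explicit expression as a martingale and as the stochastic integral\<close>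

context ito_calculus
begin

lemma ito_formula_axioms_uniform: "0 < t \<Longrightarrow> t \<le> T \<Longrightarrow> ito_formula M F T X a \<phi> \<phi>' \<phi>'' C t (uniform_partition t)"
  by unfold_locales (auto intro!: wpart_part part_uniform mesh_uniform)

lemma ito_int_square_integrable:
  assumes "0 \<le> t" "t \<le> T"
  shows "integrable M (\<lambda>\<omega>. (ito_int \<omega> t)^2)"
proof (cases "t = 0")
  case True
  have "integrable M (\<lambda>\<omega>. (ito_int \<omega> 0)^2) \<longleftrightarrow> integrable M (\<lambda>\<omega>. 0 :: real)"
    by (rule integrable_cong_AE) (use ito_int_0 ito_int_M[of 0] assms in auto)
  then show ?thesis using True by simp
next
  case False
  then interpret ito_formula M F T X a \<phi> \<phi>' \<phi>'' C t "uniform_partition t"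
    by (intro ito_formula_axioms_uniform) (use assms in auto)
  show ?thesis by (rule ito_int_sq)
qed

text \<open>One sequence of partitions of [0, r] serves all earlier times s: stopped at s it is a
  weak partition of [0, s] with no larger mesh. The sums at different times then share their nodes
  and can be subtracted.\<close>

lemma stopped_limit:
  assumes r: "0 < r" "r \<le> T" and s: "0 \<le> s" "s \<le> r"
  defines "P \<equiv> uniform_partition r"
  shows "(\<lambda>n. \<integral>\<omega>. \<bar>isum (\<lambda>k. min (P n k) s) n (\<lambda>k \<omega>. \<phi>' (X \<omega> (min (P n k) s))) \<omega> - ito_int \<omega> s\<bar> \<partial>M) \<longlonglongrightarrow> 0"
    and "1 \<le> n \<Longrightarrow> integrable M (isum (\<lambda>k. min (P n k) s) n (\<lambda>k \<omega>. \<phi>' (X \<omega> (min (P n k) s))))"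
proof -
  have P0: "0 \<le> P n k" for n k unfolding P_def uniform_partition_def using r by simp
  have "(\<lambda>n. \<integral>\<omega>. \<bar>isum (\<lambda>k. min (P n k) s) n (\<lambda>k \<omega>. \<phi>' (X \<omega> (min (P n k) s))) \<omega> - ito_int \<omega> s\<bar> \<partial>M) \<longlonglongrightarrow> 0 \<and>
     (1 \<le> n \<longrightarrow> integrable M (isum (\<lambda>k. min (P n k) s) n (\<lambda>k \<omega>. \<phi>' (X \<omega> (min (P n k) s)))))"
  proof (cases "s = 0")
    case True
    then have "isum (\<lambda>k. min (P n k) s) n h = (\<lambda>_. 0)" for n h
      using P0 by (simp add: isum_def[abs_def] min_absorb2)
    moreover have "(\<integral>\<omega>. \<bar>ito_int \<omega> 0\<bar> \<partial>M) = (\<integral>\<omega>. 0 \<partial>M)"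
      by (rule integral_cong_AE) (use ito_int_0 ito_int_M[of 0] r in auto)
    ultimately show ?thesis using True by simp
  next
    case False
    have w: "wpart r (P n) n" if "1 \<le> n" for n
      unfolding P_def using part_uniform[OF r(1) that] by (rule wpart_part)
    interpret ito_formula M F T X a \<phi> \<phi>' \<phi>'' C s "\<lambda>n k. min (P n k) s"
    proof unfold_locales
      show "0 < s" "s \<le> T" using False s r by auto
      show "wpart s (\<lambda>k. min (P n k) s) n" if "1 \<le> n" for n
        using w[OF that] s by (auto simp: wpart_def min_def intro: order_trans)
      show "(\<lambda>n. mesh (\<lambda>k. min (P n k) s) n) \<longlonglongrightarrow> 0"
      proof (rule tendsto_sandwich[OF _ _ tendsto_const mesh_uniform[OF r(1)]])
        show "\<forall>\<^sub>F n in sequentially. 0 \<le> mesh (\<lambda>k. min (P n k) s) n"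
          using eventually_ge_at_top[of 1] by eventually_elim (rule mesh_min_le(1)[OF w]; assumption)
        show "\<forall>\<^sub>F n in sequentially. mesh (\<lambda>k. min (P n k) s) n \<le> mesh (uniform_partition r n) n"
          using eventually_ge_at_top[of 1] unfolding P_def[symmetric] by eventually_elim (rule mesh_min_le(2)[OF w]; assumption)
      qed
    qed
    show ?thesis using L1_limit S_integrable by blast
  qed
  then show "(\<lambda>n. \<integral>\<omega>. \<bar>isum (\<lambda>k. min (P n k) s) n (\<lambda>k \<omega>. \<phi>' (X \<omega> (min (P n k) s))) \<omega> - ito_int \<omega> s\<bar> \<partial>M) \<longlonglongrightarrow> 0"
    and "1 \<le> n \<Longrightarrow> integrable M (isum (\<lambda>k. min (P n k) s) n (\<lambda>k \<omega>. \<phi>' (X \<omega> (min (P n k) s))))" by auto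
qed

text \<open>Terms before s cancel, a step containing s leaves its part after s, and later steps
  remain whole; \<open>max (p k) s\<close> covers the three cases at once. What is left consists of
  increments after s with weights known at their left ends. Stopping at r changes nothing and only
  gives both sums the same form.\<close>

lemma stopped_difference:
  assumes s: "0 \<le> s" "s \<le> r" "r \<le> T" and A: "A \<in> sets (F s)" and p: "wpart r p n"
  shows "(\<integral>\<omega>. indicator A \<omega> * (isum (\<lambda>k. min (p k) r) n (\<lambda>k \<omega>. \<phi>' (X \<omega> (min (p k) r))) \<omega>
      - isum (\<lambda>k. min (p k) s) n (\<lambda>k \<omega>. \<phi>' (X \<omega> (min (p k) s))) \<omega>) \<partial>M) = 0"
proof -
  note pf = wpart_mono[OF p] wpart_nonneg[OF p] wpart_le[OF p] wpart_bound[OF p s(3)]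
  have eq: "isum (\<lambda>k. min (p k) r) n (\<lambda>k \<omega>. \<phi>' (X \<omega> (min (p k) r))) \<omega>
      - isum (\<lambda>k. min (p k) s) n (\<lambda>k \<omega>. \<phi>' (X \<omega> (min (p k) s))) \<omega>
    = (\<Sum>k<n. \<phi>' (X \<omega> (p k)) * (X \<omega> (max (p (Suc k)) s) - X \<omega> (max (p k) s)))" for \<omega>
    unfolding isum_def sum_subtractf[symmetric]
  proof (rule sum.cong[OF refl])
    fix k assume "k \<in> {..<n}"
    then have "p k \<le> p (Suc k)" "p (Suc k) \<le> r" "p k \<le> r" using pf(1)[of k "Suc k"] pf(3)[of k] pf(3)[of "Suc k"] by auto
    then show "\<phi>' (X \<omega> (min (p k) r)) * (X \<omega> (min (p (Suc k)) r) - X \<omega> (min (p k) r))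
       - \<phi>' (X \<omega> (min (p k) s)) * (X \<omega> (min (p (Suc k)) s) - X \<omega> (min (p k) s))
      = \<phi>' (X \<omega> (p k)) * (X \<omega> (max (p (Suc k)) s) - X \<omega> (max (p k) s))"
      by (cases "p (Suc k) \<le> s"; cases "p k \<le> s") (auto simp: min_def max_def algebra_simps)
  qed
  have summand: "integrable M (\<lambda>\<omega>. (indicator A \<omega> * \<phi>' (X \<omega> (p k))) * (X \<omega> (max (p (Suc k)) s) - X \<omega> (max (p k) s)))"
     "(\<integral>\<omega>. (indicator A \<omega> * \<phi>' (X \<omega> (p k))) * (X \<omega> (max (p (Suc k)) s) - X \<omega> (max (p k) s)) \<partial>M) = 0"
    if k: "k < n" for k
  proof -
    let ?c = "max (p k) s"
    have c: "0 \<le> ?c" "?c \<le> max (p (Suc k)) s" "max (p (Suc k)) s \<le> T" "?c \<le> T" "p k \<le> ?c" "0 \<le> p k"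
      using pf(1)[of k "Suc k"] pf(2,4)[of k] pf(4)[of "Suc k"] k s by auto
    have [measurable]: "(\<lambda>\<omega>. X \<omega> (p k)) \<in> borel_measurable (F ?c)"
      by (rule adapted_mono[OF X_ad]) (use c pf(4)[of k] k in auto)
    have [measurable]: "A \<in> sets (F ?c)" using A F_mono[of s ?c] s c by auto
    have Wm: "(\<lambda>\<omega>. indicator A \<omega> * \<phi>' (X \<omega> (p k))) \<in> borel_measurable (F ?c)" by measurable
    have Wsq: "integrable M (\<lambda>\<omega>. (indicator A \<omega> * \<phi>' (X \<omega> (p k)))^2)"
    proof (rule integrable_const_bound[where B="C^2"])
      show "(\<lambda>\<omega>. (indicator A \<omega> * \<phi>' (X \<omega> (p k)))^2) \<in> borel_measurable M"
        using adapted_M[OF Wm c(1,4)] by measurable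
      show "AE \<omega> in M. norm ((indicator A \<omega> * \<phi>' (X \<omega> (p k)))^2) \<le> C^2"
        using power_mono[OF b1 abs_ge_zero, of _ 2] by (auto simp: indicator_def)
    qed
    show "integrable M (\<lambda>\<omega>. (indicator A \<omega> * \<phi>' (X \<omega> (p k))) * (X \<omega> (max (p (Suc k)) s) - X \<omega> (max (p k) s)))"
     "(\<integral>\<omega>. (indicator A \<omega> * \<phi>' (X \<omega> (p k))) * (X \<omega> (max (p (Suc k)) s) - X \<omega> (max (p k) s)) \<partial>M) = 0"
      by (rule orth_increment[OF Wm Wsq c(1,2,3)])+
  qed
  show ?thesis
    unfolding eq sum_distrib_left mult.assoc[symmetric]
    by (subst Bochner_Integration.integral_sum) (use summand in auto)
qed

text \<open>The martingale property is not visible in the explicit expression. It is inherited from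
  the approximating sums, whose integrals over an event of \<open>F s\<close> agree at the times s
  and r and converge in L1.\<close>

lemma ito_int_mart: "mart M F T ito_int"
proof (rule martI)
  fix s r A assume sr: "0 \<le> s" "s \<le> r" "r \<le> T" and A: "A \<in> sets (F s)"
  show "(\<integral>\<omega>. indicator A \<omega> * ito_int \<omega> r \<partial>M) = (\<integral>\<omega>. indicator A \<omega> * ito_int \<omega> s \<partial>M)"
  proof (cases "r = 0")
    case False
    then have r: "0 < r" "r \<le> T" using sr by auto
    define P where "P = uniform_partition r"
    define N where "N u n = isum (\<lambda>k. min (P n k) u) n (\<lambda>k \<omega>. \<phi>' (X \<omega> (min (P n k) u)))" for u n
    have [measurable]: "A \<in> sets M" using A sub[of s] sr by (auto simp: subalgebra_def)
    have lim: "(\<lambda>n. \<integral>\<omega>. \<bar>N u n \<omega> - ito_int \<omega> u\<bar> \<partial>M) \<longlonglongrightarrow> 0" "1 \<le> n \<Longrightarrow> integrable M (N u n)" if "0 \<le> u" "u \<le> r" for u n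
      unfolding N_def P_def using stopped_limit[OF r that] by blast+
    have iI: "integrable M (\<lambda>\<omega>. ito_int \<omega> u)" if "0 \<le> u" "u \<le> r" for u
      by (rule ito_int_integrable) (use that r in auto)
    have ind: "integrable M (\<lambda>\<omega>. indicator A \<omega> * f \<omega>)" if "integrable M f" for f :: "'a \<Rightarrow> real"
      by (rule integrable_mult_bounded[where C=1]) (use that in \<open>auto simp: indicator_def\<close>)
    have *: "(\<lambda>n. \<integral>\<omega>. indicator A \<omega> * N u n \<omega> \<partial>M) \<longlonglongrightarrow> (\<integral>\<omega>. indicator A \<omega> * ito_int \<omega> u \<partial>M)" if u: "0 \<le> u" "u \<le> r" for u
      by (rule tendsto_integral_indicator) (use lim[OF u] iI[OF u] in auto)
    have "\<forall>\<^sub>F n in sequentially. (\<integral>\<omega>. indicator A \<omega> * N r n \<omega> \<partial>M) = (\<integral>\<omega>. indicator A \<omega> * N s n \<omega> \<partial>M)"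
      using eventually_ge_at_top[of 1]
    proof eventually_elim
      case (elim n)
      have "(\<integral>\<omega>. indicator A \<omega> * (N r n \<omega> - N s n \<omega>) \<partial>M) = 0"
        unfolding N_def P_def
        by (rule stopped_difference[OF sr A]) (intro wpart_part part_uniform r elim)
      then show ?case using ind[OF lim(2)[of r, OF _ _ elim]] ind[OF lim(2)[of s, OF _ _ elim]] sr
        by (simp add: right_diff_distrib)
    qed
    then have "(\<lambda>n. \<integral>\<omega>. indicator A \<omega> * N s n \<omega> \<partial>M) \<longlonglongrightarrow> (\<integral>\<omega>. indicator A \<omega> * ito_int \<omega> r \<partial>M)"
      using *[of r] sr by (simp add: tendsto_cong)
    then show ?thesis using *[of s] sr LIMSEQ_unique by blast
  qed (use sr in simp)
qed (auto intro: ito_int_ad ito_int_integrable)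

lemma ito_int_cmart: "cmart M F T ito_int"
  unfolding cmart_def using ito_int_mart ito_int_square_integrable ito_int_continuous by auto

text \<open>The integrator \<open>X'\<close> is allowed to differ from \<open>X\<close> outside
  [0, T]: the statement concerns the original field, while the calculus runs on a version extended
  to all times.\<close>

lemma ito_is_ito_int:
  assumes X': "\<And>\<omega> s. s \<in> {0..T} \<Longrightarrow> X' \<omega> s = X \<omega> s"
  shows "ito_is M F T (\<lambda>\<omega> s. \<phi>' (X' \<omega> s)) X' ito_int"
  unfolding ito_is_def
proof (intro conjI ballI allI impI)
  fix t and P :: "nat \<Rightarrow> nat \<Rightarrow> real" assume t: "t \<in> {0..T}"
    and P: "(\<forall>n\<ge>1. part 0 t (P n) n) \<and> (\<lambda>n. mesh (P n) n) \<longlonglongrightarrow> 0"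
  \<comment> \<open>Nodes of \<open>part\<close> increase strictly, so the one-step partition rules
    out t = 0, where the requirement is vacuous.\<close>
  have "0 < t" using P[THEN conjunct1, rule_format, of 1] t by (auto simp: part_def)
  interpret ito_formula M F T X a \<phi> \<phi>' \<phi>'' C t P
    by unfold_locales (use \<open>0 < t\<close> t P in \<open>auto intro!: wpart_part\<close>)
  have "\<forall>\<^sub>F n in sequentially. (\<integral>\<omega>. (S n \<omega> - ito_int \<omega> t)^2 \<partial>M)
     = (\<integral>\<omega>. ((\<Sum>k<n. \<phi>' (X' \<omega> (P n k)) * (X' \<omega> (P n (Suc k)) - X' \<omega> (P n k))) - ito_int \<omega> t)^2 \<partial>M)"
    using eventually_ge_at_top[of 1]
  proof eventually_elim
    case (elim n)
    have "X' \<omega> (P n k) = X \<omega> (P n k)" if "k \<le> n" for \<omega> k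
      by (rule X') (use Pf(2,4)[OF elim that] in auto)
    then have "(\<Sum>k<n. \<phi>' (X' \<omega> (P n k)) * (X' \<omega> (P n (Suc k)) - X' \<omega> (P n k))) = S n \<omega>" for \<omega>
      unfolding isum_def by (intro sum.cong) auto
    then show ?case by simp
  qed
  with L2_limit(2) show "(\<lambda>n. \<integral>\<omega>. ((\<Sum>k<n. \<phi>' (X' \<omega> (P n k)) * (X' \<omega> (P n (Suc k)) - X' \<omega> (P n k))) - ito_int \<omega> t)^2 \<partial>M) \<longlonglongrightarrow> 0"
    by (simp add: tendsto_cong)
qed (use ito_int_cmart ito_int_0 in auto)

text \<open>\<open>stoch_int\<close> is a chosen limit about which only the defining property is
  known. The explicit integral shows that the choice is not empty, and uniqueness of L2 limits along
  one partition sequence identifies the two.\<close>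

lemma stoch_int_eq_ito_int:
  assumes X': "\<And>\<omega> s. s \<in> {0..T} \<Longrightarrow> X' \<omega> s = X \<omega> s" and t: "0 < t" "t \<le> T"
  shows "AE \<omega> in M. stoch_int M F T (\<lambda>\<omega> s. \<phi>' (X' \<omega> s)) X' \<omega> t = ito_int \<omega> t"
proof -
  define J where "J = stoch_int M F T (\<lambda>\<omega> s. \<phi>' (X' \<omega> s)) X'"
  have J: "ito_is M F T (\<lambda>\<omega> s. \<phi>' (X' \<omega> s)) X' J"
    unfolding J_def stoch_int_def by (rule someI[where x=ito_int]) (rule ito_is_ito_int[OF X'])
  interpret ito_formula M F T X a \<phi> \<phi>' \<phi>'' C t "uniform_partition t"
    by (rule ito_formula_axioms_uniform[OF t])
  have Jm: "mart M F T J" and Jsq: "integrable M (\<lambda>\<omega>. (J \<omega> t)^2)"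
    using J t by (auto simp: ito_is_def cmart_def)
  have tT: "0 \<le> t" "t \<le> T" using t by auto
  have "\<forall>P :: nat \<Rightarrow> nat \<Rightarrow> real. (\<forall>n\<ge>1. part 0 t (P n) n) \<and> (\<lambda>n. mesh (P n) n) \<longlonglongrightarrow> 0 \<longrightarrow>
        (\<lambda>n. \<integral>\<omega>. ((\<Sum>k<n. \<phi>' (X' \<omega> (P n k)) * (X' \<omega> (P n (Suc k)) - X' \<omega> (P n k))) - J \<omega> t)^2 \<partial>M) \<longlonglongrightarrow> 0"
    using J tT unfolding ito_is_def by simp
  from this[rule_format, of "uniform_partition t"]
  have limJ: "(\<lambda>n. \<integral>\<omega>. ((\<Sum>k<n. \<phi>' (X' \<omega> (uniform_partition t n k)) * (X' \<omega> (uniform_partition t n (Suc k)) - X' \<omega> (uniform_partition t n k))) - J \<omega> t)^2 \<partial>M) \<longlonglongrightarrow> 0"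
    using part_uniform[OF t(1)] mesh_uniform[OF t(1)] by blast
  have "\<forall>\<^sub>F n in sequentially. (\<integral>\<omega>. (S n \<omega> - J \<omega> t)^2 \<partial>M)
     = (\<integral>\<omega>. ((\<Sum>k<n. \<phi>' (X' \<omega> (uniform_partition t n k)) * (X' \<omega> (uniform_partition t n (Suc k)) - X' \<omega> (uniform_partition t n k))) - J \<omega> t)^2 \<partial>M)"
    using eventually_ge_at_top[of 1]
  proof eventually_elim
    case (elim n)
    have "X' \<omega> (uniform_partition t n k) = X \<omega> (uniform_partition t n k)" if "k \<le> n" for \<omega> k
      by (rule X') (use Pf(2,4)[OF elim that] in auto)
    then have "(\<Sum>k<n. \<phi>' (X' \<omega> (uniform_partition t n k)) * (X' \<omega> (uniform_partition t n (Suc k)) - X' \<omega> (uniform_partition t n k))) = S n \<omega>" for \<omega>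
      unfolding isum_def by (intro sum.cong) auto
    then show ?case by simp
  qed
  with limJ have limJ': "(\<lambda>n. \<integral>\<omega>. (S n \<omega> - J \<omega> t)^2 \<partial>M) \<longlonglongrightarrow> 0" by (simp add: tendsto_cong)
  have JM: "(\<lambda>\<omega>. J \<omega> t) \<in> borel_measurable M" by (rule adapted_M[OF mart_adapted[OF Jm tT] tT])
  show ?thesis unfolding J_def[symmetric]
    by (rule L2_limit_unique[OF _ JM ito_int_M[OF tT] _ Jsq ito_int_sq limJ' L2_limit(2)])
      (use isum_M[OF simple] isum_sq[OF simple] in auto)
qed

end

section \<open>Joint measurability of the flow\<close>

text \<open>Projection onto [0, b] for b \<ge> 0. Clipping the arguments extends the field from
  [0,1] x [0,T] to all real arguments, so that measurability can be stated on full product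
  spaces.\<close>

definition clip :: "real \<Rightarrow> real \<Rightarrow> real" where
  "clip b x = max 0 (min b x)"

lemma clip_in: "0 \<le> b \<Longrightarrow> clip b x \<in> {0..b}"
  by (auto simp: clip_def)

lemma clip_bounds[simp]: "0 \<le> clip b x" "0 \<le> b \<Longrightarrow> clip b x \<le> b"
  by (auto simp: clip_def)

lemma clip_id: "0 \<le> x \<Longrightarrow> x \<le> b \<Longrightarrow> clip b x = x"
  by (auto simp: clip_def)

lemma clip_min: "0 \<le> t \<Longrightarrow> t \<le> T \<Longrightarrow> clip T (min s t) = clip t s"
  by (auto simp: clip_def)

lemma clip_clip: "0 \<le> b \<Longrightarrow> clip b (clip (clip b s) q) = clip (clip b s) q"
  by (auto simp: clip_def)

lemma clip_meas[measurable]: "clip b \<in> borel_measurable borel"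
  unfolding clip_def by measurable

lemma clip_meas2[measurable (raw)]: 
  assumes [measurable]: "f \<in> borel_measurable M" "g \<in> borel_measurable M"
  shows "(\<lambda>x. clip (f x) (g x)) \<in> borel_measurable M"
  unfolding clip_def by (intro borel_measurable_max) measurable

lemma continuous_on_clip: "continuous_on UNIV (clip b)"
  unfolding clip_def by (intro continuous_intros)

lemma clip_dist: "\<bar>clip b x - clip b y\<bar> \<le> \<bar>x - y\<bar>"
  by (auto simp: clip_def max_def min_def)

text \<open>The flow observed up to time t, over a space \<open>N\<close> that stands for the
  information available. With \<open>N\<close> taken as the filtration at time t the results give
  progressive measurability, and with t = T joint measurability.\<close>

locale flow_paths =
  fixes N :: "'a measure" and y :: "'a \<Rightarrow> real \<Rightarrow> real \<Rightarrow> real" and t :: real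
  assumes t_nonneg: "0 \<le> t"
    and y_meas: "u \<in> {0..1} \<Longrightarrow> s \<in> {0..t} \<Longrightarrow> (\<lambda>\<omega>. y \<omega> u s) \<in> borel_measurable N"
    and y_cont: "\<omega> \<in> space N \<Longrightarrow> u \<in> {0..1} \<Longrightarrow> continuous_on {0..t} (y \<omega> u)"
    and y_rc: "\<omega> \<in> space N \<Longrightarrow> u \<in> {0..<1} \<Longrightarrow> 0 < e \<Longrightarrow>
      \<exists>d>0. \<forall>v\<in>{0..1}. u \<le> v \<and> v < u + d \<longrightarrow> (\<forall>s\<in>{0..t}. \<bar>y \<omega> v s - y \<omega> u s\<bar> < e)"
begin

text \<open>Grid points for u are taken from above by the ceiling, since the paths are
  right-continuous in u; for s the side is irrelevant by continuity. Both limits combine because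
  right-continuity is uniform in time.\<close>

lemma approximation:
  assumes \<omega>: "\<omega> \<in> space N" and u: "u \<in> {0..1}" and s: "s \<in> {0..t}"
  shows "(\<lambda>n. y \<omega> (clip 1 (real_of_int \<lceil>real (Suc n) * u\<rceil> / real (Suc n)))
                (clip t (real_of_int \<lfloor>real (Suc n) * s\<rfloor> / real (Suc n)))) \<longlonglongrightarrow> y \<omega> u s"
proof -
  define U where "U n = clip 1 (real_of_int \<lceil>real (Suc n) * u\<rceil> / real (Suc n))" for n
  define S where "S n = clip t (real_of_int \<lfloor>real (Suc n) * s\<rfloor> / real (Suc n))" for n
  have inv0: "(\<lambda>n. 1 / real (Suc n)) \<longlonglongrightarrow> 0" using LIMSEQ_inverse_real_of_nat by (simp add: inverse_eq_divide)
  have Sin: "S n \<in> {0..t}" for n unfolding S_def by (rule clip_in[OF t_nonneg])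
  have Uin: "U n \<in> {0..1}" for n unfolding U_def by (rule clip_in) simp
  have Sd: "\<bar>S n - s\<bar> \<le> 1 / real (Suc n)" for n
  proof -
    have "\<bar>S n - clip t s\<bar> \<le> \<bar>real_of_int \<lfloor>real (Suc n) * s\<rfloor> / real (Suc n) - s\<bar>"
      unfolding S_def by (rule clip_dist)
    also have "\<bar>real_of_int \<lfloor>real (Suc n) * s\<rfloor> / real (Suc n) - s\<bar> = \<bar>real_of_int \<lfloor>real (Suc n) * s\<rfloor> - real (Suc n) * s\<bar> / real (Suc n)"
    proof -
      have "real_of_int \<lfloor>real (Suc n) * s\<rfloor> / real (Suc n) - s = (real_of_int \<lfloor>real (Suc n) * s\<rfloor> - real (Suc n) * s) / real (Suc n)"
        by (simp add: diff_divide_distrib del: of_nat_Suc)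
      then show ?thesis by (simp only: abs_divide abs_of_nat)
    qed
    also have "\<dots> \<le> 1 / real (Suc n)"
      by (rule divide_right_mono) (linarith, simp)
    finally show ?thesis using s by (simp add: clip_id)
  qed
  have Ud: "u \<le> U n" "U n - u \<le> 1 / real (Suc n)" for n
  proof -
    let ?z = "real_of_int \<lceil>real (Suc n) * u\<rceil> / real (Suc n)"
    have z1: "u \<le> ?z" by (simp add: le_divide_eq mult.commute del: of_nat_Suc)
    have "real_of_int \<lceil>real (Suc n) * u\<rceil> \<le> real (Suc n) * u + 1" by linarith
    then have "?z \<le> (real (Suc n) * u + 1) / real (Suc n)" by (rule divide_right_mono) simp
    also have "\<dots> = u + 1 / real (Suc n)" by (simp add: add_divide_distrib del: of_nat_Suc)
    finally have z2: "?z \<le> u + 1 / real (Suc n)" .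
    show "u \<le> U n" using z1 u unfolding U_def clip_def by auto
    show "U n - u \<le> 1 / real (Suc n)" using z2 z1 u unfolding U_def clip_def by auto
  qed
  have SL: "S \<longlonglongrightarrow> s"
    by (rule LIM_zero_cancel, rule tendsto_rabs_zero_cancel, rule tendsto_sandwich[OF _ _ tendsto_const inv0])
       (use Sd in auto)
  have "(\<lambda>n. y \<omega> u (S n)) \<longlonglongrightarrow> y \<omega> u s"
    by (rule continuous_on_tendsto_compose[OF y_cont[OF \<omega> u] SL s]) (use Sin in simp)
  moreover have "(\<lambda>n. y \<omega> (U n) (S n) - y \<omega> u (S n)) \<longlonglongrightarrow> 0"
  \<comment> \<open>At the right end no points from above exist; clipping makes the approximants
    equal to 1 there.\<close>
  proof (cases "u = 1")
    case True
    then have "U n = u" for n using Ud(1)[of n] Uin[of n] by simp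
    then show ?thesis by simp
  next
    case False
    show ?thesis
    proof (rule LIMSEQ_I)
      fix e :: real assume "0 < e"
      with y_rc[OF \<omega>, of u e] False u obtain d where d: "0 < d"
        "\<And>v s. v \<in> {0..1} \<Longrightarrow> u \<le> v \<Longrightarrow> v < u + d \<Longrightarrow> s \<in> {0..t} \<Longrightarrow> \<bar>y \<omega> v s - y \<omega> u s\<bar> < e"
        by auto
      from order_tendstoD(2)[OF inv0 d(1)]
      have "\<forall>\<^sub>F n in sequentially. norm (y \<omega> (U n) (S n) - y \<omega> u (S n) - 0) < e"
      proof eventually_elim
        case (elim n)
        then have "U n < u + d" using Ud(2)[of n] by linarith
        from d(2)[OF Uin Ud(1) this Sin] show ?case by simp
      qed
      then show "\<exists>no. \<forall>n\<ge>no. norm (y \<omega> (U n) (S n) - y \<omega> u (S n) - 0) < e"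
        by (simp add: eventually_sequentially)
    qed
  qed
  ultimately have "(\<lambda>n. (y \<omega> (U n) (S n) - y \<omega> u (S n)) + y \<omega> u (S n)) \<longlonglongrightarrow> 0 + y \<omega> u s"
    by (intro tendsto_add)
  then show ?thesis unfolding U_def S_def by simp
qed

text \<open>The approximants take countably many grid values, each giving a measurable coordinate.
  The arguments are measurable maps on an arbitrary space, which covers sections, products with time
  and products with the starting point.\<close>

lemma joint_measurable:
  assumes [measurable]: "f \<in> measurable K N" "g \<in> borel_measurable K" "h \<in> borel_measurable K"
  shows "(\<lambda>x. y (f x) (clip 1 (g x)) (clip t (h x))) \<in> borel_measurable K"
proof (rule borel_measurable_LIMSEQ_real)
  fix x assume "x \<in> space K"
  then have "f x \<in> space N" using measurable_space[OF assms(1)] by simp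
  then show "(\<lambda>n. y (f x) (clip 1 (real_of_int \<lceil>real (Suc n) * clip 1 (g x)\<rceil> / real (Suc n)))
                (clip t (real_of_int \<lfloor>real (Suc n) * clip t (h x)\<rfloor> / real (Suc n)))) \<longlonglongrightarrow> y (f x) (clip 1 (g x)) (clip t (h x))"
    by (rule approximation) (auto simp: t_nonneg)
next
  fix n :: nat
  have *: "(\<lambda>x. y (f x) (clip 1 (real_of_int k / real (Suc n))) (clip t (real_of_int j / real (Suc n)))) \<in> borel_measurable K" for j k :: int
    by (rule measurable_compose[OF assms(1) y_meas]) (auto simp: t_nonneg)
  have "(\<lambda>x. y (f x) (clip 1 (real_of_int \<lceil>real (Suc n) * clip 1 (g x)\<rceil> / real (Suc n))) (clip t (real_of_int j / real (Suc n)))) \<in> borel_measurable K" for j :: int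
    by (rule measurable_compose_countable[where f="\<lambda>k x. y (f x) (clip 1 (real_of_int k / real (Suc n))) (clip t (real_of_int j / real (Suc n)))", OF *]) measurable
  then show "(\<lambda>x. y (f x) (clip 1 (real_of_int \<lceil>real (Suc n) * clip 1 (g x)\<rceil> / real (Suc n)))
                (clip t (real_of_int \<lfloor>real (Suc n) * clip t (h x)\<rfloor> / real (Suc n)))) \<in> borel_measurable K"
    by (rule measurable_compose_countable[where f="\<lambda>j x. y (f x) (clip 1 (real_of_int \<lceil>real (Suc n) * clip 1 (g x)\<rceil> / real (Suc n))) (clip t (real_of_int j / real (Suc n)))"]) measurable
qed

text \<open>The distance of two paths is continuous and attains its minimum on [0, \<tau>], so a
  meeting is the same as arbitrarily small distances at a countable dense set of times. Clipped
  rationals are dense in [0, \<tau>] also when \<tau> varies with the sample point.\<close>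

lemma meet_iff:
  assumes \<omega>: "\<omega> \<in> space N" and u: "u \<in> {0..1}" "v \<in> {0..1}" and \<tau>: "\<tau> \<in> {0..t}"
  shows "(\<exists>r\<in>{0..\<tau>}. y \<omega> v r = y \<omega> u r) \<longleftrightarrow>
    (\<forall>n::nat. \<exists>q::rat. \<bar>y \<omega> v (clip \<tau> (of_rat q)) - y \<omega> u (clip \<tau> (of_rat q))\<bar> < 1 / real (Suc n))"
proof -
  define g where "g r = \<bar>y \<omega> v r - y \<omega> u r\<bar>" for r
  have g: "continuous_on {0..\<tau>} g"
    unfolding g_def by (intro continuous_intros continuous_on_subset[OF y_cont[OF \<omega>]]) (use u \<tau> in auto)
  have gc: "continuous_on UNIV (\<lambda>q. g (clip \<tau> q))"
    by (rule continuous_on_compose2[OF g continuous_on_clip]) (use \<tau> clip_in[of \<tau>] in auto)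
  have "(\<exists>r\<in>{0..\<tau>}. g r = 0) \<longleftrightarrow> (\<forall>n::nat. \<exists>q::rat. g (clip \<tau> (of_rat q)) < 1 / real (Suc n))"
  proof
    assume "\<exists>r\<in>{0..\<tau>}. g r = 0"
    then obtain r where r: "r \<in> {0..\<tau>}" "g r = 0" by blast
    show "\<forall>n::nat. \<exists>q::rat. g (clip \<tau> (of_rat q)) < 1 / real (Suc n)"
    proof
      fix n :: nat
      have "open ((\<lambda>q. g (clip \<tau> q)) -` {..<1 / real (Suc n)})"
        by (rule open_vimage[OF _ gc]) simp
      moreover have "r \<in> (\<lambda>q. g (clip \<tau> q)) -` {..<1 / real (Suc n)}" using r by (simp add: clip_id)
      ultimately obtain e where e: "0 < e" "\<And>q. dist q r < e \<Longrightarrow> g (clip \<tau> q) < 1 / real (Suc n)"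
        unfolding open_dist by force
      obtain q :: rat where "r < of_rat q" "of_rat q < r + e"
        using of_rat_dense[of r "r + e"] e by auto
      then show "\<exists>q::rat. g (clip \<tau> (of_rat q)) < 1 / real (Suc n)"
        using e(2)[of "of_rat q"] by (auto simp: dist_real_def)
    qed
  next
    assume R: "\<forall>n::nat. \<exists>q::rat. g (clip \<tau> (of_rat q)) < 1 / real (Suc n)"
    have "{0..\<tau>} \<noteq> {}" using \<tau> by auto
    then obtain r where r: "r \<in> {0..\<tau>}" "\<And>x. x \<in> {0..\<tau>} \<Longrightarrow> g r \<le> g x"
      using continuous_attains_inf[OF compact_Icc _ g] by blast
    have "g r < 1 / real (Suc n)" for n
    proof -
      obtain q :: rat where "g (clip \<tau> (of_rat q)) < 1 / real (Suc n)" using R by blast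
      moreover have "g r \<le> g (clip \<tau> (of_rat q))" by (rule r(2)) (use \<tau> in auto)
      ultimately show ?thesis by linarith
    qed
    then have "g r \<le> 0"
      using LIMSEQ_inverse_real_of_nat
      by (intro LIMSEQ_le_const[OF LIMSEQ_inverse_real_of_nat]) (auto simp: inverse_eq_divide less_imp_le)
    then have "g r = 0" by (simp add: g_def)
    with r show "\<exists>r\<in>{0..\<tau>}. g r = 0" by blast
  qed
  then show ?thesis by (simp add: g_def)
qed

text \<open>By \<open>meet_iff\<close> the set of particles that have met the given one is a section
  of a measurable set in a product space, and the measure of sections is measurable.\<close>

lemma mfun_measurable:
  assumes [measurable]: "f \<in> measurable K N" "g \<in> borel_measurable K" "h \<in> borel_measurable K"
  shows "(\<lambda>x. mfun y (f x) (clip 1 (g x)) (clip t (h x))) \<in> borel_measurable K"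
proof -
  \<comment> \<open>The outer clipping to t is inert, since the inner one already lands below t; it
    only puts the expression into the form of \<open>joint_measurable\<close>.\<close>
  define Q where "Q x v \<longleftrightarrow> v \<in> {0..1} \<and> (\<forall>n::nat. \<exists>q::rat. \<bar>y (f x) (clip 1 v) (clip t (clip (clip t (h x)) (of_rat q)))
     - y (f x) (clip 1 (g x)) (clip t (clip (clip t (h x)) (of_rat q)))\<bar> < 1 / real (Suc n))" for x v
  have [measurable]: "(\<lambda>z. y (f (fst z)) (clip 1 (snd z)) (clip t (clip (clip t (h (fst z))) (of_rat q)))) \<in> borel_measurable (K \<Otimes>\<^sub>M lborel)"
    "(\<lambda>z. y (f (fst z)) (clip 1 (g (fst z))) (clip t (clip (clip t (h (fst z))) (of_rat q)))) \<in> borel_measurable (K \<Otimes>\<^sub>M lborel)" for q :: rat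
    by (rule joint_measurable; measurable)+
  have Qm: "{z \<in> space (K \<Otimes>\<^sub>M lborel). Q (fst z) (snd z)} \<in> sets (K \<Otimes>\<^sub>M lborel)"
    unfolding Q_def by measurable
  have eq: "mfun y (f x) (clip 1 (g x)) (clip t (h x)) = enn2real (emeasure lborel (Pair x -` {z \<in> space (K \<Otimes>\<^sub>M lborel). Q (fst z) (snd z)}))"
    if x: "x \<in> space K" for x
  proof -
    have fx: "f x \<in> space N" using measurable_space[OF assms(1)] x by simp
    have set: "{v \<in> {0..1}. \<exists>s\<in>{0..clip t (h x)}. y (f x) v s = y (f x) (clip 1 (g x)) s} = Pair x -` {z \<in> space (K \<Otimes>\<^sub>M lborel). Q (fst z) (snd z)}"
      (is "?L = ?R")
    proof (rule set_eqI)
      fix v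
      show "v \<in> ?L \<longleftrightarrow> v \<in> ?R"
      proof (cases "v \<in> {0..1}")
        case True
        have "(\<exists>s\<in>{0..clip t (h x)}. y (f x) v s = y (f x) (clip 1 (g x)) s) \<longleftrightarrow> Q x v"
          unfolding Q_def using True meet_iff[OF fx _ True, of "clip 1 (g x)" "clip t (h x)"]
          by (simp add: clip_in t_nonneg clip_bounds clip_clip clip_id)
        then show ?thesis using True x by (simp add: space_pair_measure)
      next
        case False
        then show ?thesis by (auto simp: Q_def)
      qed
    qed
    have "?R \<in> sets lborel" by (rule sets_Pair1[OF Qm])
    \<comment> \<open>The section is a Borel set, so the completed measure in \<open>mfun\<close>
      may be replaced by \<open>lborel\<close>.\<close>
    then have "measure lebesgue ?R = measure lborel ?R" by (rule measure_completion)
    then show ?thesis unfolding mfun_def set by (simp add: measure_def)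
  qed
  have "(\<lambda>x. enn2real (emeasure lborel (Pair x -` {z \<in> space (K \<Otimes>\<^sub>M lborel). Q (fst z) (snd z)}))) \<in> borel_measurable K"
    using lborel.measurable_emeasure_Pair[OF Qm] by measurable
  then show ?thesis using eq by (simp cong: measurable_cong)
qed

end

section \<open>One-particle motions of the flow\<close>

lemma mart_cong:
  assumes "\<And>\<omega> t. t \<in> {0..T} \<Longrightarrow> X \<omega> t = Y \<omega> t"
  shows "mart M F T X \<longleftrightarrow> mart M F T Y"
proof -
  have e: "(\<lambda>\<omega>. X \<omega> t) = (\<lambda>\<omega>. Y \<omega> t)" if "0 \<le> t" "t \<le> T" for t using assms that by auto
  have "(AE \<omega> in M. real_cond_exp M (F s) (\<lambda>\<omega>. X \<omega> t) \<omega> = X \<omega> s) \<longleftrightarrow> (AE \<omega> in M. real_cond_exp M (F s) (\<lambda>\<omega>. Y \<omega> t) \<omega> = Y \<omega> s)"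
    if "0 \<le> s \<and> s \<le> t \<and> t \<le> T" for s t
    using e[of t] assms[of s] that by simp
  moreover have "(\<forall>t\<in>{0..T}. integrable M (\<lambda>\<omega>. X \<omega> t) \<and> (\<lambda>\<omega>. X \<omega> t) \<in> borel_measurable (F t))
      \<longleftrightarrow> (\<forall>t\<in>{0..T}. integrable M (\<lambda>\<omega>. Y \<omega> t) \<and> (\<lambda>\<omega>. Y \<omega> t) \<in> borel_measurable (F t))"
    using e by auto
  ultimately show ?thesis unfolding mart_def by blast
qed

text \<open>Null sets need not belong to \<open>F t\<close>, so an almost sure modification does not
  inherit adaptedness; it is required separately.\<close>

lemma (in filtered_prob_space) mart_cong_AE:
  assumes N: "mart M F T N" and ae: "\<And>t. 0 \<le> t \<Longrightarrow> t \<le> T \<Longrightarrow> AE \<omega> in M. N \<omega> t = L \<omega> t"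
    and ad: "\<And>t. 0 \<le> t \<Longrightarrow> t \<le> T \<Longrightarrow> (\<lambda>\<omega>. L \<omega> t) \<in> borel_measurable (F t)"
  shows "mart M F T L"
proof (rule martI)
  show "(\<lambda>\<omega>. L \<omega> t) \<in> borel_measurable (F t)" if "0 \<le> t" "t \<le> T" for t by (rule ad[OF that])
  have NM: "(\<lambda>\<omega>. N \<omega> t) \<in> borel_measurable M" and LM: "(\<lambda>\<omega>. L \<omega> t) \<in> borel_measurable M" if "0 \<le> t" "t \<le> T" for t
    using adapted_M[OF mart_adapted[OF N that] that] adapted_M[OF ad[OF that] that] by auto
  show "integrable M (\<lambda>\<omega>. L \<omega> t)" if "0 \<le> t" "t \<le> T" for t
    using mart_integrable[OF N that] integrable_cong_AE[OF NM[OF that] LM[OF that] ae[OF that]] by simp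
  fix s t A assume st: "0 \<le> s" "s \<le> t" "t \<le> T" and A: "A \<in> sets (F s)"
  have [measurable]: "A \<in> sets M" using A sub[of s] st by (auto simp: subalgebra_def)
  have "(\<integral>\<omega>. indicator A \<omega> * L \<omega> r \<partial>M) = (\<integral>\<omega>. indicator A \<omega> * N \<omega> r \<partial>M)" if r: "0 \<le> r" "r \<le> T" for r
    by (rule integral_cong_AE) (use NM[OF r] LM[OF r] ae[OF r] in auto)
  then show "(\<integral>\<omega>. indicator A \<omega> * L \<omega> t \<partial>M) = (\<integral>\<omega>. indicator A \<omega> * L \<omega> s \<partial>M)"
    using mart_indicator[OF N st A] st by simp
qed

lemma mfun_bounds: "0 \<le> mfun y \<omega> u s" "mfun y \<omega> u s \<le> 1"
proof -
  show "0 \<le> mfun y \<omega> u s" by (simp add: mfun_def)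
  let ?S = "{v \<in> {0..1}. \<exists>r\<in>{0..s}. y \<omega> v r = y \<omega> u r}"
  show "mfun y \<omega> u s \<le> 1"
  \<comment> \<open>A set that is not Lebesgue measurable has measure 0 by convention, so the bound
    holds in either case.\<close>
  proof (cases "?S \<in> sets lebesgue")
    case True
    have "measure lebesgue ?S \<le> measure lebesgue {0..1::real}"
      by (rule measure_mono_fmeasurable) (use True in auto)
    then show ?thesis by (simp add: mfun_def)
  qed (simp add: mfun_def measure_notin_sets)
qed

locale coalescing_flow = prob_space M for M :: "'a measure" +
  fixes T :: real and y :: "'a \<Rightarrow> real \<Rightarrow> real \<Rightarrow> real"
  assumes T_pos: "0 < T" and rD: "random_D M T y"
    and C1: "u \<in> {0..1} \<Longrightarrow> cmart M (filt M y) T (\<lambda>\<omega> t. y \<omega> u t)"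
    and C2: "\<omega> \<in> space M \<Longrightarrow> u \<in> {0..1} \<Longrightarrow> y \<omega> u 0 = u"
    and C3: "\<omega> \<in> space M \<Longrightarrow> u \<in> {0..1} \<Longrightarrow> v \<in> {0..1} \<Longrightarrow> t \<in> {0..T} \<Longrightarrow> u < v \<Longrightarrow> y \<omega> u t \<le> y \<omega> v t"
    and C4: "u \<in> {0..1} \<Longrightarrow> \<exists>A. is_covariation M (filt M y) T (\<lambda>\<omega> t. y \<omega> u t) (\<lambda>\<omega> t. y \<omega> u t) A \<and>
               (AE \<omega> in M. \<forall>t\<in>{0..T}. ennreal (A \<omega> t) = (\<integral>\<^sup>+ s\<in>{0..t}. inverse (ennreal (mfun y \<omega> u s)) \<partial>lborel))"
begin

abbreviation F where "F \<equiv> filt M y"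

text \<open>The flow extended to all real arguments by clipping. The parameter u comes first, so
  that \<open>X u\<close> is a process to which the one-particle calculus applies.\<close>

definition X :: "real \<Rightarrow> 'a \<Rightarrow> real \<Rightarrow> real" where
  "X u \<omega> s = y \<omega> (clip 1 u) (clip T s)"

text \<open>The real inverse is 0 where \<open>mfun\<close> vanishes, whereas (C4) has the value
  \<infinity> there. That the two agree for almost all times follows from finiteness of the bracket,
  in \<open>clock_identity\<close>.\<close>

definition rate :: "real \<Rightarrow> 'a \<Rightarrow> real \<Rightarrow> real" where
  "rate u \<omega> s = inverse (mfun y \<omega> (clip 1 u) (clip T s))"

lemma X_eq: "u \<in> {0..1} \<Longrightarrow> s \<in> {0..T} \<Longrightarrow> X u \<omega> s = y \<omega> u s"
  by (simp add: X_def clip_id)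

lemma rate_eq: "u \<in> {0..1} \<Longrightarrow> s \<in> {0..T} \<Longrightarrow> rate u \<omega> s = inverse (mfun y \<omega> u s)"
  by (simp add: rate_def clip_id)

lemma space_filt: "space (F t) = space M"
  unfolding filt_def by (rule space_measure_of) auto

lemma sets_filt: "sets (F t) = sigma_sets (space M)
     {(\<lambda>\<omega>. y \<omega> u s) -` A \<inter> space M | u s A. u \<in> {0..1} \<and> s \<in> {0..t} \<and> A \<in> sets borel}"
  unfolding filt_def by (rule sets_measure_of) auto

lemma y_M: "u \<in> {0..1} \<Longrightarrow> s \<in> {0..T} \<Longrightarrow> (\<lambda>\<omega>. y \<omega> u s) \<in> borel_measurable M"
  using rD by (auto simp: random_D_def)

lemma sub_filt: "t \<in> {0..T} \<Longrightarrow> subalgebra M (F t)"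
  unfolding subalgebra_def space_filt sets_filt
  by (auto intro!: sets.sigma_sets_subset measurable_sets[OF y_M])

lemma y_F:
  assumes "u \<in> {0..1}" "s \<in> {0..t}"
  shows "(\<lambda>\<omega>. y \<omega> u s) \<in> borel_measurable (F t)"
proof (rule measurableI)
  fix A :: "real set" assume "A \<in> sets borel"
  then show "(\<lambda>\<omega>. y \<omega> u s) -` A \<inter> space (F t) \<in> sets (F t)"
    unfolding space_filt sets_filt using assms by (intro sigma_sets.Basic) blast
qed simp

lemma F_mono_filt: "s \<le> t \<Longrightarrow> sets (F s) \<subseteq> sets (F t)"
  unfolding sets_filt
proof (rule sigma_sets_mono', rule subsetI)
  fix S assume st: "s \<le> t" and "S \<in> {(\<lambda>\<omega>. y \<omega> u r) -` A \<inter> space M | u r A. u \<in> {0..1} \<and> r \<in> {0..s} \<and> A \<in> sets borel}"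
  then obtain u r A where S: "S = (\<lambda>\<omega>. y \<omega> u r) -` A \<inter> space M" "u \<in> {0..1}" "r \<in> {0..s}" "A \<in> sets borel"
    by blast
  moreover have "r \<in> {0..t}" using S(3) st by simp
  ultimately show "S \<in> {(\<lambda>\<omega>. y \<omega> u r) -` A \<inter> space M | u r A. u \<in> {0..1} \<and> r \<in> {0..t} \<and> A \<in> sets borel}"
    by blast
qed

sublocale filtered_prob_space M F T
  by unfold_locales (use T_pos sub_filt F_mono_filt in auto)

lemma flow: "t \<in> {0..T} \<Longrightarrow> flow_paths (F t) y t"
proof
  assume t: "t \<in> {0..T}"
  then show "0 \<le> t" by simp
  show "(\<lambda>\<omega>. y \<omega> u s) \<in> borel_measurable (F t)" if "u \<in> {0..1}" "s \<in> {0..t}" for u s by (rule y_F[OF that])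
  show "continuous_on {0..t} (y \<omega> u)" if "\<omega> \<in> space (F t)" "u \<in> {0..1}" for \<omega> u
  proof (rule continuous_on_subset)
    show "continuous_on {0..T} (y \<omega> u)" using rD that unfolding random_D_def space_filt by blast
  qed (use t in auto)
  show "\<exists>d>0. \<forall>v\<in>{0..1}. u \<le> v \<and> v < u + d \<longrightarrow> (\<forall>s\<in>{0..t}. \<bar>y \<omega> v s - y \<omega> u s\<bar> < e)"
    if h: "\<omega> \<in> space (F t)" "u \<in> {0..<1}" "0 < e" for \<omega> u e
  proof -
    have "\<exists>d>0. \<forall>v\<in>{0..1}. u \<le> v \<and> v < u + d \<longrightarrow> (\<forall>s\<in>{0..T}. \<bar>y \<omega> v s - y \<omega> u s\<bar> < e)"
      using rD h unfolding random_D_def space_filt by blast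
    then show ?thesis using t by (meson atLeastAtMost_iff order_trans)
  qed
qed

text \<open>All events of \<open>F T\<close> are events of \<open>M\<close>; composing with this map
  transfers measurability over \<open>F T\<close> to \<open>M\<close>.\<close>

lemma measurable_filt_M: "id \<in> measurable M (F T)"
proof (rule measurableI)
  fix A assume A: "A \<in> sets (F T)"
  then have "A \<in> sets M" using sub_filt[of T] T_pos by (auto simp: subalgebra_def)
  moreover have "id -` A \<inter> space M = A" using sets.sets_into_space[OF \<open>A \<in> sets M\<close>] by auto
  ultimately show "id -` A \<inter> space M \<in> sets M" by simp
qed (simp add: space_filt)

lemma X_joint:
  assumes f: "f \<in> measurable K M" and [measurable]: "g \<in> borel_measurable K" "h \<in> borel_measurable K"
  shows "(\<lambda>x. X (g x) (f x) (h x)) \<in> borel_measurable K"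
proof -
  interpret flow_paths "F T" y T by (rule flow) (use T_pos in auto)
  have "f \<in> measurable K (F T)" using measurable_comp[OF f measurable_filt_M] by simp
  then show ?thesis unfolding X_def by (rule joint_measurable) measurable
qed

lemma rate_joint:
  assumes f: "f \<in> measurable K M" and [measurable]: "g \<in> borel_measurable K" "h \<in> borel_measurable K"
  shows "(\<lambda>x. rate (g x) (f x) (h x)) \<in> borel_measurable K"
proof -
  interpret flow_paths "F T" y T by (rule flow) (use T_pos in auto)
  have "f \<in> measurable K (F T)" using measurable_comp[OF f measurable_filt_M] by simp
  then have "(\<lambda>x. mfun y (f x) (clip 1 (g x)) (clip T (h x))) \<in> borel_measurable K" by (rule mfun_measurable) measurable
  then show ?thesis unfolding rate_def by measurable
qed

lemma X_joint_F:
  assumes t: "t \<in> {0..T}" and f: "f \<in> measurable K (F t)" and [measurable]: "g \<in> borel_measurable K" "h \<in> borel_measurable K"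
  shows "(\<lambda>x. X (g x) (f x) (min (h x) t)) \<in> borel_measurable K"
proof -
  interpret flow_paths "F t" y t by (rule flow[OF t])
  have "(\<lambda>x. y (f x) (clip 1 (g x)) (clip t (h x))) \<in> borel_measurable K" by (rule joint_measurable[OF f]) measurable
  then show ?thesis unfolding X_def using t by (simp add: clip_min)
qed

text \<open>\<open>mfun\<close> at time s looks only at the paths on [0, s], so running the
  measurability argument over \<open>F t\<close> in place of \<open>F T\<close> yields progressive
  measurability.\<close>

lemma rate_joint_F:
  assumes t: "t \<in> {0..T}" and f: "f \<in> measurable K (F t)" and [measurable]: "g \<in> borel_measurable K" "h \<in> borel_measurable K"
  shows "(\<lambda>x. rate (g x) (f x) (min (h x) t)) \<in> borel_measurable K"
proof -
  interpret flow_paths "F t" y t by (rule flow[OF t])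
  have "(\<lambda>x. mfun y (f x) (clip 1 (g x)) (clip t (h x))) \<in> borel_measurable K" by (rule mfun_measurable[OF f]) measurable
  then show ?thesis unfolding rate_def using t by (simp add: clip_min)
qed

lemma rate_nonneg: "0 \<le> rate u \<omega> s"
  by (simp add: rate_def mfun_bounds)

lemma X_continuous: "\<omega> \<in> space M \<Longrightarrow> continuous_on {0..T} (X u \<omega>)"
proof -
  assume "\<omega> \<in> space M"
  moreover have "clip 1 u \<in> {0..1}" by (rule clip_in) simp
  ultimately have "continuous_on {0..T} (y \<omega> (clip 1 u))"
    using rD unfolding random_D_def by blast
  then show ?thesis by (rule continuous_on_eq) (simp add: X_def clip_id)
qed

lemma X_martingale: "mart M F T (X u)"
proof -
  have "mart M F T (\<lambda>\<omega> t. y \<omega> (clip 1 u) t)" using C1[of "clip 1 u"] by (simp add: cmart_def clip_in)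
  then show ?thesis by (subst mart_cong[of T "X u" "\<lambda>\<omega> t. y \<omega> (clip 1 u) t"]) (auto simp: X_def clip_id)
qed

lemma X_square_integrable: "t \<in> {0..T} \<Longrightarrow> integrable M (\<lambda>\<omega>. (X u \<omega> t)^2)"
  using C1[of "clip 1 u"] by (simp add: cmart_def clip_in X_def clip_id)

lemma rate_section: "\<omega> \<in> space M \<Longrightarrow> (\<lambda>s. rate u \<omega> s) \<in> borel_measurable lborel"
  by (rule rate_joint) auto

text \<open>Two features of extended reals have to be removed from (C4): the inverse of 0 is
  infinite, and \<open>ennreal\<close> sends negative numbers to 0, so that equality there does not
  determine the sign of \<open>A\<close>.\<close>

lemma clock_identity:
  shows "\<exists>A. is_covariation M F T (\<lambda>\<omega> t. y \<omega> (clip 1 u) t) (\<lambda>\<omega> t. y \<omega> (clip 1 u) t) A \<and>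
    (AE \<omega> in M. \<forall>t\<in>{0..T}. 0 \<le> A \<omega> t \<and> ennreal (A \<omega> t) = (\<integral>\<^sup>+ s. ennreal (indicator {0..t} s * rate u \<omega> s) \<partial>lborel))"
proof -
  define w where "w = clip 1 u"
  have w: "w \<in> {0..1}" unfolding w_def by (rule clip_in) simp
  obtain A where A: "is_covariation M F T (\<lambda>\<omega> t. y \<omega> w t) (\<lambda>\<omega> t. y \<omega> w t) A"
    and ae: "AE \<omega> in M. \<forall>t\<in>{0..T}. ennreal (A \<omega> t) = (\<integral>\<^sup>+ s\<in>{0..t}. inverse (ennreal (mfun y \<omega> w s)) \<partial>lborel)"
    using C4[OF w] by blast
  have A0: "AE \<omega> in M. A \<omega> 0 = 0" using A by (auto simp: is_covariation_def)
  have "AE \<omega> in M. \<forall>t\<in>{0..T}. 0 \<le> A \<omega> t \<and> ennreal (A \<omega> t) = (\<integral>\<^sup>+ s. ennreal (indicator {0..t} s * rate u \<omega> s) \<partial>lborel)"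
    using ae A0 AE_space
  proof eventually_elim
    case (elim \<omega>)
    have rt: "rate u \<omega> s = inverse (mfun y \<omega> w (clip T s))" for s by (simp add: rate_def w_def)
    have [measurable]: "(\<lambda>s. rate u \<omega> s) \<in> borel_measurable lborel" by (rule rate_section[OF elim(3)])
    have [measurable]: "(\<lambda>s. mfun y \<omega> w (clip T s)) \<in> borel_measurable lborel"
    proof -
      have "(\<lambda>s. inverse (rate u \<omega> s)) \<in> borel_measurable lborel" by measurable
      then show ?thesis by (simp add: rt)
    qed
    have eqm: "(\<integral>\<^sup>+ s\<in>{0..t}. inverse (ennreal (mfun y \<omega> w s)) \<partial>lborel) = (\<integral>\<^sup>+ s\<in>{0..t}. inverse (ennreal (mfun y \<omega> w (clip T s))) \<partial>lborel)"
      if "t \<in> {0..T}" for t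
      by (rule nn_integral_cong) (use that in \<open>auto simp: indicator_def clip_id\<close>)
    have TT: "T \<in> {0..T}" using T_pos by simp
    have "(\<integral>\<^sup>+ s\<in>{0..T}. inverse (ennreal (mfun y \<omega> w (clip T s))) \<partial>lborel) \<noteq> \<infinity>"
      using bspec[OF elim(1) TT] eqm[OF TT] by (metis ennreal_neq_top infinity_ennreal_def)
    \<comment> \<open>The left side of (C4) is a finite number, so the integrand is finite and
      \<open>mfun\<close> positive for almost every time.\<close>
    then have "AE s in lborel. inverse (ennreal (mfun y \<omega> w (clip T s))) * indicator {0..T} s \<noteq> \<infinity>"
      by (intro nn_integral_PInf_AE) auto
    then have pos: "AE s in lborel. s \<in> {0..T} \<longrightarrow> 0 < mfun y \<omega> w (clip T s)"
    proof eventually_elim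
      case (elim s)
      show ?case
      proof
        assume "s \<in> {0..T}"
        with elim have "mfun y \<omega> w (clip T s) \<noteq> 0" by (auto simp: indicator_def)
        then show "0 < mfun y \<omega> w (clip T s)" using mfun_bounds(1)[of y \<omega> w "clip T s"] by linarith
      qed
    qed
    show ?case
    proof
      fix t assume t: "t \<in> {0..T}"
      have 1: "ennreal (A \<omega> t) = (\<integral>\<^sup>+ s. ennreal (indicator {0..t} s * rate u \<omega> s) \<partial>lborel)"
      proof -
        have "ennreal (A \<omega> t) = (\<integral>\<^sup>+ s\<in>{0..t}. inverse (ennreal (mfun y \<omega> w (clip T s))) \<partial>lborel)"
          using elim(1) t eqm by simp
        also have "\<dots> = (\<integral>\<^sup>+ s. ennreal (indicator {0..t} s * rate u \<omega> s) \<partial>lborel)"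
        proof (rule nn_integral_cong_AE)
          show "AE s in lborel. inverse (ennreal (mfun y \<omega> w (clip T s))) * indicator {0..t} s = ennreal (indicator {0..t} s * rate u \<omega> s)"
            using pos by eventually_elim (use t in \<open>auto simp: indicator_def rt inverse_ennreal\<close>)
        qed
        finally show ?thesis .
      qed
      have "0 \<le> A \<omega> t"
      proof (cases "t = 0")
        case False
        \<comment> \<open>Since \<open>mfun\<close> is at most 1, the integrand is at least 1 and
          the integral at least t > 0; \<open>ennreal (A \<omega> t)\<close> is therefore positive,
          which excludes a negative \<open>A \<omega> t\<close>.\<close>
        have "ennreal t = (\<integral>\<^sup>+ s. ennreal (indicator {0..t} s * 1) \<partial>lborel)"
          using t by (simp add: ennreal_indicator)
        also have "\<dots> \<le> (\<integral>\<^sup>+ s. ennreal (indicator {0..t} s * rate u \<omega> s) \<partial>lborel)"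
        proof (rule nn_integral_mono_AE)
          show "AE s in lborel. ennreal (indicator {0..t} s * 1) \<le> ennreal (indicator {0..t} s * rate u \<omega> s)"
            using pos
          proof eventually_elim
            case (elim s)
            then show ?case using t mfun_bounds(2)[of y \<omega> w "clip T s"]
              by (intro ennreal_leI) (auto simp: indicator_def rt one_le_inverse)
          qed
        qed
        finally have "ennreal t \<le> ennreal (A \<omega> t)" using 1 by simp
        then show ?thesis using False t by (smt (verit) atLeastAtMost_iff ennreal_le_iff2)
      qed (use elim in simp)
      with 1 show "0 \<le> A \<omega> t \<and> ennreal (A \<omega> t) = (\<integral>\<^sup>+ s. ennreal (indicator {0..t} s * rate u \<omega> s) \<partial>lborel)" by simp
    qed
  qed
  with A show ?thesis unfolding w_def by blast
qed

text \<open>\<open>A\<close> is the difference of the integrable X^2 and a martingale, so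
  \<open>A\<close> at time T has finite mean, and Tonelli's theorem turns this into integrability of
  the density. The explicit integral replaces \<open>A\<close> almost surely at each time, and it is
  adapted by progressive measurability.\<close>

lemma rate_finite:
  shows "integrable (M \<Otimes>\<^sub>M lborel) (\<lambda>(\<omega>, s). indicator {0..T} s * rate u \<omega> s)"
    and "mart M F T (\<lambda>\<omega> t. (X u \<omega> t)^2 - (\<integral>s. indicator {0..t} s * rate u \<omega> s \<partial>lborel))"
proof -
  obtain A where A: "is_covariation M F T (\<lambda>\<omega> t. y \<omega> (clip 1 u) t) (\<lambda>\<omega> t. y \<omega> (clip 1 u) t) A"
    and ae: "AE \<omega> in M. \<forall>t\<in>{0..T}. 0 \<le> A \<omega> t \<and> ennreal (A \<omega> t) = (\<integral>\<^sup>+ s. ennreal (indicator {0..t} s * rate u \<omega> s) \<partial>lborel)"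
    using clock_identity by blast
  have mA: "mart M F T (\<lambda>\<omega> t. y \<omega> (clip 1 u) t * y \<omega> (clip 1 u) t - A \<omega> t)"
    using A by (simp add: is_covariation_def)
  have mA': "mart M F T (\<lambda>\<omega> t. (X u \<omega> t)^2 - A \<omega> t)"
    by (rule mart_cong[THEN iffD1, OF _ mA]) (simp add: X_def clip_id power2_eq_square)
  have TT: "T \<in> {0..T}" "0 \<le> T" using T_pos by auto
  have "integrable M (\<lambda>\<omega>. (X u \<omega> T)^2 - ((X u \<omega> T)^2 - A \<omega> T))"
    by (intro Bochner_Integration.integrable_diff X_square_integrable TT mart_integrable[OF mA']) auto
  then have iA: "integrable M (\<lambda>\<omega>. A \<omega> T)" by simp
  have [measurable]: "(\<lambda>(\<omega>, s). rate u \<omega> s) \<in> borel_measurable (M \<Otimes>\<^sub>M lborel)"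
    unfolding split_beta' by (rule rate_joint) auto
  show "integrable (M \<Otimes>\<^sub>M lborel) (\<lambda>(\<omega>, s). indicator {0..T} s * rate u \<omega> s)"
  proof (rule integrableI_bounded)
    have "(\<integral>\<^sup>+x. ennreal (norm (case x of (\<omega>, s) \<Rightarrow> indicator {0..T} s * rate u \<omega> s)) \<partial>(M \<Otimes>\<^sub>M lborel))
       = (\<integral>\<^sup>+x. (case x of (\<omega>, s) \<Rightarrow> ennreal (indicator {0..T} s * rate u \<omega> s)) \<partial>(M \<Otimes>\<^sub>M lborel))"
      by (intro nn_integral_cong) (auto simp: rate_nonneg)
    also have "\<dots> = (\<integral>\<^sup>+\<omega>. (\<integral>\<^sup>+s. ennreal (indicator {0..T} s * rate u \<omega> s) \<partial>lborel) \<partial>M)"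
      by (subst lborel.nn_integral_fst[symmetric]) auto
    also have "\<dots> = (\<integral>\<^sup>+\<omega>. ennreal (A \<omega> T) \<partial>M)"
      by (rule nn_integral_cong_AE) (use ae TT in auto)
    also have "\<dots> < \<infinity>"
    proof -
      have "(\<integral>\<^sup>+\<omega>. ennreal (A \<omega> T) \<partial>M) \<le> (\<integral>\<^sup>+\<omega>. ennreal (norm (A \<omega> T)) \<partial>M)"
        by (intro nn_integral_mono ennreal_leI) auto
      also have "\<dots> < \<infinity>" using iA unfolding integrable_iff_bounded by simp
      finally show ?thesis .
    qed
    finally show "(\<integral>\<^sup>+x. ennreal (norm (case x of (\<omega>, s) \<Rightarrow> indicator {0..T} s * rate u \<omega> s)) \<partial>(M \<Otimes>\<^sub>M lborel)) < \<infinity>" .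
  qed measurable
  show "mart M F T (\<lambda>\<omega> t. (X u \<omega> t)^2 - (\<integral>s. indicator {0..t} s * rate u \<omega> s \<partial>lborel))"
  proof (rule mart_cong_AE[OF mA'])
    fix t assume t: "0 \<le> t" "t \<le> T"
    show "AE \<omega> in M. (X u \<omega> t)^2 - A \<omega> t = (X u \<omega> t)^2 - (\<integral>s. indicator {0..t} s * rate u \<omega> s \<partial>lborel)"
      using ae AE_space
    proof eventually_elim
      case (elim \<omega>)
      have [measurable]: "(\<lambda>s. rate u \<omega> s) \<in> borel_measurable lborel" by (rule rate_section[OF elim(2)])
      have "(\<integral>s. indicator {0..t} s * rate u \<omega> s \<partial>lborel) = enn2real (\<integral>\<^sup>+s. ennreal (indicator {0..t} s * rate u \<omega> s) \<partial>lborel)"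
        by (rule integral_eq_nn_integral) (auto simp: rate_nonneg)
      also have "\<dots> = A \<omega> t" using elim(1) t by (metis atLeastAtMost_iff enn2real_ennreal)
      finally show ?case by simp
    qed
    have [measurable]: "(\<lambda>\<omega>. X u \<omega> t) \<in> borel_measurable (F t)"
      using mart_adapted[OF X_martingale t] .
    have [measurable]: "(\<lambda>(\<omega>, s). rate u \<omega> (min s t)) \<in> borel_measurable (F t \<Otimes>\<^sub>M lborel)"
      unfolding split_beta' by (rule rate_joint_F) (use t in auto)
    have "(\<lambda>\<omega>. \<integral>s. indicator {0..t} s * rate u \<omega> s \<partial>lborel) = (\<lambda>\<omega>. \<integral>s. indicator {0..t} s * rate u \<omega> (min s t) \<partial>lborel)"
      by (intro ext Bochner_Integration.integral_cong) (auto simp: indicator_def min_def)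
    also have "\<dots> \<in> borel_measurable (F t)" by measurable
    finally have [measurable]: "(\<lambda>\<omega>. \<integral>s. indicator {0..t} s * rate u \<omega> s \<partial>lborel) \<in> borel_measurable (F t)" .
    show "(\<lambda>\<omega>. (X u \<omega> t)^2 - (\<integral>s. indicator {0..t} s * rate u \<omega> s \<partial>lborel)) \<in> borel_measurable (F t)"
      by measurable
  qed
qed

lemma ito_process_X: "ito_process M F T (X u) (rate u)"
proof unfold_locales
  show "(\<lambda>(\<omega>, s). X u \<omega> s) \<in> borel_measurable (M \<Otimes>\<^sub>M lborel)"
    unfolding split_beta' by (rule X_joint) auto
  show "(\<lambda>(\<omega>, s). rate u \<omega> s) \<in> borel_measurable (M \<Otimes>\<^sub>M lborel)"
    unfolding split_beta' by (rule rate_joint) auto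
  show "(\<lambda>(\<omega>, s). X u \<omega> (min s t)) \<in> borel_measurable (F t \<Otimes>\<^sub>M lborel)" if "t \<in> {0..T}" for t
    unfolding split_beta' by (rule X_joint_F[OF that]) auto
  show "(\<lambda>(\<omega>, s). rate u \<omega> (min s t)) \<in> borel_measurable (F t \<Otimes>\<^sub>M lborel)" if "t \<in> {0..T}" for t
    unfolding split_beta' by (rule rate_joint_F[OF that]) auto
qed (use X_continuous rate_nonneg X_martingale X_square_integrable rate_finite in auto)

end

section \<open>Continuity of the stochastic integral in the starting point\<close>

context coalescing_flow
begin

lemma X_clip: "X u \<omega> s = X (clip 1 u) \<omega> s"
  by (simp add: X_def clip_id)

lemma X_mono:
  assumes "\<omega> \<in> space M" "u \<le> v"
  shows "X u \<omega> s \<le> X v \<omega> s"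
proof (cases "clip 1 u = clip 1 v")
  case False
  then have "clip 1 u < clip 1 v" using assms(2) by (auto simp: clip_def max_def min_def split: if_splits)
  then show ?thesis unfolding X_def using T_pos by (intro C3 assms) (auto simp: clip_in)
qed (simp add: X_def)

lemma X_0: "\<omega> \<in> space M \<Longrightarrow> X u \<omega> 0 = clip 1 u"
  using T_pos by (simp add: X_def clip_id C2)

text \<open>Every particle lies between the two extreme ones. This gives dominating functions that
  are uniform in the starting point.\<close>

lemma X_envelope:
  assumes "\<omega> \<in> space M"
  shows "\<bar>X u \<omega> s\<bar> \<le> \<bar>X 0 \<omega> s\<bar> + \<bar>X 1 \<omega> s\<bar>"
proof -
  have "X 0 \<omega> s \<le> X (clip 1 u) \<omega> s" "X (clip 1 u) \<omega> s \<le> X 1 \<omega> s"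
    by (rule X_mono[OF assms]; simp)+
  then show ?thesis using X_clip[of u \<omega> s] by linarith
qed

lemma X_M: "0 \<le> s \<Longrightarrow> s \<le> T \<Longrightarrow> (\<lambda>\<omega>. X u \<omega> s) \<in> borel_measurable M"
  by (rule adapted_M[OF mart_adapted[OF X_martingale]])

lemma X_integrable: "0 \<le> s \<Longrightarrow> s \<le> T \<Longrightarrow> integrable M (\<lambda>\<omega>. X u \<omega> s)"
  by (rule mart_integrable[OF X_martingale])

lemma X_expectation:
  assumes s: "0 \<le> s" "s \<le> T"
  shows "(\<integral>\<omega>. X u \<omega> s \<partial>M) = clip 1 u"
proof -
  have "space M \<in> sets (F 0)" using sets.top[of "F 0"] by (simp add: space_filt)
  from mart_indicator[OF X_martingale order_refl s this]
  have "(\<integral>\<omega>. indicator (space M) \<omega> * X u \<omega> s \<partial>M) = (\<integral>\<omega>. indicator (space M) \<omega> * X u \<omega> 0 \<partial>M)" .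
  moreover have "(\<integral>\<omega>. indicator (space M) \<omega> * X u \<omega> s \<partial>M) = (\<integral>\<omega>. X u \<omega> s \<partial>M)"
    by (intro Bochner_Integration.integral_cong) auto
  moreover have "(\<integral>\<omega>. indicator (space M) \<omega> * X u \<omega> 0 \<partial>M) = (\<integral>\<omega>. clip 1 u \<partial>M)"
    by (intro Bochner_Integration.integral_cong) (auto simp: X_0)
  ultimately show ?thesis by (simp add: prob_space)
qed

text \<open>By monotonicity in u, the oscillation of X at u is the limit of non-negative variables
with mean at most 2 / (n + 1), since every coordinate has constant mean.\<close>

lemma X_tendsto_AE:
  assumes v: "v \<longlonglongrightarrow> u" and s: "0 \<le> s" "s \<le> T"
  shows "AE \<omega> in M. (\<lambda>j. X (v j) \<omega> s) \<longlonglongrightarrow> X u \<omega> s"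
proof -
  define e where "e n = 1 / real (Suc n)" for n
  have e0: "e \<longlonglongrightarrow> 0" unfolding e_def using LIMSEQ_inverse_real_of_nat by (simp add: inverse_eq_divide)
  have epos: "0 < e n" for n by (simp add: e_def)
  define D where "D n \<omega> = X (u + e n) \<omega> s - X (u - e n) \<omega> s" for n \<omega>
  have iD: "integrable M (D n)" for n unfolding D_def using X_integrable[OF s] by auto
  have "(\<lambda>n. \<integral>\<omega>. norm (D n \<omega>) \<partial>M) \<longlonglongrightarrow> 0"
  proof (rule tendsto_sandwich[OF _ _ tendsto_const])
    show "(\<lambda>n. 2 * e n) \<longlonglongrightarrow> 0" using tendsto_mult_left[OF e0, of 2] by simp
    have "(\<integral>\<omega>. norm (D n \<omega>) \<partial>M) \<le> 2 * e n" for n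
    proof -
      have "(\<integral>\<omega>. norm (D n \<omega>) \<partial>M) = (\<integral>\<omega>. D n \<omega> \<partial>M)"
        using X_mono[of _ "u - e n" "u + e n" s] epos[of n]
        by (intro Bochner_Integration.integral_cong) (auto simp: D_def)
      also have "\<dots> = clip 1 (u + e n) - clip 1 (u - e n)"
        unfolding D_def using X_integrable[OF s] X_expectation[OF s] by simp
      also have "\<dots> \<le> 2 * e n" using clip_dist[of 1 "u + e n" "u - e n"] epos[of n] by simp
      finally show ?thesis .
    qed
    then show "\<forall>\<^sub>F n in sequentially. (\<integral>\<omega>. norm (D n \<omega>) \<partial>M) \<le> 2 * e n" by simp
  qed simp
  from tendsto_L1_AE_subseq[OF iD this] obtain r where r: "strict_mono r" "AE \<omega> in M. (\<lambda>n. D (r n) \<omega>) \<longlonglongrightarrow> 0"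
    by blast
  from r(2) AE_space show ?thesis
  proof eventually_elim
    case (elim \<omega>)
    show ?case
    proof (rule LIMSEQ_I)
      fix \<eta> :: real assume "0 < \<eta>"
      with elim(1) have "\<forall>\<^sub>F n in sequentially. D (r n) \<omega> < \<eta>" by (rule order_tendstoD(2))
      then obtain n where n: "D (r n) \<omega> < \<eta>" by (auto simp: eventually_sequentially)
      have "\<forall>\<^sub>F j in sequentially. \<bar>v j - u\<bar> < e (r n)"
        using tendstoD[OF v epos[of "r n"]] by (simp add: dist_real_def)
      then have "\<forall>\<^sub>F j in sequentially. norm (X (v j) \<omega> s - X u \<omega> s) < \<eta>"
      proof eventually_elim
        case (elim j)
        have "X (u - e (r n)) \<omega> s \<le> X (v j) \<omega> s" "X (v j) \<omega> s \<le> X (u + e (r n)) \<omega> s"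
          "X (u - e (r n)) \<omega> s \<le> X u \<omega> s" "X u \<omega> s \<le> X (u + e (r n)) \<omega> s"
          using elim epos[of "r n"] by (intro X_mono \<open>\<omega> \<in> space M\<close>; linarith)+
        then show ?case using n unfolding D_def by (simp add: abs_less_iff)
      qed
      then show "\<exists>no. \<forall>j\<ge>no. norm (X (v j) \<omega> s - X u \<omega> s) < \<eta>" by (simp add: eventually_sequentially)
    qed
  qed
qed

end

locale coalescing_flow_function = coalescing_flow M T y + smooth_function \<phi> \<phi>' \<phi>'' C
  for M :: "'a measure" and T y \<phi> \<phi>' \<phi>'' C
begin

lemma ito_calculus_X: "ito_calculus M F T (X u) (rate u) \<phi> \<phi>' \<phi>'' C"
  by (intro ito_calculus.intro ito_process_X) unfold_locales

text \<open>\<open>ito_calculus.ito_int\<close> of the particle started at u, written out with u as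
  an ordinary argument so that joint measurability and integration in u make sense.\<close>

definition ito_X :: "real \<Rightarrow> 'a \<Rightarrow> real \<Rightarrow> real" where
  "ito_X u \<omega> t = \<phi> (X u \<omega> t) - \<phi> (X u \<omega> 0) - (\<integral>s. indicator {0..t} s * (\<phi>'' (X u \<omega> s) * rate u \<omega> s) \<partial>lborel) / 2"

lemma ito_X_eq: "ito_calculus.ito_int (X u) (rate u) \<phi> \<phi>'' = ito_X u"
  by (intro ext) (simp add: ito_X_def ito_calculus.ito_int_def[OF ito_calculus_X] ito_calculus.drift_def[OF ito_calculus_X])

lemma ito_X_facts:
  shows ito_X_mart: "mart M F T (ito_X u)"
    and ito_X_M: "0 \<le> t \<Longrightarrow> t \<le> T \<Longrightarrow> (\<lambda>\<omega>. ito_X u \<omega> t) \<in> borel_measurable M"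
    and ito_X_sq: "0 \<le> t \<Longrightarrow> t \<le> T \<Longrightarrow> integrable M (\<lambda>\<omega>. (ito_X u \<omega> t)^2)"
    and ito_X_0: "AE \<omega> in M. ito_X u \<omega> 0 = 0"
  using ito_calculus.ito_int_mart[OF ito_calculus_X, of u] ito_calculus.ito_int_M[OF ito_calculus_X, of t u]
    ito_calculus.ito_int_square_integrable[OF ito_calculus_X, of t u] ito_calculus.ito_int_0[OF ito_calculus_X, of u]
  unfolding ito_X_eq by auto

lemma stoch_int_ito_X:
  assumes v: "v \<in> {0..1}"
  shows "AE \<omega> in M. stoch_int M F T (\<lambda>\<omega> s. \<phi>' (y \<omega> v s)) (\<lambda>\<omega> s. y \<omega> v s) \<omega> T = ito_X v \<omega> T"
  using ito_calculus.stoch_int_eq_ito_int[OF ito_calculus_X, of "\<lambda>\<omega> s. y \<omega> v s" v T] X_eq[OF v] T_pos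
  unfolding ito_X_eq by auto

text \<open>The decomposition is \<phi>'(X_u) dX_u - \<phi>'(X_v) dX_v = (\<phi>'(X_u) -
  \<phi>'(X_v)) dX_u + \<phi>'(X_v) d(X_u - X_v). The first part is measured by the isometry for the
  particle u, the second by orthogonality of the increments of the difference. It is carried out on
  the sums, where both integrators share one partition.\<close>

lemma ito_X_difference_bound:
  assumes t: "0 < t" "t \<le> T"
  shows "(\<integral>\<omega>. (ito_X u \<omega> t - ito_X v \<omega> t)^2 \<partial>M) \<le> 6 * (C^2 * (\<integral>\<omega>. ((X u \<omega> t - X v \<omega> t) - (X u \<omega> 0 - X v \<omega> 0))^2 \<partial>M)
     + (\<integral>x. ((\<phi>' (X u (fst x) (snd x)) - \<phi>' (X v (fst x) (snd x))) * indicator {0<..t} (snd x))^2 \<partial>ito_process.doleans M T (rate u)))"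
proof -
  interpret U: ito_formula M F T "X u" "rate u" \<phi> \<phi>' \<phi>'' C t "uniform_partition t"
    by (rule ito_calculus.ito_formula_axioms_uniform[OF ito_calculus_X t])
  interpret V: ito_formula M F T "X v" "rate v" \<phi> \<phi>' \<phi>'' C t "uniform_partition t"
    by (rule ito_calculus.ito_formula_axioms_uniform[OF ito_calculus_X t])
  let ?P = "uniform_partition t"
  have tT: "0 \<le> t" "t \<le> T" using t by auto
  define d where "d \<omega> s = \<phi>' (X u \<omega> s) - \<phi>' (X v \<omega> s)" for \<omega> s
  have d2C: "\<bar>d \<omega> s\<bar> \<le> 2 * C" for \<omega> s unfolding d_def using b1[of "X u \<omega> s"] b1[of "X v \<omega> s"] by linarith
  have dF: "(\<lambda>\<omega>. d \<omega> s) \<in> borel_measurable (F s)" if "0 \<le> s" "s \<le> T" for s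
    unfolding d_def using mart_adapted[OF X_martingale that, of u] mart_adapted[OF X_martingale that, of v] by measurable
  have dM: "(\<lambda>\<omega>. d \<omega> s) \<in> borel_measurable M" if "0 \<le> s" "s \<le> t" for s
    by (rule adapted_M[OF dF]) (use that t in auto)
  have dc: "continuous_on {0..t} (d \<omega>)" if "\<omega> \<in> space M" for \<omega>
  proof -
    have "continuous_on {0..t} (\<lambda>s. \<phi>' (X w \<omega> s))" for w
    proof (rule continuous_on_compose2[OF \<phi>'_cont[of UNIV]])
      show "continuous_on {0..t} (X w \<omega>)"
        by (rule continuous_on_subset[OF X_continuous[OF that]]) (use t in auto)
    qed simp
    then show ?thesis unfolding d_def[abs_def] by (intro continuous_intros)
  qed
  define N where "N \<omega> s = X u \<omega> s - X v \<omega> s" for \<omega> s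
  have Nm: "mart M F T N" unfolding N_def by (rule mart_diff[OF X_martingale X_martingale])
  have Nsq: "integrable M (\<lambda>\<omega>. (N \<omega> s)^2)" if "0 \<le> s" "s \<le> T" for s
    unfolding N_def by (rule integrable_square_diff) (use X_M X_square_integrable that in auto)
  define EN where "EN = (\<integral>\<omega>. (N \<omega> t - N \<omega> 0)^2 \<partial>M)"
  define q where "q n = (\<integral>x. (U.istep (?P n) n (\<lambda>k \<omega>. d \<omega> (?P n k)) x)^2 \<partial>U.doleans)" for n
  have q: "q \<longlonglongrightarrow> (\<integral>x. (d (fst x) (snd x) * indicator {0<..t} (snd x))^2 \<partial>U.doleans)"
    unfolding q_def by (rule U.istep_norm[OF dc dM d2C])
  have main: "(\<integral>\<omega>. (ito_X u \<omega> t - ito_X v \<omega> t)^2 \<partial>M) \<le> 3 * (\<integral>\<omega>. (U.S n \<omega> - ito_X u \<omega> t)^2 \<partial>M) + 3 * (\<integral>\<omega>. (V.S n \<omega> - ito_X v \<omega> t)^2 \<partial>M) + 6 * (C^2 * EN + q n)"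
    if n: "1 \<le> n" for n
  proof -
    define D1 where "D1 = U.isum (?P n) n (\<lambda>k \<omega>. d \<omega> (?P n k))"
    define D2 where "D2 \<omega> = (\<Sum>k<n. \<phi>' (X v \<omega> (?P n k)) * (N \<omega> (?P n (Suc k)) - N \<omega> (?P n k)))" for \<omega>
    have D: "U.S n \<omega> - V.S n \<omega> = D1 \<omega> + D2 \<omega>" for \<omega>
      unfolding U.isum_def V.isum_def D1_def D2_def d_def N_def sum.distrib[symmetric] sum_subtractf[symmetric]
      by (intro sum.cong) (auto simp: algebra_simps)
    have simp_d: "U.simple_integrand t (?P n) n (\<lambda>k \<omega>. d \<omega> (?P n k))"
      unfolding U.simple_integrand_def using U.P[OF n] t d2C by (auto intro!: dF U.Pf[OF n])
    have D1sq: "integrable M (\<lambda>\<omega>. (D1 \<omega>)^2)" "(\<integral>\<omega>. (D1 \<omega>)^2 \<partial>M) = q n"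
      using U.isum_sq[OF simp_d] U.isum_inner[OF simp_d simp_d] unfolding D1_def q_def by (simp_all add: power2_eq_square)
    have h: "(\<lambda>\<omega>. \<phi>' (X v \<omega> (?P n k))) \<in> borel_measurable (F (?P n k))" if "k < n" for k
      by (rule V.\<phi>_adapted[OF n]) (use that in auto)
    have D2sq: "integrable M (\<lambda>\<omega>. (D2 \<omega>)^2)" "(\<integral>\<omega>. (D2 \<omega>)^2 \<partial>M) \<le> C^2 * EN"
      unfolding D2_def EN_def by (rule mart_transform_bound[OF Nm Nsq U.P[OF n] t(2) h b1]; assumption)+
    have LU: "integrable M (\<lambda>\<omega>. (U.S n \<omega> - ito_X u \<omega> t)^2)" using U.L2_limit(1)[OF n] unfolding ito_X_eq .
    have LV: "integrable M (\<lambda>\<omega>. (V.S n \<omega> - ito_X v \<omega> t)^2)" using V.L2_limit(1)[OF n] unfolding ito_X_eq .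
    have "(\<integral>\<omega>. (ito_X u \<omega> t - ito_X v \<omega> t)^2 \<partial>M) \<le> (\<integral>\<omega>. 3 * (U.S n \<omega> - ito_X u \<omega> t)^2 + 3 * (V.S n \<omega> - ito_X v \<omega> t)^2 + (6 * (D2 \<omega>)^2 + 6 * (D1 \<omega>)^2) \<partial>M)"
    proof (rule integral_mono)
      show "integrable M (\<lambda>\<omega>. (ito_X u \<omega> t - ito_X v \<omega> t)^2)"
        by (rule integrable_square_diff) (use ito_X_M ito_X_sq tT in auto)
      show "integrable M (\<lambda>\<omega>. 3 * (U.S n \<omega> - ito_X u \<omega> t)^2 + 3 * (V.S n \<omega> - ito_X v \<omega> t)^2 + (6 * (D2 \<omega>)^2 + 6 * (D1 \<omega>)^2))"
        using LU LV D1sq D2sq by simp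
      fix \<omega>
      have "(ito_X u \<omega> t - ito_X v \<omega> t) = - (U.S n \<omega> - ito_X u \<omega> t) + (V.S n \<omega> - ito_X v \<omega> t) + (D1 \<omega> + D2 \<omega>)"
        using D[of \<omega>] by simp
      moreover have "(- a + b + (c + d))^2 \<le> 3 * a^2 + 3 * b^2 + (6 * d^2 + 6 * c^2)" for a b c d :: real
      proof -
        \<comment> \<open>The right side minus the left side, as a sum of squares: three times the
          sum of three squares controls the square of the sum, and 3 (c + d)^2 costs another factor
          2, whence 6.\<close>
        have "0 \<le> (a + b)^2 + (a + (c + d))^2 + (b - (c + d))^2 + 3 * (c - d)^2" by simp
        then show ?thesis by (simp add: power2_eq_square algebra_simps)
      qed
      ultimately show "(ito_X u \<omega> t - ito_X v \<omega> t)^2 \<le> 3 * (U.S n \<omega> - ito_X u \<omega> t)^2 + 3 * (V.S n \<omega> - ito_X v \<omega> t)^2 + (6 * (D2 \<omega>)^2 + 6 * (D1 \<omega>)^2)"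
        by metis
    qed
    also have "\<dots> = 3 * (\<integral>\<omega>. (U.S n \<omega> - ito_X u \<omega> t)^2 \<partial>M) + 3 * (\<integral>\<omega>. (V.S n \<omega> - ito_X v \<omega> t)^2 \<partial>M) + (6 * (\<integral>\<omega>. (D2 \<omega>)^2 \<partial>M) + 6 * q n)"
      using LU LV D1sq D2sq by simp
    finally show ?thesis using D2sq(2) by simp
  qed
  have "(\<lambda>n. 3 * (\<integral>\<omega>. (U.S n \<omega> - ito_X u \<omega> t)^2 \<partial>M) + 3 * (\<integral>\<omega>. (V.S n \<omega> - ito_X v \<omega> t)^2 \<partial>M) + 6 * (C^2 * EN + q n))
     \<longlonglongrightarrow> 3 * 0 + 3 * 0 + 6 * (C^2 * EN + (\<integral>x. (d (fst x) (snd x) * indicator {0<..t} (snd x))^2 \<partial>U.doleans))"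
    by (intro tendsto_intros q U.L2_limit(2)[unfolded ito_X_eq] V.L2_limit(2)[unfolded ito_X_eq])
  then have "(\<integral>\<omega>. (ito_X u \<omega> t - ito_X v \<omega> t)^2 \<partial>M) \<le> 3 * 0 + 3 * 0 + 6 * (C^2 * EN + (\<integral>x. (d (fst x) (snd x) * indicator {0<..t} (snd x))^2 \<partial>U.doleans))"
    by (rule LIMSEQ_le_const) (use main in blast)
  then show ?thesis unfolding EN_def N_def d_def by simp
qed

lemma X_difference_tendsto:
  assumes v: "v \<longlonglongrightarrow> u" and t: "0 \<le> t" "t \<le> T"
  shows "(\<lambda>j. \<integral>\<omega>. ((X u \<omega> t - X (v j) \<omega> t) - (X u \<omega> 0 - X (v j) \<omega> 0))^2 \<partial>M) \<longlonglongrightarrow> 0"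
proof -
  \<comment> \<open>Twice the envelope bounds the difference at time t, and the summand 1 bounds the
    difference of the two starting points.\<close>
  define w where "w \<omega> = 2 * (\<bar>X 0 \<omega> t\<bar> + \<bar>X 1 \<omega> t\<bar>) + 1" for \<omega>
  have [measurable]: "(\<lambda>\<omega>. X u \<omega> s) \<in> borel_measurable M" if "0 \<le> s" "s \<le> T" for u s by (rule X_M[OF that])
  have absX: "integrable M (\<lambda>\<omega>. (\<bar>X u \<omega> t\<bar>)^2)" for u using X_square_integrable[of t u] t by simp
  have wsq: "integrable M (\<lambda>\<omega>. (w \<omega>)^2)"
  proof -
    have "integrable M (\<lambda>\<omega>. (2 * \<bar>X 0 \<omega> t\<bar> + (2 * \<bar>X 1 \<omega> t\<bar> + 1))^2)"
      by (intro integrable_square_add) (use t absX in \<open>auto simp: power_mult_distrib\<close>)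
    then show ?thesis unfolding w_def by (simp add: algebra_simps)
  qed
  have "(\<lambda>j. \<integral>\<omega>. ((X u \<omega> t - X (v j) \<omega> t) - (X u \<omega> 0 - X (v j) \<omega> 0))^2 \<partial>M) \<longlonglongrightarrow> (\<integral>\<omega>. 0 \<partial>M)"
  proof (rule integral_dominated_convergence[OF _ _ wsq])
    show "AE \<omega> in M. (\<lambda>j. ((X u \<omega> t - X (v j) \<omega> t) - (X u \<omega> 0 - X (v j) \<omega> 0))^2) \<longlonglongrightarrow> 0"
      using X_tendsto_AE[OF v t] X_tendsto_AE[OF v order_refl less_imp_le[OF T_pos]]
    proof eventually_elim
      case (elim \<omega>)
      then have "(\<lambda>j. ((X u \<omega> t - X (v j) \<omega> t) - (X u \<omega> 0 - X (v j) \<omega> 0))^2) \<longlonglongrightarrow> ((X u \<omega> t - X u \<omega> t) - (X u \<omega> 0 - X u \<omega> 0))^2"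
        by (intro tendsto_intros)
      then show ?case by simp
    qed
    show "AE \<omega> in M. norm (((X u \<omega> t - X (v j) \<omega> t) - (X u \<omega> 0 - X (v j) \<omega> 0))^2) \<le> (w \<omega>)^2" for j
    proof (rule AE_I2)
      fix \<omega> assume \<omega>: "\<omega> \<in> space M"
      have arith: "\<bar>a\<bar> \<le> K \<Longrightarrow> \<bar>b\<bar> \<le> K \<Longrightarrow> \<bar>c - d\<bar> \<le> 1 \<Longrightarrow> \<bar>a - b - (c - d)\<bar> \<le> 2 * K + 1" for a b c d K :: real
        by linarith
      have "\<bar>X u \<omega> 0 - X (v j) \<omega> 0\<bar> \<le> 1" using \<omega> by (auto simp: X_0 clip_def max_def min_def)
      then have "\<bar>(X u \<omega> t - X (v j) \<omega> t) - (X u \<omega> 0 - X (v j) \<omega> 0)\<bar> \<le> w \<omega>"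
        using arith[OF X_envelope[OF \<omega>, of u t] X_envelope[OF \<omega>, of "v j" t]] unfolding w_def by simp
      from power_mono[OF this abs_ge_zero, of 2]
      show "norm (((X u \<omega> t - X (v j) \<omega> t) - (X u \<omega> 0 - X (v j) \<omega> 0))^2) \<le> (w \<omega>)^2" by simp
    qed
    show "(\<lambda>\<omega>. ((X u \<omega> t - X (v j) \<omega> t) - (X u \<omega> 0 - X (v j) \<omega> 0))^2) \<in> borel_measurable M" for j
      by (intro borel_measurable_power borel_measurable_diff X_M) (use t T_pos in auto)
  qed simp
  then show ?thesis by simp
qed

text \<open>Convergence of the particles is almost sure at each fixed time, with a null set
  depending on that time. Fubini therefore puts the time integral outside, and dominated convergence
  is applied first in \<omega> and then in s, both times under a multiple of the rate.\<close>

lemma doleans_difference_tendsto: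
  assumes v: "v \<longlonglongrightarrow> u" and t: "0 < t" "t \<le> T"
  shows "(\<lambda>j. \<integral>x. ((\<phi>' (X u (fst x) (snd x)) - \<phi>' (X (v j) (fst x) (snd x))) * indicator {0<..t} (snd x))^2 \<partial>ito_process.doleans M T (rate u)) \<longlonglongrightarrow> 0"
proof -
  interpret U: ito_process M F T "X u" "rate u" by (rule ito_process_X)
  define G where "G j \<omega> s = indicator {0..T} s * rate u \<omega> s * ((\<phi>' (X u \<omega> s) - \<phi>' (X (v j) \<omega> s)) * indicator {0<..t} s)^2" for j \<omega> s
  define g where "g \<omega> s = (2 * C)^2 * (indicator {0..T} s * rate u \<omega> s)" for \<omega> s
  have Xm: "(\<lambda>x. X w (fst x) (snd x)) \<in> borel_measurable (M \<Otimes>\<^sub>M lborel)" for w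
    by (rule X_joint) auto
  have Rm: "(\<lambda>x. rate u (fst x) (snd x)) \<in> borel_measurable (M \<Otimes>\<^sub>M lborel)"
    by (rule rate_joint) auto
  note [measurable] = Xm Rm
  have hm: "(\<lambda>x. ((\<phi>' (X u (fst x) (snd x)) - \<phi>' (X (v j) (fst x) (snd x))) * indicator {0<..t} (snd x))^2) \<in> borel_measurable (M \<Otimes>\<^sub>M lborel)" for j
    by measurable
  have Gm: "(\<lambda>(\<omega>, s). G j \<omega> s) \<in> borel_measurable (M \<Otimes>\<^sub>M lborel)" for j
    unfolding G_def split_beta' by measurable
  have gi: "integrable (M \<Otimes>\<^sub>M lborel) (\<lambda>(\<omega>, s). g \<omega> s)"
    unfolding g_def split_beta' using U.a_int unfolding split_beta' by (rule integrable_mult_right)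
  have Gg: "norm (G j \<omega> s) \<le> g \<omega> s" for j \<omega> s
  proof -
    have "\<bar>\<phi>' (X u \<omega> s) - \<phi>' (X (v j) \<omega> s)\<bar> \<le> 2 * C" using b1[of "X u \<omega> s"] b1[of "X (v j) \<omega> s"] by linarith
    from power_mono[OF this abs_ge_zero, of 2]
    have "(\<phi>' (X u \<omega> s) - \<phi>' (X (v j) \<omega> s))^2 \<le> (2 * C)^2" by simp
    then show ?thesis unfolding G_def g_def using rate_nonneg[of u \<omega> s]
      by (auto simp: indicator_def mult.commute abs_mult intro!: mult_left_mono)
  qed
  have gnn: "0 \<le> g \<omega> s" for \<omega> s unfolding g_def using rate_nonneg by simp
  have Gi: "integrable (M \<Otimes>\<^sub>M lborel) (\<lambda>(\<omega>, s). G j \<omega> s)" for j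
    by (rule Bochner_Integration.integrable_bound[OF gi Gm]) (use Gg gnn in \<open>auto simp: abs_of_nonneg\<close>)
  have eq: "(\<integral>x. ((\<phi>' (X u (fst x) (snd x)) - \<phi>' (X (v j) (fst x) (snd x))) * indicator {0<..t} (snd x))^2 \<partial>U.doleans)
     = (\<integral>s. (\<integral>\<omega>. G j \<omega> s \<partial>M) \<partial>lborel)" for j
  proof -
    have "(\<integral>x. ((\<phi>' (X u (fst x) (snd x)) - \<phi>' (X (v j) (fst x) (snd x))) * indicator {0<..t} (snd x))^2 \<partial>U.doleans)
      = (\<integral>x. (case x of (\<omega>, s) \<Rightarrow> G j \<omega> s) \<partial>(M \<Otimes>\<^sub>M lborel))"
      by (subst U.integral_doleans(1)[OF hm]) (simp add: G_def split_beta')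
    also have "\<dots> = (\<integral>s. (\<integral>\<omega>. G j \<omega> s \<partial>M) \<partial>lborel)" by (rule U.integral_snd[OF Gi, symmetric])
    finally show ?thesis .
  qed
  have "(\<lambda>j. \<integral>s. (\<integral>\<omega>. G j \<omega> s \<partial>M) \<partial>lborel) \<longlonglongrightarrow> (\<integral>s. 0 \<partial>(lborel :: real measure))"
  proof (rule integral_dominated_convergence[where w="\<lambda>s. \<integral>\<omega>. g \<omega> s \<partial>M"])
    show "integrable lborel (\<lambda>s. \<integral>\<omega>. g \<omega> s \<partial>M)" by (rule U.integrable_snd[OF gi])
    show "(\<lambda>s. \<integral>\<omega>. G j \<omega> s \<partial>M) \<in> borel_measurable lborel" for j
      using U.integrable_snd[OF Gi[of j]] by simp
    show "AE s in lborel. norm (\<integral>\<omega>. G j \<omega> s \<partial>M) \<le> (\<integral>\<omega>. g \<omega> s \<partial>M)" for j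
      using U.AE_integrable_snd[OF Gi[of j]] U.AE_integrable_snd[OF gi]
    proof eventually_elim
      case (elim s)
      have "norm (\<integral>\<omega>. G j \<omega> s \<partial>M) \<le> (\<integral>\<omega>. norm (G j \<omega> s) \<partial>M)" by (rule integral_norm_bound)
      also have "\<dots> \<le> (\<integral>\<omega>. g \<omega> s \<partial>M)" by (rule integral_mono) (use elim Gg in auto)
      finally show ?case .
    qed
    have "AE s in lborel. (\<forall>j. integrable M (\<lambda>\<omega>. G j \<omega> s))"
      unfolding AE_all_countable using U.AE_integrable_snd[OF Gi] by blast
    then show "AE s in lborel. (\<lambda>j. \<integral>\<omega>. G j \<omega> s \<partial>M) \<longlonglongrightarrow> 0"
      using U.AE_integrable_snd[OF gi]
    proof eventually_elim
      case (elim s)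
      show ?case
      proof (cases "0 \<le> s \<and> s \<le> T")
        case True
        have "(\<lambda>j. \<integral>\<omega>. G j \<omega> s \<partial>M) \<longlonglongrightarrow> (\<integral>\<omega>. 0 \<partial>M)"
        proof (rule integral_dominated_convergence[where w="\<lambda>\<omega>. g \<omega> s"])
          show "AE \<omega> in M. (\<lambda>j. G j \<omega> s) \<longlonglongrightarrow> 0"
            using X_tendsto_AE[OF v conjunct1[OF True] conjunct2[OF True]]
          proof eventually_elim
            case (elim \<omega>)
            have "(\<lambda>j. \<phi>' (X (v j) \<omega> s)) \<longlonglongrightarrow> \<phi>' (X u \<omega> s)"
              by (rule continuous_on_tendsto_compose[OF \<phi>'_cont[of UNIV] elim]) auto
            then have "(\<lambda>j. G j \<omega> s) \<longlonglongrightarrow> indicator {0..T} s * rate u \<omega> s * ((\<phi>' (X u \<omega> s) - \<phi>' (X u \<omega> s)) * indicator {0<..t} s)^2"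
              unfolding G_def by (intro tendsto_intros)
            then show ?case by simp
          qed
        qed (use elim Gg in auto)
        then show ?thesis by simp
      next
        case False
        then have "G j \<omega> s = 0" for j \<omega> by (auto simp: G_def indicator_def)
        then show ?thesis by simp
      qed
    qed
  qed simp
  then show ?thesis unfolding eq by simp
qed

lemma ito_X_L2_sequential:
  assumes v: "v \<longlonglongrightarrow> u" and t: "0 \<le> t" "t \<le> T"
  shows "(\<lambda>j. \<integral>\<omega>. (ito_X u \<omega> t - ito_X (v j) \<omega> t)^2 \<partial>M) \<longlonglongrightarrow> 0"
proof (cases "t = 0")
  case True
  have "(\<integral>\<omega>. (ito_X u \<omega> 0 - ito_X (v j) \<omega> 0)^2 \<partial>M) = (\<integral>\<omega>. 0 \<partial>M)" for j
  proof (rule integral_cong_AE)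
    show "AE \<omega> in M. (ito_X u \<omega> 0 - ito_X (v j) \<omega> 0)^2 = 0" using ito_X_0[of u] ito_X_0[of "v j"] by eventually_elim simp
    have [measurable]: "(\<lambda>\<omega>. ito_X w \<omega> 0) \<in> borel_measurable M" for w by (rule ito_X_M) (use T_pos in auto)
    show "(\<lambda>\<omega>. (ito_X u \<omega> 0 - ito_X (v j) \<omega> 0)^2) \<in> borel_measurable M" by measurable
  qed simp
  then show ?thesis using True by simp
next
  case False
  then have t': "0 < t" using t by simp
  have lim: "(\<lambda>j. 6 * (C^2 * (\<integral>\<omega>. ((X u \<omega> t - X (v j) \<omega> t) - (X u \<omega> 0 - X (v j) \<omega> 0))^2 \<partial>M)
     + (\<integral>x. ((\<phi>' (X u (fst x) (snd x)) - \<phi>' (X (v j) (fst x) (snd x))) * indicator {0<..t} (snd x))^2 \<partial>ito_process.doleans M T (rate u))))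
     \<longlonglongrightarrow> 6 * (C^2 * 0 + 0)"
    by (intro tendsto_intros X_difference_tendsto doleans_difference_tendsto v t t')
  show ?thesis
    by (rule tendsto_sandwich[OF _ _ tendsto_const lim[simplified]])
      (use ito_X_difference_bound[OF t' t(2)] in auto)
qed

lemma ito_X_triangle:
  assumes t: "0 \<le> t" "t \<le> T"
  shows "(\<integral>\<omega>. (ito_X u \<omega> t - ito_X v \<omega> t)^2 \<partial>M) \<le> 2 * (\<integral>\<omega>. (ito_X w \<omega> t - ito_X u \<omega> t)^2 \<partial>M) + 2 * (\<integral>\<omega>. (ito_X w \<omega> t - ito_X v \<omega> t)^2 \<partial>M)"
proof -
  have i: "integrable M (\<lambda>\<omega>. (ito_X a \<omega> t - ito_X b \<omega> t)^2)" for a b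
    by (rule integrable_square_diff) (use ito_X_M ito_X_sq t in auto)
  have "(\<integral>\<omega>. (ito_X u \<omega> t - ito_X v \<omega> t)^2 \<partial>M) \<le> (\<integral>\<omega>. 2 * (ito_X w \<omega> t - ito_X u \<omega> t)^2 + 2 * (ito_X w \<omega> t - ito_X v \<omega> t)^2 \<partial>M)"
  proof (rule integral_mono)
    show "(ito_X u \<omega> t - ito_X v \<omega> t)^2 \<le> 2 * (ito_X w \<omega> t - ito_X u \<omega> t)^2 + 2 * (ito_X w \<omega> t - ito_X v \<omega> t)^2" for \<omega>
    proof -
      have "0 \<le> ((ito_X w \<omega> t - ito_X u \<omega> t) + (ito_X w \<omega> t - ito_X v \<omega> t))^2" by simp
      then show ?thesis by (simp add: power2_eq_square algebra_simps)
    qed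
  qed (use i in auto)
  then show ?thesis using i by simp
qed

text \<open>Heine-Cantor for the map from [0,1] into L2: a sequence of violating pairs has a
  subsequence along which both members tend to the same point, where sequential continuity
  contradicts the violation.\<close>

lemma ito_X_uniformly_continuous:
  assumes t: "0 \<le> t" "t \<le> T" and \<eta>: "0 < \<eta>"
  shows "\<exists>d>0. \<forall>u\<in>{0..1}. \<forall>v\<in>{0..1}. \<bar>u - v\<bar> < d \<longrightarrow> (\<integral>\<omega>. (ito_X u \<omega> t - ito_X v \<omega> t)^2 \<partial>M) < \<eta>"
proof (rule ccontr)
  assume *: "\<not> ?thesis"
  have "\<exists>u v. u \<in> {0..1} \<and> v \<in> {0..1} \<and> \<bar>u - v\<bar> < 1 / real (Suc n) \<and> \<eta> \<le> (\<integral>\<omega>. (ito_X u \<omega> t - ito_X v \<omega> t)^2 \<partial>M)" for n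
  proof -
    have "0 < 1 / real (Suc n)" by simp
    with * have "\<not> (\<forall>u\<in>{0..1}. \<forall>v\<in>{0..1}. \<bar>u - v\<bar> < 1 / real (Suc n) \<longrightarrow> (\<integral>\<omega>. (ito_X u \<omega> t - ito_X v \<omega> t)^2 \<partial>M) < \<eta>)"
      by blast
    then show ?thesis unfolding not_less[symmetric] by blast
  qed
  then have "\<forall>n. \<exists>p. fst p \<in> {0..1} \<and> snd p \<in> {0..1} \<and> \<bar>fst p - snd p\<bar> < 1 / real (Suc n) \<and> \<eta> \<le> (\<integral>\<omega>. (ito_X (fst p) \<omega> t - ito_X (snd p) \<omega> t)^2 \<partial>M)"
    unfolding split_paired_Ex fst_conv snd_conv by blast
  from choice[OF this] obtain p where p: "\<forall>n. fst (p n) \<in> {0..1} \<and> snd (p n) \<in> {0..1} \<and> \<bar>fst (p n) - snd (p n)\<bar> < 1 / real (Suc n)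
      \<and> \<eta> \<le> (\<integral>\<omega>. (ito_X (fst (p n)) \<omega> t - ito_X (snd (p n)) \<omega> t)^2 \<partial>M)" ..
  define u where "u n = fst (p n)" for n
  define v where "v n = snd (p n)" for n
  have uv: "u n \<in> {0..1::real}" "v n \<in> {0..1::real}" "\<bar>u n - v n\<bar> < 1 / real (Suc n)"
    "\<eta> \<le> (\<integral>\<omega>. (ito_X (u n) \<omega> t - ito_X (v n) \<omega> t)^2 \<partial>M)" for n
    using p unfolding u_def v_def by blast+
  have "seq_compact {0..1::real}" by (rule compact_imp_seq_compact) simp
  then obtain l r where r: "strict_mono r" "(u \<circ> r) \<longlonglongrightarrow> l"
    using uv(1) unfolding seq_compact_def by blast
  have inv0: "(\<lambda>n. 1 / real (Suc n)) \<longlonglongrightarrow> 0" using LIMSEQ_inverse_real_of_nat by (simp add: inverse_eq_divide)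
  have "(\<lambda>n. u n - v n) \<longlonglongrightarrow> 0"
    by (rule tendsto_rabs_zero_cancel, rule tendsto_sandwich[OF _ _ tendsto_const inv0])
      (use less_imp_le[OF uv(3)] in simp_all)
  then have "((\<lambda>n. u n - v n) \<circ> r) \<longlonglongrightarrow> 0" by (rule LIMSEQ_subseq_LIMSEQ[OF _ r(1)])
  from tendsto_diff[OF r(2) this] have vr: "(v \<circ> r) \<longlonglongrightarrow> l" by (simp add: o_def)
  have "(\<lambda>n. 2 * (\<integral>\<omega>. (ito_X l \<omega> t - ito_X ((u \<circ> r) n) \<omega> t)^2 \<partial>M) + 2 * (\<integral>\<omega>. (ito_X l \<omega> t - ito_X ((v \<circ> r) n) \<omega> t)^2 \<partial>M)) \<longlonglongrightarrow> 2 * 0 + 2 * 0"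
    by (intro tendsto_intros ito_X_L2_sequential r(2) vr t)
  then have "\<eta> \<le> 2 * 0 + 2 * 0"
  proof (rule LIMSEQ_le_const)
    have "\<eta> \<le> 2 * (\<integral>\<omega>. (ito_X l \<omega> t - ito_X ((u \<circ> r) n) \<omega> t)^2 \<partial>M) + 2 * (\<integral>\<omega>. (ito_X l \<omega> t - ito_X ((v \<circ> r) n) \<omega> t)^2 \<partial>M)" for n
      using order_trans[OF uv(4) ito_X_triangle[OF t]] by simp
    then show "\<exists>N. \<forall>n\<ge>N. \<eta> \<le> 2 * (\<integral>\<omega>. (ito_X l \<omega> t - ito_X ((u \<circ> r) n) \<omega> t)^2 \<partial>M) + 2 * (\<integral>\<omega>. (ito_X l \<omega> t - ito_X ((v \<circ> r) n) \<omega> t)^2 \<partial>M)"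
      by blast
  qed
  with \<eta> show False by simp
qed

end

section \<open>Integration over the starting point\<close>

lemma (in filtered_prob_space) mart_L1_limit:
  assumes N: "\<And>n. mart M F T (N n)"
    and ad: "\<And>t. 0 \<le> t \<Longrightarrow> t \<le> T \<Longrightarrow> (\<lambda>\<omega>. L \<omega> t) \<in> borel_measurable (F t)"
    and int: "\<And>t. 0 \<le> t \<Longrightarrow> t \<le> T \<Longrightarrow> integrable M (\<lambda>\<omega>. L \<omega> t)"
    and lim: "\<And>t. 0 \<le> t \<Longrightarrow> t \<le> T \<Longrightarrow> (\<lambda>n. \<integral>\<omega>. \<bar>N n \<omega> t - L \<omega> t\<bar> \<partial>M) \<longlonglongrightarrow> 0"
  shows "mart M F T L"
proof (rule martI[OF ad int])
  fix s t A assume st: "0 \<le> s" "s \<le> t" "t \<le> T" and A: "A \<in> sets (F s)"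
  have [measurable]: "A \<in> sets M" using A sub[of s] st by (auto simp: subalgebra_def)
  have *: "(\<lambda>n. \<integral>\<omega>. indicator A \<omega> * N n \<omega> u \<partial>M) \<longlonglongrightarrow> (\<integral>\<omega>. indicator A \<omega> * L \<omega> u \<partial>M)" if u: "0 \<le> u" "u \<le> T" for u
    by (rule tendsto_integral_indicator) (use mart_integrable[OF N u] int[OF u] lim[OF u] in auto)
  have "(\<integral>\<omega>. indicator A \<omega> * N n \<omega> t \<partial>M) = (\<integral>\<omega>. indicator A \<omega> * N n \<omega> s \<partial>M)" for n
    by (rule mart_indicator[OF N st A])
  then show "(\<integral>\<omega>. indicator A \<omega> * L \<omega> t \<partial>M) = (\<integral>\<omega>. indicator A \<omega> * L \<omega> s \<partial>M)"
    using *[of t] *[of s] st LIMSEQ_unique by auto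
qed

lemma (in filtered_prob_space) mart_weighted_sum:
  assumes N: "\<And>k. k \<in> I \<Longrightarrow> mart M F T (N k)" and I: "finite I"
  shows "mart M F T (\<lambda>\<omega> t. \<Sum>k\<in>I. N k \<omega> t * c k)"
proof (rule martI)
  fix s t A assume st: "0 \<le> s" "s \<le> t" "t \<le> T" and A: "A \<in> sets (F s)"
  have [measurable]: "A \<in> sets M" using A sub[of s] st by (auto simp: subalgebra_def)
  have i: "integrable M (\<lambda>\<omega>. indicator A \<omega> * N k \<omega> r)" if "k \<in> I" "0 \<le> r" "r \<le> T" for k r
    by (rule integrable_mult_bounded[where C=1]) (use mart_integrable[OF N that(2,3)] that in \<open>auto simp: indicator_def\<close>)
  have e: "(\<integral>\<omega>. indicator A \<omega> * (\<Sum>k\<in>I. N k \<omega> r * c k) \<partial>M) = (\<Sum>k\<in>I. (\<integral>\<omega>. indicator A \<omega> * N k \<omega> r \<partial>M) * c k)"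
    if r: "0 \<le> r" "r \<le> T" for r
  proof -
    have "(\<integral>\<omega>. indicator A \<omega> * (\<Sum>k\<in>I. N k \<omega> r * c k) \<partial>M) = (\<integral>\<omega>. (\<Sum>k\<in>I. (indicator A \<omega> * N k \<omega> r) * c k) \<partial>M)"
      by (simp only: sum_distrib_left mult.assoc)
    also have "\<dots> = (\<Sum>k\<in>I. \<integral>\<omega>. (indicator A \<omega> * N k \<omega> r) * c k \<partial>M)"
      by (rule Bochner_Integration.integral_sum) (intro integrable_mult_left i r)
    finally show ?thesis by simp
  qed
  show "(\<integral>\<omega>. indicator A \<omega> * (\<Sum>k\<in>I. N k \<omega> t * c k) \<partial>M) = (\<integral>\<omega>. indicator A \<omega> * (\<Sum>k\<in>I. N k \<omega> s * c k) \<partial>M)"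
    using e[of t] e[of s] st mart_indicator[OF N st A] by simp
next
  show "(\<lambda>\<omega>. \<Sum>k\<in>I. N k \<omega> t * c k) \<in> borel_measurable (F t)" if "0 \<le> t" "t \<le> T" for t
    by (intro borel_measurable_sum borel_measurable_times mart_adapted[OF N] that) auto
  show "integrable M (\<lambda>\<omega>. \<Sum>k\<in>I. N k \<omega> t * c k)" if "0 \<le> t" "t \<le> T" for t
    by (intro Bochner_Integration.integrable_sum integrable_mult_left mart_integrable[OF N] that)
qed

text \<open>Lebesgue measure on [0,1] as a density, so that the underlying space remains the whole
  real line and the clipped processes need no restriction. Being a probability, it provides (E f)^2
  \<le> E f^2 in the variable u.\<close>

definition unit_interval_measure :: "real measure" where
  "unit_interval_measure = density lborel (\<lambda>u. ennreal (indicator {0..1} u))"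

lemma sets_unit_interval_measure[measurable_cong, simp]: "sets unit_interval_measure = sets borel"
  by (simp add: unit_interval_measure_def)

lemma space_unit_interval_measure[simp]: "space unit_interval_measure = UNIV"
  by (simp add: unit_interval_measure_def)

lemma prob_unit_interval_measure: "prob_space unit_interval_measure"
proof
  have "emeasure unit_interval_measure (space unit_interval_measure) = (\<integral>\<^sup>+u. ennreal (indicator {0..1} (u::real)) \<partial>lborel)"
    unfolding unit_interval_measure_def by (subst emeasure_density) auto
  then show "emeasure unit_interval_measure (space unit_interval_measure) = 1"
    by (simp add: ennreal_indicator)
qed

interpretation unit: prob_space unit_interval_measure
  by (rule prob_unit_interval_measure)

lemma integral_unit_interval_measure:
  fixes f :: "real \<Rightarrow> real"
  assumes "f \<in> borel_measurable borel"
  shows "(\<integral>u. f u \<partial>unit_interval_measure) = (\<integral>u. indicator {0..1} u * f u \<partial>lborel)"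
  unfolding unit_interval_measure_def by (subst integral_density) (use assms in auto)

text \<open>The point 0 is left out because the steps of a partition are open on the left and do not
  contain it.\<close>

lemma AE_unit_interval_measure: "AE u in unit_interval_measure. 0 < u \<and> u \<le> 1"
proof -
  have "AE u in lborel. 0 < ennreal (indicator {0..1} u) \<longrightarrow> 0 < u \<and> u \<le> (1::real)"
    using AE_lborel_singleton[of "0::real"]
  proof eventually_elim
    case (elim u)
    then show ?case by (cases "u \<in> {0..1}") auto
  qed
  then show ?thesis unfolding unit_interval_measure_def by (subst AE_density) auto
qed

context coalescing_flow_function
begin

lemma ito_X_joint:
  assumes f[measurable]: "f \<in> measurable K M" and g[measurable]: "g \<in> borel_measurable K" and t: "0 \<le> t" "t \<le> T"
  shows "(\<lambda>x. ito_X (g x) (f x) t) \<in> borel_measurable K"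
proof -
  have [measurable]: "(\<lambda>x. X (g x) (f x) r) \<in> borel_measurable K" for r
    by (rule X_joint) auto
  have [measurable]: "(\<lambda>z. X (g (fst z)) (f (fst z)) (snd z)) \<in> borel_measurable (K \<Otimes>\<^sub>M lborel)"
    by (rule X_joint) auto
  have [measurable]: "(\<lambda>z. rate (g (fst z)) (f (fst z)) (snd z)) \<in> borel_measurable (K \<Otimes>\<^sub>M lborel)"
    by (rule rate_joint) auto
  have [measurable]: "(\<lambda>x. \<integral>s. indicator {0..t} s * (\<phi>'' (X (g x) (f x) s) * rate (g x) (f x) s) \<partial>lborel) \<in> borel_measurable K"
    by (rule lborel.borel_measurable_lebesgue_integral) (simp add: split_beta')
  show ?thesis unfolding ito_X_def by measurable
qed

lemma ito_X_joint_F: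
  assumes f[measurable]: "f \<in> measurable K (F t)" and g[measurable]: "g \<in> borel_measurable K" and t: "0 \<le> t" "t \<le> T"
  shows "(\<lambda>x. ito_X (g x) (f x) t) \<in> borel_measurable K"
proof -
  have t': "t \<in> {0..T}" using t by simp
  have "(\<lambda>x. X (g x) (f x) (min r t)) \<in> borel_measurable K" for r
    by (rule X_joint_F[OF t']) auto
  from this[of t] this[of 0] have [measurable]: "(\<lambda>x. X (g x) (f x) t) \<in> borel_measurable K" "(\<lambda>x. X (g x) (f x) 0) \<in> borel_measurable K"
    using t by simp_all
  have [measurable]: "(\<lambda>z. X (g (fst z)) (f (fst z)) (min (snd z) t)) \<in> borel_measurable (K \<Otimes>\<^sub>M lborel)"
    by (rule X_joint_F[OF t']) auto
  have [measurable]: "(\<lambda>z. rate (g (fst z)) (f (fst z)) (min (snd z) t)) \<in> borel_measurable (K \<Otimes>\<^sub>M lborel)"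
    by (rule rate_joint_F[OF t']) auto
  have "(\<lambda>x. \<integral>s. indicator {0..t} s * (\<phi>'' (X (g x) (f x) (min s t)) * rate (g x) (f x) (min s t)) \<partial>lborel) \<in> borel_measurable K"
    by (rule lborel.borel_measurable_lebesgue_integral) (simp add: split_beta')
  also have "(\<lambda>x. \<integral>s. indicator {0..t} s * (\<phi>'' (X (g x) (f x) (min s t)) * rate (g x) (f x) (min s t)) \<partial>lborel)
     = (\<lambda>x. \<integral>s. indicator {0..t} s * (\<phi>'' (X (g x) (f x) s) * rate (g x) (f x) s) \<partial>lborel)"
    by (intro ext Bochner_Integration.integral_cong) (auto simp: indicator_def)
  finally have [measurable]: "(\<lambda>x. \<integral>s. indicator {0..t} s * (\<phi>'' (X (g x) (f x) s) * rate (g x) (f x) s) \<partial>lborel) \<in> borel_measurable K" .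
  show ?thesis unfolding ito_X_def by measurable
qed

text \<open>The candidate for the double stochastic integral: the pathwise average of the explicit
  one-particle integrals.\<close>

definition mean_ito :: "'a \<Rightarrow> real \<Rightarrow> real" where
  "mean_ito \<omega> t = (\<integral>u. ito_X u \<omega> t \<partial>unit_interval_measure)"

lemma mean_ito_F:
  assumes t: "0 \<le> t" "t \<le> T"
  shows "(\<lambda>\<omega>. mean_ito \<omega> t) \<in> borel_measurable (F t)"
  unfolding mean_ito_def
  by (rule unit.borel_measurable_lebesgue_integral, unfold split_beta', rule ito_X_joint_F[OF _ _ t]) auto

lemma mean_ito_M: "0 \<le> t \<Longrightarrow> t \<le> T \<Longrightarrow> (\<lambda>\<omega>. mean_ito \<omega> t) \<in> borel_measurable M"
  by (rule adapted_M[OF mean_ito_F])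

definition rsum :: "(nat \<Rightarrow> real) \<Rightarrow> nat \<Rightarrow> (nat \<Rightarrow> real) \<Rightarrow> 'a \<Rightarrow> real \<Rightarrow> real" where
  "rsum p n v \<omega> t = (\<Sum>k<n. ito_X (v k) \<omega> t * (p (Suc k) - p k))"

lemma rsum_mart: "mart M F T (rsum p n v)"
  unfolding rsum_def[abs_def] by (rule mart_weighted_sum) (auto intro: ito_X_mart)

lemma rsum_M: "0 \<le> t \<Longrightarrow> t \<le> T \<Longrightarrow> (\<lambda>\<omega>. rsum p n v \<omega> t) \<in> borel_measurable M"
  by (rule adapted_M[OF mart_adapted[OF rsum_mart]])

lemma rsum_sq: "0 \<le> t \<Longrightarrow> t \<le> T \<Longrightarrow> integrable M (\<lambda>\<omega>. (rsum p n v \<omega> t)^2)"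
proof -
  assume t: "0 \<le> t" "t \<le> T"
  have "integrable M (\<lambda>\<omega>. (\<Sum>k<n. ito_X (v k) \<omega> t * (p (Suc k) - p k))^2)"
    by (rule integrable_square_sum) (use ito_X_M[OF t] ito_X_sq[OF t] in \<open>auto simp: power_mult_distrib\<close>)
  then show ?thesis unfolding rsum_def .
qed

text \<open>The Riemann sum is the integral over u of a step function whose value on a step is the
  integral at its tag. The square of the mean over u is at most the mean of the square, and
  Tonelli's theorem leaves the L2 distance of two particles at distance below \<open>d\<close>,
  which is less than \<open>\<eta>\<close>.\<close>

lemma rsum_error:
  assumes t: "0 \<le> t" "t \<le> T" and p: "wpart 1 p n" and v: "\<And>k. k < n \<Longrightarrow> v k \<in> {p k..p (Suc k)}"
    and mesh: "\<And>k. k < n \<Longrightarrow> p (Suc k) - p k < d"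
    and d: "\<And>u v. u \<in> {0..1} \<Longrightarrow> v \<in> {0..1} \<Longrightarrow> \<bar>u - v\<bar> < d \<Longrightarrow> (\<integral>\<omega>. (ito_X u \<omega> t - ito_X v \<omega> t)^2 \<partial>M) < \<eta>"
  shows "integrable M (\<lambda>\<omega>. (rsum p n v \<omega> t - mean_ito \<omega> t)^2)"
    and "(\<integral>\<omega>. (rsum p n v \<omega> t - mean_ito \<omega> t)^2 \<partial>M) \<le> \<eta>"
proof -
  interpret PU: pair_sigma_finite M unit_interval_measure ..
  have IIm: "(\<lambda>x. ito_X (snd x) (fst x) t) \<in> borel_measurable (M \<Otimes>\<^sub>M unit_interval_measure)"
    by (rule ito_X_joint[OF _ _ t]) auto
  define st where "st \<omega> u = (\<Sum>k<n. ito_X (v k) \<omega> t * indicator {p k<..p (Suc k)} u)" for \<omega> u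
  define f where "f \<omega> u = st \<omega> u - ito_X u \<omega> t" for \<omega> u
  have "(\<lambda>x. st (fst x) (snd x)) \<in> borel_measurable (M \<Otimes>\<^sub>M unit_interval_measure)"
    unfolding st_def using ito_X_M[OF t] by measurable
  then have fm: "(\<lambda>x. f (fst x) (snd x)) \<in> borel_measurable (M \<Otimes>\<^sub>M unit_interval_measure)"
    unfolding f_def using IIm by measurable
  have fsec: "(\<lambda>u. f \<omega> u) \<in> borel_measurable unit_interval_measure" if "\<omega> \<in> space M" for \<omega>
    using measurable_Pair2[OF fm that] by simp
  have key: "AE u in unit_interval_measure. (\<integral>\<^sup>+\<omega>. ennreal ((f \<omega> u)^2) \<partial>M) \<le> ennreal \<eta>"
    using AE_unit_interval_measure
  proof eventually_elim
    case (elim u)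
    then obtain k where k: "k < n" "p k < u" "u \<le> p (Suc k)" using wpart_find[OF p] by blast
    have fu: "f \<omega> u = ito_X (v k) \<omega> t - ito_X u \<omega> t" for \<omega>
      unfolding f_def st_def using wpart_sum_indicator[OF p k] by simp
    have vk: "v k \<in> {0..1}" using v[OF k(1)] wpart_nonneg[OF p, of k] wpart_le[OF p, of "Suc k"] k by auto
    have "\<bar>v k - u\<bar> < d" using v[OF k(1)] mesh[OF k(1)] k by auto
    then have "(\<integral>\<omega>. (ito_X (v k) \<omega> t - ito_X u \<omega> t)^2 \<partial>M) < \<eta>" by (intro d vk) (use elim in auto)
    moreover have "integrable M (\<lambda>\<omega>. (ito_X (v k) \<omega> t - ito_X u \<omega> t)^2)"
      by (rule integrable_square_diff) (use ito_X_M[OF t] ito_X_sq[OF t] in auto)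
    ultimately show ?case unfolding fu by (subst nn_integral_eq_integral) (auto intro: ennreal_leI)
  qed
  have total: "(\<integral>\<^sup>+\<omega>. (\<integral>\<^sup>+u. ennreal ((f \<omega> u)^2) \<partial>unit_interval_measure) \<partial>M) \<le> ennreal \<eta>"
  proof -
    have "(\<integral>\<^sup>+\<omega>. (\<integral>\<^sup>+u. ennreal ((f \<omega> u)^2) \<partial>unit_interval_measure) \<partial>M) = (\<integral>\<^sup>+u. (\<integral>\<^sup>+\<omega>. ennreal ((f \<omega> u)^2) \<partial>M) \<partial>unit_interval_measure)"
      by (rule PU.Fubini'[symmetric]) (use fm in \<open>simp add: split_beta'\<close>)
    also have "\<dots> \<le> (\<integral>\<^sup>+u. ennreal \<eta> \<partial>unit_interval_measure)" by (rule nn_integral_mono_AE[OF key])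
    also have "\<dots> = ennreal \<eta>" using unit.emeasure_space_1 by simp
    finally show ?thesis .
  qed
  have inner_m: "(\<lambda>\<omega>. \<integral>\<^sup>+u. ennreal ((f \<omega> u)^2) \<partial>unit_interval_measure) \<in> borel_measurable M"
    by (rule unit.borel_measurable_nn_integral) (use fm in \<open>simp add: split_beta'\<close>)
  have "AE \<omega> in M. (\<integral>\<^sup>+u. ennreal ((f \<omega> u)^2) \<partial>unit_interval_measure) \<noteq> \<infinity>"
    by (rule nn_integral_PInf_AE[OF inner_m]) (use total in \<open>auto simp: top_unique\<close>)
  then have pointwise: "AE \<omega> in M. ennreal ((rsum p n v \<omega> t - mean_ito \<omega> t)^2) \<le> (\<integral>\<^sup>+u. ennreal ((f \<omega> u)^2) \<partial>unit_interval_measure)"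
    using AE_space
  proof eventually_elim
    case (elim \<omega>)
    have fsq: "integrable unit_interval_measure (\<lambda>u. (f \<omega> u)^2)"
      by (rule integrableI_bounded) (use elim fsec[OF elim(2)] in \<open>auto simp: less_top\<close>)
    have fi: "integrable unit_interval_measure (\<lambda>u. f \<omega> u)"
      by (rule unit.integrable_of_square[OF fsec[OF elim(2)] fsq])
    have sti: "integrable unit_interval_measure (\<lambda>u. ito_X (v k) \<omega> t * indicator {p k<..p (Suc k)} u)" for k
      by (intro integrable_mult_right unit.integrable_const_bound[where B=1]) (auto simp: indicator_def)
    have "(\<integral>u. indicator {p k<..p (Suc k)} u \<partial>unit_interval_measure) = p (Suc k) - p k" if "k < n" for k
    proof -
      have "p k \<le> p (Suc k)" "0 \<le> p k" "p (Suc k) \<le> 1"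
        using wpart_mono[OF p, of k "Suc k"] wpart_nonneg[OF p, of k] wpart_le[OF p, of "Suc k"] that by auto
      then have "(\<lambda>u. indicator {0..1} u * indicator {p k<..p (Suc k)} u) = (indicator {p k<..p (Suc k)} :: real \<Rightarrow> real)"
        by (auto simp: indicator_def fun_eq_iff)
      moreover have "(\<integral>u. indicator {p k<..p (Suc k)} u \<partial>unit_interval_measure) = (\<integral>u. indicator {0..1} u * indicator {p k<..p (Suc k)} u \<partial>lborel :: real)"
        by (rule integral_unit_interval_measure) simp
      ultimately show ?thesis using \<open>p k \<le> p (Suc k)\<close> by (simp only:) simp
    qed
    then have "rsum p n v \<omega> t = (\<integral>u. st \<omega> u \<partial>unit_interval_measure)"
      unfolding st_def rsum_def by (subst Bochner_Integration.integral_sum[OF sti]) simp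
    \<comment> \<open>Integrability of u \<mapsto> \<open>ito_X u \<omega> t\<close> is itself a
      consequence: it is a bounded step function minus \<open>f\<close>, and \<open>f\<close> is
      square integrable for almost every \<omega>.\<close>
    moreover have "integrable unit_interval_measure (\<lambda>u. ito_X u \<omega> t)"
    proof -
      have "integrable unit_interval_measure (\<lambda>u. st \<omega> u - f \<omega> u)"
        unfolding st_def by (intro Bochner_Integration.integrable_diff Bochner_Integration.integrable_sum fi sti)
      then show ?thesis by (simp add: f_def)
    qed
    moreover have "integrable unit_interval_measure (st \<omega>)" unfolding st_def by (intro Bochner_Integration.integrable_sum sti)
    ultimately have "rsum p n v \<omega> t - mean_ito \<omega> t = (\<integral>u. f \<omega> u \<partial>unit_interval_measure)"
      unfolding f_def mean_ito_def by simp
    then have "(rsum p n v \<omega> t - mean_ito \<omega> t)^2 \<le> (\<integral>u. (f \<omega> u)^2 \<partial>unit_interval_measure)"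
      using unit.square_integral_le[OF fsec[OF elim(2)] fsq] by simp
    then show ?case using nn_integral_eq_integral[OF fsq] by (simp add: ennreal_leI)
  qed
  have bound: "(\<integral>\<^sup>+\<omega>. ennreal ((rsum p n v \<omega> t - mean_ito \<omega> t)^2) \<partial>M) \<le> ennreal \<eta>"
    by (rule order_trans[OF nn_integral_mono_AE[OF pointwise] total])
  \<comment> \<open>Positivity is hidden in the hypothesis \<open>d\<close>, read at u = v =
    0.\<close>
  have \<eta>: "0 < \<eta>"
  proof -
    have "0 < n" using p by (cases n) (auto simp: wpart_def)
    then have "0 < d" using mesh[of 0] wpart_mono[OF p, of 0 1] by simp
    then have "(\<integral>\<omega>. (ito_X 0 \<omega> t - ito_X 0 \<omega> t)^2 \<partial>M) < \<eta>" by (intro d) auto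
    then show ?thesis by simp
  qed
  show i: "integrable M (\<lambda>\<omega>. (rsum p n v \<omega> t - mean_ito \<omega> t)^2)"
    using rsum_M[OF t] mean_ito_M[OF t] by (intro integrableI_bounded) (auto intro: le_less_trans[OF bound])
  show "(\<integral>\<omega>. (rsum p n v \<omega> t - mean_ito \<omega> t)^2 \<partial>M) \<le> \<eta>"
    using bound nn_integral_eq_integral[OF i] \<eta> by simp
qed


text \<open>E<X>_T equals E X_T^2 - E X_0^2, and the envelope bounds the first term by a quantity
  independent of u. Uniformity in u is what makes the bracket integrable over the starting
  point.\<close>

lemma clock_bound:
  "(\<integral>\<^sup>+\<omega>. (\<integral>\<^sup>+s. ennreal (indicator {0..T} s * rate u \<omega> s) \<partial>lborel) \<partial>M) \<le> ennreal (\<integral>\<omega>. (\<bar>X 0 \<omega> T\<bar> + \<bar>X 1 \<omega> T\<bar>)^2 \<partial>M)"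
proof -
  interpret U: ito_process M F T "X u" "rate u" by (rule ito_process_X)
  note TT = less_imp_le[OF T_pos] order_refl[of T]
  define A where "A \<omega> = (\<integral>s. indicator {0..T} s * rate u \<omega> s \<partial>lborel)" for \<omega>
  have space0: "space M \<in> sets (F 0)" using sets.top[of "F 0"] by (simp add: space_filt)
  have ind: "(\<integral>\<omega>. indicator (space M) \<omega> * f \<omega> \<partial>M) = (\<integral>\<omega>. f \<omega> \<partial>M)" for f :: "'a \<Rightarrow> real"
    by (intro Bochner_Integration.integral_cong) auto
  have iA: "integrable M A" unfolding A_def using U.integrable_fst[OF U.a_int] by simp
  have iX: "integrable M (\<lambda>\<omega>. (X v \<omega> s)^2)" if "s \<in> {0..T}" for v s using X_square_integrable that .
  have z: "(\<integral>s. indicator {0..0} s * rate u \<omega> s \<partial>lborel) = 0" for \<omega>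
    by (rule integral_eq_zero_AE) (use AE_lborel_singleton[of 0] in eventually_elim, auto simp: indicator_def)
  from mart_indicator[OF rate_finite(2) order_refl TT space0, of u]
  have "(\<integral>\<omega>. (X u \<omega> T)^2 - A \<omega> \<partial>M) = (\<integral>\<omega>. (X u \<omega> 0)^2 \<partial>M)"
    unfolding ind A_def z by simp
  then have "(\<integral>\<omega>. A \<omega> \<partial>M) = (\<integral>\<omega>. (X u \<omega> T)^2 \<partial>M) - (\<integral>\<omega>. (X u \<omega> 0)^2 \<partial>M)"
    using iA iX[of T u] TT by simp
  also have "\<dots> \<le> (\<integral>\<omega>. (X u \<omega> T)^2 \<partial>M)" by simp
  also have "\<dots> \<le> (\<integral>\<omega>. (\<bar>X 0 \<omega> T\<bar> + \<bar>X 1 \<omega> T\<bar>)^2 \<partial>M)"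
  proof (rule integral_mono)
    show "integrable M (\<lambda>\<omega>. (\<bar>X 0 \<omega> T\<bar> + \<bar>X 1 \<omega> T\<bar>)^2)"
      by (rule integrable_square_add) (use X_M[OF TT] iX TT in auto)
    show "(X u \<omega> T)^2 \<le> (\<bar>X 0 \<omega> T\<bar> + \<bar>X 1 \<omega> T\<bar>)^2" if "\<omega> \<in> space M" for \<omega>
      using power_mono[OF X_envelope[OF that] abs_ge_zero, of u T 2] by simp
  qed (use iX TT in auto)
  finally have A_le: "(\<integral>\<omega>. A \<omega> \<partial>M) \<le> (\<integral>\<omega>. (\<bar>X 0 \<omega> T\<bar> + \<bar>X 1 \<omega> T\<bar>)^2 \<partial>M)" .
  have "(\<integral>\<^sup>+\<omega>. (\<integral>\<^sup>+s. ennreal (indicator {0..T} s * rate u \<omega> s) \<partial>lborel) \<partial>M) = (\<integral>\<^sup>+\<omega>. ennreal (A \<omega>) \<partial>M)"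
  proof (rule nn_integral_cong_AE)
    show "AE \<omega> in M. (\<integral>\<^sup>+s. ennreal (indicator {0..T} s * rate u \<omega> s) \<partial>lborel) = ennreal (A \<omega>)"
      using U.a_AE
    proof eventually_elim
      case (elim \<omega>)
      then show ?case unfolding A_def by (intro nn_integral_eq_integral) (auto simp: rate_nonneg)
    qed
  qed
  also have "\<dots> = ennreal (\<integral>\<omega>. A \<omega> \<partial>M)"
    by (rule nn_integral_eq_integral[OF iA]) (auto simp: A_def rate_nonneg intro!: integral_nonneg_AE)
  also have "\<dots> \<le> ennreal (\<integral>\<omega>. (\<bar>X 0 \<omega> T\<bar> + \<bar>X 1 \<omega> T\<bar>)^2 \<partial>M)" by (rule ennreal_leI[OF A_le])
  finally show ?thesis .
qed

text \<open>Provides a single null set outside which the order of integration in u and s may be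
  exchanged, for all times t at once.\<close>

lemma rate_total_AE:
  "AE \<omega> in M. integrable (unit_interval_measure \<Otimes>\<^sub>M lborel) (\<lambda>(u, s). indicator {0..T} s * rate u \<omega> s)"
proof -
  interpret PU: pair_sigma_finite M unit_interval_measure ..
  have rm: "(\<lambda>z. rate (snd (fst z)) (fst (fst z)) (snd z)) \<in> borel_measurable ((M \<Otimes>\<^sub>M unit_interval_measure) \<Otimes>\<^sub>M lborel)"
    by (rule rate_joint) auto
  define g where "g \<omega> u = (\<integral>\<^sup>+s. ennreal (indicator {0..T} s * rate u \<omega> s) \<partial>lborel)" for \<omega> u
  have gm: "(\<lambda>(\<omega>, u). g \<omega> u) \<in> borel_measurable (M \<Otimes>\<^sub>M unit_interval_measure)"
    unfolding g_def split_beta'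
    by (rule lborel.borel_measurable_nn_integral) (use rm in \<open>simp add: split_beta'\<close>)
  have "(\<integral>\<^sup>+\<omega>. (\<integral>\<^sup>+u. g \<omega> u \<partial>unit_interval_measure) \<partial>M) = (\<integral>\<^sup>+u. (\<integral>\<^sup>+\<omega>. g \<omega> u \<partial>M) \<partial>unit_interval_measure)"
    by (rule PU.Fubini'[symmetric, OF gm])
  also have "\<dots> \<le> (\<integral>\<^sup>+u. ennreal (\<integral>\<omega>. (\<bar>X 0 \<omega> T\<bar> + \<bar>X 1 \<omega> T\<bar>)^2 \<partial>M) \<partial>unit_interval_measure)"
    unfolding g_def by (intro nn_integral_mono clock_bound)
  also have "\<dots> < \<infinity>" using unit.emeasure_space_1 by simp
  finally have fin: "(\<integral>\<^sup>+\<omega>. (\<integral>\<^sup>+u. g \<omega> u \<partial>unit_interval_measure) \<partial>M) < \<infinity>" .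
  have "(\<lambda>\<omega>. \<integral>\<^sup>+u. g \<omega> u \<partial>unit_interval_measure) \<in> borel_measurable M"
    by (rule unit.borel_measurable_nn_integral[OF gm])
  then have "AE \<omega> in M. (\<integral>\<^sup>+u. g \<omega> u \<partial>unit_interval_measure) \<noteq> \<infinity>"
    by (rule nn_integral_PInf_AE) (use fin in auto)
  then show ?thesis using AE_space
  proof eventually_elim
    case (elim \<omega>)
    have m: "(\<lambda>z. rate (fst z) \<omega> (snd z)) \<in> borel_measurable (unit_interval_measure \<Otimes>\<^sub>M lborel)"
      by (rule rate_joint) (use elim in auto)
    show ?case
    proof (rule integrableI_bounded)
      show "(\<lambda>(u, s). indicator {0..T} s * rate u \<omega> s) \<in> borel_measurable (unit_interval_measure \<Otimes>\<^sub>M lborel)"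
        unfolding split_beta' using m by measurable
      have "(\<integral>\<^sup>+z. ennreal (norm (case z of (u, s) \<Rightarrow> indicator {0..T} s * rate u \<omega> s)) \<partial>(unit_interval_measure \<Otimes>\<^sub>M lborel))
        = (\<integral>\<^sup>+z. ennreal (indicator {0..T} (snd z) * rate (fst z) \<omega> (snd z)) \<partial>(unit_interval_measure \<Otimes>\<^sub>M lborel))"
        by (intro nn_integral_cong) (auto simp: rate_nonneg)
      also have "\<dots> = (\<integral>\<^sup>+u. g \<omega> u \<partial>unit_interval_measure)"
        unfolding g_def by (subst lborel.nn_integral_fst[symmetric]) (use m in auto)
      also have "\<dots> < \<infinity>" using elim by (simp add: less_top)
      finally show "(\<integral>\<^sup>+z. ennreal (norm (case z of (u, s) \<Rightarrow> indicator {0..T} s * rate u \<omega> s)) \<partial>(unit_interval_measure \<Otimes>\<^sub>M lborel)) < \<infinity>" .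
    qed
  qed
qed

section \<open>The average over the starting point: pathwise form, continuity and martingale
  property\<close>

definition mean_drift :: "'a \<Rightarrow> real \<Rightarrow> real" where
  "mean_drift \<omega> s = (\<integral>u. \<phi>'' (X u \<omega> s) * rate u \<omega> s \<partial>unit_interval_measure)"

lemma X_section: "\<omega> \<in> space M \<Longrightarrow> (\<lambda>u. X u \<omega> s) \<in> borel_measurable unit_interval_measure"
  by (rule X_joint) auto

lemma \<phi>X_unit_integrable:
  assumes \<omega>: "\<omega> \<in> space M"
  shows "integrable unit_interval_measure (\<lambda>u. \<phi> (X u \<omega> s))"
proof (rule unit.integrable_const_bound[where B="\<bar>\<phi> 0\<bar> + C * (\<bar>X 0 \<omega> s\<bar> + \<bar>X 1 \<omega> s\<bar>)"])
  show "(\<lambda>u. \<phi> (X u \<omega> s)) \<in> borel_measurable unit_interval_measure" using X_section[OF \<omega>] by measurable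
  have "\<bar>\<phi> (X u \<omega> s)\<bar> \<le> \<bar>\<phi> 0\<bar> + C * (\<bar>X 0 \<omega> s\<bar> + \<bar>X 1 \<omega> s\<bar>)" for u
    using \<phi>_growth[of "X u \<omega> s"] mult_left_mono[OF X_envelope[OF \<omega>, of u s] C_nonneg] by linarith
  then show "AE u in unit_interval_measure. norm (\<phi> (X u \<omega> s)) \<le> \<bar>\<phi> 0\<bar> + C * (\<bar>X 0 \<omega> s\<bar> + \<bar>X 1 \<omega> s\<bar>)"
    by simp
qed

text \<open>For a fixed \<omega> outside the null set of \<open>rate_total_AE\<close>, boundedness
  of \<open>\<phi>''\<close> makes the drift integrable in (u, s), and Fubini interchanges the two
  integrations. Since the exceptional set does not depend on t, the formula holds at all times
  simultaneously.\<close>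

lemma mean_ito_formula:
  "AE \<omega> in M. integrable lborel (\<lambda>s. indicator {0..T} s * mean_drift \<omega> s) \<and>
     (\<forall>t\<in>{0..T}. mean_ito \<omega> t = (\<integral>u. \<phi> (X u \<omega> t) \<partial>unit_interval_measure) - (\<integral>u. \<phi> (X u \<omega> 0) \<partial>unit_interval_measure)
        - (\<integral>s. indicator {0..t} s * mean_drift \<omega> s \<partial>lborel) / 2)"
  using rate_total_AE AE_space
proof eventually_elim
  case (elim \<omega>)
  interpret UL: pair_sigma_finite unit_interval_measure lborel ..
  have m[measurable]: "(\<lambda>z. rate (fst z) \<omega> (snd z)) \<in> borel_measurable (unit_interval_measure \<Otimes>\<^sub>M lborel)"
    "(\<lambda>z. X (fst z) \<omega> (snd z)) \<in> borel_measurable (unit_interval_measure \<Otimes>\<^sub>M lborel)"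
    by (rule rate_joint X_joint; use elim in auto)+
  have hi: "integrable (unit_interval_measure \<Otimes>\<^sub>M lborel) (\<lambda>(u, s). indicator {0..t} s * (\<phi>'' (X u \<omega> s) * rate u \<omega> s))"
    if t: "t \<in> {0..T}" for t
  proof (rule Bochner_Integration.integrable_bound)
    show "integrable (unit_interval_measure \<Otimes>\<^sub>M lborel) (\<lambda>z. C * (case z of (u, s) \<Rightarrow> indicator {0..T} s * rate u \<omega> s))"
      by (rule integrable_mult_right[OF elim(1)])
    show "(\<lambda>(u, s). indicator {0..t} s * (\<phi>'' (X u \<omega> s) * rate u \<omega> s)) \<in> borel_measurable (unit_interval_measure \<Otimes>\<^sub>M lborel)"
      unfolding split_beta' by measurable
    show "AE z in unit_interval_measure \<Otimes>\<^sub>M lborel. norm (case z of (u, s) \<Rightarrow> indicator {0..t} s * (\<phi>'' (X u \<omega> s) * rate u \<omega> s))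
        \<le> norm (C * (case z of (u, s) \<Rightarrow> indicator {0..T} s * rate u \<omega> s))"
      using t C_nonneg rate_nonneg b2 by (intro AE_I2) (auto simp: indicator_def abs_mult intro!: mult_right_mono)
  qed
  have md: "(\<integral>u. indicator {0..t} s * (\<phi>'' (X u \<omega> s) * rate u \<omega> s) \<partial>unit_interval_measure) = indicator {0..t} s * mean_drift \<omega> s" for t s
    by (simp add: mean_drift_def)
  have "integrable lborel (\<lambda>s. indicator {0..T} s * mean_drift \<omega> s)"
    using UL.integrable_snd[OF hi[of T]] T_pos unfolding md by simp
  moreover have "mean_ito \<omega> t = (\<integral>u. \<phi> (X u \<omega> t) \<partial>unit_interval_measure) - (\<integral>u. \<phi> (X u \<omega> 0) \<partial>unit_interval_measure)
        - (\<integral>s. indicator {0..t} s * mean_drift \<omega> s \<partial>lborel) / 2" if t: "t \<in> {0..T}" for t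
  proof -
    have "(\<integral>s. indicator {0..t} s * mean_drift \<omega> s \<partial>lborel)
      = (\<integral>u. (\<integral>s. indicator {0..t} s * (\<phi>'' (X u \<omega> s) * rate u \<omega> s) \<partial>lborel) \<partial>unit_interval_measure)"
      using UL.Fubini_integral[OF hi[OF t]] unfolding md by simp
    moreover have "integrable unit_interval_measure (\<lambda>u. \<integral>s. indicator {0..t} s * (\<phi>'' (X u \<omega> s) * rate u \<omega> s) \<partial>lborel)"
      using UL.integrable_fst[OF hi[OF t]] by simp
    ultimately show ?thesis
      unfolding mean_ito_def ito_X_def using \<phi>X_unit_integrable[OF elim(2)] by simp
  qed
  ultimately show ?case by blast
qed

text \<open>Dominated convergence in u: the envelope is bounded on [0, T] for a fixed path, and
  \<open>\<phi>\<close> grows at most linearly.\<close>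

lemma mean_\<phi>_continuous:
  assumes \<omega>: "\<omega> \<in> space M"
  shows "continuous_on {0..T} (\<lambda>t. \<integral>u. \<phi> (X u \<omega> t) \<partial>unit_interval_measure)"
proof (subst continuous_on_sequentially, intro ballI allI impI, elim conjE)
  fix t and s :: "nat \<Rightarrow> real" assume t: "t \<in> {0..T}" and s: "\<forall>n. s n \<in> {0..T}" "s \<longlonglongrightarrow> t"
  have "compact ((\<lambda>r. \<bar>X 0 \<omega> r\<bar> + \<bar>X 1 \<omega> r\<bar>) ` {0..T})"
    by (intro compact_continuous_image continuous_intros X_continuous[OF \<omega>]) auto
  then obtain K where K: "\<And>r. r \<in> {0..T} \<Longrightarrow> \<bar>\<bar>X 0 \<omega> r\<bar> + \<bar>X 1 \<omega> r\<bar>\<bar> \<le> K"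
    unfolding compact_eq_bounded_closed bounded_real by blast
  have m: "(\<lambda>u. \<phi> (X u \<omega> r)) \<in> borel_measurable unit_interval_measure" for r using X_section[OF \<omega>] by measurable
  show "((\<lambda>t. \<integral>u. \<phi> (X u \<omega> t) \<partial>unit_interval_measure) \<circ> s) \<longlonglongrightarrow> (\<integral>u. \<phi> (X u \<omega> t) \<partial>unit_interval_measure)"
    unfolding o_def
  proof (rule integral_dominated_convergence[where w="\<lambda>_. \<bar>\<phi> 0\<bar> + C * K"])
    show "(\<lambda>u. \<phi> (X u \<omega> t)) \<in> borel_measurable unit_interval_measure" by (rule m)
    show "(\<lambda>u. \<phi> (X u \<omega> (s n))) \<in> borel_measurable unit_interval_measure" for n by (rule m)
    show "AE u in unit_interval_measure. (\<lambda>n. \<phi> (X u \<omega> (s n))) \<longlonglongrightarrow> \<phi> (X u \<omega> t)"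
    proof (rule AE_I2)
      fix u
      have "(\<lambda>n. X u \<omega> (s n)) \<longlonglongrightarrow> X u \<omega> t"
        by (rule continuous_on_tendsto_compose[OF X_continuous[OF \<omega>] s(2) t]) (use s in simp)
      then show "(\<lambda>n. \<phi> (X u \<omega> (s n))) \<longlonglongrightarrow> \<phi> (X u \<omega> t)"
        by (rule continuous_on_tendsto_compose[OF \<phi>_cont[of UNIV]]) auto
    qed
    have "\<bar>\<phi> (X u \<omega> (s n))\<bar> \<le> \<bar>\<phi> 0\<bar> + C * K" for u n
    proof -
      have "\<bar>X u \<omega> (s n)\<bar> \<le> K" using X_envelope[OF \<omega>, of u "s n"] K[of "s n"] s(1) by (meson abs_ge_self order_trans)
      then show ?thesis using \<phi>_growth[of "X u \<omega> (s n)"] mult_left_mono[OF _ C_nonneg] by fastforce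
    qed
    then show "AE u in unit_interval_measure. norm (\<phi> (X u \<omega> (s n))) \<le> \<bar>\<phi> 0\<bar> + C * K" for n by simp
  qed simp
qed

lemma mean_ito_continuous: "AE \<omega> in M. continuous_on {0..T} (mean_ito \<omega>)"
  using mean_ito_formula AE_space
proof eventually_elim
  case (elim \<omega>)
  have "continuous_on {0..T} (\<lambda>t. (\<integral>u. \<phi> (X u \<omega> t) \<partial>unit_interval_measure) - (\<integral>u. \<phi> (X u \<omega> 0) \<partial>unit_interval_measure)
        - (\<integral>s. indicator {0..t} s * mean_drift \<omega> s \<partial>lborel) / 2)"
    using continuous_on_integral_upto[OF conjunct1[OF elim(1)]] mean_\<phi>_continuous[OF elim(2)]
    by (auto intro!: continuous_intros)
  then show ?case
    by (rule continuous_on_eq) (use elim(1) in simp)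
qed

lemma rsum_tendsto:
  assumes t: "0 \<le> t" "t \<le> T" and P: "\<And>n. 1 \<le> n \<Longrightarrow> wpart 1 (P n) n"
    and V: "\<And>n k. 1 \<le> n \<Longrightarrow> k < n \<Longrightarrow> V n k \<in> {P n k..P n (Suc k)}"
    and mesh: "(\<lambda>n. mesh (P n) n) \<longlonglongrightarrow> 0"
  shows "(\<lambda>n. \<integral>\<omega>. (rsum (P n) n (V n) \<omega> t - mean_ito \<omega> t)^2 \<partial>M) \<longlonglongrightarrow> 0"
proof (rule LIMSEQ_I)
  fix \<eta> :: real assume \<eta>: "0 < \<eta>"
  then have "0 < \<eta> / 2" by simp
  from ito_X_uniformly_continuous[OF t this] obtain d where d: "0 < d"
    "\<And>u v. u \<in> {0..1} \<Longrightarrow> v \<in> {0..1} \<Longrightarrow> \<bar>u - v\<bar> < d \<Longrightarrow> (\<integral>\<omega>. (ito_X u \<omega> t - ito_X v \<omega> t)^2 \<partial>M) < \<eta> / 2"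
    by blast
  have "\<forall>\<^sub>F n in sequentially. norm ((\<integral>\<omega>. (rsum (P n) n (V n) \<omega> t - mean_ito \<omega> t)^2 \<partial>M) - 0) < \<eta>"
    using order_tendstoD(2)[OF mesh d(1)] eventually_ge_at_top[of 1]
  proof eventually_elim
    case (elim n)
    have "P n (Suc k) - P n k < d" if "k < n" for k
    proof -
      have "P n (Suc k) - P n k \<le> mesh (P n) n"
        unfolding mesh_def by (rule Max_ge) (use that in auto)
      then show ?thesis using elim by simp
    qed
    then have "(\<integral>\<omega>. (rsum (P n) n (V n) \<omega> t - mean_ito \<omega> t)^2 \<partial>M) \<le> \<eta> / 2"
      by (intro rsum_error[OF t P V _ d(2)] elim(2)) auto
    then show ?case using \<eta> by simp
  qed
  then show "\<exists>no. \<forall>n\<ge>no. norm ((\<integral>\<omega>. (rsum (P n) n (V n) \<omega> t - mean_ito \<omega> t)^2 \<partial>M) - 0) < \<eta>"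
    by (simp add: eventually_sequentially)
qed

text \<open>The average is one sufficiently fine Riemann sum minus its error, and both are square
  integrable.\<close>

lemma mean_ito_square_integrable:
  assumes t: "0 \<le> t" "t \<le> T"
  shows "integrable M (\<lambda>\<omega>. (mean_ito \<omega> t)^2)"
proof -
  obtain d where d: "0 < d" "\<And>u v. u \<in> {0..1} \<Longrightarrow> v \<in> {0..1} \<Longrightarrow> \<bar>u - v\<bar> < d \<Longrightarrow> (\<integral>\<omega>. (ito_X u \<omega> t - ito_X v \<omega> t)^2 \<partial>M) < 1"
    using ito_X_uniformly_continuous[OF t, of 1] by auto
  obtain n :: nat where n: "1 / d < real n" using reals_Archimedean2 by blast
  have n1: "1 \<le> n" using n d(1) by (cases n) (auto simp: not_less)
  let ?p = "uniform_partition 1 n"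
  have w: "wpart 1 ?p n" by (intro wpart_part part_uniform n1) simp
  have step: "?p (Suc k) - ?p k = 1 / real n" for k using n1 by (simp add: uniform_partition_def field_simps)
  have "1 / real n < d" using n d(1) n1 by (simp add: field_simps)
  then have i: "integrable M (\<lambda>\<omega>. (rsum ?p n ?p \<omega> t - mean_ito \<omega> t)^2)"
    by (intro rsum_error(1)[OF t w, of ?p d 1] d(2)) (use step wpart_mono[OF w] in auto)
  have "integrable M (\<lambda>\<omega>. (rsum ?p n ?p \<omega> t - (rsum ?p n ?p \<omega> t - mean_ito \<omega> t))^2)"
    by (rule integrable_square_diff) (use i rsum_sq[OF t] rsum_M[OF t] mean_ito_M[OF t] in auto)
  then show ?thesis by simp
qed

lemma mean_ito_integrable: "0 \<le> t \<Longrightarrow> t \<le> T \<Longrightarrow> integrable M (\<lambda>\<omega>. mean_ito \<omega> t)"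
  by (rule integrable_of_square[OF mean_ito_M mean_ito_square_integrable])

lemma uniform_rsum_tendsto:
  assumes t: "0 \<le> t" "t \<le> T"
  shows "(\<lambda>n. \<integral>\<omega>. (rsum (uniform_partition 1 n) n (uniform_partition 1 n) \<omega> t - mean_ito \<omega> t)^2 \<partial>M) \<longlonglongrightarrow> 0"
proof (rule rsum_tendsto[OF t])
  fix n :: nat assume n: "1 \<le> n"
  show w: "wpart 1 (uniform_partition 1 n) n" by (intro wpart_part part_uniform n) simp
  show "uniform_partition 1 n k \<in> {uniform_partition 1 n k..uniform_partition 1 n (Suc k)}" if "k < n" for k
    using wpart_mono[OF w, of k "Suc k"] that by simp
qed (rule mesh_uniform, simp)

text \<open>The Riemann sums are finite combinations of martingales, and their L2 convergence at
  each time implies the L1 convergence through which the martingale property passes.\<close>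

lemma mean_ito_mart: "mart M F T mean_ito"
proof (rule mart_L1_limit[where N="\<lambda>n. rsum (uniform_partition 1 n) n (uniform_partition 1 n)"])
  show "mart M F T (rsum (uniform_partition 1 n) n (uniform_partition 1 n))" for n by (rule rsum_mart)
  fix t assume t: "0 \<le> t" "t \<le> T"
  show "(\<lambda>\<omega>. mean_ito \<omega> t) \<in> borel_measurable (F t)" by (rule mean_ito_F[OF t])
  show "integrable M (\<lambda>\<omega>. mean_ito \<omega> t)" by (rule mean_ito_integrable[OF t])
  have lim: "(\<lambda>n. sqrt (\<integral>\<omega>. (rsum (uniform_partition 1 n) n (uniform_partition 1 n) \<omega> t - mean_ito \<omega> t)^2 \<partial>M)) \<longlonglongrightarrow> sqrt 0"
    by (intro tendsto_real_sqrt uniform_rsum_tendsto t)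
  show "(\<lambda>n. \<integral>\<omega>. \<bar>rsum (uniform_partition 1 n) n (uniform_partition 1 n) \<omega> t - mean_ito \<omega> t\<bar> \<partial>M) \<longlonglongrightarrow> 0"
  proof (rule tendsto_sandwich[OF _ _ tendsto_const lim[simplified]])
    have "(\<integral>\<omega>. \<bar>rsum p n v \<omega> t - mean_ito \<omega> t\<bar> \<partial>M) \<le> sqrt (\<integral>\<omega>. (rsum p n v \<omega> t - mean_ito \<omega> t)^2 \<partial>M)" for p n v
      by (rule integral_abs_le_sqrt)
        (use rsum_M[OF t] mean_ito_M[OF t] integrable_square_diff[OF _ _ rsum_sq[OF t] mean_ito_square_integrable[OF t]] in auto)
    then show "\<forall>\<^sub>F n in sequentially. (\<integral>\<omega>. \<bar>rsum (uniform_partition 1 n) n (uniform_partition 1 n) \<omega> t - mean_ito \<omega> t\<bar> \<partial>M)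
       \<le> sqrt (\<integral>\<omega>. (rsum (uniform_partition 1 n) n (uniform_partition 1 n) \<omega> t - mean_ito \<omega> t)^2 \<partial>M)" by simp
  qed simp
qed

section \<open>Identification with the double stochastic integral\<close>

lemma stoch_int_rsum:
  assumes "\<And>k. k < n \<Longrightarrow> v k \<in> {0..1}"
  shows "AE \<omega> in M. (\<Sum>k<n. stoch_int M F T (\<lambda>\<omega> s. \<phi>' (y \<omega> (v k) s)) (\<lambda>\<omega> s. y \<omega> (v k) s) \<omega> T * (p (Suc k) - p k)) = rsum p n v \<omega> T"
proof -
  have "AE \<omega> in M. \<forall>k\<in>{..<n}. stoch_int M F T (\<lambda>\<omega> s. \<phi>' (y \<omega> (v k) s)) (\<lambda>\<omega> s. y \<omega> (v k) s) \<omega> T = ito_X (v k) \<omega> T"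
    by (rule AE_finite_allI) (use assms stoch_int_ito_X in auto)
  then show ?thesis by eventually_elim (simp add: rsum_def)
qed


text \<open>The chosen integral is measurable because its defining property contains adaptedness,
  and that property holds for the choice because the explicit integral satisfies it.\<close>

lemma stoch_int_M:
  assumes v: "v \<in> {0..1}"
  shows "(\<lambda>\<omega>. stoch_int M F T (\<lambda>\<omega> s. \<phi>' (y \<omega> v s)) (\<lambda>\<omega> s. y \<omega> v s) \<omega> T) \<in> borel_measurable M"
proof -
  have "ito_is M F T (\<lambda>\<omega> s. \<phi>' (y \<omega> v s)) (\<lambda>\<omega> s. y \<omega> v s) (ito_X v)"
    unfolding ito_X_eq[symmetric] by (rule ito_calculus.ito_is_ito_int[OF ito_calculus_X]) (rule X_eq[OF v, symmetric])
  then have "ito_is M F T (\<lambda>\<omega> s. \<phi>' (y \<omega> v s)) (\<lambda>\<omega> s. y \<omega> v s) (stoch_int M F T (\<lambda>\<omega> s. \<phi>' (y \<omega> v s)) (\<lambda>\<omega> s. y \<omega> v s))"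
    unfolding stoch_int_def by (rule someI[of "ito_is M F T (\<lambda>\<omega> s. \<phi>' (y \<omega> v s)) (\<lambda>\<omega> s. y \<omega> v s)"])
  then have "mart M F T (stoch_int M F T (\<lambda>\<omega> s. \<phi>' (y \<omega> v s)) (\<lambda>\<omega> s. y \<omega> v s))"
    by (simp add: ito_is_def cmart_def)
  from mart_adapted[OF this, of T] show ?thesis using T_pos by (intro adapted_M[of _ T]) auto
qed

lemma stoch_int_rsum_error:
  assumes "\<And>k. k < n \<Longrightarrow> v k \<in> {0..1}" and J: "J \<in> borel_measurable M"
  shows "(\<integral>\<omega>. ((\<Sum>k<n. stoch_int M F T (\<lambda>\<omega> s. \<phi>' (y \<omega> (v k) s)) (\<lambda>\<omega> s. y \<omega> (v k) s) \<omega> T * (p (Suc k) - p k)) - J \<omega>)^2 \<partial>M)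
     = (\<integral>\<omega>. (rsum p n v \<omega> T - J \<omega>)^2 \<partial>M)"
proof (rule integral_cong_AE)
  have [measurable]: "(\<lambda>\<omega>. rsum p n v \<omega> T) \<in> borel_measurable M" by (rule rsum_M) (use T_pos in auto)
  show "(\<lambda>\<omega>. (rsum p n v \<omega> T - J \<omega>)^2) \<in> borel_measurable M" using J by measurable
  show "(\<lambda>\<omega>. ((\<Sum>k<n. stoch_int M F T (\<lambda>\<omega> s. \<phi>' (y \<omega> (v k) s)) (\<lambda>\<omega> s. y \<omega> (v k) s) \<omega> T * (p (Suc k) - p k)) - J \<omega>)^2) \<in> borel_measurable M"
    by (intro borel_measurable_power borel_measurable_diff borel_measurable_sum borel_measurable_times stoch_int_M J)
      (use assms in auto)
  show "AE \<omega> in M. ((\<Sum>k<n. stoch_int M F T (\<lambda>\<omega> s. \<phi>' (y \<omega> (v k) s)) (\<lambda>\<omega> s. y \<omega> (v k) s) \<omega> T * (p (Suc k) - p k)) - J \<omega>)^2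
     = (rsum p n v \<omega> T - J \<omega>)^2"
    using stoch_int_rsum[of n v p] assms by auto
qed

lemma tagged_in_unit_interval:
  assumes "wpart 1 p n" "k < n" "v \<in> {p k..p (Suc k)}"
  shows "v \<in> {0..1}"
  using wpart_nonneg[OF assms(1), of k] wpart_le[OF assms(1), of "Suc k"] assms by auto

lemma dint_is_mean_ito: "dint_is M T y \<phi>' mean_ito"
  unfolding dint_is_def
proof (intro conjI allI impI)
  show "cmart M F T mean_ito"
    unfolding cmart_def using mean_ito_mart mean_ito_square_integrable mean_ito_continuous by auto
  fix P V :: "nat \<Rightarrow> nat \<Rightarrow> real"
  assume *: "(\<forall>n\<ge>1. part 0 1 (P n) n \<and> (\<forall>k<n. V n k \<in> {P n k..P n (Suc k)})) \<and> (\<lambda>n. mesh (P n) n) \<longlonglongrightarrow> 0"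
  have TT: "0 \<le> T" "T \<le> T" using T_pos by auto
  have w: "wpart 1 (P n) n" if "1 \<le> n" for n using * that by (auto intro: wpart_part)
  have V: "V n k \<in> {P n k..P n (Suc k)}" if "1 \<le> n" "k < n" for n k using * that by blast
  have "(\<lambda>n. \<integral>\<omega>. (rsum (P n) n (V n) \<omega> T - mean_ito \<omega> T)^2 \<partial>M) \<longlonglongrightarrow> 0"
    by (rule rsum_tendsto[OF TT w V]) (use * in auto)
  moreover have "\<forall>\<^sub>F n in sequentially. (\<integral>\<omega>. (rsum (P n) n (V n) \<omega> T - mean_ito \<omega> T)^2 \<partial>M)
     = (\<integral>\<omega>. ((\<Sum>k<n. stoch_int M F T (\<lambda>\<omega> s. \<phi>' (y \<omega> (V n k) s)) (\<lambda>\<omega> s. y \<omega> (V n k) s) \<omega> T * (P n (Suc k) - P n k)) - mean_ito \<omega> T)^2 \<partial>M)"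
    using eventually_ge_at_top[of 1]
  proof eventually_elim
    case (elim n)
    show ?case
      by (rule stoch_int_rsum_error[symmetric])
        (use tagged_in_unit_interval[OF w[OF elim]] V[OF elim] mean_ito_M[OF TT] in auto)
  qed
  ultimately show "(\<lambda>n. \<integral>\<omega>. ((\<Sum>k<n. stoch_int M F T (\<lambda>\<omega> s. \<phi>' (y \<omega> (V n k) s)) (\<lambda>\<omega> s. y \<omega> (V n k) s) \<omega> T * (P n (Suc k) - P n k)) - mean_ito \<omega> T)^2 \<partial>M) \<longlonglongrightarrow> 0"
    by (rule Lim_transform_eventually)
qed

text \<open>The norm of the martingale space only sees time T. Equality there propagates to each
  earlier time by conditional expectation, and to all times simultaneously by continuity of both
  paths.\<close>

lemma dint_is_unique:
  assumes J: "dint_is M T y \<phi>' J"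
  shows "AE \<omega> in M. \<forall>t\<in>{0..T}. J \<omega> t = mean_ito \<omega> t"
proof -
  have TT: "0 \<le> T" "T \<le> T" using T_pos by auto
  have Jc: "cmart M F T J" using J by (simp add: dint_is_def)
  then have Jm: "mart M F T J" and Jsq: "integrable M (\<lambda>\<omega>. (J \<omega> T)^2)" and Jcont: "AE \<omega> in M. continuous_on {0..T} (J \<omega>)"
    using TT by (auto simp: cmart_def)
  have JM: "(\<lambda>\<omega>. J \<omega> t) \<in> borel_measurable M" if "0 \<le> t" "t \<le> T" for t
    by (rule adapted_M[OF mart_adapted[OF Jm that] that])
  let ?P = "uniform_partition 1"
  have part: "part 0 1 (?P n) n" if "1 \<le> n" for n using that by (intro part_uniform) auto
  have tag: "?P n k \<in> {?P n k..?P n (Suc k)}" if "1 \<le> n" "k < n" for n k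
    using wpart_mono[OF wpart_part[OF part[OF that(1)]], of k "Suc k"] that by simp
  have "\<forall>P V :: nat \<Rightarrow> nat \<Rightarrow> real. (\<forall>n\<ge>1. part 0 1 (P n) n \<and> (\<forall>k<n. V n k \<in> {P n k..P n (Suc k)})) \<and> (\<lambda>n. mesh (P n) n) \<longlonglongrightarrow> 0 \<longrightarrow>
     (\<lambda>n. \<integral>\<omega>. ((\<Sum>k<n. stoch_int M F T (\<lambda>\<omega> s. \<phi>' (y \<omega> (V n k) s)) (\<lambda>\<omega> s. y \<omega> (V n k) s) \<omega> T * (P n (Suc k) - P n k)) - J \<omega> T)^2 \<partial>M) \<longlonglongrightarrow> 0"
    using J by (simp add: dint_is_def)
  from this[rule_format, of ?P ?P]
  have "(\<lambda>n. \<integral>\<omega>. ((\<Sum>k<n. stoch_int M F T (\<lambda>\<omega> s. \<phi>' (y \<omega> (?P n k) s)) (\<lambda>\<omega> s. y \<omega> (?P n k) s) \<omega> T * (?P n (Suc k) - ?P n k)) - J \<omega> T)^2 \<partial>M) \<longlonglongrightarrow> 0"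
    using part tag mesh_uniform[of 1] by simp
  moreover have "\<forall>\<^sub>F n in sequentially. (\<integral>\<omega>. ((\<Sum>k<n. stoch_int M F T (\<lambda>\<omega> s. \<phi>' (y \<omega> (?P n k) s)) (\<lambda>\<omega> s. y \<omega> (?P n k) s) \<omega> T * (?P n (Suc k) - ?P n k)) - J \<omega> T)^2 \<partial>M)
     = (\<integral>\<omega>. (rsum (?P n) n (?P n) \<omega> T - J \<omega> T)^2 \<partial>M)"
    using eventually_ge_at_top[of 1]
  proof eventually_elim
    case (elim n)
    show ?case
      by (rule stoch_int_rsum_error)
        (use tagged_in_unit_interval[OF wpart_part[OF part[OF elim]]] tag[OF elim] JM[OF TT] in auto)
  qed
  ultimately have limJ: "(\<lambda>n. \<integral>\<omega>. (rsum (?P n) n (?P n) \<omega> T - J \<omega> T)^2 \<partial>M) \<longlonglongrightarrow> 0"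
    by (rule Lim_transform_eventually)
  have final: "AE \<omega> in M. J \<omega> T = mean_ito \<omega> T"
    by (rule L2_limit_unique[OF _ JM[OF TT] mean_ito_M[OF TT] _ Jsq mean_ito_square_integrable[OF TT] limJ uniform_rsum_tendsto[OF TT]])
      (use rsum_M[OF TT] rsum_sq[OF TT] in auto)
  have at: "AE \<omega> in M. J \<omega> t = mean_ito \<omega> t" if t: "0 \<le> t" "t \<le> T" for t
  proof -
    interpret sigma_finite_subalgebra M "F t" by (rule subalgebra_sigma_finite) (use sub t in simp)
    have "AE \<omega> in M. real_cond_exp M (F t) (\<lambda>\<omega>. J \<omega> T) \<omega> = real_cond_exp M (F t) (\<lambda>\<omega>. mean_ito \<omega> T) \<omega>"
      by (rule real_cond_exp_cong[OF final JM[OF TT] mean_ito_M[OF TT]])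
    moreover have "AE \<omega> in M. real_cond_exp M (F t) (\<lambda>\<omega>. J \<omega> T) \<omega> = J \<omega> t" using Jm t by (auto simp: mart_def)
    moreover have "AE \<omega> in M. real_cond_exp M (F t) (\<lambda>\<omega>. mean_ito \<omega> T) \<omega> = mean_ito \<omega> t" using mean_ito_mart t by (auto simp: mart_def)
    ultimately show ?thesis by eventually_elim simp
  qed
  \<comment> \<open>Clipped rationals form a countable dense set of times in [0, T], so one null set
    suffices.\<close>
  have "AE \<omega> in M. \<forall>q::rat. J \<omega> (clip T (of_rat q)) = mean_ito \<omega> (clip T (of_rat q))"
    unfolding AE_all_countable using at TT by simp
  then show ?thesis using Jcont mean_ito_continuous
  proof eventually_elim
    case (elim \<omega>)
    define g where "g r = J \<omega> (clip T r) - mean_ito \<omega> (clip T r)" for r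
    have "continuous_on UNIV (\<lambda>r. J \<omega> (clip T r))" "continuous_on UNIV (\<lambda>r. mean_ito \<omega> (clip T r))"
      by (rule continuous_on_compose2[OF elim(2) continuous_on_clip] continuous_on_compose2[OF elim(3) continuous_on_clip];
        use TT in auto)+
    then have gc: "continuous_on UNIV g" unfolding g_def by (intro continuous_intros)
    have "g r = 0" for r
    proof (rule ccontr)
      assume r: "g r \<noteq> 0"
      have "open (g -` (- {0}))" by (rule open_vimage[OF _ gc]) auto
      with r obtain e where e: "0 < e" "\<And>q. dist q r < e \<Longrightarrow> g q \<noteq> 0" unfolding open_dist by force
      obtain q :: rat where "r < of_rat q" "of_rat q < r + e" using of_rat_dense[of r "r + e"] e by auto
      then have "g (of_rat q) \<noteq> 0" by (intro e) (simp add: dist_real_def)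
      then show False using elim(1) by (simp add: g_def)
    qed
    then show ?case by (metis atLeastAtMost_iff clip_id diff_eq_eq add_0 g_def)
  qed
qed

lemma mean_ito_identity:
  "AE \<omega> in M. \<forall>t\<in>{0..T}. (LINT u:{0..1}|lborel. \<phi> (y \<omega> u t))
     = (LINT u:{0..1}|lborel. \<phi> u) + mean_ito \<omega> t
       + 1/2 * (LINT s:{0..t}|lborel. LINT u:{0..1}|lborel. \<phi>'' (y \<omega> u s) / mfun y \<omega> u s)"
  using mean_ito_formula AE_space
proof eventually_elim
  case (elim \<omega>)
  have m[measurable]: "(\<lambda>u. X u \<omega> s) \<in> borel_measurable borel" "(\<lambda>u. rate u \<omega> s) \<in> borel_measurable borel" for s
    by (rule X_joint rate_joint; use elim in simp)+
  have 1: "(\<integral>u. \<phi> (X u \<omega> t) \<partial>unit_interval_measure) = (LINT u:{0..1}|lborel. \<phi> (y \<omega> u t))" if "t \<in> {0..T}" for t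
    unfolding set_lebesgue_integral_def using that
    by (subst integral_unit_interval_measure) (auto intro!: Bochner_Integration.integral_cong simp: indicator_def X_eq)
  have 2: "(\<integral>u. \<phi> (X u \<omega> 0) \<partial>unit_interval_measure) = (LINT u:{0..1}|lborel. \<phi> u)"
    unfolding set_lebesgue_integral_def using elim(2)
    by (subst integral_unit_interval_measure) (auto intro!: Bochner_Integration.integral_cong simp: indicator_def X_0 clip_id)
  \<comment> \<open>On [0,1] and [0,T] clipping is the identity. Where \<open>mfun\<close> vanishes,
    the quotient and the product with \<open>rate\<close> both take the value 0.\<close>
  have 3: "mean_drift \<omega> s = (LINT u:{0..1}|lborel. \<phi>'' (y \<omega> u s) / mfun y \<omega> u s)" if "s \<in> {0..T}" for s
    unfolding set_lebesgue_integral_def mean_drift_def using that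
    by (subst integral_unit_interval_measure) (auto intro!: Bochner_Integration.integral_cong simp: indicator_def X_eq rate_eq divide_inverse)
  have 4: "(\<integral>s. indicator {0..t} s * mean_drift \<omega> s \<partial>lborel) = (LINT s:{0..t}|lborel. LINT u:{0..1}|lborel. \<phi>'' (y \<omega> u s) / mfun y \<omega> u s)"
    if "t \<in> {0..T}" for t
  proof -
    have eq: "indicator {0..t} s * mean_drift \<omega> s = indicator {0..t} s *\<^sub>R (LINT u:{0..1}|lborel. \<phi>'' (y \<omega> u s) / mfun y \<omega> u s)" for s
      using 3[of s] that by (cases "s \<in> {0..t}") auto
    show ?thesis unfolding set_lebesgue_integral_def[of lborel "{0..t}"]
      by (rule Bochner_Integration.integral_cong[OF refl]) (rule eq)
  qed
  show ?case using elim(1) 1 2 4 by auto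
qed

theorem dint_formula:
  "(\<exists>J. dint_is M T y \<phi>' J) \<and>
   (\<forall>J. dint_is M T y \<phi>' J \<longrightarrow>
     (AE \<omega> in M. \<forall>t\<in>{0..T}.
        (LINT u:{0..1}|lborel. \<phi> (y \<omega> u t))
          = (LINT u:{0..1}|lborel. \<phi> u) + J \<omega> t
            + 1/2 * (LINT s:{0..t}|lborel. LINT u:{0..1}|lborel. \<phi>'' (y \<omega> u s) / mfun y \<omega> u s)))"
proof (intro conjI allI impI)
  show "\<exists>J. dint_is M T y \<phi>' J" using dint_is_mean_ito by blast
  fix J assume "dint_is M T y \<phi>' J"
  from dint_is_unique[OF this] mean_ito_identity
  show "AE \<omega> in M. \<forall>t\<in>{0..T}.
        (LINT u:{0..1}|lborel. \<phi> (y \<omega> u t))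
          = (LINT u:{0..1}|lborel. \<phi> u) + J \<omega> t
            + 1/2 * (LINT s:{0..t}|lborel. LINT u:{0..1}|lborel. \<phi>'' (y \<omega> u s) / mfun y \<omega> u s)"
    by eventually_elim simp
qed

end

theorem theorem3p1:
  fixes M :: "'a measure" and T :: real and y :: "'a \<Rightarrow> real \<Rightarrow> real \<Rightarrow> real"
    and \<phi> \<phi>' \<phi>'' :: "real \<Rightarrow> real"
  assumes "prob_space M" and "T > 0"
    and "random_D M T y"
    and C1: "\<forall>u\<in>{0..1}. cmart M (filt M y) T (\<lambda>\<omega> t. y \<omega> u t)"
    and C2: "\<forall>\<omega>\<in>space M. \<forall>u\<in>{0..1}. y \<omega> u 0 = u"
    and C3: "\<forall>\<omega>\<in>space M. \<forall>u\<in>{0..1}. \<forall>v\<in>{0..1}. \<forall>t\<in>{0..T}. u < v \<longrightarrow> y \<omega> u t \<le> y \<omega> v t"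
    and C4: "\<forall>u\<in>{0..1}. \<exists>A. is_covariation M (filt M y) T (\<lambda>\<omega> t. y \<omega> u t) (\<lambda>\<omega> t. y \<omega> u t) A \<and>
               (AE \<omega> in M. \<forall>t\<in>{0..T}.
                  ennreal (A \<omega> t) = (\<integral>\<^sup>+ s\<in>{0..t}. inverse (ennreal (mfun y \<omega> u s)) \<partial>lborel))"
    and C5: "\<forall>u\<in>{0..1}. \<forall>v\<in>{0..1}. \<exists>B.
               is_covariation M (filt M y) T (\<lambda>\<omega> t. y \<omega> u t) (\<lambda>\<omega> t. y \<omega> v t) B \<and>
               (AE \<omega> in M. \<forall>t\<in>{0..T}. B \<omega> (min t (meet_time T y u v \<omega>)) = 0)"
    and d1: "\<And>x. (\<phi> has_real_derivative \<phi>' x) (at x)"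
    and d2: "\<And>x. (\<phi>' has_real_derivative \<phi>'' x) (at x)"
    and c2: "continuous_on UNIV \<phi>''"
    and b1: "bounded (range \<phi>')" and b2: "bounded (range \<phi>'')"
  shows "(\<exists>J. dint_is M T y \<phi>' J) \<and>
         (\<forall>J. dint_is M T y \<phi>' J \<longrightarrow>
            (AE \<omega> in M. \<forall>t\<in>{0..T}.
               (LINT u:{0..1}|lborel. \<phi> (y \<omega> u t))
                 = (LINT u:{0..1}|lborel. \<phi> u) + J \<omega> t
                   + 1/2 * (LINT s:{0..t}|lborel. LINT u:{0..1}|lborel. \<phi>'' (y \<omega> u s) / mfun y \<omega> u s)))"
proof -
  obtain K1 where K1: "\<And>x. \<bar>\<phi>' x\<bar> \<le> K1" using b1 unfolding bounded_real by blast
  obtain K2 where K2: "\<And>x. \<bar>\<phi>'' x\<bar> \<le> K2" using b2 unfolding bounded_real by blast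
  interpret prob_space M by fact
  \<comment> \<open>The larger of the two bounds serves for both derivatives, since the calculus
    carries a single constant.\<close>
  interpret coalescing_flow_function M T y \<phi> \<phi>' \<phi>'' "max K1 K2"
  proof unfold_locales
    show "\<bar>\<phi>' x\<bar> \<le> max K1 K2" "\<bar>\<phi>'' x\<bar> \<le> max K1 K2" for x using K1[of x] K2[of x] by auto
  qed (use assms in auto)
  show ?thesis by (rule dint_formula)
qed

end
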